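(* Let $k$ be an algebraic number field of degree $d=[k:\mathbb{Q}]\geq 3$ that is not a CM-field. Let $r$ be the rank of the unit group $O_k^{\times}$, let $D_k$ be the absolute value of the discriminant of $k$, and let $\mathrm{Reg}(k)$ be the regulator of $k$. Let \[ \rho(k)=\max\{\operatorname{rank} O_{k'}^{\times} : k'\subseteq k,\ k'\neq k\}, \] the maximum being over all proper subfields $k'$ of $k$. Let $\gamma_d=d^{-\frac{d^{\log_2 d}}{2}}$ and assume $1<\gamma_d D_k$. Then \[ \frac{0.2}{r!}\left(\frac{2\log(\gamma_d D_k)}{(d-2)\,d^{\log_2 d}}\right)^{r-\rho(k)}\le \mathrm{Reg}(k). \]
   Context: $O_k$ denotes the ring of integers of $k$ and $O_k^{\times}$ its unit group. A CM-field is a totally imaginary quadratic extension of a totally real number field. *)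

theory Defs
  imports
    Complex_Main
    "HOL-Library.FuncSet"
    "HOL-Algebra.Algebraic_Closure_Type"
    "Jordan_Normal_Form.Determinant"
begin

text \<open>
  A number field is a subfield \<open>k\<close>, of finite degree over \<open>\<rat>\<close>, of the universe of an arbitrary
  type of class \<open>field_char_0\<close>.  The type itself need not be algebraically closed or of finite
  degree over \<open>\<rat>\<close>; in particular \<open>k = UNIV\<close> is allowed.
\<close>

abbreviation subfield_of_type :: "'a::field_char_0 set \<Rightarrow> bool" where
  "subfield_of_type k \<equiv> subfield k ring_of_type_algebra"

definition ext_degree :: "'a::field_char_0 set \<Rightarrow> 'a set \<Rightarrow> nat" where
  "ext_degree l k = ring.dim ring_of_type_algebra l k"

definition number_field :: "'a::field_char_0 set \<Rightarrow> bool" where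
  "number_field k \<longleftrightarrow>
     subfield_of_type k \<and> ring.finite_dimension ring_of_type_algebra \<rat> k"

text \<open>
  Embeddings are made extensional, so that two of them are equal iff they agree on \<open>k\<close>.
\<close>

definition embeddings :: "'a::field_char_0 set \<Rightarrow> ('a \<Rightarrow> complex) set" where
  "embeddings k =
     extensional k \<inter> Ring.ring_hom (ring_of_type_algebra\<lparr>carrier := k\<rparr>) ring_of_type_algebra"

definition real_embedding :: "'a::field_char_0 set \<Rightarrow> ('a \<Rightarrow> complex) \<Rightarrow> bool" where
  "real_embedding k \<sigma> \<longleftrightarrow> \<sigma> ` k \<subseteq> \<real>"

definition totally_real :: "'a::field_char_0 set \<Rightarrow> bool" where
  "totally_real k \<longleftrightarrow> (\<forall>\<sigma>\<in>embeddings k. real_embedding k \<sigma>)"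

definition totally_imaginary :: "'a::field_char_0 set \<Rightarrow> bool" where
  "totally_imaginary k \<longleftrightarrow> (\<forall>\<sigma>\<in>embeddings k. \<not> real_embedding k \<sigma>)"

definition CM_field :: "'a::field_char_0 set \<Rightarrow> bool" where
  "CM_field k \<longleftrightarrow> number_field k \<and> totally_imaginary k \<and>
     (\<exists>l. l \<subseteq> k \<and> number_field l \<and> totally_real l \<and>
          ring.dimension ring_of_type_algebra 2 l k)"

definition ring_of_integers :: "'a::field_char_0 set \<Rightarrow> 'a set" where
  "ring_of_integers k = {x \<in> k. algebraic_int x}"

definition integer_units :: "'a::field_char_0 set \<Rightarrow> 'a set" where
  "integer_units k = Units (ring_of_type_algebra\<lparr>carrier := ring_of_integers k\<rparr>)"

definition integral_basis :: "'a::field_char_0 set \<Rightarrow> 'a list \<Rightarrow> bool" where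
  "integral_basis k ws \<longleftrightarrow> set ws \<subseteq> ring_of_integers k \<and>
     (\<forall>x\<in>ring_of_integers k. \<exists>c::nat \<Rightarrow> int. x = (\<Sum>j<length ws. of_int (c j) * ws ! j)) \<and>
     (\<forall>c::nat \<Rightarrow> int. (\<Sum>j<length ws. of_int (c j) * ws ! j) = 0 \<longrightarrow> (\<forall>j<length ws. c j = 0))"

text \<open>
  The value does not depend on the integral basis or on the order of the embeddings.
\<close>

definition discriminant :: "'a::field_char_0 set \<Rightarrow> complex" where
  "discriminant k = (THE D. \<exists>ws \<sigma>s. integral_basis k ws \<and>
     distinct \<sigma>s \<and> set \<sigma>s = embeddings k \<and>
     D = (det (mat (length \<sigma>s) (length ws) (\<lambda>(i, j). (\<sigma>s ! i) (ws ! j))))\<^sup>2)"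

definition abs_discriminant :: "'a::field_char_0 set \<Rightarrow> real" where
  "abs_discriminant k = cmod (discriminant k)"

definition mult_independent :: "'a::field_char_0 set \<Rightarrow> bool" where
  "mult_independent S \<longleftrightarrow>
     (\<forall>e::'a \<Rightarrow> int. (\<Prod>u\<in>S. u powi e u) = 1 \<longrightarrow> (\<forall>u\<in>S. e u = 0))"

text \<open>
  The rank of an abelian group is the maximal size of a \<open>\<int>\<close>-independent subset.  For the units of
  a number field the maximum exists, by Dirichlet's unit theorem.
\<close>

definition unit_rank :: "'a::field_char_0 set \<Rightarrow> nat" where
  "unit_rank k = Max {card S | S. finite S \<and> S \<subseteq> integer_units k \<and> mult_independent S}"

definition max_subfield_unit_rank :: "'a::field_char_0 set \<Rightarrow> nat" where
  "max_subfield_unit_rank k = Max {unit_rank l | l. subfield_of_type l \<and> l \<subset> k}"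

definition fundamental_units :: "'a::field_char_0 set \<Rightarrow> 'a list \<Rightarrow> bool" where
  "fundamental_units k us \<longleftrightarrow>
     distinct us \<and> set us \<subseteq> integer_units k \<and> mult_independent (set us) \<and>
     (\<forall>u\<in>integer_units k. \<exists>z (e::'a \<Rightarrow> int).
        (\<exists>n>0. z ^ n = 1) \<and> u = z * (\<Prod>x\<in>set us. x powi e x))"

text \<open>
  An archimedean place is an unordered pair of complex conjugate embeddings (a single embedding if
  it is real); the list contains exactly one embedding for each place.
\<close>

definition place_representatives ::
    "'a::field_char_0 set \<Rightarrow> ('a \<Rightarrow> complex) list \<Rightarrow> bool" where
  "place_representatives k \<sigma>s \<longleftrightarrow> distinct \<sigma>s \<and> set \<sigma>s \<subseteq> embeddings k \<and>
     (\<forall>\<tau>\<in>embeddings k. \<exists>!\<sigma>. \<sigma> \<in> set \<sigma>s \<and> (\<sigma> = \<tau> \<or> \<sigma> = restrict (\<lambda>x. cnj (\<tau> x)) k))"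

definition local_degree :: "'a::field_char_0 set \<Rightarrow> ('a \<Rightarrow> complex) \<Rightarrow> nat" where
  "local_degree k \<sigma> = (if real_embedding k \<sigma> then 1 else 2)"

text \<open>
  There is one place more than there are fundamental units; the last place of the list is omitted.
  The value depends neither on the omitted place nor on the fundamental units.
\<close>

definition regulator :: "'a::field_char_0 set \<Rightarrow> real" where
  "regulator k = (THE R. \<exists>us \<sigma>s. fundamental_units k us \<and> place_representatives k \<sigma>s \<and>
     R = \<bar>det (mat (length us) (length \<sigma>s - 1)
            (\<lambda>(j, i). real (local_degree k (\<sigma>s ! i)) * ln (cmod ((\<sigma>s ! i) (us ! j)))))\<bar>)"

definition gamma_const :: "nat \<Rightarrow> real" where
  "gamma_const d = real d powr (- (real d powr log 2 (real d)) / 2)"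

end

theory Submission
  imports "HOL-Analysis.Simplex_Content" Defs "Jordan_Normal_Form.Char_Poly"
begin

text \<open>
  Write \<open>h(u)\<close> for the sum of \<open>max 0 (ln \<bar>\<sigma> u\<bar>)\<close> over all embeddings \<open>\<sigma>\<close>. If the units with \<open>h(u) \<le> h\<close> generate \<open>k\<close>,
  then suitable monomials in them form a basis of \<open>k\<close>, and bounding its discriminant gives
  \<open>ln D \<le> 2 ln (d!) + 2 (d - 1) h\<close>. Hence for \<open>h\<close> below a multiple of \<open>ln D\<close> all these units lie in a proper
  subfield \<open>l\<close>, and \<open>rank l < r\<close> because \<open>k\<close> is not a CM-field.

  The regulator is the covolume of the lattice of logarithms of units. Split the logarithmic space of \<open>k\<close>
  into the directions coming from the places of \<open>l\<close> and the relative directions, and take a simplex of size \<open>A\<close> in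
  the former and \<open>\<tau>\<close> in the latter. Two units in one translate of it have a quotient with \<open>h \<le> A + 2 \<tau>\<close>; this
  quotient lies in \<open>l\<close>, where a pigeonhole argument (a nonzero integer has norm at least 1) bounds the number
  \<open>N\<close> of such units. Averaging over translates gives \<open>A ^ rank l * \<tau> ^ (r - rank l) \<le> N r! Reg\<close>, and \<open>\<tau>\<close> may be
  taken proportional to \<open>ln (\<gamma> D)\<close>.
\<close>

text \<open>The simplex accounts for \<open>1 / r!\<close>, which is its volume. The sign given to
  its first coordinates turns membership into upper bounds with total \<open>A\<close> for the
  logarithms of a unit of \<open>l\<close> at all places, and this is what the pigeonhole count can
  use. The count costs \<open>4 ^ n\<close> with \<open>n\<close> the degree of \<open>l\<close>; it
  is paid for by \<open>A ^ rank l\<close> and by one factor \<open>kap d\<close>, gained because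
  \<open>\<tau>\<close> is about \<open>kap d\<close> times the base \<open>L\<close> of the power
  in the theorem. \<open>A\<close> stays just below the threshold
  \<open>m * (rank l + 1) * ln 2\<close> of the count, with \<open>m\<close> the degree of
  \<open>k\<close> over \<open>l\<close>. The rank of \<open>l\<close> may fall below the maximal
  rank \<open>\<rho>\<close>, so \<open>\<tau> \<ge> 1\<close> is arranged in order to lower the
  exponent. In degrees below 6 the part of \<open>ln D\<close> free of \<open>L\<close> does not
  cover this \<open>A\<close> and \<open>\<tau>\<close>. In degrees 3 and 5 the units of
  \<open>l\<close> are torsion; in degree 4 a real quadratic \<open>l\<close> gets an exact count. A
  cubic field needs Hadamard's inequality in place of Leibniz's expansion, and for \<open>L\<close>
  near 0, where the discriminant says nothing about heights, its own units are counted.\<close>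

abbreviation type_ring :: "'a::field_char_0 ring" where
  "type_ring \<equiv> ring_of_type_algebra"

lemma type_ring_simps [simp]:
  "carrier type_ring = UNIV" "x \<otimes>\<^bsub>type_ring\<^esub> y = x * y" "x \<oplus>\<^bsub>type_ring\<^esub> y = x + y"
  "\<one>\<^bsub>type_ring\<^esub> = 1" "\<zero>\<^bsub>type_ring\<^esub> = 0"
  by (simp_all add: ring_of_type_algebra_def)

interpretation type_ring: Ring.ring "type_ring :: 'a::field_char_0 ring"
  by (rule ring_from_type_algebra)

lemma type_ring_a_inv [simp]: "\<ominus>\<^bsub>type_ring\<^esub> x = - x"
  using type_ring.minus_equality[of "-x" x] by simp

lemma type_ring_inv: "x \<noteq> 0 \<Longrightarrow> inv\<^bsub>type_ring\<^esub> x = inverse x"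
  using comm_monoid.comm_inv_char[OF cring.axioms(2)[OF cring_from_type_algebra], of x "inverse x"] by simp

section \<open>Subfields of the ambient type\<close>

lemma subfield_of_type_iff:
  "subfield_of_type k \<longleftrightarrow> 1 \<in> k \<and> (\<forall>x\<in>k. \<forall>y\<in>k. x + y \<in> k \<and> x * y \<in> k) \<and>
     (\<forall>x\<in>k. - x \<in> k \<and> inverse x \<in> k)" (is "_ = ?R")
proof
  assume k: "subfield_of_type k"
  then have sr: "subring k type_ring" by (rule subfieldE(1))
  have "inverse x \<in> k" if "x \<in> k" for x
  proof (cases "x = 0")
    case True
    then show ?thesis using subringE(2)[OF sr] by simp
  next
    case False
    then show ?thesis using type_ring.subfield_m_inv(1)[OF k, of x] that
      by (simp add: type_ring_inv)
  qed
  then show ?R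
    using subringE(3)[OF sr] subringE(5)[OF sr] subringE(6)[OF sr] subringE(7)[OF sr] by auto
next
  assume R: ?R
  show "subfield_of_type k"
  proof (rule field.subfieldI'[OF field_from_type_algebra])
    show "subring k type_ring" by (rule type_ring.subringI) (use R in auto)
    show "inv\<^bsub>type_ring\<^esub> x \<in> k" if "x \<in> k - {\<zero>\<^bsub>type_ring\<^esub>}" for x
      using that R by (simp add: type_ring_inv)
  qed
qed

context
  fixes k :: "'a::field_char_0 set"
  assumes k: "subfield_of_type k"
begin

lemma sf_1: "1 \<in> k" and sf_add: "x \<in> k \<Longrightarrow> y \<in> k \<Longrightarrow> x + y \<in> k"
  and sf_mult: "x \<in> k \<Longrightarrow> y \<in> k \<Longrightarrow> x * y \<in> k"
  and sf_uminus: "x \<in> k \<Longrightarrow> - x \<in> k" and sf_inverse: "x \<in> k \<Longrightarrow> inverse x \<in> k"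
  using k by (auto simp: subfield_of_type_iff)

lemma sf_0: "0 \<in> k"
  using sf_add[OF sf_1 sf_uminus[OF sf_1]] by simp

lemma sf_diff: "x \<in> k \<Longrightarrow> y \<in> k \<Longrightarrow> x - y \<in> k"
  using sf_add[of x "- y"] sf_uminus by simp

lemma sf_divide: "x \<in> k \<Longrightarrow> y \<in> k \<Longrightarrow> x / y \<in> k"
  by (simp add: divide_inverse sf_mult sf_inverse)

lemma sf_sum: "(\<And>i. i \<in> I \<Longrightarrow> f i \<in> k) \<Longrightarrow> sum f I \<in> k"
  by (induction I rule: infinite_finite_induct) (auto intro: sf_0 sf_add)

lemma sf_prod: "(\<And>i. i \<in> I \<Longrightarrow> f i \<in> k) \<Longrightarrow> prod f I \<in> k"
  by (induction I rule: infinite_finite_induct) (auto intro: sf_1 sf_mult)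

lemma sf_power: "x \<in> k \<Longrightarrow> x ^ n \<in> k"
  by (induction n) (auto intro: sf_1 sf_mult)

lemma sf_powi: "x \<in> k \<Longrightarrow> x powi n \<in> k"
  by (auto simp: power_int_def intro!: sf_power sf_inverse)

lemma sf_of_nat: "of_nat n \<in> k"
  by (induction n) (auto intro: sf_0 sf_1 sf_add)

lemma sf_of_int: "of_int n \<in> k"
  by (cases n) (auto simp del: of_nat_Suc intro!: sf_of_nat sf_uminus sf_diff sf_1 simp: algebra_simps)

lemma sf_Rats: "\<rat> \<subseteq> k"
proof
  fix x :: 'a assume "x \<in> \<rat>"
  then show "x \<in> k" by (cases rule: Rats_cases') (auto intro!: sf_divide sf_of_int)
qed

lemmas sf_intros = sf_0 sf_1 sf_add sf_mult sf_uminus sf_inverse sf_diff sf_divide sf_sum sf_prod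
  sf_power sf_powi sf_of_nat sf_of_int

end

lemma subfield_Rats: "subfield_of_type (\<rat> :: 'a::field_char_0 set)"
  by (auto simp: subfield_of_type_iff)

section \<open>Finite extensions\<close>

text \<open>A relation instead of the total function \<open>ext_degree\<close>: a number occurs as a
  degree only if both sets are subfields, one inside the other, and the dimension is finite.\<close>

definition degree_over :: "'a::field_char_0 set \<Rightarrow> 'a set \<Rightarrow> nat \<Rightarrow> bool" where
  "degree_over l k n \<longleftrightarrow> subfield_of_type l \<and> subfield_of_type k \<and> l \<subseteq> k \<and>
     type_ring.dimension n l k"

text \<open>Coefficient families are total functions with all values in \<open>l\<close>, so
  witnesses are padded with 0 beyond the length of the list.\<close>

definition basis_over :: "'a::field_char_0 set \<Rightarrow> 'a set \<Rightarrow> 'a list \<Rightarrow> bool" where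
  "basis_over l k bs \<longleftrightarrow> set bs \<subseteq> k \<and>
     (\<forall>x\<in>k. \<exists>c. (\<forall>j. c j \<in> l) \<and> x = (\<Sum>j<length bs. c j * bs ! j)) \<and>
     (\<forall>c. (\<forall>j. c j \<in> l) \<longrightarrow> (\<Sum>j<length bs. c j * bs ! j) = 0 \<longrightarrow> (\<forall>j<length bs. c j = 0))"

lemma type_ring_combine:
  "length Ks = length Us \<Longrightarrow> type_ring.combine Ks Us = (\<Sum>j<length Us. Ks ! j * Us ! j)"
proof (induction Ks Us rule: list_induct2)
  case (Cons x xs y ys)
  then show ?case by (simp add: sum.lessThan_Suc_shift del: sum.lessThan_Suc)
qed auto

text \<open>\<open>combine\<close> truncates to the shorter list, and the independence criterion
  quantifies over coefficient lists of every length.\<close>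

lemma type_ring_combine_min:
  "type_ring.combine Ks Us = (\<Sum>j<min (length Ks) (length Us). Ks ! j * Us ! j)"
  by (induction Ks Us rule: list_induct2')
    (simp_all add: sum.lessThan_Suc_shift del: sum.lessThan_Suc)

lemma degree_over_basis:
  assumes "degree_over l k n"
  obtains bs where "length bs = n" "basis_over l k bs"
proof -
  from assms have l: "subfield_of_type l" and k: "subfield_of_type k"
    and dim: "type_ring.dimension n l k" by (auto simp: degree_over_def)
  from type_ring.exists_base[OF l dim] obtain Vs where Vs:
    "type_ring.independent l Vs" "length Vs = n" "type_ring.Span l Vs = k" by auto
  have sub: "set Vs \<subseteq> k"
    using type_ring.Span_base_incl[OF l, of Vs] Vs by auto
  have ex: "\<exists>c. (\<forall>j. c j \<in> l) \<and> x = (\<Sum>j<length Vs. c j * Vs ! j)" if "x \<in> k" for x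
  proof -
    have "x \<in> type_ring.Span l Vs" using that Vs by simp
    then obtain Ks where Ks: "set Ks \<subseteq> l" "length Ks = length Vs" "x = type_ring.combine Ks Vs"
      using type_ring.Span_eq_combine_set_length_version[OF l, of Vs] by auto
    show ?thesis
      by (rule exI[of _ "\<lambda>j. if j < length Vs then Ks ! j else 0"])
        (use Ks in \<open>auto simp: type_ring_combine subset_iff sf_0[OF l] intro!: sum.cong\<close>)
  qed
  have ind: "\<forall>j<length Vs. c j = 0" if c: "\<forall>j. c j \<in> l" "(\<Sum>j<length Vs. c j * Vs ! j) = 0" for c
  proof -
    let ?Ks = "map c [0..<length Vs]"
    have "type_ring.combine ?Ks Vs = 0"
      using c by (subst type_ring_combine) auto
    then have "set (take (length Vs) ?Ks) \<subseteq> {0}"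
      using type_ring.independent_imp_trivial_combine[OF l Vs(1), of ?Ks] c(1) by auto
    then show ?thesis by (auto simp: image_subset_iff)
  qed
  show thesis by (rule that[of Vs]) (use Vs sub ex ind in \<open>auto simp: basis_over_def\<close>)
qed

lemma basis_degree_over:
  assumes l: "subfield_of_type l" and k: "subfield_of_type k" and lk: "l \<subseteq> k"
    and bs: "basis_over l k bs"
  shows "degree_over l k (length bs)"
proof -
  have "type_ring.independent l bs"
  proof (rule type_ring.trivial_combine_imp_independent[OF l])
    fix Ks assume Ks: "set Ks \<subseteq> l" "type_ring.combine Ks bs = \<zero>\<^bsub>type_ring\<^esub>"
    let ?m = "min (length Ks) (length bs)"
    define c where "c = (\<lambda>j. if j < ?m then Ks ! j else 0)"
    have "\<forall>j. c j \<in> l" using Ks(1) sf_0[OF l] by (auto simp: c_def subset_iff)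
    moreover have "(\<Sum>j<length bs. c j * bs ! j) = (\<Sum>j<?m. Ks ! j * bs ! j)"
      by (rule sum.mono_neutral_cong_right) (auto simp: c_def)
    then have "(\<Sum>j<length bs. c j * bs ! j) = 0"
      using Ks(2) by (simp add: type_ring_combine_min)
    ultimately have c0: "\<forall>j<length bs. c j = 0" using bs unfolding basis_over_def by blast
    have "Ks ! j = 0" if "j < length Ks" "j < length bs" for j
      using c0[rule_format, of j] that by (simp add: c_def)
    then show "set (take (length bs) Ks) \<subseteq> {\<zero>\<^bsub>type_ring\<^esub>}"
      by (auto simp: in_set_conv_nth)
  qed auto
  moreover have "type_ring.Span l bs = k"
  proof
    show "type_ring.Span l bs \<subseteq> k"
    proof
      fix x assume "x \<in> type_ring.Span l bs"
      then obtain Ks where Ks: "set Ks \<subseteq> l" "length Ks = length bs" "x = type_ring.combine Ks bs"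
        using type_ring.Span_eq_combine_set_length_version[OF l, of bs] by auto
      then show "x \<in> k" using bs lk
        by (auto simp: type_ring_combine basis_over_def subset_iff intro!: sf_sum[OF k] sf_mult[OF k])
    qed
    show "k \<subseteq> type_ring.Span l bs"
    proof
      fix x assume "x \<in> k"
      then obtain c where c: "\<forall>j. c j \<in> l" "x = (\<Sum>j<length bs. c j * bs ! j)"
        using bs by (auto simp: basis_over_def)
      then have "x = type_ring.combine (map c [0..<length bs]) bs"
        by (simp add: type_ring_combine)
      then show "x \<in> type_ring.Span l bs"
        using c type_ring.Span_eq_combine_set[OF l, of bs] by (auto intro!: exI[of _ "map c [0..<length bs]"])
    qed
  qed
  ultimately show ?thesis using type_ring.dimension_independent[of l bs] l k lk
    by (auto simp: degree_over_def)
qed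

lemma degree_over_unique: "degree_over l k n \<Longrightarrow> degree_over l k n' \<Longrightarrow> n = n'"
  unfolding degree_over_def using type_ring.dimension_is_inj by blast

lemma degree_over_pos: "degree_over l k n \<Longrightarrow> n > 0"
  unfolding degree_over_def using type_ring.dimension_zero[of l k] sf_1[of k] by (cases n) auto

text \<open>Both dimensions are finite: \<open>e\<close> is an \<open>l\<close>-subspace of
  \<open>k\<close>, and an \<open>l\<close>-basis of \<open>k\<close> still spans \<open>k\<close>
  over \<open>e\<close>. The product formula then follows from uniqueness of the dimension.\<close>

lemma degree_over_tower:
  assumes "degree_over l k n" "subfield_of_type e" "l \<subseteq> e" "e \<subseteq> k"
  obtains a b where "degree_over l e a" "degree_over e k b" "n = a * b"
proof -
  from assms have l: "subfield_of_type l" and k: "subfield_of_type k"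
    and dim: "type_ring.dimension n l k" by (auto simp: degree_over_def)
  have "subalgebra l e type_ring"
    unfolding subalgebra_def subalgebra_axioms_def
    using subring.axioms(1)[OF subfieldE(1)[OF assms(2)]] assms(3) sf_mult[OF assms(2)] by auto
  then have "type_ring.finite_dimension l e"
    using type_ring.subalbegra_incl_imp_finite_dimension[OF l type_ring.finite_dimensionI[OF dim]] assms(4)
    by auto
  then obtain a where a: "type_ring.dimension a l e" by (rule type_ring.finite_dimensionE')
  from type_ring.exists_base[OF l dim] obtain Vs where Vs:
    "type_ring.independent l Vs" "length Vs = n" "type_ring.Span l Vs = k" by auto
  have "type_ring.Span e Vs = k"
  proof
    have "set Vs \<subseteq> k" using type_ring.Span_base_incl[OF l, of Vs] Vs by auto
    then show "type_ring.Span e Vs \<subseteq> k"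
      using type_ring.Span_eq_combine_set_length_version[OF assms(2), of Vs] assms(4)
      by (auto simp: type_ring_combine subset_iff intro!: sf_sum[OF k] sf_mult[OF k])
    show "k \<subseteq> type_ring.Span e Vs"
      using type_ring.Span_eq_combine_set[OF assms(2), of Vs] type_ring.Span_eq_combine_set[OF l, of Vs]
        Vs assms(3) by fastforce
  qed
  then have "type_ring.finite_dimension e k"
    using type_ring.Span_finite_dimension[OF assms(2), of Vs] by auto
  then obtain b where b: "type_ring.dimension b e k" by (rule type_ring.finite_dimensionE')
  have "type_ring.dimension (a * b) l k" by (rule type_ring.telescopic_base[OF l assms(2) a b])
  then have "n = a * b" using dim type_ring.dimension_is_inj[OF l] by blast
  with a b show thesis using that assms l k by (auto simp: degree_over_def)
qed

lemma number_field_iff: "number_field k \<longleftrightarrow> degree_over \<rat> k (ext_degree \<rat> k)"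
proof
  assume "number_field k"
  then have k: "subfield_of_type k" and fd: "type_ring.finite_dimension \<rat> k"
    by (auto simp: number_field_def)
  then obtain n where n: "type_ring.dimension n \<rat> k" by (auto elim: type_ring.finite_dimensionE')
  then have "ext_degree \<rat> k = n"
    using type_ring.dimI[OF subfield_Rats n] by (simp add: ext_degree_def over_def)
  then show "degree_over \<rat> k (ext_degree \<rat> k)"
    using n k sf_Rats[OF k] subfield_Rats by (auto simp: degree_over_def)
next
  assume "degree_over \<rat> k (ext_degree \<rat> k)"
  then show "number_field k" by (auto simp: degree_over_def number_field_def intro: type_ring.finite_dimensionI)
qed

lemma degree_over_Rats_number_field: "degree_over \<rat> k n \<Longrightarrow> number_field k"
  by (auto simp: degree_over_def number_field_def intro: type_ring.finite_dimensionI)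

text \<open>Writing 1 as a multiple \<open>c * b\<close> of the single basis element gives
  \<open>b = inverse c\<close>, so \<open>b\<close> and its multiples lie in
  \<open>l\<close>.\<close>

lemma degree_over_1_eq: assumes "degree_over l k 1" shows "k = l"
proof -
  obtain bs where bs: "length bs = 1" "basis_over l k bs" using degree_over_basis[OF assms] .
  have l: "subfield_of_type l" and k: "subfield_of_type k" and lk: "l \<subseteq> k"
    using assms by (auto simp: degree_over_def)
  have *: "\<exists>c\<in>l. x = c * bs ! 0" if "x \<in> k" for x
    using bs that unfolding basis_over_def by (fastforce simp: lessThan_Suc)
  obtain c where c: "c \<in> l" "1 = c * bs ! 0" using *[OF sf_1[OF k]] by auto
  then have "bs ! 0 = inverse c" by (metis inverse_unique)
  then have "bs ! 0 \<in> l" using sf_inverse[OF l] c by simp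
  then show ?thesis using * lk sf_mult[OF l] by blast
qed

lemma degree_over_self: "subfield_of_type l \<Longrightarrow> degree_over l l 1"
  unfolding degree_over_def using type_ring.dimension_one by blast

section \<open>Polynomials over a subfield, minimal polynomials and simple extensions\<close>

definition coeffs_in :: "'a::field_char_0 set \<Rightarrow> 'a poly \<Rightarrow> bool" where
  "coeffs_in l p \<longleftrightarrow> (\<forall>i. Polynomial.coeff p i \<in> l)"

text \<open>This is the ring \<open>l[a]\<close>. It is a field once \<open>a\<close> is algebraic
  over \<open>l\<close>, which \<open>adjoin_subfield\<close> obtains from a finite extension
  containing \<open>a\<close>.\<close>

definition adjoin :: "'a::field_char_0 set \<Rightarrow> 'a \<Rightarrow> 'a set" where
  "adjoin l a = {poly p a | p. coeffs_in l p}"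

context
  fixes l :: "'a::field_char_0 set"
  assumes l: "subfield_of_type l"
begin

lemma coeffs_in_0: "coeffs_in l 0" and coeffs_in_1: "coeffs_in l 1"
  and coeffs_in_add: "coeffs_in l p \<Longrightarrow> coeffs_in l q \<Longrightarrow> coeffs_in l (p + q)"
  and coeffs_in_diff: "coeffs_in l p \<Longrightarrow> coeffs_in l q \<Longrightarrow> coeffs_in l (p - q)"
  and coeffs_in_uminus: "coeffs_in l p \<Longrightarrow> coeffs_in l (- p)"
  and coeffs_in_mult: "coeffs_in l p \<Longrightarrow> coeffs_in l q \<Longrightarrow> coeffs_in l (p * q)"
  and coeffs_in_smult: "c \<in> l \<Longrightarrow> coeffs_in l p \<Longrightarrow> coeffs_in l (Polynomial.smult c p)"
  and coeffs_in_monom: "c \<in> l \<Longrightarrow> coeffs_in l (Polynomial.monom c n)"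
  and coeffs_in_pCons: "c \<in> l \<Longrightarrow> coeffs_in l p \<Longrightarrow> coeffs_in l (pCons c p)"
  by (auto simp: coeffs_in_def coeff_mult coeff_pCons split: nat.split
      intro!: sf_intros[OF l])

lemma coeffs_in_sum: "(\<And>i. i \<in> I \<Longrightarrow> coeffs_in l (f i)) \<Longrightarrow> coeffs_in l (sum f I)"
  by (induction I rule: infinite_finite_induct) (auto intro: coeffs_in_0 coeffs_in_add)

lemma adjoin_superset: "l \<subseteq> adjoin l a"
  unfolding adjoin_def by (rule subsetI, rule CollectI, rule_tac x="[:x:]" in exI)
    (auto intro: coeffs_in_pCons coeffs_in_0)

lemma adjoin_self: "a \<in> adjoin l a"
  unfolding adjoin_def by (rule CollectI, rule exI[of _ "[:0, 1:]"])
    (auto intro!: coeffs_in_pCons coeffs_in_0 sf_intros[OF l])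

lemma adjoin_subset:
  assumes k: "subfield_of_type k" and "l \<subseteq> k" "a \<in> k"
  shows "adjoin l a \<subseteq> k"
  using assms(2,3) unfolding adjoin_def
  by (auto simp: poly_altdef coeffs_in_def subset_iff intro!: sf_intros[OF k])

text \<open>Long division by a monic polynomial never divides a coefficient, so quotient and
  remainder keep their coefficients in \<open>l\<close>.\<close>

lemma coeffs_in_divmod:
  assumes f: "coeffs_in l f" "Polynomial.lead_coeff f = 1"
  shows "coeffs_in l p \<Longrightarrow> \<exists>q s. coeffs_in l q \<and> coeffs_in l s \<and> p = f * q + s \<and>
    (s = 0 \<or> Polynomial.degree s < Polynomial.degree f)"
proof (induction "Polynomial.degree p" arbitrary: p rule: less_induct)
  case less
  show ?case
  proof (cases "p = 0 \<or> Polynomial.degree p < Polynomial.degree f")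
    case True
    then show ?thesis using less.prems coeffs_in_0 by (intro exI[of _ 0] exI[of _ p]) auto
  next
    case False
    define t where "t = Polynomial.monom (Polynomial.lead_coeff p) (Polynomial.degree p - Polynomial.degree f)"
    define p' where "p' = p - f * t"
    have f0: "f \<noteq> 0" using f by auto
    have t: "coeffs_in l t" using less.prems by (auto simp: t_def coeffs_in_def intro!: coeffs_in_monom sf_intros[OF l])
    have p': "coeffs_in l p'" unfolding p'_def by (intro coeffs_in_diff coeffs_in_mult less.prems f t)
    have deg: "Polynomial.degree (f * t) = Polynomial.degree p"
      using False f0 by (simp add: t_def degree_mult_eq degree_monom_eq)
    have lc: "Polynomial.lead_coeff (f * t) = Polynomial.lead_coeff p"
      using f(2) False by (simp only: Polynomial.lead_coeff_mult) (simp add: t_def lead_coeff_monom degree_monom_eq)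
    have c0: "Polynomial.coeff p' (Polynomial.degree p) = 0" using deg lc by (simp add: p'_def)
    have "p' = 0 \<or> Polynomial.degree p' < Polynomial.degree p"
    proof (cases "p' = 0")
      case False
      have "Polynomial.degree p' \<le> Polynomial.degree p" unfolding p'_def
        using Polynomial.degree_diff_le[of p "Polynomial.degree p" "f * t"] deg by simp
      moreover have "Polynomial.degree p' \<noteq> Polynomial.degree p"
        using c0 False by (metis leading_coeff_0_iff)
      ultimately show ?thesis by simp
    qed simp
    then have "\<exists>q s. coeffs_in l q \<and> coeffs_in l s \<and> p' = f * q + s \<and>
      (s = 0 \<or> Polynomial.degree s < Polynomial.degree f)"
    proof
      assume "p' = 0"
      then show ?thesis using coeffs_in_0 by (intro exI[of _ 0]) auto
    next
      assume "Polynomial.degree p' < Polynomial.degree p"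
      from less.hyps[OF this p'] show ?thesis .
    qed
    then obtain q s where qs: "coeffs_in l q" "coeffs_in l s" "p' = f * q + s"
      "s = 0 \<or> Polynomial.degree s < Polynomial.degree f" by blast
    have "p = f * (q + t) + s" using qs(3) by (simp add: p'_def algebra_simps)
    then show ?thesis using qs t coeffs_in_add by blast
  qed
qed

definition min_poly :: "'a \<Rightarrow> 'a poly \<Rightarrow> bool" where
  "min_poly a f \<longleftrightarrow> coeffs_in l f \<and> Polynomial.lead_coeff f = 1 \<and> poly f a = 0 \<and>
     (\<forall>p. coeffs_in l p \<longrightarrow> p \<noteq> 0 \<longrightarrow> poly p a = 0 \<longrightarrow> Polynomial.degree f \<le> Polynomial.degree p)"

text \<open>The \<open>n + 1\<close> powers \<open>1, a, ..., a ^ n\<close> are dependent in an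
  \<open>n\<close>-dimensional space.\<close>

lemma ex_annihilator:
  assumes "degree_over l k n" "a \<in> k"
  shows "\<exists>p. coeffs_in l p \<and> p \<noteq> 0 \<and> poly p a = 0"
proof -
  from assms have k: "subfield_of_type k" and lk: "l \<subseteq> k"
    and dim: "type_ring.dimension n l k" by (auto simp: degree_over_def)
  let ?Us = "map (\<lambda>i. a ^ i) [0..<Suc n]"
  have "\<not> type_ring.independent l ?Us"
  proof
    assume "type_ring.independent l ?Us"
    then have "length ?Us \<le> n"
      by (rule type_ring.independent_length_le_dimension[OF l dim])
        (use assms sf_power[OF k] in auto)
    then show False by simp
  qed
  then obtain Ks where Ks: "set Ks \<subseteq> l" "type_ring.combine Ks ?Us = 0"
      "\<not> set (take (length ?Us) Ks) \<subseteq> {0}"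
    using type_ring.trivial_combine_imp_independent[OF l, of ?Us] by auto
  let ?m = "min (length Ks) (length ?Us)"
  define p where "p = (\<Sum>j<?m. Polynomial.monom (Ks ! j) j)"
  have pc: "coeffs_in l p" unfolding p_def
    by (rule coeffs_in_sum, rule coeffs_in_monom) (use Ks(1) in \<open>auto simp: subset_iff simp del: upt_Suc\<close>)
  have "poly p a = (\<Sum>j<?m. Ks ! j * ?Us ! j)"
    by (auto simp: p_def poly_sum poly_monom intro!: sum.cong simp del: upt_Suc)
  then have pa: "poly p a = 0" using Ks(2) by (simp add: type_ring_combine_min del: upt_Suc)
  obtain y where "y \<in> set (take (length ?Us) Ks)" "y \<noteq> 0" using Ks(3) by blast
  then obtain j where "j < length (take (length ?Us) Ks)" "take (length ?Us) Ks ! j \<noteq> 0"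
    by (metis in_set_conv_nth)
  then have j: "j < ?m" "Ks ! j \<noteq> 0" by auto
  have "Polynomial.coeff p j = (\<Sum>i<?m. if i = j then Ks ! j else 0)"
    by (auto simp: p_def Polynomial.coeff_sum intro!: sum.cong)
  also have "\<dots> = Ks ! j" using j by (simp del: upt_Suc)
  finally have "p \<noteq> 0" using j by auto
  with pc pa show ?thesis by blast
qed

lemma ex_min_poly:
  assumes "degree_over l k n" "a \<in> k"
  obtains f where "min_poly a f"
proof -
  let ?P = "\<lambda>p. coeffs_in l p \<and> p \<noteq> 0 \<and> poly p a = 0"
  from ex_has_least_nat[of ?P, OF ex_annihilator[OF assms, THEN someI_ex], of Polynomial.degree]
  obtain p where p: "?P p" "\<And>q. ?P q \<Longrightarrow> Polynomial.degree p \<le> Polynomial.degree q" by blast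
  define f where "f = Polynomial.smult (inverse (Polynomial.lead_coeff p)) p"
  have lc: "Polynomial.lead_coeff p \<noteq> 0" using p by simp
  have "min_poly a f" unfolding min_poly_def
  proof (intro conjI allI impI)
    show "coeffs_in l f" unfolding f_def using p(1)
      by (intro coeffs_in_smult sf_inverse[OF l]) (auto simp: coeffs_in_def)
    show "Polynomial.lead_coeff f = 1" using lc by (simp add: f_def)
    show "poly f a = 0" using p by (simp add: f_def)
    show "Polynomial.degree f \<le> Polynomial.degree q"
      if "coeffs_in l q" "q \<noteq> 0" "poly q a = 0" for q
      using p(2)[of q] that lc by (simp add: f_def)
  qed
  then show thesis by (rule that)
qed

lemma min_poly_degree_pos: "min_poly a f \<Longrightarrow> Polynomial.degree f > 0"
  by (rule ccontr) (auto simp: min_poly_def elim!: degree_eq_zeroE)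

lemma min_poly_dvd:
  assumes "min_poly a f" "coeffs_in l p" "poly p a = 0"
  obtains q where "coeffs_in l q" "p = f * q"
proof -
  from assms have f: "coeffs_in l f" "Polynomial.lead_coeff f = 1" "poly f a = 0"
    by (auto simp: min_poly_def)
  from coeffs_in_divmod[OF f(1,2) assms(2)] obtain q s where qs: "coeffs_in l q" "coeffs_in l s"
    "p = f * q + s" "s = 0 \<or> Polynomial.degree s < Polynomial.degree f" by blast
  have "poly s a = 0" using qs(3) assms(3) f(3) by simp
  then have "s = 0" using qs assms(1) unfolding min_poly_def by fastforce
  then show thesis using that qs by auto
qed

lemma adjoin_mult: "x \<in> adjoin l a \<Longrightarrow> y \<in> adjoin l a \<Longrightarrow> x * y \<in> adjoin l a"
  unfolding adjoin_def by (auto simp flip: poly_mult intro: coeffs_in_mult)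

lemma adjoin_add: "x \<in> adjoin l a \<Longrightarrow> y \<in> adjoin l a \<Longrightarrow> x + y \<in> adjoin l a"
  unfolding adjoin_def by (auto simp flip: poly_add intro: coeffs_in_add)

lemma adjoin_uminus: "x \<in> adjoin l a \<Longrightarrow> - x \<in> adjoin l a"
  unfolding adjoin_def by (auto simp flip: poly_minus intro: coeffs_in_uminus)

text \<open>Only inverses need an argument. If \<open>c + x * g(x) = 0\<close> comes from the
  minimal polynomial of \<open>x\<close> itself, then \<open>inverse x = - inverse c * g(x)\<close>,
  a polynomial expression in \<open>x\<close> and hence in \<open>a\<close>.\<close>

lemma adjoin_subfield:
  assumes kn: "degree_over l k n" and a: "a \<in> k"
  shows "subfield_of_type (adjoin l a)"
proof -
  from assms have k: "subfield_of_type k" and lk: "l \<subseteq> k" by (auto simp: degree_over_def)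
  have inv: "inverse x \<in> adjoin l a" if x: "x \<in> adjoin l a" for x
  proof (cases "x = 0")
    case True
    then show ?thesis using x by simp
  next
    case False
    have xk: "x \<in> k" using adjoin_subset[OF k lk a] x by auto
    from ex_min_poly[OF kn xk] obtain f where f: "min_poly x f" .
    obtain c g where fc: "f = pCons c g" by (cases f)
    have cg: "c \<in> l" "coeffs_in l g"
      using f unfolding min_poly_def coeffs_in_def fc
      by (metis coeff_pCons_0, metis coeff_pCons_Suc)
    have fx: "c + x * poly g x = 0" using f by (simp add: min_poly_def fc)
    have g0: "g \<noteq> 0" using min_poly_degree_pos[OF f] fc by auto
    \<comment> \<open>With a vanishing constant term, \<open>g\<close> would annihilate
      \<open>x\<close> and have smaller degree than \<open>f\<close>.\<close>
    have "c \<noteq> 0"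
    proof
      assume "c = 0"
      then have "poly g x = 0" using fx False by simp
      then have "Polynomial.degree f \<le> Polynomial.degree g" using f cg g0 by (auto simp: min_poly_def)
      then show False using fc g0 by simp
    qed
    then have eq: "inverse x = (- inverse c) * poly g x"
      using fx False by (simp add: field_simps eq_neg_iff_add_eq_0)
    have "poly g x \<in> adjoin l a"
    proof -
      have pw: "x ^ i \<in> adjoin l a" for i
        by (induction i) (use adjoin_superset[of a] sf_1[OF l] x adjoin_mult in auto)
      have sm: "sum h {..m} \<in> adjoin l a" if "\<And>i. h i \<in> adjoin l a" for h and m :: nat
        by (induction m) (use that adjoin_add in auto)
      show ?thesis unfolding poly_altdef
        by (rule sm, rule adjoin_mult) (use cg adjoin_superset[of a] pw in \<open>auto simp: coeffs_in_def\<close>)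
    qed
    moreover have "- inverse c \<in> adjoin l a"
      using cg adjoin_superset[of a] sf_inverse[OF l] sf_uminus[OF l] by auto
    ultimately show ?thesis unfolding eq by (intro adjoin_mult)
  qed
  show ?thesis unfolding subfield_of_type_iff
    using inv adjoin_mult adjoin_add adjoin_uminus adjoin_superset[of a] sf_1[OF l] by auto
qed

lemma adjoin_basis:
  assumes f: "min_poly a f"
  shows "basis_over l (adjoin l a) (map (\<lambda>i. a ^ i) [0..<Polynomial.degree f])"
proof -
  let ?m = "Polynomial.degree f" and ?bs = "map (\<lambda>i. a ^ i) [0..<Polynomial.degree f]"
  have pw: "a ^ i \<in> adjoin l a" for i
    by (induction i) (use adjoin_superset[of a] sf_1[OF l] adjoin_self adjoin_mult in auto)
  have f': "coeffs_in l f" "Polynomial.lead_coeff f = 1" "poly f a = 0"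
    using f by (auto simp: min_poly_def)
  have sp: "\<exists>c. (\<forall>j. c j \<in> l) \<and> x = (\<Sum>j<?m. c j * a ^ j)" if x: "x \<in> adjoin l a" for x
  proof -
    obtain p where p: "coeffs_in l p" "x = poly p a" using x by (auto simp: adjoin_def)
    from coeffs_in_divmod[OF f'(1,2) p(1)] obtain q s where qs: "coeffs_in l q" "coeffs_in l s"
      "p = f * q + s" "s = 0 \<or> Polynomial.degree s < ?m" by blast
    have "x = poly s a" using p qs f'(3) by simp
    also have "\<dots> = (\<Sum>j\<le>Polynomial.degree s. Polynomial.coeff s j * a ^ j)" by (rule poly_altdef)
    also have "\<dots> = (\<Sum>j<?m. Polynomial.coeff s j * a ^ j)"
      by (rule sum.mono_neutral_left)
        (use qs(4) min_poly_degree_pos[OF f] in \<open>auto intro!: coeff_eq_0\<close>)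
    finally show ?thesis using qs(2) by (auto simp: coeffs_in_def)
  qed
  have ind: "\<forall>j<?m. c j = 0" if c: "\<forall>j. c j \<in> l" "(\<Sum>j<?m. c j * a ^ j) = 0" for c
  proof -
    define p where "p = (\<Sum>j<?m. Polynomial.monom (c j) j)"
    have "coeffs_in l p" unfolding p_def by (intro coeffs_in_sum coeffs_in_monom) (use c in auto)
    moreover have "poly p a = 0" using c(2) by (simp add: p_def poly_sum poly_monom)
    moreover have "Polynomial.degree p < ?m" unfolding p_def
      using min_poly_degree_pos[OF f]
      by (intro degree_sum_less) (auto intro: le_less_trans[OF degree_monom_le])
    ultimately have "p = 0" using f unfolding min_poly_def by fastforce
    moreover have "Polynomial.coeff p j = c j" if "j < ?m" for j
    proof -
      have "Polynomial.coeff p j = (\<Sum>i<?m. if i = j then c j else 0)"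
        by (auto simp: p_def Polynomial.coeff_sum intro!: sum.cong)
      then show ?thesis using that by simp
    qed
    ultimately show ?thesis by auto
  qed
  show ?thesis unfolding basis_over_def using pw sp ind by auto
qed

end

section \<open>Embeddings\<close>

lemma embeddings_iff:
  "\<sigma> \<in> embeddings k \<longleftrightarrow> \<sigma> \<in> extensional k \<and>
     (\<forall>x\<in>k. \<forall>y\<in>k. \<sigma> (x * y) = \<sigma> x * \<sigma> y \<and> \<sigma> (x + y) = \<sigma> x + \<sigma> y) \<and> \<sigma> 1 = 1"
  unfolding embeddings_def Ring.ring_hom_def by (auto simp: ring_of_type_algebra_def)

context
  fixes k :: "'a::field_char_0 set" and \<sigma> :: "'a \<Rightarrow> complex"
  assumes k: "subfield_of_type k" and \<sigma>: "\<sigma> \<in> embeddings k"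
begin

lemma emb_1: "\<sigma> 1 = 1" and emb_add: "x \<in> k \<Longrightarrow> y \<in> k \<Longrightarrow> \<sigma> (x + y) = \<sigma> x + \<sigma> y"
  and emb_mult: "x \<in> k \<Longrightarrow> y \<in> k \<Longrightarrow> \<sigma> (x * y) = \<sigma> x * \<sigma> y"
  using \<sigma> by (auto simp: embeddings_iff)

lemma emb_0: "\<sigma> 0 = 0"
  using emb_add[of 0 0] sf_0[OF k] by simp

lemma emb_uminus: "x \<in> k \<Longrightarrow> \<sigma> (- x) = - \<sigma> x"
  using emb_add[of x "- x"] sf_uminus[OF k, of x] by (simp add: emb_0 eq_neg_iff_add_eq_0 add.commute)

lemma emb_diff: "x \<in> k \<Longrightarrow> y \<in> k \<Longrightarrow> \<sigma> (x - y) = \<sigma> x - \<sigma> y"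
  using emb_add[of x "- y"] sf_uminus[OF k, of y] by (simp add: emb_uminus)

lemma emb_eq_0_iff: "x \<in> k \<Longrightarrow> \<sigma> x = 0 \<longleftrightarrow> x = 0"
  using emb_mult[of x "inverse x"] sf_inverse[OF k, of x] by (cases "x = 0") (auto simp: emb_0 emb_1)

lemma emb_inverse: "x \<in> k \<Longrightarrow> \<sigma> (inverse x) = inverse (\<sigma> x)"
  using emb_mult[of x "inverse x"] sf_inverse[OF k, of x]
  by (cases "x = 0") (auto simp: emb_0 emb_1 intro!: inverse_unique[symmetric])

lemma emb_divide: "x \<in> k \<Longrightarrow> y \<in> k \<Longrightarrow> \<sigma> (x / y) = \<sigma> x / \<sigma> y"
  by (simp add: divide_inverse emb_mult emb_inverse sf_inverse[OF k])

lemma emb_sum: "(\<And>i. i \<in> I \<Longrightarrow> f i \<in> k) \<Longrightarrow> \<sigma> (sum f I) = (\<Sum>i\<in>I. \<sigma> (f i))"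
  by (induction I rule: infinite_finite_induct) (auto simp: emb_0 emb_add sf_sum[OF k])

lemma emb_power: "x \<in> k \<Longrightarrow> \<sigma> (x ^ n) = \<sigma> x ^ n"
  by (induction n) (auto simp: emb_1 emb_mult sf_power[OF k])

lemma emb_of_nat: "\<sigma> (of_nat n) = of_nat n"
  by (induction n) (auto simp: emb_0 emb_1 emb_add sf_intros[OF k])

lemma emb_of_int: "\<sigma> (of_int n) = of_int n"
proof (cases "n \<ge> 0")
  case True
  then show ?thesis using emb_of_nat[of "nat n"] by simp
next
  case False
  then have "n = - int (nat (- n))" by simp
  then show ?thesis using emb_uminus[OF sf_of_nat[OF k], of "nat (- n)"] emb_of_nat
    by (metis of_int_minus of_int_of_nat_eq)
qed

lemma emb_Rats: "x \<in> \<rat> \<Longrightarrow> \<sigma> x = of_rat (THE q. x = of_rat q)"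
proof -
  assume "x \<in> \<rat>"
  then obtain a b where ab: "b > 0" "x = of_int a / of_int b" by (auto elim!: Rats_cases')
  define q :: rat where "q = of_int a / of_int b"
  have q: "x = of_rat q" by (simp add: q_def ab of_rat_divide)
  have "\<sigma> x = of_rat q"
    by (simp add: q_def ab(2) of_rat_divide emb_divide emb_of_int sf_of_int[OF k])
  moreover have "(THE q. x = of_rat q) = q" using q by (intro the_equality) auto
  ultimately show ?thesis by simp
qed

lemma coeff_map_emb: "Polynomial.coeff (map_poly \<sigma> p) i = \<sigma> (Polynomial.coeff p i)"
  by (rule coeff_map_poly) (rule emb_0)

lemma map_emb_mult:
  "coeffs_in k p \<Longrightarrow> coeffs_in k q \<Longrightarrow> map_poly \<sigma> (p * q) = map_poly \<sigma> p * map_poly \<sigma> q"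
  by (intro poly_eqI)
    (auto simp: coeff_map_emb coeff_mult emb_sum emb_mult coeffs_in_def sf_intros[OF k])

lemma map_emb_add:
  "coeffs_in k p \<Longrightarrow> coeffs_in k q \<Longrightarrow> map_poly \<sigma> (p + q) = map_poly \<sigma> p + map_poly \<sigma> q"
  by (intro poly_eqI) (auto simp: coeff_map_emb emb_add coeffs_in_def)

lemma map_emb_diff:
  "coeffs_in k p \<Longrightarrow> coeffs_in k q \<Longrightarrow> map_poly \<sigma> (p - q) = map_poly \<sigma> p - map_poly \<sigma> q"
  by (intro poly_eqI) (auto simp: coeff_map_emb emb_diff coeffs_in_def)

lemma map_emb_pderiv:
  "coeffs_in k p \<Longrightarrow> map_poly \<sigma> (pderiv p) = pderiv (map_poly \<sigma> p)"
  by (intro poly_eqI)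
    (auto simp: coeff_map_emb coeff_pderiv emb_mult emb_add emb_1 emb_of_nat coeffs_in_def
      sf_intros[OF k] simp del: of_nat_Suc)

lemma emb_poly:
  assumes "coeffs_in k p" "x \<in> k"
  shows "\<sigma> (poly p x) = poly (map_poly \<sigma> p) (\<sigma> x)"
proof -
  have "\<sigma> (poly p x) = (\<Sum>i\<le>Polynomial.degree p. \<sigma> (Polynomial.coeff p i) * \<sigma> x ^ i)"
    using assms by (simp add: poly_altdef emb_sum emb_mult emb_power coeffs_in_def sf_intros[OF k])
  also have "\<dots> = (\<Sum>i\<le>Polynomial.degree (map_poly \<sigma> p). \<sigma> (Polynomial.coeff p i) * \<sigma> x ^ i)"
    by (rule sum.mono_neutral_right)
      (auto simp: not_le coeff_map_emb[symmetric] intro: coeff_eq_0 degree_map_poly_le le_trans)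
  finally show ?thesis by (simp add: poly_altdef coeff_map_emb)
qed

end

lemma emb_restrict:
  assumes "subfield_of_type k" "\<sigma> \<in> embeddings k" "subfield_of_type l" "l \<subseteq> k"
  shows "restrict \<sigma> l \<in> embeddings l"
  using assms sf_intros[OF assms(3)] unfolding embeddings_iff[of "restrict \<sigma> l"]
  by (auto simp: emb_add emb_mult emb_1 subset_iff)

lemma emb_cnj:
  assumes "subfield_of_type k" "\<sigma> \<in> embeddings k"
  shows "restrict (\<lambda>x. cnj (\<sigma> x)) k \<in> embeddings k"
  using assms(2) sf_intros[OF assms(1)] unfolding embeddings_iff[of "restrict _ k"]
  by (auto simp: emb_add[OF assms] emb_mult[OF assms] emb_1[OF assms])

section \<open>Counting extensions of embeddings\<close>

definition emb_ext :: "'a::field_char_0 set \<Rightarrow> 'a set \<Rightarrow> ('a \<Rightarrow> complex) \<Rightarrow> ('a \<Rightarrow> complex) set" where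
  "emb_ext l k \<sigma> = {\<tau> \<in> embeddings k. \<forall>x\<in>l. \<tau> x = \<sigma> x}"

text \<open>An extension of \<open>\<sigma>\<close> to \<open>l(a)\<close> is determined by the
  image of \<open>a\<close>, which can be any complex root of \<open>\<sigma> f\<close>. These roots
  are simple in characteristic 0, so there are as many as the degree of \<open>f\<close>.\<close>

lemma emb_ext_adjoin:
  assumes kn: "degree_over l k n" and a: "a \<in> k" and \<sigma>: "\<sigma> \<in> embeddings l"
    and f: "min_poly l a f"
  shows "bij_betw (\<lambda>\<tau>. \<tau> a) (emb_ext l (adjoin l a) \<sigma>) {z. poly (map_poly \<sigma> f) z = 0}"
    and "card {z. poly (map_poly \<sigma> f) z = 0} = Polynomial.degree f"
proof -
  from kn have l: "subfield_of_type l" by (auto simp: degree_over_def)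
  let ?L = "adjoin l a"
  have L: "subfield_of_type ?L" by (rule adjoin_subfield[OF l kn a])
  have lL: "l \<subseteq> ?L" by (rule adjoin_superset[OF l])
  have aL: "a \<in> ?L" by (rule adjoin_self[OF l])
  have f': "coeffs_in l f" "Polynomial.lead_coeff f = 1" "poly f a = 0"
    using f by (auto simp: min_poly_def[OF l])
  have val: "\<tau> (poly p a) = poly (map_poly \<sigma> p) (\<tau> a)"
    if "\<tau> \<in> emb_ext l ?L \<sigma>" "coeffs_in l p" for \<tau> p
  proof -
    have t: "\<tau> \<in> embeddings ?L" using that by (simp add: emb_ext_def)
    have "map_poly \<tau> p = map_poly \<sigma> p"
      using that by (intro poly_eqI)
        (auto simp: coeff_map_emb[OF L t] coeff_map_emb[OF l \<sigma>] coeffs_in_def emb_ext_def)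
    moreover have "coeffs_in ?L p" using that lL by (auto simp: coeffs_in_def)
    ultimately show ?thesis using emb_poly[OF L t _ aL] by simp
  qed
  have ex: "\<exists>\<tau>\<in>emb_ext l ?L \<sigma>. \<tau> a = z" if z: "poly (map_poly \<sigma> f) z = 0" for z
  proof -
    \<comment> \<open>Well-definedness of the extension: two polynomials representing the same
      element of \<open>l(a)\<close> differ by a multiple of \<open>f\<close>, which vanishes at
      \<open>z\<close> after applying \<open>\<sigma>\<close>.\<close>
    have wd: "poly (map_poly \<sigma> p) z = poly (map_poly \<sigma> q) z"
      if "coeffs_in l p" "coeffs_in l q" "poly p a = poly q a" for p q
    proof -
      have "coeffs_in l (p - q)" "poly (p - q) a = 0" using that coeffs_in_diff[OF l] by auto
      then obtain h where h: "coeffs_in l h" "p - q = f * h" by (rule min_poly_dvd[OF l f])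
      have "poly (map_poly \<sigma> (p - q)) z = 0"
        using z by (simp add: h map_emb_mult[OF l \<sigma> f'(1) h(1)])
      then show ?thesis by (simp add: map_emb_diff[OF l \<sigma>] that)
    qed
    define P where "P = (\<lambda>x. SOME p. coeffs_in l p \<and> x = poly p a)"
    have P: "coeffs_in l (P x) \<and> x = poly (P x) a" if "x \<in> ?L" for x
    proof -
      from that obtain p where "coeffs_in l p \<and> x = poly p a" by (auto simp: adjoin_def)
      then show ?thesis unfolding P_def by (rule someI)
    qed
    define \<tau> where "\<tau> = restrict (\<lambda>x. poly (map_poly \<sigma> (P x)) z) ?L"
    have \<tau>: "\<tau> (poly p a) = poly (map_poly \<sigma> p) z" if "coeffs_in l p" for p
    proof -
      have "poly p a \<in> ?L" using that by (auto simp: adjoin_def)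
      then show ?thesis using wd[of "P (poly p a)" p] P[of "poly p a"] that by (simp add: \<tau>_def)
    qed
    have "\<tau> \<in> embeddings ?L" unfolding embeddings_iff
    proof (intro conjI ballI)
      show "\<tau> \<in> extensional ?L" by (simp add: \<tau>_def)
      have "\<tau> (poly 1 a) = 1" by (subst \<tau>) (auto simp: coeffs_in_1[OF l] emb_1[OF l \<sigma>])
      then show "\<tau> 1 = 1" by simp
      fix x y assume xy: "x \<in> ?L" "y \<in> ?L"
      then obtain p q where pq: "coeffs_in l p" "x = poly p a" "coeffs_in l q" "y = poly q a"
        by (auto simp: adjoin_def)
      show "\<tau> (x * y) = \<tau> x * \<tau> y"
        using \<tau>[of "p * q"] pq by (simp add: \<tau> coeffs_in_mult[OF l] map_emb_mult[OF l \<sigma>])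
      show "\<tau> (x + y) = \<tau> x + \<tau> y"
        using \<tau>[of "p + q"] pq by (simp add: \<tau> coeffs_in_add[OF l] map_emb_add[OF l \<sigma>])
    qed
    moreover have mp: "map_poly \<sigma> [:x, y:] = [:\<sigma> x, \<sigma> y:]" "map_poly \<sigma> [:x:] = [:\<sigma> x:]" for x y
      by (auto intro!: poly_eqI simp: coeff_map_emb[OF l \<sigma>] emb_0[OF l \<sigma>] coeff_pCons split: nat.split)
    moreover have "\<tau> x = \<sigma> x" if "x \<in> l" for x
      using \<tau>[of "[:x:]"] that coeffs_in_pCons[OF l that coeffs_in_0[OF l]]
      by (simp add: mp emb_0[OF l \<sigma>])
    moreover have "\<tau> a = z"
      using \<tau>[of "[:0, 1:]"] coeffs_in_pCons[OF l sf_0[OF l] coeffs_in_pCons[OF l sf_1[OF l] coeffs_in_0[OF l]]]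
      by (simp add: mp emb_0[OF l \<sigma>] emb_1[OF l \<sigma>])
    ultimately show ?thesis by (intro bexI[of _ \<tau>]) (auto simp: emb_ext_def)
  qed
  show "bij_betw (\<lambda>\<tau>. \<tau> a) (emb_ext l ?L \<sigma>) {z. poly (map_poly \<sigma> f) z = 0}"
    unfolding bij_betw_def
  proof
    show "inj_on (\<lambda>\<tau>. \<tau> a) (emb_ext l ?L \<sigma>)"
    proof (rule inj_onI)
      fix \<tau> \<tau>' assume t: "\<tau> \<in> emb_ext l ?L \<sigma>" "\<tau>' \<in> emb_ext l ?L \<sigma>" "\<tau> a = \<tau>' a"
      have "\<tau> x = \<tau>' x" if "x \<in> ?L" for x
      proof -
        from that obtain p where p: "coeffs_in l p" "x = poly p a" by (auto simp: adjoin_def)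
        show ?thesis using val[OF t(1) p(1)] val[OF t(2) p(1)] t(3) p(2) by simp
      qed
      then show "\<tau> = \<tau>'"
        using t by (auto simp: emb_ext_def embeddings_iff intro: extensionalityI)
    qed
    show "(\<lambda>\<tau>. \<tau> a) ` emb_ext l ?L \<sigma> = {z. poly (map_poly \<sigma> f) z = 0}"
    proof (intro equalityI subsetI)
      fix z assume "z \<in> (\<lambda>\<tau>. \<tau> a) ` emb_ext l ?L \<sigma>"
      then obtain \<tau> where t: "\<tau> \<in> emb_ext l ?L \<sigma>" "z = \<tau> a" by auto
      have "\<tau> (poly f a) = 0" using t(1) f'(3) emb_0[OF L] by (auto simp: emb_ext_def)
      then show "z \<in> {z. poly (map_poly \<sigma> f) z = 0}" using val[OF t(1) f'(1)] t(2) by simp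
    next
      fix z assume "z \<in> {z. poly (map_poly \<sigma> f) z = 0}"
      then show "z \<in> (\<lambda>\<tau>. \<tau> a) ` emb_ext l ?L \<sigma>" using ex by fastforce
    qed
  qed
  define g where "g = map_poly \<sigma> f"
  have cg: "Polynomial.coeff g i = \<sigma> (Polynomial.coeff f i)" for i
    unfolding g_def by (rule coeff_map_emb[OF l \<sigma>])
  have dg: "Polynomial.degree g = Polynomial.degree f"
  proof (rule antisym)
    show "Polynomial.degree g \<le> Polynomial.degree f" unfolding g_def by (rule degree_map_poly_le)
    show "Polynomial.degree f \<le> Polynomial.degree g"
      by (rule le_degree) (use f'(2) in \<open>simp add: cg emb_1[OF l \<sigma>]\<close>)
  qed
  have g0: "g \<noteq> 0" using min_poly_degree_pos[OF l f] dg by auto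
  \<comment> \<open>The derivative of \<open>f\<close> has smaller degree and so does not vanish at
    \<open>a\<close>; an embedding sending \<open>a\<close> to \<open>z\<close> carries this over to
    \<open>z\<close>.\<close>
  have simple: "poly (pderiv g) z \<noteq> 0" if z: "poly g z = 0" for z
  proof -
    obtain \<tau> where t: "\<tau> \<in> emb_ext l ?L \<sigma>" "\<tau> a = z" using ex z by (auto simp: g_def)
    have pd: "coeffs_in l (pderiv f)"
      using f'(1) by (auto simp: coeffs_in_def coeff_pderiv intro!: sf_intros[OF l] simp del: of_nat_Suc)
    have dpd: "Polynomial.degree (pderiv f) < Polynomial.degree f" "pderiv f \<noteq> 0"
      using min_poly_degree_pos[OF l f] by (auto simp: degree_pderiv pderiv_eq_0_iff)
    have "poly (pderiv f) a \<noteq> 0"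
      using f pd dpd unfolding min_poly_def[OF l] by (metis not_le)
    moreover have "poly (pderiv f) a \<in> ?L" using pd by (auto simp: adjoin_def)
    ultimately have "\<tau> (poly (pderiv f) a) \<noteq> 0"
      using t emb_eq_0_iff[OF L, of \<tau>] by (auto simp: emb_ext_def)
    then show ?thesis using val[OF t(1) pd] t(2) by (simp add: map_emb_pderiv[OF l \<sigma> f'(1)] g_def)
  qed
  then have "rsquarefree g" using g0 by (auto simp: rsquarefree_roots)
  then show "card {z. poly (map_poly \<sigma> f) z = 0} = Polynomial.degree f"
    using rsquarefree_card_degree[OF g0] dg by (simp add: g_def)
qed

text \<open>Adjoin one element outside \<open>l\<close>: \<open>\<sigma>\<close> extends to
  \<open>l(a)\<close> in \<open>m\<close> ways, and by induction each of these extends to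
  \<open>k\<close> in \<open>n / m\<close> ways. The induction leaves \<open>l\<close> and
  \<open>\<sigma>\<close> arbitrary because the base field grows.\<close>

lemma card_emb_ext:
  assumes "degree_over l k n" "\<sigma> \<in> embeddings l"
  shows "card (emb_ext l k \<sigma>) = n \<and> finite (emb_ext l k \<sigma>)"
  using assms
proof (induction n arbitrary: l \<sigma> rule: less_induct)
  case (less n)
  have l: "subfield_of_type l" and k: "subfield_of_type k" and lk: "l \<subseteq> k"
    using less.prems by (auto simp: degree_over_def)
  show ?case
  proof (cases "l = k")
    case True
    have "emb_ext l k \<sigma> = {\<sigma>}"
      using less.prems(2) True by (auto simp: emb_ext_def embeddings_iff intro: extensionalityI)
    moreover have "n = 1" using degree_over_unique[OF less.prems(1)] degree_over_self[OF l] True by auto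
    ultimately show ?thesis by simp
  next
    case False
    then obtain a where a: "a \<in> k" "a \<notin> l" using lk by auto
    obtain f where f: "min_poly l a f" by (rule ex_min_poly[OF l less.prems(1) a(1)])
    let ?L = "adjoin l a" and ?m = "Polynomial.degree f"
    have L: "subfield_of_type ?L" by (rule adjoin_subfield[OF l less.prems(1) a(1)])
    have lL: "l \<subseteq> ?L" and Lk: "?L \<subseteq> k" and aL: "a \<in> ?L"
      using adjoin_superset[OF l] adjoin_subset[OF l k lk a(1)] adjoin_self[OF l] by auto
    have m: "degree_over l ?L ?m"
      using basis_degree_over[OF l L lL adjoin_basis[OF l f]] by simp
    obtain a' b where ab: "degree_over l ?L a'" "degree_over ?L k b" "n = a' * b"
      using degree_over_tower[OF less.prems(1) L lL Lk] .
    have n: "n = ?m * b" using ab degree_over_unique[OF m ab(1)] by simp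
    have "?m \<noteq> 1" using degree_over_1_eq[of l ?L] m aL a by auto
    moreover have "?m > 0" "b > 0" using degree_over_pos m ab by auto
    ultimately have bn: "b < n" unfolding n by (cases ?m) auto
    let ?E = "emb_ext l ?L \<sigma>"
    have cE: "card ?E = ?m"
      using emb_ext_adjoin[OF less.prems(1) a(1) less.prems(2) f] bij_betw_same_card by metis
    then have fE: "finite ?E" using \<open>?m > 0\<close> by (metis card.infinite less_irrefl)
    have U: "emb_ext l k \<sigma> = (\<Union>\<tau>\<in>?E. emb_ext ?L k \<tau>)"
    proof (intro equalityI subsetI)
      fix \<rho> assume r: "\<rho> \<in> emb_ext l k \<sigma>"
      then have "restrict \<rho> ?L \<in> embeddings ?L"
        using emb_restrict[OF k _ L Lk] by (auto simp: emb_ext_def)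
      then show "\<rho> \<in> (\<Union>\<tau>\<in>?E. emb_ext ?L k \<tau>)"
        using r lL by (intro UN_I[of "restrict \<rho> ?L"]) (auto simp: emb_ext_def)
    qed (use lL in \<open>auto simp: emb_ext_def\<close>)
    have IH: "card (emb_ext ?L k \<tau>) = b \<and> finite (emb_ext ?L k \<tau>)" if "\<tau> \<in> ?E" for \<tau>
      by (rule less.IH[OF bn ab(2)]) (use that in \<open>simp add: emb_ext_def\<close>)
    have disj: "emb_ext ?L k \<tau> \<inter> emb_ext ?L k \<tau>' = {}" if "\<tau> \<in> ?E" "\<tau>' \<in> ?E" "\<tau> \<noteq> \<tau>'" for \<tau> \<tau>'
    proof (rule ccontr)
      assume "emb_ext ?L k \<tau> \<inter> emb_ext ?L k \<tau>' \<noteq> {}"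
      then have "\<forall>x\<in>?L. \<tau> x = \<tau>' x" by (auto simp: emb_ext_def)
      then have "\<tau> = \<tau>'" using that by (auto simp: emb_ext_def embeddings_iff intro: extensionalityI)
      then show False using that by simp
    qed
    have "card (emb_ext l k \<sigma>) = (\<Sum>\<tau>\<in>?E. card (emb_ext ?L k \<tau>))"
      unfolding U by (rule card_UN_disjoint) (use fE IH disj in auto)
    also have "\<dots> = n" using IH cE n by simp
    finally show ?thesis using U fE IH by auto
  qed
qed

text \<open>Every embedding extends the unique embedding of \<open>\<rat>\<close>, so
  \<open>card_emb_ext\<close> applies with the base field \<open>\<rat>\<close>.\<close>

lemma card_embeddings:
  assumes "degree_over \<rat> k n"
  shows "card (embeddings k) = n" "finite (embeddings k)"
proof -
  have k: "subfield_of_type k" using assms by (auto simp: degree_over_def)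
  define \<sigma> :: "'a \<Rightarrow> complex" where "\<sigma> = restrict (\<lambda>x. of_rat (THE q. x = of_rat q)) \<rat>"
  have s: "\<sigma> (of_rat q) = of_rat q" for q
  proof -
    have "(THE q'. (of_rat q :: 'a) = of_rat q') = q" by (rule the_equality) auto
    then show ?thesis by (simp add: \<sigma>_def)
  qed
  have "\<sigma> \<in> embeddings \<rat>" unfolding embeddings_iff
  proof (intro conjI ballI)
    show "\<sigma> \<in> extensional \<rat>" by (simp add: \<sigma>_def)
    show "\<sigma> 1 = 1" using s[of 1] by simp
    fix x y :: 'a assume "x \<in> \<rat>" "y \<in> \<rat>"
    then obtain p q where "x = of_rat p" "y = of_rat q" by (auto elim!: Rats_cases)
    then show "\<sigma> (x * y) = \<sigma> x * \<sigma> y" "\<sigma> (x + y) = \<sigma> x + \<sigma> y"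
      by (simp_all add: s flip: of_rat_mult of_rat_add)
  qed
  moreover have "emb_ext \<rat> k \<sigma> = embeddings k"
    by (auto simp: emb_ext_def \<sigma>_def emb_Rats[OF k])
  ultimately show "card (embeddings k) = n" "finite (embeddings k)"
    using card_emb_ext[OF assms, of \<sigma>] by auto
qed

text \<open>Artin's argument for independence of characters: subtracting \<open>\<tau> y\<close>
  times the relation at \<open>x\<close> from the relation at \<open>y * x\<close> removes the term
  of \<open>\<tau>\<close>, and \<open>y\<close> is chosen to separate \<open>\<sigma>\<close> from
  \<open>\<tau>\<close>.\<close>

lemma embeddings_independent:
  assumes k: "subfield_of_type k" and "finite S" "S \<subseteq> embeddings k"
    and "\<forall>x\<in>k. (\<Sum>\<sigma>\<in>S. c \<sigma> * \<sigma> x) = 0"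
  shows "\<forall>\<sigma>\<in>S. c \<sigma> = 0"
  using assms(2-4)
proof (induction S arbitrary: c rule: finite_induct)
  case (insert \<tau> S)
  have t: "\<tau> \<in> embeddings k" using insert.prems by auto
  have cS: "c \<sigma> = 0" if s: "\<sigma> \<in> S" for \<sigma>
  proof -
    have se: "\<sigma> \<in> embeddings k" using insert.prems s by auto
    have "\<sigma> \<noteq> \<tau>" using insert.hyps s by auto
    then have "\<not> (\<forall>y\<in>k. \<sigma> y = \<tau> y)"
      using se t by (auto simp: embeddings_iff intro: extensionalityI)
    then obtain y where y: "y \<in> k" "\<sigma> y \<noteq> \<tau> y" by auto
    have "\<forall>x\<in>k. (\<Sum>\<rho>\<in>S. (c \<rho> * (\<rho> y - \<tau> y)) * \<rho> x) = 0"
    proof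
      fix x assume x: "x \<in> k"
      have "(\<Sum>\<rho>\<in>insert \<tau> S. c \<rho> * \<rho> (y * x)) = 0"
        using insert.prems(2) sf_mult[OF k y(1) x] by blast
      moreover have "(\<Sum>\<rho>\<in>insert \<tau> S. c \<rho> * \<rho> (y * x)) = (\<Sum>\<rho>\<in>insert \<tau> S. c \<rho> * (\<rho> y * \<rho> x))"
        by (rule sum.cong) (use insert.prems(1) emb_mult[OF k _ y(1) x] in auto)
      moreover have "\<tau> y * (\<Sum>\<rho>\<in>insert \<tau> S. c \<rho> * \<rho> x) = 0" using insert.prems(2) x by simp
      ultimately have "(\<Sum>\<rho>\<in>insert \<tau> S. c \<rho> * (\<rho> y * \<rho> x)) - \<tau> y * (\<Sum>\<rho>\<in>insert \<tau> S. c \<rho> * \<rho> x) = 0"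
        by simp
      then have "(\<Sum>\<rho>\<in>insert \<tau> S. (c \<rho> * (\<rho> y - \<tau> y)) * \<rho> x) = 0"
        by (simp add: sum_distrib_left algebra_simps flip: sum_subtractf)
      then show "(\<Sum>\<rho>\<in>S. (c \<rho> * (\<rho> y - \<tau> y)) * \<rho> x) = 0" using insert.hyps by simp
    qed
    then have "c \<sigma> * (\<sigma> y - \<tau> y) = 0" using insert.IH[of "\<lambda>\<rho>. c \<rho> * (\<rho> y - \<tau> y)"] insert.prems(1) s by auto
    then show ?thesis using y by simp
  qed
  have "(\<Sum>\<sigma>\<in>insert \<tau> S. c \<sigma> * \<sigma> 1) = 0" using insert.prems(2) sf_1[OF k] by blast
  then have "c \<tau> = 0" using insert.hyps cS emb_1[OF k t] by simp
  then show ?case using cS by auto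
qed simp

section \<open>Algebraic integers form a ring\<close>

definition int_span :: "'a::field_char_0 set \<Rightarrow> 'a set" where
  "int_span W = {\<Sum>w\<in>W. of_int (c w) * w | c. True}"

lemma int_span_add: "x \<in> int_span W \<Longrightarrow> y \<in> int_span W \<Longrightarrow> x + y \<in> int_span W"
  unfolding int_span_def
proof clarify
  fix c d :: "'a \<Rightarrow> int"
  show "\<exists>e. (\<Sum>w\<in>W. of_int (c w) * w) + (\<Sum>w\<in>W. of_int (d w) * w) = (\<Sum>w\<in>W. of_int (e w) * w) \<and> True"
    by (rule exI[of _ "\<lambda>w. c w + d w"]) (simp add: algebra_simps sum.distrib)
qed

lemma int_span_mult: "x \<in> int_span W \<Longrightarrow> of_int n * x \<in> int_span W"
  unfolding int_span_def
proof clarify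
  fix c :: "'a \<Rightarrow> int"
  show "\<exists>e. of_int n * (\<Sum>w\<in>W. of_int (c w) * w) = (\<Sum>w\<in>W. of_int (e w) * w) \<and> True"
    by (rule exI[of _ "\<lambda>w. n * c w"]) (simp add: algebra_simps sum_distrib_left)
qed

lemma int_span_0: "0 \<in> int_span W"
  unfolding int_span_def by (rule CollectI, rule exI[of _ "\<lambda>_. 0"]) simp

lemma int_span_sum: "(\<And>i. i \<in> I \<Longrightarrow> f i \<in> int_span W) \<Longrightarrow> sum f I \<in> int_span W"
  by (induction I rule: infinite_finite_induct) (auto intro: int_span_0 int_span_add)

lemma int_span_base:
  assumes "finite W" "w \<in> W"
  shows "w \<in> int_span W"
proof -
  have eq: "w = (\<Sum>v\<in>W. of_int (if v = w then 1 else 0) * v)"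
    using assms by (simp add: if_distrib[of "\<lambda>a. of_int a * _"] sum.delta cong: if_cong)
  show ?thesis unfolding int_span_def
    by (rule CollectI, rule exI[of _ "\<lambda>v. if v = w then 1 else 0"], rule conjI[OF eq TrueI])
qed

text \<open>Multiplication by \<open>x\<close> on the span of \<open>W\<close> is given by an
  integer matrix. The vector of generators is an eigenvector for \<open>x\<close>, nonzero because
  of \<open>w0\<close>, so \<open>x\<close> is a root of a monic integer characteristic
  polynomial.\<close>

lemma algebraic_int_if_int_span:
  fixes x :: "'a::field_char_0"
  assumes W: "finite W" "w0 \<in> W" "w0 \<noteq> 0" and x: "\<And>w. w \<in> W \<Longrightarrow> x * w \<in> int_span W"
  shows "algebraic_int x"
proof -
  obtain ws where ws: "set ws = W" "distinct ws" using finite_distinct_list[OF W(1)] by blast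
  define n where "n = length ws"
  have "\<exists>a. \<forall>i<n. x * ws ! i = (\<Sum>j<n. of_int (a i j) * ws ! j)"
  proof -
    have "\<exists>a. x * ws ! i = (\<Sum>j<n. of_int (a j) * ws ! j)" if i: "i < n" for i
    proof -
      have "x * ws ! i \<in> int_span W" using i ws by (intro x) (auto simp: n_def)
      then obtain c where c: "x * ws ! i = (\<Sum>w\<in>W. of_int (c w) * w)" by (auto simp: int_span_def)
      have "bij_betw (\<lambda>j. ws ! j) {..<n} W" using ws by (auto simp: n_def intro!: bij_betw_nth)
      then show ?thesis using c sum.reindex_bij_betw[of "\<lambda>j. ws ! j" "{..<n}" W "\<lambda>w. of_int (c w) * w"]
        by (intro exI[of _ "\<lambda>j. c (ws ! j)"]) simp
    qed
    then show ?thesis by metis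
  qed
  then obtain a where a: "\<And>i. i < n \<Longrightarrow> x * ws ! i = (\<Sum>j<n. of_int (a i j) * ws ! j)" by blast
  define A where "A = mat n n (\<lambda>(i, j). a i j)"
  let ?A = "map_mat of_int A :: 'a mat"
  have A: "A \<in> carrier_mat n n" and A': "?A \<in> carrier_mat n n" by (auto simp: A_def)
  have "eigenvector ?A (vec n (\<lambda>i. ws ! i)) x"
    unfolding eigenvector_def
  proof (intro conjI)
    show "vec n (\<lambda>i. ws ! i) \<in> carrier_vec (dim_row ?A)" using A by auto
    obtain i where i: "i < n" "ws ! i = w0" using W ws by (metis in_set_conv_nth n_def)
    then have "vec n (\<lambda>i. ws ! i) $ i \<noteq> 0\<^sub>v n $ i" using W by simp
    then show "vec n (\<lambda>i. ws ! i) \<noteq> 0\<^sub>v (dim_row ?A)" using A by auto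
    show "?A *\<^sub>v vec n (\<lambda>i. ws ! i) = x \<cdot>\<^sub>v vec n (\<lambda>i. ws ! i)"
      by (rule eq_vecI) (auto simp: A_def a scalar_prod_def atLeast0LessThan)
  qed
  then have "eigenvalue ?A x" by (auto simp: eigenvalue_def)
  then have "poly (char_poly ?A) x = 0" using eigenvalue_root_char_poly[OF A'] by simp
  then have "poly (map_poly of_int (char_poly A)) x = 0"
    by (simp add: of_int_hom.char_poly_hom[OF A])
  moreover have "Polynomial.lead_coeff (char_poly A) = 1" using degree_monic_char_poly[OF A] by auto
  ultimately show ?thesis unfolding algebraic_int_altdef_ipoly by blast
qed

lemma algebraic_int_power_sum:
  fixes x :: "'a::field_char_0"
  assumes "algebraic_int x"
  obtains m c where "m > 0" "x ^ m = (\<Sum>i<m. of_int (c i) * x ^ i)"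
proof -
  obtain p where p: "poly (map_poly of_int p) x = 0" "Polynomial.lead_coeff p = 1"
    using assms by (auto simp: algebraic_int_altdef_ipoly)
  define m where "m = Polynomial.degree p"
  have m: "m > 0"
  proof (rule ccontr)
    assume "\<not> m > 0"
    then have "p = [:1:]" using p(2) by (auto simp: m_def elim!: degree_eq_zeroE)
    then show False using p(1) by simp
  qed
  have "0 = (\<Sum>i\<le>m. of_int (Polynomial.coeff p i) * x ^ i)"
    using p(1) by (simp add: poly_altdef m_def)
  also have "\<dots> = x ^ m + (\<Sum>i<m. of_int (Polynomial.coeff p i) * x ^ i)"
    using p(2) by (simp add: lessThan_Suc_atMost[symmetric] m_def)
  finally have "x ^ m = (\<Sum>i<m. of_int (- Polynomial.coeff p i) * x ^ i)"
    by (simp add: sum_negf eq_neg_iff_add_eq_0)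
  from that[OF m this] show thesis .
qed

text \<open>The products \<open>x ^ i * y ^ j\<close> with \<open>i < m\<close> and
  \<open>j < n\<close> span a module stable under both \<open>x\<close> and \<open>y\<close>; at the
  boundary exponent the integral equations reduce the power.\<close>

lemma
  fixes x y :: "'a::field_char_0"
  assumes "algebraic_int x" "algebraic_int y"
  shows algebraic_int_add: "algebraic_int (x + y)"
    and algebraic_int_mult: "algebraic_int (x * y)"
proof -
  obtain m c where c: "m > 0" "x ^ m = (\<Sum>i<m. of_int (c i) * x ^ i)"
    by (rule algebraic_int_power_sum[OF assms(1)])
  obtain n d where d: "n > 0" "y ^ n = (\<Sum>i<n. of_int (d i) * y ^ i)"
    by (rule algebraic_int_power_sum[OF assms(2)])
  define W where "W = (\<lambda>(i, j). x ^ i * y ^ j) ` ({..<m} \<times> {..<n})"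
  have fin: "finite W" by (simp add: W_def)
  have mem: "x ^ i * y ^ j \<in> W" if "i < m" "j < n" for i j using that by (auto simp: W_def)
  have one: "1 \<in> W" using mem[of 0 0] c(1) d(1) by simp
  have xW: "x * w \<in> int_span W" if "w \<in> W" for w
  proof -
    from that obtain i j where ij: "i < m" "j < n" "w = x ^ i * y ^ j" by (auto simp: W_def)
    show ?thesis
    proof (cases "Suc i < m")
      case True
      then have "x * w \<in> W" using mem[of "Suc i" j] ij by (simp add: mult.assoc)
      then show ?thesis by (rule int_span_base[OF fin])
    next
      case False
      then have "Suc i = m" using ij by simp
      then have "x * w = x ^ m * y ^ j" using ij by (auto simp: mult.assoc)
      also have "\<dots> = (\<Sum>i<m. of_int (c i) * (x ^ i * y ^ j))"
        by (simp add: c(2) sum_distrib_right mult.assoc)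
      also have "\<dots> \<in> int_span W"
        by (intro int_span_sum int_span_mult int_span_base[OF fin] mem) (use ij in auto)
      finally show ?thesis .
    qed
  qed
  have yW: "y * w \<in> int_span W" if "w \<in> W" for w
  proof -
    from that obtain i j where ij: "i < m" "j < n" "w = x ^ i * y ^ j" by (auto simp: W_def)
    show ?thesis
    proof (cases "Suc j < n")
      case True
      then have "y * w \<in> W" using mem[of i "Suc j"] ij by (simp add: ac_simps)
      then show ?thesis by (rule int_span_base[OF fin])
    next
      case False
      then have "Suc j = n" using ij by simp
      then have "y * w = x ^ i * y ^ n" using ij by (auto simp: ac_simps)
      also have "\<dots> = (\<Sum>j<n. of_int (d j) * (x ^ i * y ^ j))"
        by (simp add: d(2) sum_distrib_left ac_simps)
      also have "\<dots> \<in> int_span W"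
        by (intro int_span_sum int_span_mult int_span_base[OF fin] mem) (use ij in auto)
      finally show ?thesis .
    qed
  qed
  have xS: "x * s \<in> int_span W" if "s \<in> int_span W" for s
  proof -
    from that obtain e where "s = (\<Sum>w\<in>W. of_int (e w) * w)" by (auto simp: int_span_def)
    then have "x * s = (\<Sum>w\<in>W. of_int (e w) * (x * w))" by (simp add: sum_distrib_left ac_simps)
    then show ?thesis using xW by (auto intro!: int_span_sum int_span_mult)
  qed
  show "algebraic_int (x + y)"
    by (rule algebraic_int_if_int_span[OF fin one]) (auto simp: distrib_right intro: int_span_add xW yW)
  show "algebraic_int (x * y)"
    by (rule algebraic_int_if_int_span[OF fin one]) (auto simp: mult.assoc intro: xS yW)
qed

lemma algebraic_int_sum:
  "(\<And>i. i \<in> I \<Longrightarrow> algebraic_int (f i :: 'a::field_char_0)) \<Longrightarrow> algebraic_int (sum f I)"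
  by (induction I rule: infinite_finite_induct) (simp_all add: algebraic_int_add)

section \<open>Integer linear algebra\<close>

text \<open>Induction on the number of coordinates: the vectors with last coordinate 0 form a
  lattice of the same kind, and one vector with least positive last coordinate completes their
  basis. Discreteness is expressed by finiteness in the closed unit cube. The same lemma serves the
  ring of integers and the logarithms of units, once coordinates are chosen in which the lattice
  contains the standard basis.\<close>

lemma lattice_basis:
  fixes L :: "(nat \<Rightarrow> real) set"
  assumes "\<And>x i. x \<in> L \<Longrightarrow> i \<ge> r \<Longrightarrow> x i = 0"
    and "\<And>x y. x \<in> L \<Longrightarrow> y \<in> L \<Longrightarrow> (\<lambda>i. x i - y i) \<in> L"
    and "\<And>i. i < r \<Longrightarrow> (\<lambda>j. if j = i then 1 else 0) \<in> L" and "L \<noteq> {}"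
    and "finite {x \<in> L. \<forall>i<r. 0 \<le> x i \<and> x i \<le> 1}"
  shows "\<exists>b. (\<forall>i<r. b i \<in> L) \<and>
    (\<forall>x\<in>L. \<exists>c :: nat \<Rightarrow> int. \<forall>j. x j = (\<Sum>i<r. of_int (c i) * b i j)) \<and>
    (\<forall>c :: nat \<Rightarrow> int. (\<forall>j. (\<Sum>i<r. of_int (c i) * b i j) = 0) \<longrightarrow> (\<forall>i<r. c i = 0))"
  using assms
proof (induction r arbitrary: L)
  case 0
  then show ?case by auto
next
  case (Suc r)
  note L0 = Suc.prems(1) and Ld = Suc.prems(2) and Le = Suc.prems(3) and Lf = Suc.prems(5)
  have zero: "(\<lambda>_. 0) \<in> L" using Suc.prems(4) Ld by fastforce
  have Lm: "(\<lambda>i. - x i) \<in> L" if "x \<in> L" for x using Ld[OF zero that] by simp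
  have La: "(\<lambda>i. x i + y i) \<in> L" if "x \<in> L" "y \<in> L" for x y using Ld[OF that(1) Lm[OF that(2)]] by simp
  have Ln: "(\<lambda>i. of_nat n * x i) \<in> L" if "x \<in> L" for x and n :: nat
  proof (induction n)
    case (Suc n)
    then show ?case using La[OF Suc that] by (simp add: algebra_simps)
  qed (simp add: zero)
  have Li: "(\<lambda>i. of_int n * x i) \<in> L" if "x \<in> L" for x and n :: int
  proof (cases "n \<ge> 0")
    case True
    then show ?thesis using Ln[OF that, of "nat n"] by simp
  next
    case False
    then have "(\<lambda>i. of_int n * x i) = (\<lambda>i. - (of_nat (nat (- n)) * x i))" by auto
    then show ?thesis using Lm[OF Ln[OF that, of "nat (- n)"]] by (simp only:)
  qed
  have Ls: "(\<lambda>j. \<Sum>i\<in>I. f i j) \<in> L" if "finite I" "\<And>i. i \<in> I \<Longrightarrow> f i \<in> L" for f and I :: "nat set"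
    using that by (induction I rule: finite_induct) (auto simp: zero intro: La)
  \<comment> \<open>Subtracting integer parts leaves the last coordinate alone, so every last
    coordinate in \<open>(0, 1]\<close> is already attained in the finite cube and a least positive
    one exists.\<close>
  have red: "\<exists>y\<in>L. y r = x r \<and> (\<forall>i<r. 0 \<le> y i \<and> y i \<le> 1)" if x: "x \<in> L" for x
  proof -
    define s where "s = (\<lambda>j. \<Sum>i<r. of_int \<lfloor>x i\<rfloor> * (if j = i then 1 else 0 :: real))"
    have sL: "s \<in> L" unfolding s_def by (rule Ls) (auto intro!: Li Le)
    have sj: "s j = (if j < r then of_int \<lfloor>x j\<rfloor> else 0)" for j
      by (simp add: s_def if_distrib cong: if_cong)
    show ?thesis
    proof (intro bexI[of _ "\<lambda>i. x i - s i"] conjI allI impI)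
      show "(\<lambda>i. x i - s i) \<in> L" by (rule Ld[OF x sL])
      show "x r - s r = x r" by (simp add: sj)
      fix i assume "i < r"
      then have "x i - s i = frac (x i)" by (simp add: sj frac_def)
      then show "0 \<le> x i - s i" "x i - s i \<le> 1" using frac_lt_1[of "x i"] by auto
    qed
  qed
  define V where "V = (\<lambda>x. x r) ` {x \<in> L. (\<forall>i<Suc r. 0 \<le> x i \<and> x i \<le> 1) \<and> 0 < x r}"
  have finV: "finite V" unfolding V_def by (rule finite_imageI, rule finite_subset[OF _ Lf]) auto
  have VI: "x r \<in> V" if "x \<in> L" "0 < x r" "x r \<le> 1" for x
  proof -
    obtain y where "y \<in> L" "y r = x r" "\<forall>i<r. 0 \<le> y i \<and> y i \<le> 1" using red[OF \<open>x \<in> L\<close>] by auto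
    then show ?thesis unfolding V_def using that by (intro image_eqI[of _ _ y]) (auto simp: less_Suc_eq)
  qed
  have "1 \<in> V" using VI[OF Le[of r]] by simp
  define v where "v = Min V"
  have vV: "v \<in> V" unfolding v_def using finV \<open>1 \<in> V\<close> by (intro Min_in) auto
  then obtain b0 where b0: "b0 \<in> L" "b0 r = v" "0 < v" "v \<le> 1" by (auto simp: V_def)
  define L' where "L' = {x \<in> L. x r = 0}"
  have "\<exists>b. (\<forall>i<r. b i \<in> L') \<and>
    (\<forall>x\<in>L'. \<exists>c :: nat \<Rightarrow> int. \<forall>j. x j = (\<Sum>i<r. of_int (c i) * b i j)) \<and>
    (\<forall>c :: nat \<Rightarrow> int. (\<forall>j. (\<Sum>i<r. of_int (c i) * b i j) = 0) \<longrightarrow> (\<forall>i<r. c i = 0))"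
  proof (rule Suc.IH)
    show "x i = 0" if "x \<in> L'" "i \<ge> r" for x i
      using that L0[of x i] by (cases "i = r") (auto simp: L'_def)
    show "finite {x \<in> L'. \<forall>i<r. 0 \<le> x i \<and> x i \<le> 1}"
      by (rule finite_subset[OF _ Lf]) (auto simp: L'_def less_Suc_eq)
    show "(\<lambda>i. x i - y i) \<in> L'" if "x \<in> L'" "y \<in> L'" for x y
      using that Ld[of x y] by (simp add: L'_def)
    show "(\<lambda>j. if j = i then 1 else 0) \<in> L'" if "i < r" for i
      using that Le[of i] by (simp add: L'_def)
    have "(\<lambda>_. 0) \<in> L'" using zero by (simp add: L'_def)
    then show "L' \<noteq> {}" by blast
  qed
  then obtain b where "(\<forall>i<r. b i \<in> L') \<and>
    (\<forall>x\<in>L'. \<exists>c :: nat \<Rightarrow> int. \<forall>j. x j = (\<Sum>i<r. of_int (c i) * b i j)) \<and>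
    (\<forall>c :: nat \<Rightarrow> int. (\<forall>j. (\<Sum>i<r. of_int (c i) * b i j) = 0) \<longrightarrow> (\<forall>i<r. c i = 0))" ..
  then have b: "\<And>i. i < r \<Longrightarrow> b i \<in> L'"
    "\<And>x. x \<in> L' \<Longrightarrow> \<exists>c :: nat \<Rightarrow> int. \<forall>j. x j = (\<Sum>i<r. of_int (c i) * b i j)"
    "\<And>c :: nat \<Rightarrow> int. \<forall>j. (\<Sum>i<r. of_int (c i) * b i j) = 0 \<Longrightarrow> (\<forall>i<r. c i = 0)" by simp_all
  define b' where "b' = b(r := b0)"
  have b'r: "(\<Sum>i<r. of_int (c i) * b' i j) = (\<Sum>i<r. of_int (c i) * b i j)" for c :: "nat \<Rightarrow> int" and j
    by (rule sum.cong) (auto simp: b'_def)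
  have br0: "(\<Sum>i<r. of_int (c i) * b i r) = 0" for c :: "nat \<Rightarrow> int"
    by (rule sum.neutral) (use b(1) in \<open>auto simp: L'_def\<close>)
  show ?case
  proof (intro exI[of _ b'] conjI allI impI ballI)
    fix i assume "i < Suc r"
    then show "b' i \<in> L" using b(1) b0 by (auto simp: b'_def L'_def less_Suc_eq)
  next
    fix x assume x: "x \<in> L"
    \<comment> \<open>Division with remainder of the last coordinate by \<open>v\<close>: the
      remainder lies in \<open>[0, v)\<close>, and minimality of \<open>v\<close> makes it
      0.\<close>
    define n where "n = \<lfloor>x r / v\<rfloor>"
    define y where "y = (\<lambda>i. x i - of_int n * b0 i)"
    have yL: "y \<in> L" unfolding y_def by (rule Ld[OF x Li[OF b0(1)]])
    have n1: "of_int n \<le> x r / v" and n2: "x r / v < of_int n + 1" by (simp_all add: n_def)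
    have yr: "0 \<le> y r" "y r < v"
      using n1 n2 b0(3) by (simp_all add: y_def b0(2) field_simps)
    have "y r = 0"
    proof (rule ccontr)
      assume "y r \<noteq> 0"
      then have "y r \<in> V" using VI[OF yL] yr b0 by auto
      then have "v \<le> y r" unfolding v_def using finV by (rule Min_le[rotated])
      then show False using yr by simp
    qed
    then have "y \<in> L'" using yL by (simp add: L'_def)
    from b(2)[OF this] obtain c :: "nat \<Rightarrow> int" where c: "\<forall>j. y j = (\<Sum>i<r. of_int (c i) * b i j)" by blast
    have "\<forall>j. x j = (\<Sum>i<Suc r. of_int ((c(r := n)) i) * b' i j)"
    proof
      fix j
      have "(\<Sum>i<r. of_int ((c(r := n)) i) * b' i j) = y j"
        using c by (simp add: b'_def)
      then show "x j = (\<Sum>i<Suc r. of_int ((c(r := n)) i) * b' i j)" by (simp add: y_def b'_def)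
    qed
    then show "\<exists>c :: nat \<Rightarrow> int. \<forall>j. x j = (\<Sum>i<Suc r. of_int (c i) * b' i j)" by blast
  next
    fix c :: "nat \<Rightarrow> int" and i
    assume c: "\<forall>j. (\<Sum>i<Suc r. of_int (c i) * b' i j) = 0" and i: "i < Suc r"
    have "of_int (c r) * v = 0" using c[rule_format, of r] by (simp add: b'r br0) (simp add: b'_def b0)
    then have cr: "c r = 0" using b0 by simp
    then have "\<forall>j. (\<Sum>i<r. of_int (c i) * b i j) = 0" using c by (simp add: b'r)
    from b(3)[OF this] show "c i = 0" using i cr by (auto simp: less_Suc_eq)
  qed
qed

text \<open>Unless the determinant of \<open>B\<close> is 0, the integers \<open>det T\<close> and
  \<open>det T'\<close> have product 1, so each is 1 or -1. Independence of the discriminant and of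
  the regulator from all choices rests on this and on its column version.\<close>

lemma det_int_change_rows:
  fixes A B :: "nat \<Rightarrow> nat \<Rightarrow> 'f::field_char_0" and T T' :: "nat \<Rightarrow> nat \<Rightarrow> int"
  assumes A: "\<And>i j. i < n \<Longrightarrow> j < n \<Longrightarrow> A i j = (\<Sum>l<n. of_int (T i l) * B l j)"
    and B: "\<And>i j. i < n \<Longrightarrow> j < n \<Longrightarrow> B i j = (\<Sum>l<n. of_int (T' i l) * A l j)"
  shows "det (mat n n (\<lambda>(i, j). A i j)) = det (mat n n (\<lambda>(i, j). B i j)) \<or>
    det (mat n n (\<lambda>(i, j). A i j)) = - det (mat n n (\<lambda>(i, j). B i j))"
proof -
  let ?A = "mat n n (\<lambda>(i, j). A i j)" and ?B = "mat n n (\<lambda>(i, j). B i j)"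
  let ?T = "mat n n (\<lambda>(i, j). T i j)" and ?T' = "mat n n (\<lambda>(i, j). T' i j)"
  have "?A = map_mat of_int ?T * ?B"
    by (rule eq_matI) (auto simp: A scalar_prod_def atLeast0LessThan)
  then have dA: "det ?A = of_int (det ?T) * det ?B"
    by (simp add: det_mult[of _ n] of_int_hom.hom_det)
  have "?B = map_mat of_int ?T' * ?A"
    by (rule eq_matI) (auto simp: B scalar_prod_def atLeast0LessThan)
  then have dB: "det ?B = of_int (det ?T') * det ?A"
    by (simp add: det_mult[of _ n] of_int_hom.hom_det)
  show ?thesis
  proof (cases "det ?B = 0")
    case True
    then show ?thesis using dA by simp
  next
    case False
    have "(of_int (det ?T' * det ?T) :: 'f) * det ?B = of_int (det ?T') * (of_int (det ?T) * det ?B)"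
      by simp
    also have "\<dots> = det ?B" unfolding dA[symmetric] by (rule dB[symmetric])
    finally have "(of_int (det ?T' * det ?T) :: 'f) * det ?B = det ?B" .
    then have "(of_int (det ?T' * det ?T) :: 'f) = of_int 1" using False by simp
    then have "det ?T' * det ?T = 1" by (simp only: of_int_eq_iff)
    then have "det ?T = 1 \<or> det ?T = - 1"
      by (metis mult.commute zmult_eq_1_iff)
    then show ?thesis using dA by auto
  qed
qed

lemma det_int_change_cols:
  fixes A B :: "nat \<Rightarrow> nat \<Rightarrow> 'f::field_char_0" and T T' :: "nat \<Rightarrow> nat \<Rightarrow> int"
  assumes A: "\<And>i j. i < n \<Longrightarrow> j < n \<Longrightarrow> A i j = (\<Sum>l<n. of_int (T j l) * B i l)"
    and B: "\<And>i j. i < n \<Longrightarrow> j < n \<Longrightarrow> B i j = (\<Sum>l<n. of_int (T' j l) * A i l)"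
  shows "det (mat n n (\<lambda>(i, j). A i j)) = det (mat n n (\<lambda>(i, j). B i j)) \<or>
    det (mat n n (\<lambda>(i, j). A i j)) = - det (mat n n (\<lambda>(i, j). B i j))"
proof -
  have tr: "det (mat n n (\<lambda>(i, j). C i j)) = det (mat n n (\<lambda>(i, j). C j i))" for C :: "nat \<Rightarrow> nat \<Rightarrow> 'f"
  proof -
    have "transpose_mat (mat n n (\<lambda>(i, j). C i j)) = mat n n (\<lambda>(i, j). C j i)"
      by (rule eq_matI) auto
    then show ?thesis using det_transpose[of "mat n n (\<lambda>(i, j). C i j)" n] by simp
  qed
  show ?thesis unfolding tr[of A] tr[of B]
    by (rule det_int_change_rows[where T = T and T' = T']) (rule A B; assumption)+
qed

text \<open>The coordinates are padded with zero rows to a square integer matrix. Its row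
  \<open>n\<close> vanishes, so its determinant is 0, and a nonzero kernel vector already exists
  over the integers.\<close>

lemma int_vectors_dependent:
  fixes v :: "nat \<Rightarrow> nat \<Rightarrow> int"
  assumes "n < m"
  shows "\<exists>c :: nat \<Rightarrow> int. (\<exists>i<m. c i \<noteq> 0) \<and> (\<forall>j<n. (\<Sum>i<m. c i * v i j) = 0)"
proof -
  define A where "A = mat m m (\<lambda>(j, i). if j < n then v i j else 0)"
  have A: "A \<in> carrier_mat m m" by (simp add: A_def)
  have "\<exists>w. w \<in> carrier_vec m \<and> w \<noteq> 0\<^sub>v m \<and> transpose_mat A *\<^sub>v w = 0\<^sub>v m"
  proof (intro exI[of _ "unit_vec m n"] conjI)
    have "(unit_vec m n :: int vec) $ n \<noteq> 0\<^sub>v m $ n" using assms by simp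
    then show "(unit_vec m n :: int vec) \<noteq> 0\<^sub>v m" by metis
    show "transpose_mat A *\<^sub>v unit_vec m n = 0\<^sub>v m"
      by (rule eq_vecI) (use assms in \<open>auto simp: A_def scalar_prod_def intro!: sum.neutral\<close>)
  qed auto
  then have "det (transpose_mat A) = 0"
    using det_0_iff_vec_prod_zero[of "transpose_mat A" m] A by auto
  then have "det A = 0" using det_transpose[OF A] by simp
  then obtain w where w: "w \<in> carrier_vec m" "w \<noteq> 0\<^sub>v m" "A *\<^sub>v w = 0\<^sub>v m"
    using det_0_iff_vec_prod_zero[OF A] by auto
  have "(\<Sum>i<m. w $ i * v i j) = 0" if "j < n" for j
  proof -
    have "(A *\<^sub>v w) $ j = 0" using w that assms by simp
    moreover have "(A *\<^sub>v w) $ j = (\<Sum>i<m. w $ i * v i j)"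
      using that assms w(1) by (auto simp: A_def scalar_prod_def atLeast0LessThan intro!: sum.cong)
    ultimately show ?thesis by simp
  qed
  moreover have "\<exists>i<m. w $ i \<noteq> 0"
  proof (rule ccontr)
    assume "\<not> ?thesis"
    then have "w = 0\<^sub>v m" using w(1) by (intro eq_vecI) auto
    then show False using w(2) by simp
  qed
  ultimately show ?thesis by (intro exI[of _ "\<lambda>i. w $ i"]) auto
qed

section \<open>The ring of integers of a number field\<close>

lemma basis_over_indep:
  assumes "basis_over l k bs" "\<And>j. c j \<in> l" "(\<Sum>j<length bs. c j * bs ! j) = 0" "j < length bs"
  shows "c j = 0"
  using assms unfolding basis_over_def by blast

locale nf =
  fixes k :: "'a::field_char_0 set" and d :: nat
  assumes kd: "degree_over \<rat> k d"
begin

lemma sub: "subfield_of_type k" using kd by (auto simp: degree_over_def)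

lemma number_field: "number_field k" using kd by (rule degree_over_Rats_number_field)

lemma card_emb: "card (embeddings k) = d" and finite_emb: "finite (embeddings k)"
  using card_embeddings[OF kd] by auto

lemma d_pos: "d > 0" using degree_over_pos[OF kd] .

abbreviation "OK \<equiv> ring_of_integers k"

lemma OK_k: "x \<in> OK \<Longrightarrow> x \<in> k" and OK_alg: "x \<in> OK \<Longrightarrow> algebraic_int x"
  by (auto simp: ring_of_integers_def)

lemma OK_0: "0 \<in> OK" and OK_1: "1 \<in> OK" and OK_of_int: "of_int n \<in> OK"
  by (auto simp: ring_of_integers_def sf_intros[OF sub] int_imp_algebraic_int)

lemma OK_add: "x \<in> OK \<Longrightarrow> y \<in> OK \<Longrightarrow> x + y \<in> OK"
  and OK_mult: "x \<in> OK \<Longrightarrow> y \<in> OK \<Longrightarrow> x * y \<in> OK"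
  and OK_uminus: "x \<in> OK \<Longrightarrow> - x \<in> OK"
  by (simp_all add: ring_of_integers_def sf_add[OF sub] sf_mult[OF sub] sf_uminus[OF sub]
      algebraic_int_add algebraic_int_mult)

lemma OK_diff: "x \<in> OK \<Longrightarrow> y \<in> OK \<Longrightarrow> x - y \<in> OK"
  using OK_add[of x "- y"] OK_uminus[of y] by simp

lemma OK_sum: "(\<And>i. i \<in> I \<Longrightarrow> f i \<in> OK) \<Longrightarrow> sum f I \<in> OK"
  by (induction I rule: infinite_finite_induct) (simp_all add: OK_0 OK_add)

lemma OK_power: "x \<in> OK \<Longrightarrow> x ^ n \<in> OK"
  by (induction n) (simp_all add: OK_1 OK_mult)

lemma emb_alg_int: assumes "\<sigma> \<in> embeddings k" "x \<in> OK" shows "algebraic_int (\<sigma> x)"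
proof -
  obtain p where p: "poly (map_poly of_int p) x = 0" "Polynomial.lead_coeff p = 1"
    using OK_alg[OF assms(2)] by (auto simp: algebraic_int_altdef_ipoly)
  have c: "coeffs_in k (map_poly of_int p)"
    by (auto simp: coeffs_in_def coeff_map_poly sf_intros[OF sub])
  have "map_poly \<sigma> (map_poly of_int p) = map_poly of_int p"
    by (rule poly_eqI) (simp add: coeff_map_emb[OF sub assms(1)] emb_of_int[OF sub assms(1)] coeff_map_poly)
  then have "poly (map_poly of_int p) (\<sigma> x) = 0"
    using emb_poly[OF sub assms(1) c OK_k[OF assms(2)]] p(1) emb_0[OF sub assms(1)] by simp
  then show ?thesis using p(2) unfolding algebraic_int_altdef_ipoly by blast
qed

text \<open>Let \<open>N\<close> clear the denominators of the minimal polynomial of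
  \<open>x\<close>. Then \<open>y = N * x\<close> satisfies a monic equation with integer
  coefficients, and the powers of \<open>y\<close> below the degree span a module stable under
  \<open>y\<close>.\<close>

lemma ex_integral_multiple:
  assumes x: "x \<in> k"
  obtains n :: int where "n \<noteq> 0" "of_int n * x \<in> OK"
proof -
  note Q = subfield_Rats[where ?'a = 'a]
  obtain f where f: "min_poly \<rat> x f" by (rule ex_min_poly[OF Q kd x])
  define m where "m = Polynomial.degree f"
  have m: "m > 0" unfolding m_def by (rule min_poly_degree_pos[OF Q f])
  have fc: "\<And>i. Polynomial.coeff f i \<in> \<rat>" "Polynomial.coeff f m = 1" "poly f x = 0"
    using f by (auto simp: min_poly_def[OF Q] coeffs_in_def m_def)
  have "\<exists>N :: int. N \<noteq> 0 \<and> (\<forall>i<t. of_int N * Polynomial.coeff f i \<in> \<int>)" for t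
  proof (induction t)
    case 0
    then show ?case by (intro exI[of _ 1]) auto
  next
    case (Suc t)
    then obtain N :: int where N: "N \<noteq> 0" "\<forall>i<t. of_int N * Polynomial.coeff f i \<in> \<int>" by blast
    obtain a b where ab: "b > 0" "Polynomial.coeff f t = of_int a / of_int b"
      using fc(1)[of t] by (auto elim!: Rats_cases')
    have b1: "of_int (N * b) * Polynomial.coeff f i \<in> \<int>" if "i < t" for i
    proof -
      have "of_int (N * b) * Polynomial.coeff f i = of_int b * (of_int N * Polynomial.coeff f i)" by simp
      also have "\<dots> \<in> \<int>" by (rule Ints_mult) (use N(2) that in auto)
      finally show ?thesis .
    qed
    have b2: "of_int (N * b) * Polynomial.coeff f t \<in> \<int>"
    proof -
      have "of_int (N * b) * Polynomial.coeff f t = of_int (N * a)" using ab by simp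
      then show ?thesis by (metis Ints_of_int)
    qed
    show ?case using b1 b2 N(1) ab(1) by (intro exI[of _ "N * b"]) (auto simp: less_Suc_eq)
  qed
  then obtain N :: int where N: "N \<noteq> 0" "\<And>i. i < m \<Longrightarrow> of_int N * Polynomial.coeff f i \<in> \<int>" by blast
  define y where "y = of_int N * x"
  define W where "W = (\<lambda>i. y ^ i) ` {..<m}"
  have fin: "finite W" by (simp add: W_def)
  have "x ^ m = - (\<Sum>i<m. Polynomial.coeff f i * x ^ i)"
  proof -
    have "0 = (\<Sum>i\<le>m. Polynomial.coeff f i * x ^ i)" using fc(3) by (simp add: poly_altdef m_def)
    also have "\<dots> = x ^ m + (\<Sum>i<m. Polynomial.coeff f i * x ^ i)"
      using fc(2) by (simp add: lessThan_Suc_atMost[symmetric])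
    finally show ?thesis by (simp add: eq_neg_iff_add_eq_0)
  qed
  then have "y ^ m = of_int N ^ m * - (\<Sum>i<m. Polynomial.coeff f i * x ^ i)"
    by (simp add: y_def power_mult_distrib)
  also have "\<dots> = (\<Sum>i<m. - (of_int N ^ m * (Polynomial.coeff f i * x ^ i)))"
    by (simp add: sum_distrib_left sum_negf)
  \<comment> \<open>Of the \<open>m\<close> factors \<open>N\<close>, \<open>i\<close> turn
    \<open>x ^ i\<close> into \<open>y ^ i\<close> and one makes the coefficient an integer;
    \<open>i < m\<close> leaves room for both.\<close>
  also have "\<dots> = (\<Sum>i<m. - (of_int N ^ (m - Suc i) * (of_int N * Polynomial.coeff f i)) * y ^ i)"
  proof (rule sum.cong)
    fix i assume "i \<in> {..<m}"
    then have "m = (m - Suc i) + 1 + i" by auto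
    then have "(of_int N :: 'a) ^ m = of_int N ^ (m - Suc i) * of_int N * of_int N ^ i"
      by (metis power_add power_one_right)
    then show "- (of_int N ^ m * (Polynomial.coeff f i * x ^ i)) =
      - (of_int N ^ (m - Suc i) * (of_int N * Polynomial.coeff f i)) * y ^ i"
      by (simp add: y_def power_mult_distrib)
  qed simp
  finally have ym: "y ^ m = (\<Sum>i<m. - (of_int N ^ (m - Suc i) * (of_int N * Polynomial.coeff f i)) * y ^ i)" .
  have ymS: "y ^ m \<in> int_span W" unfolding ym
  proof (rule int_span_sum)
    fix i assume i: "i \<in> {..<m}"
    obtain a where "of_int N * Polynomial.coeff f i = of_int a" using N(2) i by (auto elim: Ints_cases)
    then have "- (of_int N ^ (m - Suc i) * (of_int N * Polynomial.coeff f i)) * y ^ i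
      = of_int (- (N ^ (m - Suc i) * a)) * y ^ i" by simp
    also have "\<dots> \<in> int_span W"
      by (rule int_span_mult, rule int_span_base[OF fin]) (use i in \<open>auto simp: W_def\<close>)
    finally show "- (of_int N ^ (m - Suc i) * (of_int N * Polynomial.coeff f i)) * y ^ i \<in> int_span W" .
  qed
  have "algebraic_int y"
  proof (rule algebraic_int_if_int_span[OF fin])
    show "1 \<in> W" unfolding W_def by (rule image_eqI[of _ _ 0]) (use m in auto)
    fix w assume "w \<in> W"
    then obtain i where i: "i < m" "w = y ^ i" by (auto simp: W_def)
    show "y * w \<in> int_span W"
    proof (cases "Suc i < m")
      case True
      then have "y * w \<in> W" using i by (auto simp: W_def intro!: image_eqI[of _ _ "Suc i"])
      then show ?thesis by (rule int_span_base[OF fin])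
    next
      case False
      then have "y * w = y ^ m" using i by (simp flip: power_Suc) (metis Suc_lessI)
      then show ?thesis using ymS by simp
    qed
  qed simp
  then have "y \<in> OK" using x by (auto simp: ring_of_integers_def y_def intro!: sf_intros[OF sub])
  from that[OF N(1) this[unfolded y_def]] show thesis .
qed

definition es :: "('a \<Rightarrow> complex) list" where
  "es = (SOME es. distinct es \<and> set es = embeddings k)"

lemma es: "distinct es" "set es = embeddings k"
proof -
  have "\<exists>es. distinct es \<and> set es = embeddings k" using finite_distinct_list[OF finite_emb] by blast
  then have "distinct es \<and> set es = embeddings k" unfolding es_def by (rule someI_ex)
  then show "distinct es" "set es = embeddings k" by auto
qed

lemma length_es: "length es = d" using es card_emb distinct_card by metis

lemma es_emb: "i < d \<Longrightarrow> es ! i \<in> embeddings k"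
  using es(2) length_es nth_mem by metis

lemma sum_es: "(\<Sum>i<d. f (es ! i)) = (\<Sum>\<sigma>\<in>embeddings k. f \<sigma>)"
  using sum.reindex_bij_betw[OF bij_betw_nth[OF es(1) refl refl], of f]
  by (simp add: es(2) length_es)

lemma prod_es: "(\<Prod>i<d. f (es ! i)) = (\<Prod>\<sigma>\<in>embeddings k. f \<sigma>)"
  using prod.reindex_bij_betw[OF bij_betw_nth[OF es(1) refl refl], of f]
  by (simp add: es(2) length_es)

definition emb_mat :: "'a list \<Rightarrow> complex mat" where
  "emb_mat bs = mat d d (\<lambda>(i, j). (es ! i) (bs ! j))"

lemma emb_mat_carrier: "emb_mat bs \<in> carrier_mat d d" by (simp add: emb_mat_def)

lemma basis_length: "basis_over \<rat> k bs \<Longrightarrow> length bs = d"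
  using basis_degree_over[OF subfield_Rats sub sf_Rats[OF sub]] degree_over_unique[OF kd] by blast

text \<open>A kernel vector of the transpose is a linear relation among the embeddings on the basis.
  It extends to \<open>k\<close> because embeddings are linear over \<open>\<rat>\<close>,
  contradicting their independence.\<close>

lemma det_emb_mat:
  assumes bs: "basis_over \<rat> k bs"
  shows "det (emb_mat bs) \<noteq> 0"
proof
  assume "det (emb_mat bs) = 0"
  then have "det (transpose_mat (emb_mat bs)) = 0" using det_transpose[OF emb_mat_carrier] by simp
  then obtain v where v: "v \<in> carrier_vec d" "v \<noteq> 0\<^sub>v d" "transpose_mat (emb_mat bs) *\<^sub>v v = 0\<^sub>v d"
    using det_0_iff_vec_prod_zero[of "transpose_mat (emb_mat bs)" d] emb_mat_carrier by auto
  have len: "length bs = d" by (rule basis_length[OF bs])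
  have z: "(\<Sum>i<d. v $ i * (es ! i) (bs ! j)) = 0" if j: "j < d" for j
  proof -
    have "(transpose_mat (emb_mat bs) *\<^sub>v v) $ j = 0" using v(3) j by simp
    moreover have "(transpose_mat (emb_mat bs) *\<^sub>v v) $ j = (\<Sum>i<d. v $ i * (es ! i) (bs ! j))"
      using j v(1) by (auto simp: emb_mat_def scalar_prod_def atLeast0LessThan intro!: sum.cong)
    ultimately show ?thesis by simp
  qed
  define c where "c = (\<lambda>\<sigma>. v $ (SOME i. i < d \<and> es ! i = \<sigma>))"
  have c: "c (es ! i) = v $ i" if "i < d" for i
  proof -
    have "(SOME j. j < d \<and> es ! j = es ! i) = i"
      by (rule some_equality) (use that es(1) length_es nth_eq_iff_index_eq in auto)
    then show ?thesis by (simp add: c_def)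
  qed
  have "\<forall>x\<in>k. (\<Sum>\<sigma>\<in>embeddings k. c \<sigma> * \<sigma> x) = 0"
  proof
    fix x assume "x \<in> k"
    then obtain q where q: "\<forall>j. q j \<in> \<rat>" "x = (\<Sum>j<d. q j * bs ! j)"
      using bs len by (auto simp: basis_over_def)
    have bk: "bs ! j \<in> k" if "j < d" for j using bs len that by (auto simp: basis_over_def)
    have qk: "q j \<in> k" for j using q(1) sf_Rats[OF sub] by auto
    define r where "r = (\<lambda>j. of_rat (THE r. q j = of_rat r) :: complex)"
    have "(\<Sum>\<sigma>\<in>embeddings k. c \<sigma> * \<sigma> x) = (\<Sum>i<d. v $ i * (es ! i) x)"
      by (subst sum_es[symmetric]) (simp add: c)
    also have "\<dots> = (\<Sum>i<d. v $ i * (\<Sum>j<d. r j * (es ! i) (bs ! j)))"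
    proof (rule sum.cong)
      fix i assume "i \<in> {..<d}"
      then have e: "es ! i \<in> embeddings k" by (auto intro: es_emb)
      have "(es ! i) x = (\<Sum>j<d. (es ! i) (q j * bs ! j))"
        unfolding q(2) by (rule emb_sum[OF sub e]) (use bk qk in \<open>auto intro: sf_mult[OF sub]\<close>)
      also have "\<dots> = (\<Sum>j<d. r j * (es ! i) (bs ! j))"
        by (rule sum.cong) (use bk qk q(1) in \<open>auto simp: emb_mult[OF sub e] emb_Rats[OF sub e] r_def\<close>)
      finally show "v $ i * (es ! i) x = v $ i * (\<Sum>j<d. r j * (es ! i) (bs ! j))" by simp
    qed simp
    also have "\<dots> = (\<Sum>j<d. r j * (\<Sum>i<d. v $ i * (es ! i) (bs ! j)))"
      unfolding sum_distrib_left by (subst sum.swap) (simp add: ac_simps)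
    also have "\<dots> = 0" by (simp add: z)
    finally show "(\<Sum>\<sigma>\<in>embeddings k. c \<sigma> * \<sigma> x) = 0" .
  qed
  from embeddings_independent[OF sub finite_emb order_refl this]
  have "v $ i = 0" if "i < d" for i using c[OF that] es_emb[OF that] by auto
  then have "v = 0\<^sub>v d" using v(1) by (intro eq_vecI) auto
  then show False using v(2) by simp
qed

lemma emb_mat_inverse:
  assumes bs: "basis_over \<rat> k bs"
  shows "\<exists>P. \<forall>i<d. \<forall>j<d. (\<Sum>l<d. P i l * (es ! l) (bs ! j)) = (if i = j then 1 else 0)"
proof -
  let ?S = "emb_mat bs"
  from det_non_zero_imp_unit[OF emb_mat_carrier det_emb_mat[OF bs]]
  obtain B where B: "B \<in> carrier_mat d d" "B * ?S = 1\<^sub>m d"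
    by (auto simp: Units_def ring_mat_def)
  have "(\<Sum>l<d. B $$ (i, l) * (es ! l) (bs ! j)) = (if i = j then 1 else 0)" if "i < d" "j < d" for i j
  proof -
    have "(B * ?S) $$ (i, j) = (\<Sum>l<d. B $$ (i, l) * (es ! l) (bs ! j))"
      using that B(1) by (auto simp: emb_mat_def scalar_prod_def atLeast0LessThan intro!: sum.cong)
    then show ?thesis using B(2) that by simp
  qed
  then show ?thesis by (intro exI[of _ "\<lambda>i l. B $$ (i, l)"]) simp
qed

text \<open>The trace is rational because it is also the trace of the matrix of multiplication by \<open>y\<close>.\<close>

lemma trace_Ints:
  assumes y: "y \<in> OK"
  shows "(\<Sum>\<sigma>\<in>embeddings k. \<sigma> y) \<in> \<int>"
proof -
  obtain bs where bs: "length bs = d" "basis_over \<rat> k bs" using degree_over_basis[OF kd] .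
  obtain P :: "nat \<Rightarrow> nat \<Rightarrow> complex" where P:
    "\<And>i j. i < d \<Longrightarrow> j < d \<Longrightarrow> (\<Sum>l<d. P i l * (es ! l) (bs ! j)) = (if i = j then 1 else 0)"
    using emb_mat_inverse[OF bs(2)] by blast
  have bk: "bs ! j \<in> k" if "j < d" for j using bs that by (auto simp: basis_over_def)
  have yk: "y \<in> k" using OK_k[OF y] .
  have "\<exists>a. (\<forall>l. a l \<in> \<rat>) \<and> y * bs ! j = (\<Sum>l<d. a l * bs ! l)" if "j < d" for j
    using bs sf_mult[OF sub yk bk[OF that]] unfolding basis_over_def by blast
  then obtain a where a: "\<And>j l. j < d \<Longrightarrow> a j l \<in> \<rat>"
    "\<And>j. j < d \<Longrightarrow> y * bs ! j = (\<Sum>l<d. a j l * bs ! l)" by metis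
  define r where "r = (\<lambda>j l. of_rat (THE r. a j l = of_rat r) :: complex)"
  have mul: "(es ! i) y * (es ! i) (bs ! j) = (\<Sum>l<d. r j l * (es ! i) (bs ! l))" if i: "i < d" and j: "j < d" for i j
  proof -
    note e = es_emb[OF i]
    have ak: "a j l \<in> k" for l using a(1)[OF j] sf_Rats[OF sub] by blast
    have "(es ! i) y * (es ! i) (bs ! j) = (es ! i) (y * bs ! j)" by (simp add: emb_mult[OF sub e yk bk[OF j]])
    also have "\<dots> = (\<Sum>l<d. (es ! i) (a j l * bs ! l))"
      unfolding a(2)[OF j] by (rule emb_sum[OF sub e]) (use bk ak in \<open>auto intro: sf_mult[OF sub]\<close>)
    also have "\<dots> = (\<Sum>l<d. r j l * (es ! i) (bs ! l))"
      by (rule sum.cong) (use bk ak a(1)[OF j] in \<open>auto simp: emb_mult[OF sub e] emb_Rats[OF sub e] r_def\<close>)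
    finally show ?thesis .
  qed
  have P': "(\<Sum>j<d. (es ! i) (bs ! j) * P j l) = (if i = l then 1 else 0)" if il: "i < d" "l < d" for i l
  proof -
    let ?S = "emb_mat bs" and ?P = "mat d d (\<lambda>(i, j). P i j)"
    have "?P * ?S = 1\<^sub>m d"
      by (rule eq_matI) (auto simp: emb_mat_def scalar_prod_def atLeast0LessThan P)
    then have "?S * ?P = 1\<^sub>m d"
      using mat_mult_left_right_inverse[of ?P d ?S] emb_mat_carrier by auto
    then have "(?S * ?P) $$ (i, l) = (1\<^sub>m d) $$ (i, l)" by simp
    moreover have "(?S * ?P) $$ (i, l) = (\<Sum>j<d. (es ! i) (bs ! j) * P j l)"
      using il by (auto simp: emb_mat_def scalar_prod_def atLeast0LessThan intro!: sum.cong)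
    ultimately show ?thesis using il by simp
  qed
  have "(\<Sum>\<sigma>\<in>embeddings k. \<sigma> y) = (\<Sum>i<d. (es ! i) y)" by (rule sum_es[symmetric])
  also have "\<dots> = (\<Sum>i<d. \<Sum>j<d. ((es ! i) y * (es ! i) (bs ! j)) * P j i)"
  proof (rule sum.cong)
    fix i assume "i \<in> {..<d}"
    then have "(es ! i) y * (\<Sum>j<d. (es ! i) (bs ! j) * P j i) = (es ! i) y" by (simp add: P')
    then show "(es ! i) y = (\<Sum>j<d. ((es ! i) y * (es ! i) (bs ! j)) * P j i)"
      by (simp add: sum_distrib_left mult.assoc)
  qed simp
  also have "\<dots> = (\<Sum>i<d. \<Sum>j<d. \<Sum>l<d. r j l * ((es ! i) (bs ! l) * P j i))"
    by (intro sum.cong refl) (simp add: mul sum_distrib_right mult.assoc)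
  also have "\<dots> = (\<Sum>j<d. \<Sum>l<d. \<Sum>i<d. r j l * ((es ! i) (bs ! l) * P j i))"
    by (subst sum.swap, rule sum.cong[OF refl], subst sum.swap) (rule refl)
  also have "\<dots> = (\<Sum>j<d. \<Sum>l<d. r j l * (\<Sum>i<d. P j i * (es ! i) (bs ! l)))"
    by (simp add: sum_distrib_left ac_simps)
  also have "\<dots> = (\<Sum>j<d. \<Sum>l<d. if l = j then r j j else 0)"
    by (intro sum.cong refl) (auto simp: P)
  also have "\<dots> \<in> \<rat>" by (intro Rats_sum) (auto simp: r_def)
  finally have "(\<Sum>\<sigma>\<in>embeddings k. \<sigma> y) \<in> \<rat>" .
  moreover have "algebraic_int (\<Sum>\<sigma>\<in>embeddings k. \<sigma> y)"
    by (rule algebraic_int_sum) (rule emb_alg_int[OF _ y])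
  ultimately show ?thesis using rational_algebraic_int_is_int by blast
qed

lemma integer_Q_basis:
  obtains ws where "length ws = d" "basis_over \<rat> k ws" "set ws \<subseteq> OK"
proof -
  obtain bs where bs: "length bs = d" "basis_over \<rat> k bs" using degree_over_basis[OF kd] .
  have bk: "bs ! j \<in> k" if "j < d" for j using bs that by (auto simp: basis_over_def)
  have "\<exists>n :: int. n \<noteq> 0 \<and> of_int n * bs ! j \<in> OK" if j: "j < d" for j
  proof -
    obtain n :: int where "n \<noteq> 0" "of_int n * bs ! j \<in> OK" by (rule ex_integral_multiple[OF bk[OF j]])
    then show ?thesis by blast
  qed
  then obtain n :: "nat \<Rightarrow> int" where n: "\<And>j. j < d \<Longrightarrow> n j \<noteq> 0" "\<And>j. j < d \<Longrightarrow> of_int (n j) * bs ! j \<in> OK"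
    by metis
  define ws where "ws = map (\<lambda>j. of_int (n j) * bs ! j) [0..<d]"
  have lw: "length ws = d" and wj: "\<And>j. j < d \<Longrightarrow> ws ! j = of_int (n j) * bs ! j" by (auto simp: ws_def)
  have "basis_over \<rat> k ws" unfolding basis_over_def lw
  proof (intro conjI ballI allI impI)
    show "set ws \<subseteq> k" using n(2) OK_k by (auto simp: ws_def)
    fix x assume "x \<in> k"
    then obtain c where c: "\<forall>j. c j \<in> \<rat>" "x = (\<Sum>j<d. c j * bs ! j)"
      using bs by (auto simp: basis_over_def)
    have "x = (\<Sum>j<d. (c j / of_int (n j)) * ws ! j)"
      unfolding c(2) by (rule sum.cong) (auto simp: wj n(1))
    then show "\<exists>c. (\<forall>j. c j \<in> \<rat>) \<and> x = (\<Sum>j<d. c j * ws ! j)"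
      using c(1) by (intro exI[of _ "\<lambda>j. c j / of_int (n j)"]) auto
  next
    fix c j assume c: "\<forall>j. c j \<in> \<rat>" "(\<Sum>j<d. c j * ws ! j) = 0" and j: "j < d"
    have "(\<Sum>j<d. (c j * of_int (n j)) * bs ! j) = (\<Sum>j<d. c j * ws ! j)"
      by (rule sum.cong) (auto simp: wj)
    then have "(\<Sum>j<d. (c j * of_int (n j)) * bs ! j) = 0" using c(2) by simp
    then have "c j * of_int (n j) = 0"
      by (intro basis_over_indep[OF bs(2), of "\<lambda>j. c j * of_int (n j)"]) (use bs(1) j c(1) in auto)
    then show "c j = 0" using n(1)[OF j] by simp
  qed
  moreover have "set ws \<subseteq> OK" using n(2) by (auto simp: ws_def)
  ultimately show thesis using that lw by blast
qed

end

context nf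
begin

section \<open>Integral bases and the discriminant\<close>

definition tr :: "'a \<Rightarrow> complex" where "tr x = (\<Sum>\<sigma>\<in>embeddings k. \<sigma> x)"

lemma tr_Ints: "x \<in> OK \<Longrightarrow> of_int \<lfloor>Re (tr x)\<rfloor> = tr x"
  using trace_Ints[of x] by (auto simp: tr_def[symmetric] elim!: Ints_cases)

text \<open>In coordinates with respect to a \<open>\<rat>\<close>-basis of integers, all integers
  of \<open>k\<close> have denominators dividing the determinant of the trace form. The coordinate
  vectors thus form a lattice between the standard lattice and a fixed multiple of it, to which
  \<open>lattice_basis\<close> applies.\<close>

lemma ex_integral_basis: "\<exists>ws. integral_basis k ws"
proof -
  obtain ws where ws: "length ws = d" "basis_over \<rat> k ws" "set ws \<subseteq> OK" by (rule integer_Q_basis)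
  have wO: "ws ! j \<in> OK" if "j < d" for j using ws that by auto
  let ?val = "\<lambda>q :: nat \<Rightarrow> rat. \<Sum>j<d. of_rat (q j) * ws ! j"
  \<comment> \<open>Coordinates are set to 0 from index \<open>d\<close> on, which makes them unique
    as functions and meets the support condition of \<open>lattice_basis\<close>.\<close>
  define crd where "crd = (\<lambda>x. SOME q :: nat \<Rightarrow> rat. x = ?val q \<and> (\<forall>j\<ge>d. q j = 0))"
  have crd: "x = ?val (crd x) \<and> (\<forall>j\<ge>d. crd x j = 0)" if x: "x \<in> k" for x
  proof -
    obtain c where c: "\<forall>j. c j \<in> \<rat>" "x = (\<Sum>j<d. c j * ws ! j)"
      using ws x by (auto simp: basis_over_def)
    have "\<forall>j. \<exists>q. c j = of_rat q" using c(1) by (auto elim: Rats_cases)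
    then obtain q where q: "\<And>j. c j = of_rat (q j)" by metis
    have "x = ?val (\<lambda>j. if j < d then q j else 0)" unfolding c(2) by (rule sum.cong) (auto simp: q)
    then show ?thesis unfolding crd_def
      by (intro someI[of "\<lambda>q. x = ?val q \<and> (\<forall>j\<ge>d. q j = 0)" "\<lambda>j. if j < d then q j else 0"]) auto
  qed
  have uniq: "q = q'" if "?val q = ?val q'" "\<forall>j\<ge>d. q j = 0" "\<forall>j\<ge>d. q' j = 0" for q q'
  proof
    fix j
    have "(\<Sum>j<d. (of_rat (q j) - of_rat (q' j)) * ws ! j) = 0"
      using that(1) by (simp add: left_diff_distrib sum_subtractf)
    then have "of_rat (q j) - of_rat (q' j) = (0 :: 'a)" if "j < d"
      by (intro basis_over_indep[OF ws(2), of "\<lambda>j. of_rat (q j) - of_rat (q' j)"]) (use ws(1) that in auto)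
    then show "q j = q' j" using that(2,3) by (cases "j < d") auto
  qed
  have crdI: "crd x = q" if "x \<in> k" "x = ?val q" "\<forall>j\<ge>d. q j = 0" for x q
    using uniq[of "crd x" q] crd[OF that(1)] that by auto
  \<comment> \<open>The Gram matrix of the trace form has integer entries, since traces of integers
    are integers. It is the transposed embedding matrix times the embedding matrix, so its
    determinant is a nonzero square.\<close>
  define G where "G = mat d d (\<lambda>(i, j). \<lfloor>Re (tr (ws ! i * ws ! j))\<rfloor>)"
  have G: "of_int (G $$ (i, j)) = (\<Sum>\<sigma>\<in>embeddings k. \<sigma> (ws ! i * ws ! j))" if "i < d" "j < d" for i j
  proof -
    have "of_int (G $$ (i, j)) = tr (ws ! i * ws ! j)"
      using that tr_Ints[OF OK_mult[OF wO wO], of i j] by (simp add: G_def)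
    then show ?thesis by (simp add: tr_def)
  qed
  have Gc: "G \<in> carrier_mat d d" by (simp add: G_def)
  have "map_mat of_int G = transpose_mat (emb_mat ws) * emb_mat ws"
  proof (rule eq_matI)
    fix i j assume "i < dim_row (transpose_mat (emb_mat ws) * emb_mat ws)"
      "j < dim_col (transpose_mat (emb_mat ws) * emb_mat ws)"
    then have ij: "i < d" "j < d" by (auto simp: emb_mat_def)
    have "(map_mat of_int G :: complex mat) $$ (i, j) = (\<Sum>\<sigma>\<in>embeddings k. \<sigma> (ws ! i * ws ! j))"
      using ij Gc G by simp
    also have "\<dots> = (\<Sum>l<d. (es ! l) (ws ! i * ws ! j))" by (rule sum_es[symmetric])
    also have "\<dots> = (\<Sum>l<d. (es ! l) (ws ! i) * (es ! l) (ws ! j))"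
      by (rule sum.cong) (auto simp: emb_mult[OF sub es_emb] OK_k wO ij)
    also have "\<dots> = (transpose_mat (emb_mat ws) * emb_mat ws) $$ (i, j)"
      using ij by (simp add: emb_mat_def scalar_prod_def atLeast0LessThan)
    finally show "(map_mat of_int G :: complex mat) $$ (i, j) = (transpose_mat (emb_mat ws) * emb_mat ws) $$ (i, j)" .
  qed (use Gc in \<open>auto simp: emb_mat_def\<close>)
  then have "det (map_mat of_int G :: complex mat) = det (emb_mat ws) * det (emb_mat ws)"
    using det_mult[of "transpose_mat (emb_mat ws)" d "emb_mat ws"] det_transpose[OF emb_mat_carrier, of ws]
      emb_mat_carrier[of ws] by simp
  then have "of_int (det G) \<noteq> (0 :: complex)" using det_emb_mat[OF ws(2)] by (simp add: of_int_hom.hom_det)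
  define \<Delta> where "\<Delta> = det G"
  have \<Delta>: "\<Delta> \<noteq> 0" using \<open>of_int (det G) \<noteq> (0 :: complex)\<close> by (auto simp: \<Delta>_def)
  \<comment> \<open>Cramer's rule: \<open>G\<close> maps the coordinates of \<open>x\<close> to the
    integers \<open>tr (ws ! i * x)\<close>, and the adjugate of \<open>G\<close> inverts it up to
    the factor \<open>\<Delta>\<close>.\<close>
  have den: "of_int \<Delta> * crd x j \<in> \<int>" if x: "x \<in> OK" for x j
  proof (cases "j < d")
    case True
    have xk: "x \<in> k" using OK_k[OF x] .
    note cx = crd[OF xk, THEN conjunct1]
    define t where "t = (\<lambda>i. \<lfloor>Re (tr (ws ! i * x))\<rfloor>)"
    have t: "of_int (t i) = (\<Sum>l<d. of_int (G $$ (i, l)) * of_rat (crd x l) :: complex)" if i: "i < d" for i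
    proof -
      have "of_int (t i) = (\<Sum>\<sigma>\<in>embeddings k. \<sigma> (ws ! i * x))"
        using tr_Ints[OF OK_mult[OF wO[OF i] x]] by (simp only: t_def tr_def)
      also have "\<dots> = (\<Sum>\<sigma>\<in>embeddings k. \<Sum>l<d. of_rat (crd x l) * \<sigma> (ws ! i * ws ! l))"
      proof (rule sum.cong)
        fix \<sigma> assume s: "\<sigma> \<in> embeddings k"
        have rat: "\<sigma> (of_rat q) = of_rat q" for q
        proof -
          have "(THE q'. (of_rat q :: 'a) = of_rat q') = q" by (rule the_equality) auto
          then show ?thesis using emb_Rats[OF sub s, of "of_rat q"] by simp
        qed
        have mem: "of_rat q \<in> k" for q using sf_Rats[OF sub] by auto
        have "ws ! i * x = (\<Sum>l<d. of_rat (crd x l) * (ws ! i * ws ! l))"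
          by (subst cx) (simp add: sum_distrib_left ac_simps)
        then have "\<sigma> (ws ! i * x) = \<sigma> (\<Sum>l<d. of_rat (crd x l) * (ws ! i * ws ! l))" by simp
        also have "\<dots> = (\<Sum>l<d. \<sigma> (of_rat (crd x l) * (ws ! i * ws ! l)))"
          by (rule emb_sum[OF sub s]) (simp add: sf_mult[OF sub] mem OK_k wO i)
        also have "\<dots> = (\<Sum>l<d. of_rat (crd x l) * \<sigma> (ws ! i * ws ! l))"
          by (rule sum.cong) (auto simp: emb_mult[OF sub s mem] rat OK_k wO i sf_mult[OF sub])
        finally show "\<sigma> (ws ! i * x) = (\<Sum>l<d. of_rat (crd x l) * \<sigma> (ws ! i * ws ! l))" .
      qed simp
      also have "\<dots> = (\<Sum>l<d. of_int (G $$ (i, l)) * of_rat (crd x l))"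
        by (subst sum.swap) (auto simp: G i sum_distrib_left sum_distrib_right ac_simps intro!: sum.cong)
      finally show ?thesis .
    qed
    have adj: "(\<Sum>i<d. adj_mat G $$ (j, i) * G $$ (i, l)) = (if j = l then \<Delta> else 0)" if l: "l < d" for l
    proof -
      have "(adj_mat G * G) $$ (j, l) = (det G \<cdot>\<^sub>m 1\<^sub>m d) $$ (j, l)" using adj_mat(3)[OF Gc] by simp
      moreover have "(adj_mat G * G) $$ (j, l) = (\<Sum>i<d. adj_mat G $$ (j, i) * G $$ (i, l))"
        using True l Gc adj_mat(1)[OF Gc] by (auto simp: scalar_prod_def atLeast0LessThan)
      ultimately show ?thesis using True l by (simp add: \<Delta>_def)
    qed
    define Z where "Z = (\<Sum>i<d. adj_mat G $$ (j, i) * t i)"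
    have "of_int Z =
      (\<Sum>i<d. of_int (adj_mat G $$ (j, i)) * (\<Sum>l<d. of_int (G $$ (i, l)) * of_rat (crd x l) :: complex))"
      by (simp add: t Z_def)
    also have "\<dots> = (\<Sum>l<d. of_int (\<Sum>i<d. adj_mat G $$ (j, i) * G $$ (i, l)) * of_rat (crd x l))"
      unfolding sum_distrib_left of_int_sum sum_distrib_right
      by (subst sum.swap) (simp add: ac_simps)
    also have "\<dots> = (\<Sum>l<d. if l = j then of_int \<Delta> * of_rat (crd x j) else 0)"
      by (rule sum.cong) (auto simp: adj)
    also have "\<dots> = of_int \<Delta> * of_rat (crd x j)" using True by simp
    finally have "(of_rat (of_int Z) :: complex) = of_rat (of_int \<Delta> * crd x j)"
      by (simp only: of_rat_mult of_rat_of_int_eq)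
    then have "of_int Z = of_int \<Delta> * crd x j"
      by (simp only: of_rat_eq_iff)
    then show ?thesis by (metis Ints_of_int)
  qed (use crd[OF OK_k[OF x]] in auto)
  define L where "L = (\<lambda>x j. real_of_rat (crd x j)) ` OK"
  have crd_diff: "crd (x - y) = (\<lambda>j. crd x j - crd y j)" if "x \<in> k" "y \<in> k" for x y
  proof (rule crdI)
    have "x - y = ?val (crd x) - ?val (crd y)" using crd[OF that(1)] crd[OF that(2)] by simp
    then show "x - y = ?val (\<lambda>j. crd x j - crd y j)"
      by (simp add: of_rat_diff left_diff_distrib sum_subtractf)
  qed (use that crd in \<open>auto intro: sf_diff[OF sub]\<close>)
  have "\<exists>b. (\<forall>i<d. b i \<in> L) \<and>
    (\<forall>x\<in>L. \<exists>c :: nat \<Rightarrow> int. \<forall>j. x j = (\<Sum>i<d. of_int (c i) * b i j)) \<and>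
    (\<forall>c :: nat \<Rightarrow> int. (\<forall>j. (\<Sum>i<d. of_int (c i) * b i j) = 0) \<longrightarrow> (\<forall>i<d. c i = 0))"
  proof (rule lattice_basis)
    show "x i = 0" if "x \<in> L" "i \<ge> d" for x i
      using that crd OK_k by (auto simp: L_def)
    show "(\<lambda>i. x i - y i) \<in> L" if xy: "x \<in> L" "y \<in> L" for x y
    proof -
      obtain u v where uv: "u \<in> OK" "v \<in> OK" "x = (\<lambda>j. real_of_rat (crd u j))" "y = (\<lambda>j. real_of_rat (crd v j))"
        using xy by (auto simp: L_def)
      have "(\<lambda>i. x i - y i) = (\<lambda>j. real_of_rat (crd (u - v) j))"
        using crd_diff[OF OK_k[OF uv(1)] OK_k[OF uv(2)]] by (simp add: uv of_rat_diff)
      then show ?thesis using OK_diff[OF uv(1,2)] by (auto simp: L_def)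
    qed
    show "(\<lambda>j. if j = i then 1 else 0) \<in> L" if i: "i < d" for i
    proof -
      have "crd (ws ! i) = (\<lambda>j. if j = i then 1 else 0)"
      proof (rule crdI)
        have "?val (\<lambda>j. if j = i then 1 else 0) = (\<Sum>j<d. if j = i then ws ! j else 0)"
          by (rule sum.cong) auto
        then show "ws ! i = ?val (\<lambda>j. if j = i then 1 else 0)" using i by simp
      qed (use i wO OK_k in auto)
      then have "(\<lambda>j. if j = i then 1 else 0) = (\<lambda>j. real_of_rat (crd (ws ! i) j))" by auto
      then show ?thesis unfolding L_def using wO[OF i] by blast
    qed
    show "L \<noteq> {}" using OK_0 by (auto simp: L_def)
    \<comment> \<open>In the unit cube each coordinate is one of the finitely many fractions with
      denominator \<open>\<Delta>\<close>.\<close>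
    let ?F = "(\<lambda>n. of_int n / real_of_int \<Delta>) ` {- \<bar>\<Delta>\<bar>..\<bar>\<Delta>\<bar>}"
    have "{x \<in> L. \<forall>i<d. 0 \<le> x i \<and> x i \<le> 1} \<subseteq> {f. \<forall>x. (x \<in> {..<d} \<longrightarrow> f x \<in> ?F) \<and> (x \<notin> {..<d} \<longrightarrow> f x = 0)}"
    proof (intro subsetI CollectI allI conjI impI)
      fix x j assume x: "x \<in> {x \<in> L. \<forall>i<d. 0 \<le> x i \<and> x i \<le> 1}" and j: "j \<in> {..<d}"
      then obtain u where u: "u \<in> OK" "x = (\<lambda>j. real_of_rat (crd u j))" by (auto simp: L_def)
      obtain n where n: "of_int \<Delta> * crd u j = of_int n" using den[OF u(1), of j] by (auto elim: Ints_cases)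
      have "real_of_rat (of_int \<Delta> * crd u j) = real_of_rat (of_int n)" using n by simp
      then have e: "of_int \<Delta> * x j = of_int n" using u(2) by (simp add: of_rat_mult)
      then have xj: "x j = of_int n / of_int \<Delta>" using \<Delta> by (simp add: field_simps)
      have "\<bar>real_of_int \<Delta> * x j\<bar> \<le> \<bar>real_of_int \<Delta>\<bar> * 1"
        unfolding abs_mult using x j by (intro mult_left_mono) auto
      then have "\<bar>real_of_int n\<bar> \<le> \<bar>real_of_int \<Delta>\<bar>" using e by simp
      then have "\<bar>n\<bar> \<le> \<bar>\<Delta>\<bar>" by linarith
      then show "x j \<in> ?F" using xj by (intro image_eqI[of _ _ n]) auto
    next
      fix x j assume x: "x \<in> {x \<in> L. \<forall>i<d. 0 \<le> x i \<and> x i \<le> 1}" and j: "j \<notin> {..<d}"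
      then show "x j = 0" using crd OK_k by (auto simp: L_def)
    qed
    moreover have "finite \<dots>" by (rule finite_set_of_finite_funs) auto
    ultimately show "finite {x \<in> L. \<forall>i<d. 0 \<le> x i \<and> x i \<le> 1}" by (rule finite_subset)
  qed
  then obtain b where "(\<forall>i<d. b i \<in> L) \<and>
    (\<forall>x\<in>L. \<exists>c :: nat \<Rightarrow> int. \<forall>j. x j = (\<Sum>i<d. of_int (c i) * b i j)) \<and>
    (\<forall>c :: nat \<Rightarrow> int. (\<forall>j. (\<Sum>i<d. of_int (c i) * b i j) = 0) \<longrightarrow> (\<forall>i<d. c i = 0))" ..
  then have b: "\<And>i. i < d \<Longrightarrow> b i \<in> L"
    "\<And>x. x \<in> L \<Longrightarrow> \<exists>c :: nat \<Rightarrow> int. \<forall>j. x j = (\<Sum>i<d. of_int (c i) * b i j)"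
    "\<And>c :: nat \<Rightarrow> int. \<forall>j. (\<Sum>i<d. of_int (c i) * b i j) = 0 \<Longrightarrow> (\<forall>i<d. c i = 0)" by simp_all
  have "\<forall>i<d. \<exists>w. w \<in> OK \<and> b i = (\<lambda>j. real_of_rat (crd w j))" using b(1) by (auto simp: L_def)
  then obtain w where w: "\<And>i. i < d \<Longrightarrow> w i \<in> OK" "\<And>i. i < d \<Longrightarrow> b i = (\<lambda>j. real_of_rat (crd (w i) j))"
    by metis
  have comb_k: "(\<Sum>i<d. of_int (c i) * w i) \<in> k" for c :: "nat \<Rightarrow> int"
    by (rule sf_sum[OF sub], rule sf_mult[OF sub], rule sf_of_int[OF sub], rule OK_k, rule w) auto
  have lin: "crd (\<Sum>i<d. of_int (c i) * w i) = (\<lambda>j. \<Sum>i<d. of_int (c i) * crd (w i) j)" for c :: "nat \<Rightarrow> int"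
  proof (rule crdI)
    have "(\<Sum>i<d. of_int (c i) * w i) = (\<Sum>i<d. of_int (c i) * ?val (crd (w i)))"
      by (rule sum.cong) (use crd OK_k w in auto)
    also have "\<dots> = ?val (\<lambda>j. \<Sum>i<d. of_int (c i) * crd (w i) j)"
      unfolding of_rat_sum sum_distrib_left sum_distrib_right
      by (subst sum.swap) (simp add: of_rat_mult mult.assoc)
    finally show "(\<Sum>i<d. of_int (c i) * w i) = ?val (\<lambda>j. \<Sum>i<d. of_int (c i) * crd (w i) j)" .
    show "\<forall>j\<ge>d. (\<Sum>i<d. of_int (c i) * crd (w i) j) = 0"
      by (auto intro!: sum.neutral) (use crd OK_k w in auto)
  qed (rule comb_k)
  have bsum: "(\<Sum>i<d. of_int (c i) * b i j) = real_of_rat (crd (\<Sum>i<d. of_int (c i) * w i) j)" for c :: "nat \<Rightarrow> int" and j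
    by (simp add: lin of_rat_sum of_rat_mult w(2))
  have "integral_basis k (map w [0..<d])" unfolding integral_basis_def
  proof (intro conjI ballI allI impI)
    show "set (map w [0..<d]) \<subseteq> OK" using w by auto
    fix x assume x: "x \<in> OK"
    then have "(\<lambda>j. real_of_rat (crd x j)) \<in> L" by (auto simp: L_def)
    from b(2)[OF this] obtain c :: "nat \<Rightarrow> int" where "\<forall>j. real_of_rat (crd x j) = (\<Sum>i<d. of_int (c i) * b i j)" by blast
    then have "crd x = crd (\<Sum>i<d. of_int (c i) * w i)" by (auto simp: bsum)
    then have "x = (\<Sum>i<d. of_int (c i) * w i)"
      using crd[OF OK_k[OF x]] crd[OF comb_k[of c]] by metis
    then show "\<exists>c :: nat \<Rightarrow> int. x = (\<Sum>j<length (map w [0..<d]). of_int (c j) * map w [0..<d] ! j)"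
      by (intro exI[of _ c]) simp
  next
    fix c :: "nat \<Rightarrow> int" and j
    assume c: "(\<Sum>j<length (map w [0..<d]). of_int (c j) * map w [0..<d] ! j) = 0" and j: "j < length (map w [0..<d])"
    have "crd 0 = (\<lambda>_. 0)" by (rule crdI) (auto intro: sf_0[OF sub])
    then have "\<forall>j. (\<Sum>i<d. of_int (c i) * b i j) = 0" using c by (simp add: bsum)
    from b(3)[OF this] show "c j = 0" using j by simp
  qed
  then show ?thesis by blast
qed

lemma integral_basis_Q_basis:
  assumes ws: "integral_basis k ws"
  shows "basis_over \<rat> k ws"
proof -
  let ?n = "length ws"
  have wO: "ws ! j \<in> OK" if "j < ?n" for j using ws that by (auto simp: integral_basis_def)
  show ?thesis unfolding basis_over_def
  proof (intro conjI ballI allI impI)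
    show "set ws \<subseteq> k" using ws OK_k by (auto simp: integral_basis_def)
    fix x assume x: "x \<in> k"
    obtain n :: int where n: "n \<noteq> 0" "of_int n * x \<in> OK" by (rule ex_integral_multiple[OF x])
    obtain c :: "nat \<Rightarrow> int" where c: "of_int n * x = (\<Sum>j<?n. of_int (c j) * ws ! j)"
      using ws n(2) by (auto simp: integral_basis_def)
    have "x = (of_int n * x) / of_int n" using n(1) by simp
    also have "\<dots> = (\<Sum>j<?n. (of_int (c j) / of_int n) * ws ! j)"
      unfolding c by (simp add: sum_divide_distrib)
    finally show "\<exists>c. (\<forall>j. c j \<in> \<rat>) \<and> x = (\<Sum>j<?n. c j * ws ! j)"
      by (intro exI[of _ "\<lambda>j. of_int (c j) / of_int n"]) auto
  next
    fix c j assume c: "\<forall>j. c j \<in> \<rat>" "(\<Sum>j<?n. c j * ws ! j) = 0" and j: "j < ?n"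
    have "\<exists>N :: int. N \<noteq> 0 \<and> (\<forall>i<t. of_int N * c i \<in> \<int>)" for t
    proof (induction t)
      case 0
      then show ?case by (intro exI[of _ 1]) auto
    next
      case (Suc t)
      then obtain N :: int where N: "N \<noteq> 0" "\<forall>i<t. of_int N * c i \<in> \<int>" by blast
      obtain a b where ab: "b > 0" "c t = of_int a / of_int b"
        using c(1) by (metis Rats_cases')
      have b1: "of_int (N * b) * c i \<in> \<int>" if "i < t" for i
      proof -
        have "of_int (N * b) * c i = of_int b * (of_int N * c i)" by simp
        also have "\<dots> \<in> \<int>" by (rule Ints_mult) (use N(2) that in auto)
        finally show ?thesis .
      qed
      have "of_int (N * b) * c t = of_int (N * a)" using ab by simp
      then have b2: "of_int (N * b) * c t \<in> \<int>" by (metis Ints_of_int)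
      show ?case using b1 b2 N(1) ab(1) by (intro exI[of _ "N * b"]) (auto simp: less_Suc_eq)
    qed
    then obtain N :: int where N: "N \<noteq> 0" "\<And>i. i < ?n \<Longrightarrow> of_int N * c i \<in> \<int>" by blast
    have "\<forall>i<?n. \<exists>e :: int. of_int N * c i = of_int e" using N(2) by (auto elim: Ints_cases)
    then obtain e :: "nat \<Rightarrow> int" where e: "\<And>i. i < ?n \<Longrightarrow> of_int N * c i = of_int (e i)" by metis
    have "(\<Sum>i<?n. of_int (e i) * ws ! i) = (\<Sum>i<?n. of_int N * (c i * ws ! i))"
      by (rule sum.cong) (auto simp flip: e simp: mult.assoc)
    also have "\<dots> = 0" using c(2) by (simp flip: sum_distrib_left)
    finally have "e j = 0" using ws j unfolding integral_basis_def by blast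
    then show "c j = 0" using e[OF j] N(1) by simp
  qed
qed

lemma integral_basis_length: "integral_basis k ws \<Longrightarrow> length ws = d"
  using basis_length integral_basis_Q_basis by blast

lemma integral_basis_mem:
  assumes "integral_basis k ws" "j < d"
  shows "ws ! j \<in> OK" "ws ! j \<in> k"
proof -
  show "ws ! j \<in> OK" using assms integral_basis_length[OF assms(1)] by (auto simp: integral_basis_def)
  then show "ws ! j \<in> k" by (rule OK_k)
qed

lemma integral_basis_coords:
  assumes "integral_basis k ws" "x \<in> OK"
  shows "\<exists>c :: nat \<Rightarrow> int. x = (\<Sum>j<d. of_int (c j) * ws ! j)"
  using assms integral_basis_length[OF assms(1)] by (auto simp: integral_basis_def)

lemma emb_int_comb:
  assumes s: "\<sigma> \<in> embeddings k" and "\<And>j. j < d \<Longrightarrow> ws ! j \<in> k"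
  shows "\<sigma> (\<Sum>j<d. of_int (c j) * ws ! j) = (\<Sum>j<d. of_int (c j) * \<sigma> (ws ! j))"
proof -
  have "\<sigma> (\<Sum>j<d. of_int (c j) * ws ! j) = (\<Sum>j<d. \<sigma> (of_int (c j) * ws ! j))"
    by (rule emb_sum[OF sub s]) (auto intro!: sf_mult[OF sub] sf_of_int[OF sub] assms)
  also have "\<dots> = (\<Sum>j<d. of_int (c j) * \<sigma> (ws ! j))"
    by (rule sum.cong) (auto simp: emb_mult[OF sub s sf_of_int[OF sub]] emb_of_int[OF sub s] assms)
  finally show ?thesis .
qed

lemma emb_mat_comb:
  assumes T: "\<And>j. j < d \<Longrightarrow> bs ! j = (\<Sum>l<d. of_int (T l j) * ws ! l)"
    and ws: "\<And>j. j < d \<Longrightarrow> ws ! j \<in> k"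
  shows "det (emb_mat bs) = det (emb_mat ws) * of_int (det (mat d d (\<lambda>(l, j). T l j)))"
proof -
  let ?T = "mat d d (\<lambda>(l, j). T l j)"
  have "emb_mat bs = emb_mat ws * map_mat of_int ?T"
  proof (rule eq_matI)
    fix i j assume "i < dim_row (emb_mat ws * map_mat of_int ?T)" "j < dim_col (emb_mat ws * map_mat of_int ?T)"
    then have ij: "i < d" "j < d" by (auto simp: emb_mat_def)
    have "emb_mat bs $$ (i, j) = (\<Sum>l<d. of_int (T l j) * (es ! i) (ws ! l))"
      using ij by (simp add: emb_mat_def T emb_int_comb[OF es_emb] ws)
    also have "\<dots> = (emb_mat ws * map_mat of_int ?T) $$ (i, j)"
      using ij by (auto simp: emb_mat_def scalar_prod_def atLeast0LessThan mult.commute intro!: sum.cong)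
    finally show "emb_mat bs $$ (i, j) = (emb_mat ws * map_mat of_int ?T) $$ (i, j)" .
  qed (auto simp: emb_mat_def)
  then show ?thesis using det_mult[of "emb_mat ws" d "map_mat of_int ?T"] emb_mat_carrier
    by (simp add: of_int_hom.hom_det)
qed

text \<open>Another integral basis changes the columns by integer matrices in both directions, and
  another order of the embeddings permutes the rows. Each affects only the sign of the determinant,
  which the square removes, so the definite description denotes.\<close>

lemma discriminant_eq:
  assumes ws: "integral_basis k ws"
  shows "discriminant k = (det (emb_mat ws))\<^sup>2"
proof -
  have key: "(det (mat (length ss) (length ws') (\<lambda>(i, j). (ss ! i) (ws' ! j))))\<^sup>2 = (det (emb_mat ws))\<^sup>2"
    if ws': "integral_basis k ws'" and ss: "distinct ss" "set ss = embeddings k" for ws' ss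
  proof -
    have l1: "length ws' = d" by (rule integral_basis_length[OF ws'])
    have l2: "length ss = d" using ss card_emb distinct_card by metis
    have wk: "ws ! j \<in> k" if "j < d" for j
      by (rule integral_basis_mem[OF ws that])
    have wk': "ws' ! j \<in> k" if "j < d" for j
      by (rule integral_basis_mem[OF ws' that])
    have wO: "ws ! j \<in> OK" "ws' ! j \<in> OK" if "j < d" for j
      by (rule integral_basis_mem[OF ws that], rule integral_basis_mem[OF ws' that])
    have "\<forall>j. \<exists>c :: nat \<Rightarrow> int. j < d \<longrightarrow> ws ! j = (\<Sum>l<d. of_int (c l) * ws' ! l)"
      using integral_basis_coords[OF ws'] wO by blast
    then obtain T where T: "\<And>j. j < d \<Longrightarrow> ws ! j = (\<Sum>l<d. of_int (T j l) * ws' ! l)" by metis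
    have "\<forall>j. \<exists>c :: nat \<Rightarrow> int. j < d \<longrightarrow> ws' ! j = (\<Sum>l<d. of_int (c l) * ws ! l)"
      using integral_basis_coords[OF ws] wO by blast
    then obtain T' where T': "\<And>j. j < d \<Longrightarrow> ws' ! j = (\<Sum>l<d. of_int (T' j l) * ws ! l)" by metis
    have c1: "det (mat d d (\<lambda>(i, j). (es ! i) (ws' ! j))) = det (mat d d (\<lambda>(i, j). (es ! i) (ws ! j))) \<or>
      det (mat d d (\<lambda>(i, j). (es ! i) (ws' ! j))) = - det (mat d d (\<lambda>(i, j). (es ! i) (ws ! j)))"
      by (rule det_int_change_cols[where T = T' and T' = T])
        (simp_all add: T' emb_int_comb[OF es_emb] wk, simp add: emb_int_comb[OF es_emb, symmetric] wk T'[symmetric] T[symmetric] emb_int_comb[OF es_emb, of _ ws', symmetric] wk')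
    have ind: "\<exists>T. \<forall>i<d. as ! i = bs ! (T i) \<and> T i < d"
      if ab: "set as = set bs" "length as = d" "length bs = d" for as bs :: "('a \<Rightarrow> complex) list"
    proof -
      have "\<exists>t. i < d \<longrightarrow> as ! i = bs ! t \<and> t < d" for i
      proof (cases "i < d")
        case True
        then have "as ! i \<in> set bs" using ab nth_mem[of i as] by simp
        then obtain t where "t < length bs" "bs ! t = as ! i" by (auto simp: in_set_conv_nth)
        then show ?thesis using ab(3) by (intro exI[of _ t]) simp
      qed simp
      then have "\<exists>T. \<forall>i. i < d \<longrightarrow> as ! i = bs ! T i \<and> T i < d" by (intro choice allI)
      then show ?thesis by blast
    qed
    have "\<exists>T. \<forall>i<d. ss ! i = es ! (T i) \<and> T i < d"
      by (rule ind[OF _ l2 length_es]) (simp add: ss es)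
    then obtain P where P: "\<And>i. i < d \<Longrightarrow> ss ! i = es ! (P i)" "\<And>i. i < d \<Longrightarrow> P i < d" by blast
    have "\<exists>T. \<forall>i<d. es ! i = ss ! (T i) \<and> T i < d"
      by (rule ind[OF _ length_es l2]) (simp add: ss es)
    then obtain P' where P': "\<And>i. i < d \<Longrightarrow> es ! i = ss ! (P' i)" "\<And>i. i < d \<Longrightarrow> P' i < d" by blast
    have delta: "(\<Sum>l<d. of_int (if l = p then 1 else 0) * f l) = f p" if "p < d" for p and f :: "nat \<Rightarrow> complex"
    proof -
      have "(\<Sum>l<d. of_int (if l = p then 1 else 0) * f l) = (\<Sum>l<d. if l = p then f l else 0)"
        by (rule sum.cong) auto
      then show ?thesis using that by simp
    qed
    \<comment> \<open>The permutation of the rows is written as multiplication by integer matrices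
      with entries 0 and 1, so that \<open>det_int_change_rows\<close> covers it as well.\<close>
    have c2: "det (mat d d (\<lambda>(i, j). (ss ! i) (ws' ! j))) = det (mat d d (\<lambda>(i, j). (es ! i) (ws' ! j))) \<or>
      det (mat d d (\<lambda>(i, j). (ss ! i) (ws' ! j))) = - det (mat d d (\<lambda>(i, j). (es ! i) (ws' ! j)))"
      by (rule det_int_change_rows[where T = "\<lambda>i l. if l = P i then 1 else 0" and T' = "\<lambda>i l. if l = P' i then 1 else 0"])
        (simp_all only: delta P P')
    show ?thesis unfolding l1 l2 emb_mat_def using c1 c2 by auto
  qed
  show ?thesis unfolding discriminant_def
  proof (rule the_equality)
    show "\<exists>ws' ss. integral_basis k ws' \<and> distinct ss \<and> set ss = embeddings k \<and>
      (det (emb_mat ws))\<^sup>2 = (det (mat (length ss) (length ws') (\<lambda>(i, j). (ss ! i) (ws' ! j))))\<^sup>2"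
      using key[OF ws es] ws es by metis
  next
    fix D
    assume "\<exists>ws' ss. integral_basis k ws' \<and> distinct ss \<and> set ss = embeddings k \<and>
      D = (det (mat (length ss) (length ws') (\<lambda>(i, j). (ss ! i) (ws' ! j))))\<^sup>2"
    then obtain ws' ss where "integral_basis k ws'" "distinct ss" "set ss = embeddings k"
      "D = (det (mat (length ss) (length ws') (\<lambda>(i, j). (ss ! i) (ws' ! j))))\<^sup>2" by blast
    then show "D = (det (emb_mat ws))\<^sup>2" using key[of ws' ss] by simp
  qed
qed

text \<open>The matrix expressing \<open>bs\<close> in an integral basis is integral with nonzero
  determinant, hence of determinant at least 1 in absolute value.\<close>

lemma abs_discriminant_le:
  assumes bs: "basis_over \<rat> k bs" "set bs \<subseteq> OK"
  shows "abs_discriminant k \<le> (cmod (det (emb_mat bs)))\<^sup>2"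
proof -
  obtain ws where ws: "integral_basis k ws" using ex_integral_basis by blast
  have lb: "length bs = d" by (rule basis_length[OF bs(1)])
  have wk: "ws ! j \<in> k" if "j < d" for j
    by (rule integral_basis_mem[OF ws that])
  have "\<forall>j. \<exists>c :: nat \<Rightarrow> int. j < d \<longrightarrow> bs ! j = (\<Sum>l<d. of_int (c l) * ws ! l)"
    using integral_basis_coords[OF ws] bs(2) lb by (metis nth_mem subsetD)
  then obtain T where T: "\<And>j. j < d \<Longrightarrow> bs ! j = (\<Sum>l<d. of_int (T j l) * ws ! l)" by metis
  let ?D = "det (mat d d (\<lambda>(l, j). T j l))"
  have e: "det (emb_mat bs) = det (emb_mat ws) * of_int ?D"
    using emb_mat_comb[of bs "\<lambda>l j. T j l" ws] T wk by blast
  have "?D \<noteq> 0" using det_emb_mat[OF bs(1)] e by auto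
  then have "1 \<le> real_of_int \<bar>?D\<bar>" by linarith
  then have "1 \<le> (real_of_int \<bar>?D\<bar>)\<^sup>2" by (rule one_le_power)
  then have "(cmod (det (emb_mat ws)))\<^sup>2 * 1 \<le> (cmod (det (emb_mat ws)))\<^sup>2 * (real_of_int \<bar>?D\<bar>)\<^sup>2"
    by (intro mult_left_mono) auto
  then show ?thesis
    by (simp add: abs_discriminant_def discriminant_eq[OF ws] e norm_mult norm_power power_mult_distrib)
qed

section \<open>Norms and units\<close>

text \<open>Let \<open>A\<close> be the integer matrix of multiplication by \<open>x\<close> on an
  integral basis. Comparing determinants after multiplying the embedding matrix by the diagonal
  matrix of conjugates shows that the norm is \<open>det A\<close>. The adjugate of \<open>A\<close>
  describes multiplication by \<open>det A / x\<close>, which is therefore integral.\<close>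

lemma norm_divides:
  assumes x: "x \<in> OK" "x \<noteq> 0"
  obtains n :: int and y where "(\<Prod>\<sigma>\<in>embeddings k. \<sigma> x) = of_int n" "n \<noteq> 0" "y \<in> OK" "x * y = of_int n"
proof -
  obtain ws where ws: "integral_basis k ws" using ex_integral_basis by blast
  have lw: "length ws = d" by (rule integral_basis_length[OF ws])
  have wO: "ws ! j \<in> OK" if "j < d" for j using ws lw that by (auto simp: integral_basis_def)
  have wk: "ws ! j \<in> k" if "j < d" for j using wO that OK_k by auto
  have xk: "x \<in> k" using OK_k x by simp
  have "\<forall>j. \<exists>c :: nat \<Rightarrow> int. j < d \<longrightarrow> x * ws ! j = (\<Sum>l<d. of_int (c l) * ws ! l)"
    using integral_basis_coords[OF ws] OK_mult[OF x(1)] wO by blast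
  then obtain a where a: "\<And>j. j < d \<Longrightarrow> x * ws ! j = (\<Sum>l<d. of_int (a j l) * ws ! l)" by metis
  define A where "A = mat d d (\<lambda>(l, j). a j l)"
  have Ac: "A \<in> carrier_mat d d" by (simp add: A_def)
  define bs where "bs = map (\<lambda>j. x * ws ! j) [0..<d]"
  have "det (emb_mat bs) = det (emb_mat ws) * of_int (det A)"
    unfolding A_def by (rule emb_mat_comb) (auto simp: bs_def a wk)
  moreover have "det (emb_mat bs) = (\<Prod>\<sigma>\<in>embeddings k. \<sigma> x) * det (emb_mat ws)"
  proof -
    let ?D = "mat d d (\<lambda>(i, j). if i = j then (es ! i) x else 0)"
    have "emb_mat bs = ?D * emb_mat ws"
    proof (rule eq_matI)
      fix i j assume "i < dim_row (?D * emb_mat ws)" "j < dim_col (?D * emb_mat ws)"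
      then have ij: "i < d" "j < d" by (auto simp: emb_mat_def)
      have "(?D * emb_mat ws) $$ (i, j) = (\<Sum>l<d. (if i = l then (es ! i) x else 0) * (es ! l) (ws ! j))"
        using ij by (auto simp: emb_mat_def scalar_prod_def atLeast0LessThan intro!: sum.cong)
      also have "\<dots> = (\<Sum>l<d. if i = l then (es ! i) x * (es ! i) (ws ! j) else 0)"
        by (rule sum.cong) auto
      also have "\<dots> = (es ! i) x * (es ! i) (ws ! j)" using ij by simp
      finally show "emb_mat bs $$ (i, j) = (?D * emb_mat ws) $$ (i, j)"
        using ij by (simp add: emb_mat_def bs_def emb_mult[OF sub es_emb xk wk])
    qed (auto simp: emb_mat_def)
    moreover have "det ?D = (\<Prod>i<d. (es ! i) x)"
      by (subst det_upper_triangular[of _ d]) (auto simp: prod_list_diag_prod atLeast0LessThan intro!: prod.cong)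
    ultimately show ?thesis using det_mult[of ?D d "emb_mat ws"] emb_mat_carrier prod_es[of "\<lambda>\<sigma>. \<sigma> x"] by simp
  qed
  ultimately have N: "(\<Prod>\<sigma>\<in>embeddings k. \<sigma> x) = of_int (det A)"
    using det_emb_mat[OF integral_basis_Q_basis[OF ws]] by (simp add: mult.commute)
  have nz: "det A \<noteq> 0"
  proof
    assume "det A = 0"
    then have "(\<Prod>\<sigma>\<in>embeddings k. \<sigma> x) = 0" using N by simp
    then show False using finite_emb emb_eq_0_iff[OF sub _ xk] x(2) by auto
  qed
  define y where "y = of_int (det A) / x"
  have yw: "y * ws ! j = (\<Sum>l<d. of_int (adj_mat A $$ (l, j)) * ws ! l)" if j: "j < d" for j
  proof -
    have adj: "(\<Sum>l<d. A $$ (m, l) * adj_mat A $$ (l, j)) = (if m = j then det A else 0)" if m: "m < d" for m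
    proof -
      have "(A * adj_mat A) $$ (m, j) = (det A \<cdot>\<^sub>m 1\<^sub>m d) $$ (m, j)" using adj_mat(2)[OF Ac] by simp
      moreover have "(A * adj_mat A) $$ (m, j) = (\<Sum>l<d. A $$ (m, l) * adj_mat A $$ (l, j))"
        using j m Ac adj_mat(1)[OF Ac] by (auto simp: scalar_prod_def atLeast0LessThan)
      ultimately show ?thesis using j m by simp
    qed
    have "x * (\<Sum>l<d. of_int (adj_mat A $$ (l, j)) * ws ! l) = (\<Sum>l<d. of_int (adj_mat A $$ (l, j)) * (x * ws ! l))"
      by (simp add: sum_distrib_left ac_simps)
    also have "\<dots> = (\<Sum>l<d. of_int (adj_mat A $$ (l, j)) * (\<Sum>m<d. of_int (A $$ (m, l)) * ws ! m))"
      by (rule sum.cong) (auto simp: a A_def)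
    also have "\<dots> = (\<Sum>m<d. of_int (\<Sum>l<d. A $$ (m, l) * adj_mat A $$ (l, j)) * ws ! m)"
      unfolding sum_distrib_left of_int_sum sum_distrib_right by (subst sum.swap) (simp add: ac_simps)
    also have "\<dots> = (\<Sum>m<d. if m = j then of_int (det A) * ws ! j else 0)"
      by (rule sum.cong) (auto simp: adj)
    also have "\<dots> = of_int (det A) * ws ! j" using j by simp
    finally show ?thesis using x(2) by (simp add: y_def field_simps)
  qed
  obtain c :: "nat \<Rightarrow> int" where c: "1 = (\<Sum>j<d. of_int (c j) * ws ! j)"
    using integral_basis_coords[OF ws OK_1] by blast
  have "y = y * (\<Sum>j<d. of_int (c j) * ws ! j)" using c by simp
  also have "\<dots> = (\<Sum>j<d. of_int (c j) * (y * ws ! j))" by (simp add: sum_distrib_left ac_simps)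
  also have "\<dots> \<in> OK" by (auto simp: yw intro!: OK_sum OK_mult OK_of_int wO)
  finally have "y \<in> OK" .
  moreover have "x * y = of_int (det A)" using x(2) by (simp add: y_def)
  ultimately show thesis using that N nz by blast
qed

lemma norm_ge_1:
  assumes "x \<in> OK" "x \<noteq> 0"
  shows "1 \<le> (\<Prod>\<sigma>\<in>embeddings k. cmod (\<sigma> x))"
proof -
  obtain n :: int and y where n: "(\<Prod>\<sigma>\<in>embeddings k. \<sigma> x) = of_int n" "n \<noteq> 0" "y \<in> OK" "x * y = of_int n"
    by (rule norm_divides[OF assms])
  have "(\<Prod>\<sigma>\<in>embeddings k. cmod (\<sigma> x)) = cmod (of_int n)" using n(1) by (simp add: prod_norm)
  also have "\<dots> = real_of_int \<bar>n\<bar>" by simp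
  finally show ?thesis using n(2) by linarith
qed

lemma integer_units_iff: "x \<in> integer_units k \<longleftrightarrow> x \<in> OK \<and> inverse x \<in> OK \<and> x \<noteq> 0"
proof -
  have "x \<in> integer_units k \<longleftrightarrow> x \<in> OK \<and> (\<exists>y\<in>OK. y * x = 1 \<and> x * y = 1)"
    unfolding integer_units_def Units_def by (auto simp: ring_of_type_algebra_def)
  also have "\<dots> \<longleftrightarrow> x \<in> OK \<and> inverse x \<in> OK \<and> x \<noteq> 0"
    by (auto intro!: bexI[of _ "inverse x"]) (metis inverse_unique)
  finally show ?thesis .
qed

lemma units_k: "x \<in> integer_units k \<Longrightarrow> x \<in> k" and units_nz: "x \<in> integer_units k \<Longrightarrow> x \<noteq> 0"
  and units_OK: "x \<in> integer_units k \<Longrightarrow> x \<in> OK"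
  using OK_k by (auto simp: integer_units_iff)

lemma units_1: "1 \<in> integer_units k" and units_mult: "x \<in> integer_units k \<Longrightarrow> y \<in> integer_units k \<Longrightarrow> x * y \<in> integer_units k"
  and units_inverse: "x \<in> integer_units k \<Longrightarrow> inverse x \<in> integer_units k"
  by (auto simp: integer_units_iff OK_1 OK_mult)

lemma units_divide: "x \<in> integer_units k \<Longrightarrow> y \<in> integer_units k \<Longrightarrow> x / y \<in> integer_units k"
  by (simp add: divide_inverse units_mult units_inverse)

lemma units_power: "x \<in> integer_units k \<Longrightarrow> x ^ n \<in> integer_units k"
  by (induction n) (simp_all add: units_1 units_mult)

lemma units_powi: "x \<in> integer_units k \<Longrightarrow> x powi n \<in> integer_units k"
  by (simp add: power_int_def units_power units_inverse)

lemma units_prod: "(\<And>i. i \<in> I \<Longrightarrow> f i \<in> integer_units k) \<Longrightarrow> prod f I \<in> integer_units k"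
  by (induction I rule: infinite_finite_induct) (simp_all add: units_1 units_mult)

text \<open>The norms of \<open>x\<close> and of its inverse are reciprocal and both at least
  1.\<close>

lemma units_norm:
  assumes "x \<in> integer_units k"
  shows "(\<Prod>\<sigma>\<in>embeddings k. cmod (\<sigma> x)) = 1"
proof -
  have x: "x \<in> OK" "inverse x \<in> OK" "x \<noteq> 0" using assms by (auto simp: integer_units_iff)
  have "(\<Prod>\<sigma>\<in>embeddings k. cmod (\<sigma> (inverse x))) = inverse (\<Prod>\<sigma>\<in>embeddings k. cmod (\<sigma> x))"
    unfolding prod_inversef[symmetric] comp_def
    by (rule prod.cong) (auto simp: emb_inverse[OF sub _ OK_k[OF x(1)]] norm_inverse)
  moreover have "1 \<le> (\<Prod>\<sigma>\<in>embeddings k. cmod (\<sigma> (inverse x)))" by (rule norm_ge_1) (use x in auto)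
  moreover have n1: "1 \<le> (\<Prod>\<sigma>\<in>embeddings k. cmod (\<sigma> x))" by (rule norm_ge_1) (use x in auto)
  ultimately have "1 \<le> inverse (\<Prod>\<sigma>\<in>embeddings k. cmod (\<sigma> x))" by simp
  then have "(\<Prod>\<sigma>\<in>embeddings k. cmod (\<sigma> x)) \<le> 1"
    using one_le_inverse_iff by blast
  then show ?thesis using n1 by simp
qed

text \<open>Inverting the embedding matrix recovers the coordinates in an integral basis from the
  conjugates, so bounded conjugates leave finitely many integer coordinates.\<close>

lemma finite_bounded_integers: "finite {x \<in> OK. \<forall>\<sigma>\<in>embeddings k. cmod (\<sigma> x) \<le> C}"
proof -
  obtain ws where ws: "integral_basis k ws" using ex_integral_basis by blast
  have lw: "length ws = d" by (rule integral_basis_length[OF ws])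
  have wk: "ws ! j \<in> k" if "j < d" for j by (rule integral_basis_mem[OF ws that])
  obtain P :: "nat \<Rightarrow> nat \<Rightarrow> complex" where P:
    "\<And>i j. i < d \<Longrightarrow> j < d \<Longrightarrow> (\<Sum>l<d. P i l * (es ! l) (ws ! j)) = (if i = j then 1 else 0)"
    using emb_mat_inverse[OF integral_basis_Q_basis[OF ws]] by blast
  define B where "B = (\<Sum>i<d. \<Sum>l<d. cmod (P i l) * \<bar>C\<bar>)"
  let ?F = "{f :: nat \<Rightarrow> int. \<forall>j. (j \<in> {..<d} \<longrightarrow> f j \<in> {- \<lceil>B\<rceil>..\<lceil>B\<rceil>}) \<and> (j \<notin> {..<d} \<longrightarrow> f j = 0)}"
  have "{x \<in> OK. \<forall>\<sigma>\<in>embeddings k. cmod (\<sigma> x) \<le> C} \<subseteq> (\<lambda>f. \<Sum>j<d. of_int (f j) * ws ! j) ` ?F"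
  proof
    fix x assume x: "x \<in> {x \<in> OK. \<forall>\<sigma>\<in>embeddings k. cmod (\<sigma> x) \<le> C}"
    then obtain c :: "nat \<Rightarrow> int" where c: "x = (\<Sum>j<d. of_int (c j) * ws ! j)"
      using integral_basis_coords[OF ws] by blast
    have cb: "\<bar>c i\<bar> \<le> \<lceil>B\<rceil>" if i: "i < d" for i
    proof -
      have "(\<Sum>l<d. P i l * (es ! l) x) = (\<Sum>l<d. P i l * (\<Sum>j<d. of_int (c j) * (es ! l) (ws ! j)))"
        by (rule sum.cong) (auto simp: c emb_int_comb[OF es_emb] wk)
      also have "\<dots> = (\<Sum>j<d. of_int (c j) * (\<Sum>l<d. P i l * (es ! l) (ws ! j)))"
        unfolding sum_distrib_left by (subst sum.swap) (simp add: ac_simps)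
      also have "\<dots> = (\<Sum>j<d. if j = i then of_int (c i) else 0)"
        by (rule sum.cong) (auto simp: P i)
      also have "\<dots> = of_int (c i)" using i by simp
      finally have "real_of_int \<bar>c i\<bar> = cmod (\<Sum>l<d. P i l * (es ! l) x)" by simp
      also have "\<dots> \<le> (\<Sum>l<d. cmod (P i l * (es ! l) x))" by (rule norm_sum)
      also have "\<dots> \<le> (\<Sum>l<d. cmod (P i l) * \<bar>C\<bar>)"
        unfolding norm_mult by (intro sum_mono mult_left_mono) (use x es_emb in \<open>auto intro: order_trans[OF _ abs_ge_self]\<close>)
      also have "\<dots> \<le> B" unfolding B_def
        by (rule member_le_sum[of i _ "\<lambda>i. \<Sum>l<d. cmod (P i l) * \<bar>C\<bar>"]) (auto intro!: sum_nonneg simp: i)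
      finally show ?thesis by (metis ceiling_mono ceiling_of_int)
    qed
    show "x \<in> (\<lambda>f. \<Sum>j<d. of_int (f j) * ws ! j) ` ?F"
    proof (rule image_eqI)
      show "x = (\<Sum>j<d. of_int ((\<lambda>j. if j < d then c j else 0) j) * ws ! j)" unfolding c by (rule sum.cong) auto
      show "(\<lambda>j. if j < d then c j else 0) \<in> ?F" using cb by (auto simp: abs_le_iff) (smt (verit) cb)+
    qed
  qed
  moreover have "finite ?F" by (rule finite_set_of_finite_funs) auto
  ultimately show ?thesis by (meson finite_imageI finite_subset)
qed

text \<open>All powers of \<open>x\<close> lie in the finite set of integers with conjugates of
  modulus at most 1, so two of them coincide.\<close>

lemma kronecker:
  assumes x: "x \<in> OK" "x \<noteq> 0" and le: "\<And>\<sigma>. \<sigma> \<in> embeddings k \<Longrightarrow> cmod (\<sigma> x) \<le> 1"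
  shows "\<exists>n>0. x ^ n = 1"
proof -
  have "range (\<lambda>n. x ^ n) \<subseteq> {x \<in> OK. \<forall>\<sigma>\<in>embeddings k. cmod (\<sigma> x) \<le> 1}"
    using le by (auto simp: OK_power[OF x(1)] emb_power[OF sub _ OK_k[OF x(1)]] norm_power power_le_one)
  then have "finite (range (\<lambda>n. x ^ n))" using finite_bounded_integers finite_subset by blast
  then have "\<not> inj (\<lambda>n. x ^ n)" using range_inj_infinite by blast
  then obtain m n where "x ^ m = x ^ n" "m < n" unfolding inj_def by (metis linorder_neqE_nat)
  moreover have "x ^ n = x ^ m * x ^ (n - m)" using \<open>m < n\<close> by (simp flip: power_add)
  ultimately have "x ^ m * x ^ (n - m) = x ^ m * 1" by simp
  then have "x ^ (n - m) = 1" using x(2) by (subst (asm) mult_cancel_left) auto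
  then show ?thesis using \<open>m < n\<close> by (intro exI[of _ "n - m"]) auto
qed

lemma torsion_emb:
  assumes "x \<in> k" "x ^ n = 1" "n > 0" "\<sigma> \<in> embeddings k"
  shows "cmod (\<sigma> x) = 1"
proof -
  have "\<sigma> x ^ n = 1" using emb_power[OF sub assms(4,1), of n] assms(2) emb_1[OF sub assms(4)] by simp
  then have "cmod (\<sigma> x) ^ n = 1" by (metis norm_one norm_power)
  then show ?thesis using assms(3) power_eq_imp_eq_base[of "cmod (\<sigma> x)" n 1] by simp
qed

end

section \<open>Archimedean places\<close>

context nf
begin

definition cj :: "('a \<Rightarrow> complex) \<Rightarrow> 'a \<Rightarrow> complex" where
  "cj \<sigma> = restrict (\<lambda>x. cnj (\<sigma> x)) k"

lemma cj_emb: "\<sigma> \<in> embeddings k \<Longrightarrow> cj \<sigma> \<in> embeddings k"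
  unfolding cj_def by (rule emb_cnj[OF sub])

lemma cj_apply: "x \<in> k \<Longrightarrow> cj \<sigma> x = cnj (\<sigma> x)"
  by (simp add: cj_def)

lemma emb_eqI: "\<sigma> \<in> embeddings k \<Longrightarrow> \<tau> \<in> embeddings k \<Longrightarrow> (\<And>x. x \<in> k \<Longrightarrow> \<sigma> x = \<tau> x) \<Longrightarrow> \<sigma> = \<tau>"
  by (rule extensionalityI[of _ k]) (auto simp: embeddings_iff)

lemma cj_cj: "\<sigma> \<in> embeddings k \<Longrightarrow> cj (cj \<sigma>) = \<sigma>"
  by (rule emb_eqI) (simp_all add: cj_emb cj_apply)

lemma cj_real: "\<sigma> \<in> embeddings k \<Longrightarrow> cj \<sigma> = \<sigma> \<longleftrightarrow> real_embedding k \<sigma>"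
proof
  assume s: "\<sigma> \<in> embeddings k" and eq: "cj \<sigma> = \<sigma>"
  have "\<sigma> x \<in> \<real>" if "x \<in> k" for x
    using cj_apply[OF that, of \<sigma>] eq by (simp add: Reals_cnj_iff)
  then show "real_embedding k \<sigma>" by (auto simp: real_embedding_def)
next
  assume s: "\<sigma> \<in> embeddings k" and re: "real_embedding k \<sigma>"
  show "cj \<sigma> = \<sigma>"
    by (rule emb_eqI[OF cj_emb[OF s] s])
      (use re in \<open>auto simp: cj_apply real_embedding_def image_subset_iff Reals_cnj_iff[symmetric]\<close>)
qed

lemma local_degree_card: "\<sigma> \<in> embeddings k \<Longrightarrow> local_degree k \<sigma> = card {\<sigma>, cj \<sigma>}"
  by (auto simp: local_degree_def cj_real[symmetric] card_insert_if)

lemma local_degree_pos: "local_degree k \<sigma> > 0" by (simp add: local_degree_def)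

definition nplaces :: nat where
  "nplaces = card ((\<lambda>\<sigma>. {\<sigma>, cj \<sigma>}) ` embeddings k)"

lemma place_reps_iff:
  "place_representatives k ps \<longleftrightarrow> distinct ps \<and> set ps \<subseteq> embeddings k \<and>
     (\<forall>\<tau>\<in>embeddings k. \<exists>!\<sigma>. \<sigma> \<in> set ps \<and> (\<sigma> = \<tau> \<or> \<sigma> = cj \<tau>))"
  unfolding place_representatives_def cj_def ..

lemma ex_place_reps: "\<exists>ps. place_representatives k ps"
proof -
  \<comment> \<open>The choice depends only on the unordered pair, hence is the same for
    \<open>\<tau>\<close> and its conjugate.\<close>
  define rep where "rep = (\<lambda>\<tau>. SOME \<rho>. \<rho> \<in> {\<tau>, cj \<tau>})"
  have rep: "rep \<tau> \<in> {\<tau>, cj \<tau>}" for \<tau> unfolding rep_def by (rule someI[of _ \<tau>]) simp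
  have repE: "rep \<tau> \<in> embeddings k" if "\<tau> \<in> embeddings k" for \<tau> using rep[of \<tau>] cj_emb[OF that] that by auto
  have same: "rep \<tau> = rep \<rho>" if "{\<tau>, cj \<tau>} = {\<rho>, cj \<rho>}" for \<tau> \<rho> unfolding rep_def that ..
  obtain ps where ps: "distinct ps" "set ps = rep ` embeddings k"
    using finite_distinct_list[of "rep ` embeddings k"] finite_emb by blast
  have "\<exists>!\<sigma>. \<sigma> \<in> set ps \<and> (\<sigma> = \<tau> \<or> \<sigma> = cj \<tau>)" if t: "\<tau> \<in> embeddings k" for \<tau>
  proof (rule ex1I[of _ "rep \<tau>"])
    show "rep \<tau> \<in> set ps \<and> (rep \<tau> = \<tau> \<or> rep \<tau> = cj \<tau>)" using ps t rep[of \<tau>] by auto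
    fix \<sigma> assume s: "\<sigma> \<in> set ps \<and> (\<sigma> = \<tau> \<or> \<sigma> = cj \<tau>)"
    then obtain \<rho> where r: "\<rho> \<in> embeddings k" "\<sigma> = rep \<rho>" using ps by auto
    have a: "{\<rho>, cj \<rho>} = {\<sigma>, cj \<sigma>}" using rep[of \<rho>] r cj_cj[OF r(1)] by auto
    have b: "{\<tau>, cj \<tau>} = {\<sigma>, cj \<sigma>}" using s cj_cj[OF t] by auto
    show "\<sigma> = rep \<tau>" unfolding r(2) by (rule same[OF trans[OF a b[symmetric]]])
  qed
  then have "place_representatives k ps" unfolding place_reps_iff using ps repE by auto
  then show ?thesis by blast
qed

context
  fixes ps assumes ps: "place_representatives k ps"
begin

lemma ps_distinct: "distinct ps" and ps_emb: "\<sigma> \<in> set ps \<Longrightarrow> \<sigma> \<in> embeddings k"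
  using ps by (auto simp: place_reps_iff)

lemma ps_unique: "\<sigma> \<in> set ps \<Longrightarrow> \<rho> \<in> set ps \<Longrightarrow> \<sigma> = \<rho> \<or> \<sigma> = cj \<rho> \<Longrightarrow> \<sigma> = \<rho>"
  using ps unfolding place_reps_iff by blast

lemma ps_ex: "\<tau> \<in> embeddings k \<Longrightarrow> \<exists>\<sigma>\<in>set ps. \<sigma> = \<tau> \<or> \<sigma> = cj \<tau>"
  using ps unfolding place_reps_iff by blast

lemma emb_UN_places: "embeddings k = (\<Union>\<sigma>\<in>set ps. {\<sigma>, cj \<sigma>})"
proof (intro equalityI subsetI)
  fix \<tau> assume t: "\<tau> \<in> embeddings k"
  then obtain \<sigma> where "\<sigma> \<in> set ps" "\<sigma> = \<tau> \<or> \<sigma> = cj \<tau>" using ps_ex by blast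
  then have "\<sigma> \<in> set ps" "\<tau> = \<sigma> \<or> \<tau> = cj \<sigma>" using cj_cj[OF t] by auto
  then show "\<tau> \<in> (\<Union>\<sigma>\<in>set ps. {\<sigma>, cj \<sigma>})" by blast
qed (use ps_emb cj_emb in auto)

lemma places_disjoint:
  assumes "\<sigma> \<in> set ps" "\<rho> \<in> set ps" "\<sigma> \<noteq> \<rho>"
  shows "{\<sigma>, cj \<sigma>} \<inter> {\<rho>, cj \<rho>} = {}"
proof -
  have "\<sigma> \<noteq> cj \<rho>" "\<rho> \<noteq> cj \<sigma>" using ps_unique[of \<sigma> \<rho>] ps_unique[of \<rho> \<sigma>] assms by auto
  moreover have "cj \<sigma> \<noteq> cj \<rho>"
  proof
    assume "cj \<sigma> = cj \<rho>"
    then have "cj (cj \<sigma>) = cj (cj \<rho>)" by simp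
    then show False using cj_cj[OF ps_emb] assms by simp
  qed
  ultimately show ?thesis using assms(3) by auto
qed

lemma sum_places:
  fixes f :: "('a \<Rightarrow> complex) \<Rightarrow> real"
  assumes "\<And>\<sigma>. \<sigma> \<in> embeddings k \<Longrightarrow> f (cj \<sigma>) = f \<sigma>"
  shows "(\<Sum>\<sigma>\<in>embeddings k. f \<sigma>) = (\<Sum>\<sigma>\<in>set ps. real (local_degree k \<sigma>) * f \<sigma>)"
proof -
  have "(\<Sum>\<sigma>\<in>embeddings k. f \<sigma>) = (\<Sum>\<sigma>\<in>set ps. \<Sum>\<tau>\<in>{\<sigma>, cj \<sigma>}. f \<tau>)"
    by (subst emb_UN_places, rule sum.UNION_disjoint) (use places_disjoint in auto)
  also have "\<dots> = (\<Sum>\<sigma>\<in>set ps. real (local_degree k \<sigma>) * f \<sigma>)"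
  proof (rule sum.cong)
    fix \<sigma> assume "\<sigma> \<in> set ps"
    then have s: "\<sigma> \<in> embeddings k" by (rule ps_emb)
    show "(\<Sum>\<tau>\<in>{\<sigma>, cj \<sigma>}. f \<tau>) = real (local_degree k \<sigma>) * f \<sigma>"
      using assms[OF s] local_degree_card[OF s] by (cases "\<sigma> = cj \<sigma>") auto
  qed simp
  finally show ?thesis .
qed

lemma length_places: "length ps = nplaces"
proof -
  have inj: "inj_on (\<lambda>\<sigma>. {\<sigma>, cj \<sigma>}) (set ps)"
    by (rule inj_onI, rule ccontr) (use places_disjoint in blast)
  have eq: "(\<lambda>\<sigma>. {\<sigma>, cj \<sigma>}) ` set ps = (\<lambda>\<sigma>. {\<sigma>, cj \<sigma>}) ` embeddings k"
  proof (intro equalityI subsetI)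
    fix A assume "A \<in> (\<lambda>\<sigma>. {\<sigma>, cj \<sigma>}) ` embeddings k"
    then obtain \<tau> where t: "\<tau> \<in> embeddings k" "A = {\<tau>, cj \<tau>}" by auto
    then obtain \<sigma> where "\<sigma> \<in> set ps" "\<sigma> = \<tau> \<or> \<sigma> = cj \<tau>" using ps_ex by blast
    then show "A \<in> (\<lambda>\<sigma>. {\<sigma>, cj \<sigma>}) ` set ps" using t cj_cj[OF t(1)] by (intro image_eqI[of _ _ \<sigma>]) auto
  qed (use ps_emb in auto)
  have "card (set ps) = nplaces" unfolding nplaces_def eq[symmetric] by (rule card_image[OF inj, symmetric])
  then show ?thesis using distinct_card[OF ps_distinct] by simp
qed

lemma sum_local_degree: "(\<Sum>\<sigma>\<in>set ps. local_degree k \<sigma>) = d"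
proof -
  have "real (\<Sum>\<sigma>\<in>set ps. local_degree k \<sigma>) = real d"
    using sum_places[of "\<lambda>_. 1"] by (simp add: card_emb)
  then show ?thesis by (simp only: of_nat_eq_iff)
qed

end

lemma nplaces_pos: "nplaces > 0"
proof -
  have "embeddings k \<noteq> {}" using card_emb d_pos by auto
  then show ?thesis unfolding nplaces_def using finite_emb by (simp add: card_gt_0_iff)
qed

lemma nplaces_le: "nplaces \<le> d" 
  unfolding nplaces_def using card_image_le[OF finite_emb, of "\<lambda>\<sigma>. {\<sigma>, cj \<sigma>}"] card_emb by simp

lemma d_le_nplaces: "d \<le> 2 * nplaces"
proof -
  obtain ps where ps: "place_representatives k ps" using ex_place_reps by blast
  have "d = (\<Sum>\<sigma>\<in>set ps. local_degree k \<sigma>)" by (rule sum_local_degree[OF ps, symmetric])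
  also have "\<dots> \<le> (\<Sum>\<sigma>\<in>set ps. 2)" by (rule sum_mono) (simp add: local_degree_def)
  also have "\<dots> = 2 * nplaces" using length_places[OF ps] distinct_card[OF ps_distinct[OF ps]] by simp
  finally show ?thesis .
qed

section \<open>Logarithms of units\<close>

text \<open>The logarithm carries the local degree, as in the regulator; with this weight the
  logarithms of a unit over all places sum to 0.\<close>

definition lv :: "('a \<Rightarrow> complex) \<Rightarrow> 'a \<Rightarrow> real" where
  "lv \<sigma> x = real (local_degree k \<sigma>) * ln (cmod (\<sigma> x))"

lemma emb_pos: "\<sigma> \<in> embeddings k \<Longrightarrow> x \<in> k \<Longrightarrow> x \<noteq> 0 \<Longrightarrow> cmod (\<sigma> x) > 0"
  using emb_eq_0_iff[OF sub] by simp

context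
  fixes \<sigma> assumes s: "\<sigma> \<in> embeddings k"
begin

lemma lv_1: "lv \<sigma> 1 = 0" by (simp add: lv_def emb_1[OF sub s])

lemma lv_mult: "x \<in> k \<Longrightarrow> y \<in> k \<Longrightarrow> x \<noteq> 0 \<Longrightarrow> y \<noteq> 0 \<Longrightarrow> lv \<sigma> (x * y) = lv \<sigma> x + lv \<sigma> y"
  using emb_pos[OF s] by (simp add: lv_def emb_mult[OF sub s] norm_mult ln_mult distrib_left)

lemma lv_inverse: "x \<in> k \<Longrightarrow> x \<noteq> 0 \<Longrightarrow> lv \<sigma> (inverse x) = - lv \<sigma> x"
  using emb_pos[OF s] by (simp add: lv_def emb_inverse[OF sub s] norm_inverse ln_inverse)

lemma lv_divide: "x \<in> k \<Longrightarrow> y \<in> k \<Longrightarrow> x \<noteq> 0 \<Longrightarrow> y \<noteq> 0 \<Longrightarrow> lv \<sigma> (x / y) = lv \<sigma> x - lv \<sigma> y"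
  by (simp add: divide_inverse lv_mult lv_inverse sf_inverse[OF sub])

lemma lv_power: "x \<in> k \<Longrightarrow> x \<noteq> 0 \<Longrightarrow> lv \<sigma> (x ^ n) = real n * lv \<sigma> x"
  by (induction n) (simp_all add: lv_1 lv_mult sf_power[OF sub] distrib_right)

lemma lv_powi: "x \<in> k \<Longrightarrow> x \<noteq> 0 \<Longrightarrow> lv \<sigma> (x powi n) = of_int n * lv \<sigma> x"
  by (simp add: power_int_def lv_power lv_inverse sf_inverse[OF sub])

lemma lv_prod:
  "(\<And>i. i \<in> I \<Longrightarrow> f i \<in> k \<and> f i \<noteq> 0) \<Longrightarrow> lv \<sigma> (prod f I) = (\<Sum>i\<in>I. lv \<sigma> (f i))"
  by (induction I rule: infinite_finite_induct) (simp_all add: lv_1 lv_mult sf_prod[OF sub])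

lemma lv_torsion:
  assumes "x \<in> k" "x ^ n = 1" "n > 0"
  shows "lv \<sigma> x = 0"
  by (simp add: lv_def torsion_emb[OF assms s])

lemma lv_cj: "x \<in> k \<Longrightarrow> lv (cj \<sigma>) x = lv \<sigma> x"
proof -
  assume x: "x \<in> k"
  have "local_degree k (cj \<sigma>) = local_degree k \<sigma>"
    using local_degree_card[OF s] local_degree_card[OF cj_emb[OF s]] cj_cj[OF s] by (simp add: insert_commute)
  then show ?thesis using x by (simp add: lv_def cj_apply)
qed

end

lemma sum_ln_units:
  assumes u: "u \<in> integer_units k"
  shows "(\<Sum>\<sigma>\<in>embeddings k. ln (cmod (\<sigma> u))) = 0"
proof -
  have "(\<Sum>\<sigma>\<in>embeddings k. ln (cmod (\<sigma> u))) = ln (\<Prod>\<sigma>\<in>embeddings k. cmod (\<sigma> u))"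
    by (rule ln_prod[symmetric]) (use finite_emb emb_pos units_k[OF u] units_nz[OF u] in auto)
  then show ?thesis by (simp add: units_norm[OF u])
qed

lemma sum_lv_units:
  assumes ps: "place_representatives k ps" and u: "u \<in> integer_units k"
  shows "(\<Sum>\<sigma>\<in>set ps. lv \<sigma> u) = 0"
  using sum_places[OF ps, of "\<lambda>\<sigma>. ln (cmod (\<sigma> u))"] sum_ln_units[OF u]
  by (simp add: lv_def cj_apply units_k[OF u])

lemma sum_lv_units_nth:
  assumes ps: "place_representatives k ps" and u: "u \<in> integer_units k"
  shows "(\<Sum>i<length ps. lv (ps ! i) u) = 0"
  using sum_lv_units[OF assms] sum.reindex_bij_betw[OF bij_betw_nth[OF ps_distinct[OF ps] refl refl], of "\<lambda>\<sigma>. lv \<sigma> u"]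
  by simp

lemma lv_zero_torsion:
  assumes ps: "place_representatives k ps" and u: "u \<in> integer_units k" and z: "\<And>\<sigma>. \<sigma> \<in> set ps \<Longrightarrow> lv \<sigma> u = 0"
  shows "\<exists>n>0. u ^ n = 1"
proof (rule kronecker)
  show "u \<in> OK" "u \<noteq> 0" using units_OK[OF u] units_nz[OF u] .
  fix \<tau> assume t: "\<tau> \<in> embeddings k"
  obtain \<sigma> where s: "\<sigma> \<in> set ps" "\<sigma> = \<tau> \<or> \<sigma> = cj \<tau>" using ps_ex[OF ps t] by blast
  have "lv \<tau> u = 0" using z[OF s(1)] s(2) lv_cj[OF t units_k[OF u]] by auto
  then have "ln (cmod (\<tau> u)) = 0" using local_degree_pos[of \<tau>] by (simp add: lv_def)
  then show "cmod (\<tau> u) \<le> 1" using emb_pos[OF t units_k[OF u] units_nz[OF u]] by simp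
qed

section \<open>Dirichlet's unit theorem\<close>

text \<open>The real linear forms \<open>Re (\<tau> x) + Im (\<tau> x)\<close>, one for each embedding \<open>\<tau>\<close>, treat real and
  complex places uniformly: \<open>\<bar>\<tau> x\<bar>\<close> is controlled by the forms of \<open>\<tau>\<close> and of its conjugate.\<close>

definition rform :: "('a \<Rightarrow> complex) \<Rightarrow> 'a \<Rightarrow> real" where
  "rform \<tau> x = Re (\<tau> x) + Im (\<tau> x)"

lemma rform_cj: "x \<in> k \<Longrightarrow> rform (cj \<tau>) x = Re (\<tau> x) - Im (\<tau> x)"
  by (simp add: rform_def cj_apply)

lemma cmod_le_rform: "x \<in> k \<Longrightarrow> cmod (\<tau> x) \<le> max \<bar>rform \<tau> x\<bar> \<bar>rform (cj \<tau>) x\<bar>"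
proof -
  assume x: "x \<in> k"
  have "\<bar>a\<bar> + \<bar>b\<bar> \<le> max \<bar>a + b\<bar> \<bar>a - b\<bar>" for a b :: real by linarith
  then show ?thesis unfolding rform_cj[OF x] unfolding rform_def using cmod_le[of "\<tau> x"] by (rule order_trans[rotated])
qed

lemma rform_le: "\<bar>rform \<tau> x\<bar> \<le> 2 * cmod (\<tau> x)"
  using abs_Re_le_cmod[of "\<tau> x"] abs_Im_le_cmod[of "\<tau> x"] by (simp add: rform_def)

text \<open>Dirichlet's box principle. Combinations of an integral basis with coefficients in
  \<open>0..M\<close> are sorted by the values of the forms away from \<open>\<sigma>0\<close>, cut
  into \<open>P\<close> cells each; two in one cell differ by \<open>\<beta>\<close>. At the other
  embeddings \<open>\<beta>\<close> is of order \<open>M / P\<close>, at \<open>\<sigma>0\<close> of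
  order \<open>M\<close>, and these sizes balance so that the norm is bounded independently of
  \<open>\<epsilon>\<close>.\<close>

lemma small_elements:
  assumes s0: "\<sigma>0 \<in> embeddings k"
  shows "\<exists>C. \<forall>\<epsilon>>0. \<exists>\<beta>\<in>OK. \<beta> \<noteq> 0 \<and> (\<forall>\<sigma>\<in>embeddings k - {\<sigma>0, cj \<sigma>0}. cmod (\<sigma> \<beta>) < \<epsilon>) \<and>
    (\<Prod>\<sigma>\<in>embeddings k. cmod (\<sigma> \<beta>)) \<le> C"
proof -
  obtain ws where ws: "integral_basis k ws" using ex_integral_basis by blast
  note wk = integral_basis_mem(2)[OF ws] and wO = integral_basis_mem(1)[OF ws]
  define K where "K = 1 + 2 * (\<Sum>\<sigma>\<in>embeddings k. \<Sum>j<d. cmod (\<sigma> (ws ! j)))"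
  have K1: "K \<ge> 1" unfolding K_def by (simp add: sum_nonneg)
  let ?S = "{\<sigma>0, cj \<sigma>0}"
  define E where "E = embeddings k - ?S"
  define e where "e = card E"
  define n0 where "n0 = card ?S"
  have SE: "?S \<subseteq> embeddings k" using s0 cj_emb by auto
  have fE: "finite E" using finite_emb by (simp add: E_def)
  have den: "e + n0 = d"
    using card_Diff_subset[of ?S "embeddings k"] card_mono[OF finite_emb SE] SE card_emb
    by (simp add: e_def n0_def E_def)
  have n0: "n0 \<ge> 1" by (simp add: n0_def card_insert_if)
  have cjE: "cj \<sigma> \<in> E" if "\<sigma> \<in> E" for \<sigma>
  proof -
    have s: "\<sigma> \<in> embeddings k" "\<sigma> \<noteq> \<sigma>0" "\<sigma> \<noteq> cj \<sigma>0" using that by (auto simp: E_def)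
    have "cj \<sigma> \<noteq> \<sigma>0" using cj_cj[OF s(1)] s(3) by auto
    moreover have "cj \<sigma> \<noteq> cj \<sigma>0" using cj_cj[OF s(1)] cj_cj[OF s0] s(2) by auto
    ultimately show ?thesis using cj_emb[OF s(1)] by (simp add: E_def)
  qed
  show ?thesis
  proof (intro exI[of _ "(2 * K) ^ d"] allI impI)
    fix \<epsilon> :: real assume eps: "\<epsilon> > 0"
    obtain t0 :: nat where t0: "2 * K / \<epsilon> < real t0" using reals_Archimedean2 by blast
    define t where "t = max 1 t0"
    have t1: "t \<ge> 1" and tK: "2 * K / \<epsilon> < real t" using t0 by (auto simp: t_def)
    \<comment> \<open>With \<open>P = t ^ d\<close> there are \<open>P ^ e = M ^ d\<close> cells,
      just fewer than the \<open>(M + 1) ^ d\<close> combinations, while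
      \<open>M / P = 1 / t ^ n0\<close> tends to 0.\<close>
    define M where "M = t ^ e"
    define P where "P = t ^ d"
    have M1: "M \<ge> 1" and P1: "P \<ge> 1" using t1 by (auto simp: M_def P_def)
    define val where "val = (\<lambda>c :: nat \<Rightarrow> nat. \<Sum>j<d. of_int (int (c j)) * ws ! j)"
    have valO: "val c \<in> OK" for c unfolding val_def
      by (rule OK_sum, rule OK_mult, rule OK_of_int, rule wO) simp
    note valk = OK_k[OF valO]
    define XX where "XX = PiE {..<d} (\<lambda>_. {0..M})"
    have val_bd: "2 * cmod (\<sigma> (val c)) \<le> (K - 1) * M" if c: "c \<in> XX" and s: "\<sigma> \<in> embeddings k" for c \<sigma>
    proof -
      have "\<sigma> (val c) = (\<Sum>j<d. of_int (int (c j)) * \<sigma> (ws ! j))"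
        unfolding val_def by (rule emb_int_comb[OF s, of ws "\<lambda>j. int (c j)"]) (rule wk)
      then have "cmod (\<sigma> (val c)) \<le> (\<Sum>j<d. cmod (of_int (int (c j)) * \<sigma> (ws ! j)))"
        by (simp only: norm_sum)
      also have "\<dots> \<le> (\<Sum>j<d. real M * cmod (\<sigma> (ws ! j)))"
        unfolding norm_mult by (intro sum_mono mult_right_mono) (use c in \<open>auto simp: XX_def PiE_def Pi_def\<close>)
      also have "\<dots> = real M * (\<Sum>j<d. cmod (\<sigma> (ws ! j)))" by (simp add: sum_distrib_left)
      also have "\<dots> \<le> real M * (\<Sum>\<sigma>\<in>embeddings k. \<Sum>j<d. cmod (\<sigma> (ws ! j)))"
        by (intro mult_left_mono member_le_sum[OF s _ finite_emb, of "\<lambda>\<sigma>. \<Sum>j<d. cmod (\<sigma> (ws ! j))"])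
          (auto intro: sum_nonneg)
      finally show ?thesis by (simp add: K_def algebra_simps)
    qed
    \<comment> \<open>Rescales a form from the range \<open>(- K * M, K * M)\<close> to
      \<open>[0, P)\<close>; the floor is the number of the cell.\<close>
    define g where "g = (\<lambda>c \<sigma>. (rform \<sigma> (val c) + K * M) / (2 * K * M) * P)"
    have KM: "K * M > 0" using K1 M1 by simp
    have g_bd: "0 \<le> g c \<sigma> \<and> g c \<sigma> < P" if c: "c \<in> XX" and s: "\<sigma> \<in> embeddings k" for c \<sigma>
    proof -
      have "(K - 1) * M < K * M" using M1 by (simp add: algebra_simps)
      then have "\<bar>rform \<sigma> (val c)\<bar> < K * M" using rform_le[of \<sigma> "val c"] val_bd[OF that] by linarith
      then have h: "0 \<le> (rform \<sigma> (val c) + K * M) / (2 * K * M)" "(rform \<sigma> (val c) + K * M) / (2 * K * M) < 1"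
        using KM by (auto simp: field_simps)
      have P0: "0 < real P" using P1 by simp
      show ?thesis unfolding g_def
        using mult_nonneg_nonneg[OF h(1) less_imp_le[OF P0]] mult_strict_right_mono[OF h(2) P0]
        by (simp only: mult_1 simp_thms)
    qed
    define \<Phi> where "\<Phi> = (\<lambda>c. restrict (\<lambda>\<sigma>. nat \<lfloor>g c \<sigma>\<rfloor>) E)"
    have im: "\<Phi> ` XX \<subseteq> PiE E (\<lambda>_. {0..<P})"
    proof
      fix f assume "f \<in> \<Phi> ` XX"
      then obtain c where c: "c \<in> XX" "f = \<Phi> c" by auto
      have "nat \<lfloor>g c \<sigma>\<rfloor> < P" if "\<sigma> \<in> E" for \<sigma>
      proof -
        have "0 \<le> g c \<sigma> \<and> g c \<sigma> < P" using g_bd[OF c(1)] that by (simp add: E_def)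
        then have "\<lfloor>g c \<sigma>\<rfloor> < int P" by (simp add: floor_less_iff)
        then show ?thesis using P1 by linarith
      qed
      then show "f \<in> PiE E (\<lambda>_. {0..<P})" unfolding c \<Phi>_def by auto
    qed
    have "card (PiE E (\<lambda>_. {0..<P})) = P ^ e" using fE by (simp add: card_PiE e_def)
    also have "\<dots> = M ^ d" by (simp add: P_def M_def flip: power_mult) (simp add: mult.commute)
    also have "\<dots> < (M + 1) ^ d" using d_pos by (intro power_strict_mono) auto
    also have "\<dots> = card XX" by (simp add: XX_def card_PiE)
    finally have "card (\<Phi> ` XX) < card XX"
      using card_mono[OF _ im] finite_PiE[OF fE, of "\<lambda>_. {0..<P}"] by simp
    then have "\<not> inj_on \<Phi> XX" by (rule pigeonhole)
    then obtain c c' where cc: "c \<in> XX" "c' \<in> XX" "c \<noteq> c'" "\<Phi> c = \<Phi> c'" by (auto simp: inj_on_def)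
    define \<beta> where "\<beta> = val c - val c'"
    have bO: "\<beta> \<in> OK" unfolding \<beta>_def by (intro OK_diff valO)
    note bk = OK_k[OF bO]
    have b0: "\<beta> \<noteq> 0"
    proof
      assume "\<beta> = 0"
      then have "(\<Sum>j<length ws. of_int (int (c j) - int (c' j)) * ws ! j) = 0"
        unfolding \<beta>_def val_def integral_basis_length[OF ws]
        by (simp add: left_diff_distrib sum_subtractf)
      then have "\<forall>j<length ws. int (c j) - int (c' j) = 0"
        using ws unfolding integral_basis_def by (elim conjE allE) (erule (1) impE)
      then have "\<forall>j<d. c j = c' j" using integral_basis_length[OF ws] by auto
      then have "c = c'" using cc(1,2) unfolding XX_def by (intro PiE_ext) auto
      then show False using cc(3) by simp
    qed
    have small: "\<bar>rform \<sigma> \<beta>\<bar> < 2 * K * M / P" if s: "\<sigma> \<in> E" for \<sigma>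
    proof -
      have se: "\<sigma> \<in> embeddings k" using s by (simp add: E_def)
      have "nat \<lfloor>g c \<sigma>\<rfloor> = nat \<lfloor>g c' \<sigma>\<rfloor>" using fun_cong[OF cc(4), of \<sigma>] s by (simp add: \<Phi>_def)
      moreover have "0 \<le> g c \<sigma>" "0 \<le> g c' \<sigma>" using g_bd[OF cc(1) se] g_bd[OF cc(2) se] by auto
      ultimately have "\<lfloor>g c \<sigma>\<rfloor> = \<lfloor>g c' \<sigma>\<rfloor>" by (simp add: nat_eq_iff)
      then have "\<bar>g c \<sigma> - g c' \<sigma>\<bar> < 1" by linarith
      moreover have "g c \<sigma> - g c' \<sigma> = rform \<sigma> \<beta> * (P / (2 * K * M))"
        unfolding g_def \<beta>_def rform_def emb_diff[OF sub se valk valk]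
        by (simp add: diff_divide_distrib[symmetric] left_diff_distrib[symmetric])
      ultimately have "\<bar>rform \<sigma> \<beta>\<bar> * (P / (2 * K * M)) < 1"
        using K1 by (simp add: abs_mult abs_of_nonneg[of K])
      then show ?thesis using KM P1 by (simp add: field_simps)
    qed
    have PM: "real P = real M * real t ^ n0" by (simp add: P_def M_def den[symmetric] power_add)
    have small': "cmod (\<sigma> \<beta>) < 2 * K * M / P" if s: "\<sigma> \<in> E" for \<sigma>
      using cmod_le_rform[OF bk, of \<sigma>] small[OF s] small[OF cjE[OF s]] by linarith
    have big: "cmod (\<sigma> \<beta>) \<le> K * M" if s: "\<sigma> \<in> embeddings k" for \<sigma>
    proof -
      have "cmod (\<sigma> \<beta>) \<le> cmod (\<sigma> (val c)) + cmod (\<sigma> (val c'))"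
        unfolding \<beta>_def emb_diff[OF sub s valk valk] by (rule norm_triangle_ineq4)
      moreover have "(K - 1) * M \<le> K * M" using M1 by (simp add: algebra_simps)
      ultimately show ?thesis using val_bd[OF cc(1) s] val_bd[OF cc(2) s] by linarith
    qed
    show "\<exists>\<beta>\<in>OK. \<beta> \<noteq> 0 \<and> (\<forall>\<sigma>\<in>embeddings k - {\<sigma>0, cj \<sigma>0}. cmod (\<sigma> \<beta>) < \<epsilon>) \<and>
      (\<Prod>\<sigma>\<in>embeddings k. cmod (\<sigma> \<beta>)) \<le> (2 * K) ^ d"
    proof (intro bexI[OF _ bO] conjI b0 ballI)
      fix \<sigma> assume "\<sigma> \<in> embeddings k - {\<sigma>0, cj \<sigma>0}"
      then have "cmod (\<sigma> \<beta>) < 2 * K * M / P" using small' by (simp add: E_def)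
      also have "\<dots> = 2 * K / real t ^ n0" using M1 by (simp add: PM)
      also have "\<dots> \<le> 2 * K / real t"
        using power_increasing[OF n0, of "real t"] t1 K1 by (intro divide_left_mono) auto
      also have "\<dots> < \<epsilon>" using tK eps t1 by (simp add: field_simps)
      finally show "cmod (\<sigma> \<beta>) < \<epsilon>" .
    next
      have "(\<Prod>\<sigma>\<in>embeddings k. cmod (\<sigma> \<beta>)) = (\<Prod>\<sigma>\<in>E. cmod (\<sigma> \<beta>)) * (\<Prod>\<sigma>\<in>?S. cmod (\<sigma> \<beta>))"
        unfolding E_def using prod.subset_diff[OF SE finite_emb] by blast
      also have "\<dots> \<le> (\<Prod>\<sigma>\<in>E. 2 * K * M / P) * (\<Prod>\<sigma>\<in>?S. K * M)"
        by (intro mult_mono prod_mono conjI prod_nonneg)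
          (use small' big SE KM P1 in \<open>auto intro: less_imp_le\<close>)
      also have "\<dots> = (2 * K * M / P) ^ e * (K * M) ^ n0" by (simp add: e_def n0_def)
      also have "\<dots> \<le> (2 * K * M / P) ^ e * (2 * K * M) ^ n0"
        using KM P1 by (intro mult_left_mono power_mono) auto
      also have "\<dots> = (2 * K * M) ^ d / real P ^ e"
        by (simp add: power_divide den[symmetric] power_add)
      also have "real P ^ e = real M ^ d" by (simp add: P_def M_def flip: power_mult) (simp add: mult.commute)
      also have "(2 * K * M) ^ d / real M ^ d = (2 * K) ^ d" using M1 by (simp add: power_mult_distrib)
      finally show "(\<Prod>\<sigma>\<in>embeddings k. cmod (\<sigma> \<beta>)) \<le> (2 * K) ^ d" .
    qed
  qed
qed

text \<open>Let \<open>M\<close> be a common multiple of the possible norms up to \<open>C\<close>,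
  so that every element of \<open>T\<close> divides \<open>M\<close>. If \<open>\<beta>\<close> and
  \<open>\<beta>'\<close> in \<open>T\<close> are congruent modulo \<open>M\<close>, then
  \<open>\<beta>' / \<beta>\<close> and its inverse are 1 plus an integer, so the quotient is a
  unit. There are finitely many classes; taking \<open>\<beta>'\<close> smaller away from
  \<open>\<sigma>0\<close> than a representative of every class makes the quotient small
  there.\<close>

lemma ex_unit_small:
  assumes s0: "\<sigma>0 \<in> embeddings k"
  shows "\<exists>u\<in>integer_units k. \<forall>\<sigma>\<in>embeddings k - {\<sigma>0, cj \<sigma>0}. cmod (\<sigma> u) < 1"
proof -
  obtain C where C: "\<And>\<epsilon>. \<epsilon> > 0 \<Longrightarrow> \<exists>\<beta>\<in>OK. \<beta> \<noteq> 0 \<and>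
      (\<forall>\<sigma>\<in>embeddings k - {\<sigma>0, cj \<sigma>0}. cmod (\<sigma> \<beta>) < \<epsilon>) \<and> (\<Prod>\<sigma>\<in>embeddings k. cmod (\<sigma> \<beta>)) \<le> C"
    using small_elements[OF s0] by blast
  obtain ws where ws: "integral_basis k ws" using ex_integral_basis by blast
  note wO = integral_basis_mem(1)[OF ws]
  define T where "T = {\<beta>\<in>OK. \<beta> \<noteq> 0 \<and> (\<Prod>\<sigma>\<in>embeddings k. cmod (\<sigma> \<beta>)) \<le> C}"
  define M :: int where "M = fact (nat \<lfloor>C\<rfloor>)"
  have M: "M > 0" by (simp add: M_def)
  have dvd: "\<exists>y\<in>OK. \<beta> * y = of_int M" if b: "\<beta> \<in> T" for \<beta>
  proof -
    have b': "\<beta> \<in> OK" "\<beta> \<noteq> 0" "(\<Prod>\<sigma>\<in>embeddings k. cmod (\<sigma> \<beta>)) \<le> C" using b by (auto simp: T_def)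
    obtain n :: int and y where n: "(\<Prod>\<sigma>\<in>embeddings k. \<sigma> \<beta>) = of_int n" "n \<noteq> 0" "y \<in> OK" "\<beta> * y = of_int n"
      by (rule norm_divides[OF b'(1,2)])
    have "real_of_int \<bar>n\<bar> = cmod (\<Prod>\<sigma>\<in>embeddings k. \<sigma> \<beta>)" by (simp add: n(1))
    also have "\<dots> \<le> C" using b'(3) by (simp add: prod_norm)
    finally have "\<bar>n\<bar> \<le> \<lfloor>C\<rfloor>" by (simp add: le_floor_iff)
    then have "nat \<bar>n\<bar> dvd fact (nat \<lfloor>C\<rfloor>)" using n(2) by (intro dvd_fact) auto
    then have "int (nat \<bar>n\<bar>) dvd int (fact (nat \<lfloor>C\<rfloor>))" by (rule of_nat_dvd_iff[THEN iffD2])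
    then have "n dvd M" by (simp add: M_def)
    then obtain m where "M = n * m" by (elim dvdE)
    then have "\<beta> * (y * of_int m) = of_int M" using n(4) by (simp flip: mult.assoc)
    then show ?thesis using OK_mult[OF n(3) OK_of_int] by blast
  qed
  define crd where "crd = (\<lambda>x. SOME c :: nat \<Rightarrow> int. x = (\<Sum>j<d. of_int (c j) * ws ! j))"
  have crd: "x = (\<Sum>j<d. of_int (crd x j) * ws ! j)" if x: "x \<in> OK" for x
    unfolding crd_def using integral_basis_coords[OF ws x] by (rule someI_ex)
  define cl where "cl = (\<lambda>x j. if j < d then crd x j mod M else 0)"
  have "cl ` T \<subseteq> {f. \<forall>j. (j \<in> {..<d} \<longrightarrow> f j \<in> {0..<M}) \<and> (j \<notin> {..<d} \<longrightarrow> f j = 0)}"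
    using M by (auto simp: cl_def)
  moreover have "finite {f. \<forall>j. (j \<in> {..<d} \<longrightarrow> f j \<in> {0..<M}) \<and> (j \<notin> {..<d} \<longrightarrow> f j = 0)}"
    by (rule finite_set_of_finite_funs) auto
  ultimately have fin: "finite (cl ` T)" by (rule finite_subset)
  define rp where "rp = (\<lambda>f. SOME \<beta>. \<beta> \<in> T \<and> cl \<beta> = f)"
  have rp: "rp f \<in> T \<and> cl (rp f) = f" if f: "f \<in> cl ` T" for f
  proof -
    obtain \<beta> where "\<beta> \<in> T \<and> cl \<beta> = f" using f by auto
    then show ?thesis unfolding rp_def by (rule someI)
  qed
  \<comment> \<open>All conjugates of the chosen representatives; the added 1 ensures that the
    minimum is taken over a nonempty set.\<close>
  define V where "V = insert 1 ((\<lambda>(f, \<sigma>). cmod (\<sigma> (rp f))) ` ((cl ` T) \<times> embeddings k))"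
  have finV: "finite V" unfolding V_def using fin finite_emb by simp
  have "Min V > 0"
  proof -
    have "v > 0" if "v \<in> V" for v
      using that unfolding V_def
    proof (elim insertE imageE)
      fix p assume p: "p \<in> (cl ` T) \<times> embeddings k" and v: "v = (case p of (f, \<sigma>) \<Rightarrow> cmod (\<sigma> (rp f)))"
      obtain f \<sigma> where fs: "p = (f, \<sigma>)" by (cases p)
      have "rp f \<in> T" using rp p fs by auto
      then show "v > 0" using emb_pos[of \<sigma> "rp f"] p fs v OK_k by (auto simp: T_def)
    qed auto
    then show ?thesis using finV by (subst Min_gr_iff) (auto simp: V_def)
  qed
  from C[OF this] obtain \<beta>' where b': "\<beta>' \<in> OK" "\<beta>' \<noteq> 0"
    "\<And>\<sigma>. \<sigma> \<in> embeddings k - {\<sigma>0, cj \<sigma>0} \<Longrightarrow> cmod (\<sigma> \<beta>') < Min V"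
    "(\<Prod>\<sigma>\<in>embeddings k. cmod (\<sigma> \<beta>')) \<le> C" by blast
  have b'T: "\<beta>' \<in> T" using b' by (simp add: T_def)
  define \<beta> where "\<beta> = rp (cl \<beta>')"
  have bT: "\<beta> \<in> T" and bcl: "cl \<beta> = cl \<beta>'" using rp[of "cl \<beta>'"] b'T by (auto simp: \<beta>_def)
  have b: "\<beta> \<in> OK" "\<beta> \<noteq> 0" using bT by (auto simp: T_def)
  have less: "cmod (\<sigma> \<beta>') < cmod (\<sigma> \<beta>)" if s: "\<sigma> \<in> embeddings k - {\<sigma>0, cj \<sigma>0}" for \<sigma>
  proof -
    have "cmod (\<sigma> \<beta>) \<in> V" unfolding V_def \<beta>_def
      by (rule insertI2, rule image_eqI[of _ _ "(cl \<beta>', \<sigma>)"]) (use s b'T in auto)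
    then have "Min V \<le> cmod (\<sigma> \<beta>)" using finV by (rule Min_le[rotated])
    then show ?thesis using b'(3)[OF s] by simp
  qed
  have "\<exists>\<gamma>\<in>OK. \<beta>' - \<beta> = of_int M * \<gamma>"
  proof -
    have "\<exists>e. crd \<beta>' j - crd \<beta> j = M * e" if "j < d" for j
    proof -
      have "crd \<beta>' j mod M = crd \<beta> j mod M" using fun_cong[OF bcl, of j] that by (simp add: cl_def)
      then have "M dvd crd \<beta>' j - crd \<beta> j" by (simp add: mod_eq_dvd_iff)
      then show ?thesis by (auto elim: dvdE)
    qed
    then have "\<forall>j. \<exists>e. j < d \<longrightarrow> crd \<beta>' j - crd \<beta> j = M * e" by blast
    then have "\<exists>e. \<forall>j. j < d \<longrightarrow> crd \<beta>' j - crd \<beta> j = M * e j" by (rule choice)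
    then obtain e where e: "\<And>j. j < d \<Longrightarrow> crd \<beta>' j - crd \<beta> j = M * e j" by blast
    have "\<beta>' - \<beta> = (\<Sum>j<d. of_int (crd \<beta>' j - crd \<beta> j) * ws ! j)"
      by (subst crd[OF b'(1)], subst crd[OF b(1)]) (simp add: left_diff_distrib sum_subtractf)
    also have "\<dots> = of_int M * (\<Sum>j<d. of_int (e j) * ws ! j)"
      unfolding sum_distrib_left by (rule sum.cong) (simp_all add: e mult.assoc)
    finally show ?thesis
      by (intro bexI[of _ "\<Sum>j<d. of_int (e j) * ws ! j"] OK_sum OK_mult OK_of_int wO) auto
  qed
  then obtain \<gamma> where \<gamma>: "\<gamma> \<in> OK" "\<beta>' - \<beta> = of_int M * \<gamma>" by blast
  obtain y where y: "y \<in> OK" "\<beta> * y = of_int M" using dvd[OF bT] by blast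
  obtain y' where y': "y' \<in> OK" "\<beta>' * y' = of_int M" using dvd[OF b'T] by blast
  have "\<beta> * (1 + y * \<gamma>) = \<beta> + (\<beta> * y) * \<gamma>" by (simp add: distrib_left mult.assoc)
  also have "\<dots> = \<beta>'" unfolding y(2) \<gamma>(2)[symmetric] by simp
  finally have e1: "\<beta>' / \<beta> = 1 + y * \<gamma>" using b(2) by (simp add: divide_eq_eq mult.commute)
  have "\<beta>' * (1 - y' * \<gamma>) = \<beta>' - (\<beta>' * y') * \<gamma>" by (simp add: right_diff_distrib mult.assoc)
  also have "\<dots> = \<beta>" unfolding y'(2) \<gamma>(2)[symmetric] by simp
  finally have e2: "\<beta> / \<beta>' = 1 - y' * \<gamma>" using b'(2) by (simp add: divide_eq_eq mult.commute)
  have m1: "\<beta>' / \<beta> \<in> OK" unfolding e1 by (intro OK_add OK_1 OK_mult y \<gamma>)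
  have "\<beta> / \<beta>' \<in> OK" unfolding e2 by (intro OK_diff OK_1 OK_mult y' \<gamma>)
  then have "\<beta>' / \<beta> \<in> integer_units k" unfolding integer_units_iff using m1 b(2) b'(2) by simp
  moreover have "cmod (\<sigma> (\<beta>' / \<beta>)) < 1" if s: "\<sigma> \<in> embeddings k - {\<sigma>0, cj \<sigma>0}" for \<sigma>
  proof -
    have se: "\<sigma> \<in> embeddings k" using s by simp
    show ?thesis using less[OF s] emb_pos[OF se OK_k[OF b(1)] b(2)]
      by (simp add: emb_divide[OF sub se OK_k[OF b'(1)] OK_k[OF b(1)]] norm_divide)
  qed
  ultimately show ?thesis by (intro bexI[of _ "\<beta>' / \<beta>"] ballI)
qed

end

lemma prod_powi_distrib:
  fixes f :: "'b \<Rightarrow> 'a::field"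
  shows "(\<Prod>i\<in>I. f i) powi n = (\<Prod>i\<in>I. f i powi n)"
  by (induction I rule: infinite_finite_induct) (simp_all add: power_int_mult_distrib)

lemma prod_powi_sum:
  fixes x :: "'a::field"
  assumes "x \<noteq> 0"
  shows "(\<Prod>i\<in>I. x powi f i) = x powi (\<Sum>i\<in>I. f i)"
  by (induction I rule: infinite_finite_induct) (use assms in \<open>simp_all add: power_int_add\<close>)

text \<open>The sign conditions amount to strict diagonal dominance. A kernel vector is contradicted
  in the row of its entry of largest modulus.\<close>

lemma diag_dominant_det:
  fixes A :: "nat \<Rightarrow> nat \<Rightarrow> real"
  assumes neg: "\<And>i j. i < n \<Longrightarrow> j < n \<Longrightarrow> i \<noteq> j \<Longrightarrow> A i j < 0"
    and pos: "\<And>i. i < n \<Longrightarrow> (\<Sum>j<n. A i j) > 0"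
  shows "det (mat n n (\<lambda>(i, j). A i j)) \<noteq> 0"
proof
  let ?A = "mat n n (\<lambda>(i, j). A i j)"
  assume "det ?A = 0"
  then obtain v where v: "v \<in> carrier_vec n" "v \<noteq> 0\<^sub>v n" "?A *\<^sub>v v = 0\<^sub>v n"
    using det_0_iff_vec_prod_zero[of ?A n] by auto
  have row: "(\<Sum>j<n. A i j * v $ j) = 0" if "i < n" for i
  proof -
    have "(?A *\<^sub>v v) $ i = 0" using v that by simp
    moreover have "(?A *\<^sub>v v) $ i = (\<Sum>j<n. A i j * v $ j)"
      using that v(1) by (auto simp: scalar_prod_def atLeast0LessThan intro!: sum.cong)
    ultimately show ?thesis by simp
  qed
  have "\<exists>i<n. v $ i \<noteq> 0"
  proof (rule ccontr)
    assume "\<not> ?thesis"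
    then have "v = 0\<^sub>v n" using v(1) by (intro eq_vecI) auto
    then show False using v(2) by simp
  qed
  then obtain i0 where i0: "i0 < n" "v $ i0 \<noteq> 0" by blast
  define m where "m = Max ((\<lambda>i. \<bar>v $ i\<bar>) ` {..<n})"
  have "m \<in> (\<lambda>i. \<bar>v $ i\<bar>) ` {..<n}" unfolding m_def by (rule Max_in) (use i0 in auto)
  then obtain i where i: "i < n" "m = \<bar>v $ i\<bar>" by auto
  have le: "\<bar>v $ j\<bar> \<le> m" if "j < n" for j unfolding m_def by (rule Max_ge) (use that in auto)
  have m0: "m > 0" using le[OF i0(1)] i0(2) by linarith
  have spl: "(\<Sum>j<n. f j) = f i + (\<Sum>j\<in>{..<n} - {i}. f j)" for f :: "nat \<Rightarrow> real"
    using i(1) by (simp add: sum.remove)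
  have "A i i * v $ i = - (\<Sum>j\<in>{..<n} - {i}. A i j * v $ j)" using row[OF i(1)] spl[of "\<lambda>j. A i j * v $ j"] by simp
  then have "\<bar>A i i * v $ i\<bar> \<le> (\<Sum>j\<in>{..<n} - {i}. \<bar>A i j * v $ j\<bar>)" by (simp add: sum_abs)
  also have "\<dots> \<le> (\<Sum>j\<in>{..<n} - {i}. - A i j * m)"
    unfolding abs_mult by (rule sum_mono, rule mult_mono) (use neg[OF i(1)] le in \<open>auto simp: abs_if intro: less_imp_le\<close>)
  also have "\<dots> = (\<Sum>j\<in>{..<n} - {i}. - A i j) * m" by (simp add: sum_distrib_right)
  also have "(\<Sum>j\<in>{..<n} - {i}. - A i j) = A i i - (\<Sum>j<n. A i j)" using spl[of "A i"] by (simp add: sum_negf)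
  finally have "\<bar>A i i\<bar> * m \<le> (A i i - (\<Sum>j<n. A i j)) * m" by (simp add: abs_mult i(2))
  then have "\<bar>A i i\<bar> \<le> A i i - (\<Sum>j<n. A i j)" using m0 by simp
  then show False using pos[OF i(1)] by linarith
qed

context nf
begin

text \<open>For each place there is a unit whose logarithms at all other places are negative. The
  first \<open>r\<close> of them have a nonsingular logarithm matrix, since the rows sum to minus
  the negative last entry. In coordinates relative to these units the logarithms of all units form a
  discrete lattice containing the standard basis, and a lattice basis lifts to fundamental units
  because the kernel is torsion.\<close>

lemma ex_fundamental_units:
  assumes ps: "place_representatives k ps"
  shows "\<exists>us. fundamental_units k us \<and> length us = length ps - 1 \<and>
    det (mat (length ps - 1) (length ps - 1) (\<lambda>(j, i). lv (ps ! i) (us ! j))) \<noteq> 0"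
proof -
  define r where "r = length ps - 1"
  have q: "length ps = Suc r" using length_places[OF ps] nplaces_pos by (simp add: r_def)
  have pe: "ps ! i \<in> embeddings k" if "i \<le> r" for i using ps_emb[OF ps] q that by simp
  have other: "ps ! l \<in> embeddings k - {ps ! i, cj (ps ! i)}" if "l \<le> r" "i \<le> r" "l \<noteq> i" for i l
  proof -
    have "ps ! l \<noteq> ps ! i" using ps_distinct[OF ps] q that by (simp add: nth_eq_iff_index_eq)
    moreover then have "ps ! l \<noteq> cj (ps ! i)" using ps_unique[OF ps, of "ps ! l" "ps ! i"] q that by auto
    ultimately show ?thesis using pe[OF that(1)] by simp
  qed
  have "\<forall>i. \<exists>u. i \<le> r \<longrightarrow> u \<in> integer_units k \<and> (\<forall>\<sigma>\<in>embeddings k - {ps ! i, cj (ps ! i)}. cmod (\<sigma> u) < 1)"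
    using ex_unit_small[OF pe] by blast
  then have "\<exists>v. \<forall>i. i \<le> r \<longrightarrow> v i \<in> integer_units k \<and> (\<forall>\<sigma>\<in>embeddings k - {ps ! i, cj (ps ! i)}. cmod (\<sigma> (v i)) < 1)"
    by (rule choice)
  then obtain v where v: "\<And>i. i \<le> r \<Longrightarrow> v i \<in> integer_units k"
    "\<And>i \<sigma>. i \<le> r \<Longrightarrow> \<sigma> \<in> embeddings k - {ps ! i, cj (ps ! i)} \<Longrightarrow> cmod (\<sigma> (v i)) < 1" by blast
  have neg: "lv (ps ! l) (v i) < 0" if "l \<le> r" "i \<le> r" "l \<noteq> i" for i l
  proof -
    have "cmod ((ps ! l) (v i)) > 0" by (rule emb_pos) (use pe v units_k units_nz that in auto)
    then have "ln (cmod ((ps ! l) (v i))) < 0" using v(2)[OF that(2) other[OF that]] by simp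
    then show ?thesis unfolding lv_def using local_degree_pos by (simp add: mult_pos_neg)
  qed
  define A where "A = (\<lambda>j i. lv (ps ! i) (v j))"
  have sum0: "(\<Sum>i<r. lv (ps ! i) u) = - lv (ps ! r) u" if "u \<in> integer_units k" for u
    using sum_lv_units_nth[OF ps that] by (simp add: q)
  have dA: "det (mat r r (\<lambda>(j, i). A j i)) \<noteq> 0"
  proof (rule diag_dominant_det)
    show "A i j < 0" if "i < r" "j < r" "i \<noteq> j" for i j using neg[of j i] that by (simp add: A_def)
    show "(\<Sum>j<r. A i j) > 0" if "i < r" for i
      using sum0[OF v(1), of i] neg[of r i] that by (simp add: A_def)
  qed
  define AM where "AM = mat r r (\<lambda>(j, i). A j i)"
  have AMc: "AM \<in> carrier_mat r r" by (simp add: AM_def)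
  from det_non_zero_imp_unit[OF AMc] dA obtain B where B: "B \<in> carrier_mat r r" "AM * B = 1\<^sub>m r" "B * AM = 1\<^sub>m r"
    by (auto simp: Units_def ring_mat_def AM_def)
  have AB: "(\<Sum>i<r. A j i * B $$ (i, l)) = (if j = l then 1 else 0)" if "j < r" "l < r" for j l
  proof -
    have "(AM * B) $$ (j, l) = (\<Sum>i<r. A j i * B $$ (i, l))"
      using that B(1) by (auto simp: AM_def scalar_prod_def atLeast0LessThan intro!: sum.cong)
    then show ?thesis using B(2) that by simp
  qed
  have BA: "(\<Sum>j<r. B $$ (i, j) * A j l) = (if i = l then 1 else 0)" if "i < r" "l < r" for i l
  proof -
    have "(B * AM) $$ (i, l) = (\<Sum>j<r. B $$ (i, j) * A j l)"
      using that B(1) by (auto simp: AM_def scalar_prod_def atLeast0LessThan intro!: sum.cong)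
    then show ?thesis using B(3) that by simp
  qed
  \<comment> \<open>Coordinates of the logarithm vector of \<open>u\<close> with respect to those of
    the units \<open>v j\<close>; \<open>rec\<close> inverts the change of coordinates.\<close>
  define crd where "crd = (\<lambda>u j. if j < r then (\<Sum>i<r. lv (ps ! i) u * B $$ (i, j)) else 0)"
  have rec: "lv (ps ! l) u = (\<Sum>j<r. crd u j * A j l)" if l: "l < r" for u l
  proof -
    have "(\<Sum>j<r. crd u j * A j l) = (\<Sum>j<r. \<Sum>i<r. lv (ps ! i) u * (B $$ (i, j) * A j l))"
      by (rule sum.cong) (simp_all add: crd_def sum_distrib_right mult.assoc)
    also have "\<dots> = (\<Sum>i<r. lv (ps ! i) u * (\<Sum>j<r. B $$ (i, j) * A j l))"
      by (subst sum.swap) (simp add: sum_distrib_left)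
    also have "\<dots> = (\<Sum>i<r. if i = l then lv (ps ! l) u else 0)" by (rule sum.cong) (auto simp: BA l)
    finally show ?thesis using l by simp
  qed
  define L where "L = crd ` integer_units k"
  have crd_lin: "crd (x / y) = (\<lambda>j. crd x j - crd y j)" if "x \<in> integer_units k" "y \<in> integer_units k" for x y
  proof
    fix j
    have "lv (ps ! i) (x / y) = lv (ps ! i) x - lv (ps ! i) y" if "i < r" for i
      by (rule lv_divide) (use pe that \<open>x \<in> integer_units k\<close> \<open>y \<in> integer_units k\<close> units_k units_nz in auto)
    then show "crd (x / y) j = crd x j - crd y j"
      by (simp add: crd_def left_diff_distrib sum_subtractf)
  qed
  have "\<exists>b. (\<forall>i<r. b i \<in> L) \<and>
    (\<forall>x\<in>L. \<exists>c :: nat \<Rightarrow> int. \<forall>j. x j = (\<Sum>i<r. of_int (c i) * b i j)) \<and>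
    (\<forall>c :: nat \<Rightarrow> int. (\<forall>j. (\<Sum>i<r. of_int (c i) * b i j) = 0) \<longrightarrow> (\<forall>i<r. c i = 0))"
  proof (rule lattice_basis)
    show "x i = 0" if "x \<in> L" "i \<ge> r" for x i using that by (auto simp: L_def crd_def)
    show "(\<lambda>i. x i - y i) \<in> L" if xy: "x \<in> L" "y \<in> L" for x y
    proof -
      obtain a b where ab: "a \<in> integer_units k" "b \<in> integer_units k" "x = crd a" "y = crd b"
        using xy by (auto simp: L_def)
      have "(\<lambda>i. x i - y i) = crd (a / b)" using crd_lin[OF ab(1,2)] ab by simp
      then show ?thesis using units_divide[OF ab(1,2)] by (auto simp: L_def)
    qed
    show "(\<lambda>j. if j = i then 1 else 0) \<in> L" if i: "i < r" for i
    proof -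
      have "crd (v i) = (\<lambda>j. if j = i then 1 else 0)"
      proof
        fix j
        have "(\<Sum>l<r. lv (ps ! l) (v i) * B $$ (l, j)) = (if i = j then 1 else 0)" if "j < r"
          using AB[OF i that] by (simp add: A_def)
        then show "crd (v i) j = (if j = i then 1 else 0)" using i by (auto simp: crd_def)
      qed
      then have "(\<lambda>j. if j = i then 1 else 0) = crd (v i)" by simp
      then show ?thesis using v(1)[of i] i unfolding L_def by (intro image_eqI[of _ _ "v i"]) auto
    qed
    show "L \<noteq> {}" using units_1 by (auto simp: L_def)
    \<comment> \<open>\<open>K\<close> bounds the logarithms at the first \<open>r\<close> places
      when the coordinates are in \<open>[0, 1]\<close>. The last logarithm is minus their sum, at
      most \<open>r * K\<close>; so units with such coordinates have bounded conjugates.\<close>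
    define K where "K = (\<Sum>j<r. \<Sum>l<r. \<bar>A j l\<bar>)"
    have K0: "K \<ge> 0" by (simp add: K_def sum_nonneg)
    have "{x \<in> L. \<forall>i<r. 0 \<le> x i \<and> x i \<le> 1} \<subseteq> crd ` {x \<in> OK. \<forall>\<sigma>\<in>embeddings k. cmod (\<sigma> x) \<le> exp (real r * K + K)}"
    proof
      fix x assume x: "x \<in> {x \<in> L. \<forall>i<r. 0 \<le> x i \<and> x i \<le> 1}"
      then obtain u where u: "u \<in> integer_units k" "x = crd u" by (auto simp: L_def)
      have b1: "\<bar>lv (ps ! l) u\<bar> \<le> K" if l: "l < r" for l
      proof -
        have "\<bar>lv (ps ! l) u\<bar> \<le> (\<Sum>j<r. \<bar>crd u j * A j l\<bar>)" unfolding rec[OF l] by (rule sum_abs)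
        also have "\<dots> \<le> (\<Sum>j<r. \<bar>A j l\<bar>)"
          unfolding abs_mult by (rule sum_mono, rule mult_left_le_one_le) (use x u in auto)
        also have "\<dots> \<le> K" unfolding K_def
          by (rule sum_mono, rule member_le_sum[of l "{..<r}" "\<lambda>l. \<bar>A _ l\<bar>"]) (use l in auto)
        finally show ?thesis .
      qed
      have b2: "lv (ps ! l) u \<le> real r * K + K" if "l \<le> r" for l
      proof (cases "l < r")
        case True
        then show ?thesis using b1[OF True] K0 mult_nonneg_nonneg[of "real r" K] by linarith
      next
        case False
        then have "l = r" using that by simp
        have "- (\<Sum>i<r. lv (ps ! i) u) \<le> (\<Sum>i<r. K)"
          unfolding sum_negf[symmetric] by (rule sum_mono) (use b1 in \<open>auto simp: abs_le_iff\<close>)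
        then show ?thesis using sum0[OF u(1)] \<open>l = r\<close> K0 by simp
      qed
      have "cmod (\<tau> u) \<le> exp (real r * K + K)" if t: "\<tau> \<in> embeddings k" for \<tau>
      proof -
        obtain \<sigma> where s: "\<sigma> \<in> set ps" "\<sigma> = \<tau> \<or> \<sigma> = cj \<tau>" using ps_ex[OF ps t] by blast
        obtain l where l: "l \<le> r" "\<sigma> = ps ! l" using s(1) q by (auto simp: in_set_conv_nth less_Suc_eq_le)
        have "lv \<tau> u = lv (ps ! l) u" using s(2) l(2) lv_cj[OF t units_k[OF u(1)]] by auto
        then have le: "lv \<tau> u \<le> real r * K + K" using b2[OF l(1)] by simp
        have cp: "cmod (\<tau> u) > 0" by (rule emb_pos[OF t units_k[OF u(1)] units_nz[OF u(1)]])
        have "ln (cmod (\<tau> u)) \<le> real r * K + K"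
        proof (cases "ln (cmod (\<tau> u)) \<le> 0")
          case True
          then show ?thesis using K0 mult_nonneg_nonneg[of "real r" K] by linarith
        next
          case False
          then have "ln (cmod (\<tau> u)) \<le> lv \<tau> u" unfolding lv_def
            using local_degree_pos[of \<tau>] by (simp add: mult_le_cancel_right1)
          then show ?thesis using le by simp
        qed
        then have "exp (ln (cmod (\<tau> u))) \<le> exp (real r * K + K)" by simp
        then show ?thesis unfolding exp_ln[OF cp] .
      qed
      then show "x \<in> crd ` {x \<in> OK. \<forall>\<sigma>\<in>embeddings k. cmod (\<sigma> x) \<le> exp (real r * K + K)}"
        using u units_OK[OF u(1)] by blast
    qed
    then show "finite {x \<in> L. \<forall>i<r. 0 \<le> x i \<and> x i \<le> 1}"
      using finite_bounded_integers finite_imageI finite_subset by blast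
  qed
  then obtain b where "(\<forall>i<r. b i \<in> L) \<and>
    (\<forall>x\<in>L. \<exists>c :: nat \<Rightarrow> int. \<forall>j. x j = (\<Sum>i<r. of_int (c i) * b i j)) \<and>
    (\<forall>c :: nat \<Rightarrow> int. (\<forall>j. (\<Sum>i<r. of_int (c i) * b i j) = 0) \<longrightarrow> (\<forall>i<r. c i = 0))" ..
  then have b: "\<And>i. i < r \<Longrightarrow> b i \<in> L"
    "\<And>x. x \<in> L \<Longrightarrow> \<exists>c :: nat \<Rightarrow> int. \<forall>j. x j = (\<Sum>i<r. of_int (c i) * b i j)"
    "\<And>c :: nat \<Rightarrow> int. \<forall>j. (\<Sum>i<r. of_int (c i) * b i j) = 0 \<Longrightarrow> (\<forall>i<r. c i = 0)" by simp_all
  have "\<forall>i. \<exists>w. i < r \<longrightarrow> w \<in> integer_units k \<and> b i = crd w" using b(1) by (auto simp: L_def)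
  then have "\<exists>w. \<forall>i. i < r \<longrightarrow> w i \<in> integer_units k \<and> b i = crd (w i)" by (rule choice)
  then obtain w where w: "\<And>i. i < r \<Longrightarrow> w i \<in> integer_units k" "\<And>i. i < r \<Longrightarrow> b i = crd (w i)" by blast
  define us where "us = map w [0..<r]"
  have lu: "length us = r" and un: "\<And>i. i < r \<Longrightarrow> us ! i = w i" by (auto simp: us_def)
  have su: "set us = w ` {..<r}" by (auto simp: us_def)
  have inj: "inj_on w {..<r}"
  proof (rule inj_onI, rule ccontr)
    fix i j assume ij: "i \<in> {..<r}" "j \<in> {..<r}" "w i = w j" "i \<noteq> j"
    define c where "c = (\<lambda>l. if l = i then 1 else if l = j then - 1 else 0 :: int)"
    have "(\<Sum>l<r. of_int (c l) * b l m) = 0" for m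
    proof -
      have "(\<Sum>l<r. of_int (c l) * b l m) = (\<Sum>l<r. (if l = i then b i m else 0) + (if l = j then - b j m else 0))"
        by (rule sum.cong) (use ij in \<open>auto simp: c_def\<close>)
      also have "\<dots> = b i m - b j m" using ij by (simp add: sum.distrib)
      also have "\<dots> = 0" using w(2) ij by simp
      finally show ?thesis .
    qed
    from b(3)[rule_format, OF this] have "c i = 0" using ij by simp
    then show False by (simp add: c_def)
  qed
  have reidx: "(\<Sum>x\<in>set us. f x) = (\<Sum>i<r. f (w i))" for f :: "'a \<Rightarrow> real"
    unfolding su by (rule sum.reindex_cong[OF inj]) auto
  have lvp: "lv (ps ! l) (\<Prod>x\<in>set us. x powi e x) = (\<Sum>i<r. of_int (e (w i)) * lv (ps ! l) (w i))" if "l \<le> r" for e l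
  proof -
    have "lv (ps ! l) (\<Prod>x\<in>set us. x powi e x) = (\<Sum>x\<in>set us. lv (ps ! l) (x powi e x))"
      by (rule lv_prod[OF pe[OF that]]) (use w(1) units_k units_nz in \<open>auto simp: su intro!: sf_powi[OF sub]\<close>)
    also have "\<dots> = (\<Sum>x\<in>set us. of_int (e x) * lv (ps ! l) x)"
      by (rule sum.cong) (use w(1) units_k units_nz in \<open>auto simp: su lv_powi[OF pe[OF that]]\<close>)
    finally show ?thesis by (simp add: reidx)
  qed
  have lsum: "crd x j = (\<Sum>i<r. of_int (c i) * crd (w i) j)"
    if "\<And>l. l < r \<Longrightarrow> lv (ps ! l) x = (\<Sum>i<r. of_int (c i) * lv (ps ! l) (w i))" for x j and c :: "nat \<Rightarrow> int"
  proof (cases "j < r")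
    case True
    have "crd x j = (\<Sum>l<r. \<Sum>i<r. of_int (c i) * (lv (ps ! l) (w i) * B $$ (l, j)))"
      using True by (simp add: crd_def that sum_distrib_right mult.assoc)
    also have "\<dots> = (\<Sum>i<r. of_int (c i) * crd (w i) j)"
      using True by (subst sum.swap) (simp add: crd_def sum_distrib_left)
    finally show ?thesis .
  qed (simp add: crd_def)
  have "fundamental_units k us" unfolding fundamental_units_def
  proof (intro conjI ballI)
    show "distinct us" unfolding us_def using inj by (simp add: distinct_map atLeast0LessThan)
    show "set us \<subseteq> integer_units k" using w(1) by (auto simp: su)
    show "mult_independent (set us)" unfolding mult_independent_def
    proof (intro allI impI ballI)
      fix e :: "'a \<Rightarrow> int" and x assume e: "(\<Prod>u\<in>set us. u powi e u) = 1" and x: "x \<in> set us"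
      have "(\<Sum>i<r. of_int (e (w i)) * lv (ps ! l) (w i)) = 0" if "l < r" for l
        using lvp[of l e] e lv_1[OF pe, of l] that by simp
      then have "crd 1 j = (\<Sum>i<r. of_int (e (w i)) * crd (w i) j)" for j
        by (intro lsum[of 1 "\<lambda>i. e (w i)"]) (simp add: lv_1[OF pe])
      moreover have "crd 1 j = 0" for j by (simp add: crd_def lv_1[OF pe])
      ultimately have "\<forall>j. (\<Sum>i<r. of_int (e (w i)) * b i j) = 0" using w(2) by simp
      from b(3)[OF this] show "e x = 0" using x by (auto simp: su)
    qed
    fix u assume u: "u \<in> integer_units k"
    then have "crd u \<in> L" by (simp add: L_def)
    from b(2)[OF this] obtain c :: "nat \<Rightarrow> int" where c: "\<forall>j. crd u j = (\<Sum>i<r. of_int (c i) * b i j)" by blast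
    define e where "e = (\<lambda>x. c (the_inv_into {..<r} w x))"
    have ew: "e (w i) = c i" if "i < r" for i using that inj by (simp add: e_def the_inv_into_f_f)
    define y where "y = (\<Prod>x\<in>set us. x powi e x)"
    have yU: "y \<in> integer_units k" unfolding y_def
      by (rule units_prod, rule units_powi) (use w(1) in \<open>auto simp: su\<close>)
    have z0: "lv (ps ! l) (u / y) = 0" if l: "l < r" for l
    proof -
      have "lv (ps ! l) u = (\<Sum>j<r. (\<Sum>i<r. of_int (c i) * crd (w i) j) * A j l)"
        unfolding rec[OF l, of u] by (rule sum.cong) (simp_all add: c w(2))
      also have "\<dots> = (\<Sum>i<r. of_int (c i) * (\<Sum>j<r. crd (w i) j * A j l))"
        unfolding sum_distrib_left sum_distrib_right by (subst sum.swap) (simp add: mult.assoc)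
      also have "\<dots> = (\<Sum>i<r. of_int (c i) * lv (ps ! l) (w i))" by (simp add: rec[OF l])
      also have "\<dots> = lv (ps ! l) y" using lvp[of l e] l by (simp add: y_def ew)
      finally show ?thesis
        using lv_divide[OF pe, of l u y] l units_k[OF u] units_nz[OF u] units_k[OF yU] units_nz[OF yU] by simp
    qed
    have "\<exists>n>0. (u / y) ^ n = 1"
    proof (rule lv_zero_torsion[OF ps units_divide[OF u yU]])
      fix \<sigma> assume "\<sigma> \<in> set ps"
      then obtain l where l: "l \<le> r" "\<sigma> = ps ! l" using q by (auto simp: in_set_conv_nth less_Suc_eq_le)
      show "lv \<sigma> (u / y) = 0"
      proof (cases "l < r")
        case True
        then show ?thesis using z0 l by simp
      next
        case False
        then have "l = r" using l by simp
        then show ?thesis using sum0[OF units_divide[OF u yU]] z0 l by simp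
      qed
    qed
    moreover have "u = (u / y) * y" using units_nz[OF yU] by simp
    ultimately show "\<exists>z e. (\<exists>n>0. z ^ n = 1) \<and> u = z * (\<Prod>x\<in>set us. x powi e x)"
      unfolding y_def by blast
  qed
  \<comment> \<open>The units \<open>v j\<close> are, up to torsion, integer monomials in the
    fundamental units, so the nonsingular matrix \<open>AM\<close> factors through the matrix in
    question.\<close>
  moreover have "det (mat r r (\<lambda>(j, i). lv (ps ! i) (us ! j))) \<noteq> 0"
  proof
    let ?Z = "mat r r (\<lambda>(j, i). lv (ps ! i) (us ! j))"
    assume d0: "det ?Z = 0"
    have "\<forall>j. \<exists>c :: nat \<Rightarrow> int. j < r \<longrightarrow> (\<forall>l. crd (v j) l = (\<Sum>i<r. of_int (c i) * b i l))"
      using b(2) v(1) by (auto simp: L_def)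
    then have "\<exists>T. \<forall>j. j < r \<longrightarrow> (\<forall>l. crd (v j) l = (\<Sum>i<r. of_int (T j i :: int) * b i l))" by (rule choice)
    then obtain T :: "nat \<Rightarrow> nat \<Rightarrow> int" where T: "\<And>j l. j < r \<Longrightarrow> crd (v j) l = (\<Sum>i<r. of_int (T j i) * b i l)" by blast
    have "AM = mat r r (\<lambda>(j, i). real_of_int (T j i)) * ?Z"
    proof (rule eq_matI)
      fix j l assume "j < dim_row (mat r r (\<lambda>(j, i). real_of_int (T j i)) * ?Z)" "l < dim_col (mat r r (\<lambda>(j, i). real_of_int (T j i)) * ?Z)"
      then have jl: "j < r" "l < r" by auto
      have "A j l = (\<Sum>m<r. (\<Sum>i<r. of_int (T j i) * crd (w i) m) * A m l)"
        using rec[OF jl(2), of "v j"] jl by (simp add: T w(2) A_def)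
      also have "\<dots> = (\<Sum>i<r. of_int (T j i) * (\<Sum>m<r. crd (w i) m * A m l))"
        unfolding sum_distrib_left sum_distrib_right by (subst sum.swap) (simp add: mult.assoc)
      also have "\<dots> = (\<Sum>i<r. of_int (T j i) * lv (ps ! l) (us ! i))" by (simp add: rec[OF jl(2)] un)
      finally show "AM $$ (j, l) = (mat r r (\<lambda>(j, i). real_of_int (T j i)) * ?Z) $$ (j, l)"
        using jl by (simp add: AM_def scalar_prod_def atLeast0LessThan)
    qed (auto simp: AM_def)
    then have "det AM = 0" using det_mult[of "mat r r (\<lambda>(j, i). real_of_int (T j i))" r ?Z] d0 by simp
    then show False using dA by (simp add: AM_def)
  qed
  ultimately show ?thesis using lu by (intro exI[of _ us]) (simp add: r_def)
qed

text \<open>Moves the exponents from elements to list positions; the root of unity drops out of the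
  logarithms.\<close>

lemma fundamental_units_lv:
  assumes fu: "fundamental_units k us" and u: "u \<in> integer_units k"
  shows "\<exists>c :: nat \<Rightarrow> int. \<exists>z n. n > 0 \<and> z ^ n = 1 \<and> u = z * (\<Prod>l<length us. (us ! l) powi c l) \<and>
    (\<forall>\<sigma>\<in>embeddings k. lv \<sigma> u = (\<Sum>l<length us. of_int (c l) * lv \<sigma> (us ! l)))"
proof -
  have us: "distinct us" "set us \<subseteq> integer_units k" using fu by (auto simp: fundamental_units_def)
  obtain z e n where ze: "n > 0" "z ^ n = 1" "u = z * (\<Prod>x\<in>set us. x powi e x)"
    using fu u unfolding fundamental_units_def by blast
  have bij: "bij_betw (\<lambda>i. us ! i) {..<length us} (set us)" by (rule bij_betw_nth[OF us(1) refl refl])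
  have pr: "(\<Prod>x\<in>set us. x powi e x) = (\<Prod>l<length us. (us ! l) powi e (us ! l))"
    by (rule prod.reindex_bij_betw[OF bij, symmetric])
  have nU: "us ! l \<in> integer_units k" if "l < length us" for l using us that by auto
  let ?y = "\<Prod>l<length us. (us ! l) powi e (us ! l)"
  have yU: "?y \<in> integer_units k" by (rule units_prod, rule units_powi, rule nU) simp
  have z: "z = u / ?y" using ze(3) pr units_nz[OF yU] by simp
  have zk: "z \<in> k" unfolding z by (rule sf_divide[OF sub units_k[OF u] units_k[OF yU]])
  have z0: "z \<noteq> 0" unfolding z using units_nz[OF u] units_nz[OF yU] by simp
  have "lv \<sigma> u = (\<Sum>l<length us. of_int (e (us ! l)) * lv \<sigma> (us ! l))" if s: "\<sigma> \<in> embeddings k" for \<sigma>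
  proof -
    have "lv \<sigma> u = lv \<sigma> z + lv \<sigma> ?y" unfolding ze(3) pr by (rule lv_mult[OF s zk units_k[OF yU] z0 units_nz[OF yU]])
    also have "lv \<sigma> z = 0" by (rule lv_torsion[OF s zk ze(2,1)])
    also have "lv \<sigma> ?y = (\<Sum>l<length us. lv \<sigma> ((us ! l) powi e (us ! l)))"
      by (rule lv_prod[OF s]) (use nU units_k units_nz in \<open>auto intro!: sf_powi[OF sub]\<close>)
    also have "\<dots> = (\<Sum>l<length us. of_int (e (us ! l)) * lv \<sigma> (us ! l))"
      by (rule sum.cong) (use nU units_k units_nz in \<open>auto simp: lv_powi[OF s]\<close>)
    finally show ?thesis by simp
  qed
  then show ?thesis using ze pr by (intro exI[of _ "\<lambda>l. e (us ! l)"] exI[of _ z] exI[of _ n]) auto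
qed

text \<open>With more elements than fundamental units, their exponent vectors are dependent over the
  integers. The corresponding product is torsion, and a suitable power of it is a relation in
  \<open>S\<close>.\<close>

lemma card_mult_independent_le:
  assumes fu: "fundamental_units k us" and S: "finite S" "S \<subseteq> integer_units k" "mult_independent S"
  shows "card S \<le> length us"
proof (rule ccontr)
  assume lt: "\<not> card S \<le> length us"
  define m where "m = card S"
  obtain ss where ss: "set ss = S" "distinct ss" using finite_distinct_list[OF S(1)] by blast
  have ls: "length ss = m" using ss distinct_card[of ss] by (simp add: m_def)
  have sU: "ss ! i \<in> integer_units k" if "i < m" for i using ss S(2) ls that nth_mem[of i ss] by auto
  have "\<forall>i. \<exists>c :: nat \<Rightarrow> int. i < m \<longrightarrow> (\<exists>z n. n > 0 \<and> z ^ n = 1 \<and> ss ! i = z * (\<Prod>l<length us. (us ! l) powi c l))"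
    using fundamental_units_lv[OF fu sU] by blast
  then have "\<exists>C. \<forall>i. i < m \<longrightarrow> (\<exists>z n. n > 0 \<and> z ^ n = 1 \<and> ss ! i = z * (\<Prod>l<length us. (us ! l) powi (C i l :: int)))"
    by (rule choice)
  then obtain C :: "nat \<Rightarrow> nat \<Rightarrow> int" where C: "\<forall>i. \<exists>z n. i < m \<longrightarrow> n > 0 \<and> z ^ n = 1 \<and> ss ! i = z * (\<Prod>l<length us. (us ! l) powi C i l)"
    by blast
  from choice[OF this] obtain Z where "\<forall>i. \<exists>n. i < m \<longrightarrow> n > 0 \<and> Z i ^ n = 1 \<and> ss ! i = Z i * (\<Prod>l<length us. (us ! l) powi C i l)"
    by blast
  from choice[OF this] obtain N where ZN: "\<And>i. i < m \<Longrightarrow> N i > (0 :: nat)" "\<And>i. i < m \<Longrightarrow> Z i ^ N i = 1"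
    "\<And>i. i < m \<Longrightarrow> ss ! i = Z i * (\<Prod>l<length us. (us ! l) powi C i l)" by blast
  have Z0: "Z i \<noteq> 0" if "i < m" for i using ZN(1,2)[OF that] by (auto simp: power_0_left)
  obtain c :: "nat \<Rightarrow> int" where c: "\<exists>i<m. c i \<noteq> 0" "\<forall>j<length us. (\<Sum>i<m. c i * C i j) = 0"
    using int_vectors_dependent[of "length us" m C] lt by (auto simp: m_def)
  have un: "us ! l \<noteq> 0" if "l < length us" for l
    using fu that units_nz by (auto simp: fundamental_units_def subset_iff)
  \<comment> \<open>A common exponent killing all the torsion factors \<open>Z i\<close>.\<close>
  define NN where "NN = (\<Prod>i<m. N i)"
  have NN: "NN > 0" using ZN(1) by (auto simp: NN_def intro: prod_pos)
  have ZNN: "Z i ^ NN = 1" if "i < m" for i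
  proof -
    have "N i dvd NN" unfolding NN_def by (rule dvd_prodI) (use that in auto)
    then obtain t where "NN = N i * t" by (elim dvdE)
    then show ?thesis using ZN(2)[OF that] by (simp add: power_mult)
  qed
  have "(\<Prod>i<m. (ss ! i) powi c i) = (\<Prod>i<m. Z i powi c i) * (\<Prod>i<m. \<Prod>l<length us. (us ! l) powi (c i * C i l))"
  proof -
    have "(\<Prod>i<m. (ss ! i) powi c i) = (\<Prod>i<m. Z i powi c i * (\<Prod>l<length us. (us ! l) powi (c i * C i l)))"
    proof (rule prod.cong)
      fix i assume "i \<in> {..<m}"
      then have i: "i < m" by simp
      have "(\<Prod>l<length us. (us ! l) powi C i l) powi c i = (\<Prod>l<length us. (us ! l) powi (c i * C i l))"
        unfolding prod_powi_distrib by (rule prod.cong[OF refl]) (simp only: power_int_mult[symmetric] mult.commute)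
      then show "(ss ! i) powi c i = Z i powi c i * (\<Prod>l<length us. (us ! l) powi (c i * C i l))"
        by (subst ZN(3)[OF i]) (simp add: power_int_mult_distrib)
    qed simp
    then show ?thesis by (simp add: prod.distrib)
  qed
  also have "(\<Prod>i<m. \<Prod>l<length us. (us ! l) powi (c i * C i l)) = (\<Prod>l<length us. \<Prod>i<m. (us ! l) powi (c i * C i l))"
    by (rule prod.swap)
  also have "\<dots> = (\<Prod>l<length us. (us ! l) powi (\<Sum>i<m. c i * C i l))"
    by (rule prod.cong) (use un in \<open>auto simp: prod_powi_sum\<close>)
  also have "\<dots> = 1" using c(2) by simp
  finally have e1: "(\<Prod>i<m. (ss ! i) powi c i) = (\<Prod>i<m. Z i powi c i)" by simp
  have "(\<Prod>i<m. (ss ! i) powi (int NN * c i)) = (\<Prod>i<m. ((ss ! i) powi c i) powi int NN)"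
    by (rule prod.cong[OF refl]) (simp only: power_int_mult[symmetric] mult.commute)
  also have "\<dots> = (\<Prod>i<m. (ss ! i) powi c i) powi int NN" by (rule prod_powi_distrib[symmetric])
  also have "\<dots> = (\<Prod>i<m. (Z i powi c i) powi int NN)" unfolding e1 by (rule prod_powi_distrib)
  also have "\<dots> = (\<Prod>i<m. (Z i powi int NN) powi c i)"
    by (rule prod.cong[OF refl]) (simp only: power_int_mult[symmetric] mult.commute)
  also have "\<dots> = 1" by (rule prod.neutral) (auto simp: ZNN)
  finally have e2: "(\<Prod>i<m. (ss ! i) powi (int NN * c i)) = 1" .
  have bij: "bij_betw (\<lambda>i. ss ! i) {..<m} S" using bij_betw_nth[OF ss(2)] ss(1) ls by blast
  define e where "e = (\<lambda>x. int NN * c (the_inv_into {..<m} (\<lambda>i. ss ! i) x))"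
  have es': "e (ss ! i) = int NN * c i" if "i < m" for i
    using that bij unfolding e_def bij_betw_def by (simp add: the_inv_into_f_f)
  have "(\<Prod>x\<in>S. x powi e x) = (\<Prod>i<m. (ss ! i) powi e (ss ! i))"
    by (rule prod.reindex_bij_betw[OF bij, symmetric])
  also have "\<dots> = 1" unfolding e2[symmetric] by (rule prod.cong) (auto simp: es')
  finally have "\<forall>x\<in>S. e x = 0" using S(3) unfolding mult_independent_def by blast
  then have "c i = 0" if "i < m" for i using es'[OF that] ss(1) ls that NN nth_mem[of i ss] by auto
  then show False using c(1) by blast
qed

text \<open>A system of \<open>nplaces - 1\<close> fundamental units exists, and any two systems
  bound each other's length because each is an independent set.\<close>

lemma fundamental_units_length: "fundamental_units k us \<Longrightarrow> length us = nplaces - 1"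
  and unit_rank_eq: "unit_rank k = nplaces - 1"
proof -
  obtain ps where ps: "place_representatives k ps" using ex_place_reps by blast
  obtain vs where vs: "fundamental_units k vs" "length vs = nplaces - 1"
    using ex_fundamental_units[OF ps] length_places[OF ps] by auto
  have own: "finite (set ws) \<and> set ws \<subseteq> integer_units k \<and> mult_independent (set ws) \<and> card (set ws) = length ws"
    if "fundamental_units k ws" for ws
    using that distinct_card[of ws] by (auto simp: fundamental_units_def)
  show "length us = nplaces - 1" if us: "fundamental_units k us" for us
  proof (rule antisym)
    show "length us \<le> nplaces - 1" using card_mult_independent_le[OF vs(1), of "set us"] own[OF us] vs(2) by simp
    show "nplaces - 1 \<le> length us" using card_mult_independent_le[OF us, of "set vs"] own[OF vs(1)] vs(2) by simp
  qed
  show "unit_rank k = nplaces - 1" unfolding unit_rank_def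
  proof (rule Max_eqI)
    show le: "n \<le> nplaces - 1" if "n \<in> {card S |S. finite S \<and> S \<subseteq> integer_units k \<and> mult_independent S}" for n
      using that card_mult_independent_le[OF vs(1)] vs(2) by auto
    show "finite {card S |S. finite S \<and> S \<subseteq> integer_units k \<and> mult_independent S}"
      by (rule finite_subset[OF _ finite_atMost[of "nplaces - 1"]], rule subsetI, simp only: atMost_iff, rule le)
    show "nplaces - 1 \<in> {card S |S. finite S \<and> S \<subseteq> integer_units k \<and> mult_independent S}"
      using own[OF vs(1)] vs(2) by (intro CollectI exI[of _ "set vs"]) simp
  qed
qed

definition reg_mat :: "('a \<Rightarrow> complex) list \<Rightarrow> 'a list \<Rightarrow> real mat" where
  "reg_mat ps us = mat (nplaces - 1) (nplaces - 1) (\<lambda>(j, i). lv (ps ! i) (us ! j))"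

text \<open>Changing the fundamental units acts on the rows, and changing or reordering the places
  acts on the columns, each time by integer matrices in both directions; so the absolute determinant
  is unchanged.\<close>

lemma regulator_eq:
  assumes us: "fundamental_units k us" and ps: "place_representatives k ps"
  shows "regulator k = \<bar>det (reg_mat ps us)\<bar>"
proof -
  define r where "r = nplaces - 1"
  have inv: "\<bar>det (reg_mat ps' us')\<bar> = \<bar>det (reg_mat ps us)\<bar>"
    if us': "fundamental_units k us'" and ps': "place_representatives k ps'" for us' ps'
  proof -
    have uU: "vs ! j \<in> integer_units k" if "fundamental_units k vs" "j < r" for vs j
      using that fundamental_units_length[OF that(1)] nth_mem[of j vs] by (auto simp: fundamental_units_def r_def)
    have ex: "\<exists>T :: nat \<Rightarrow> nat \<Rightarrow> int. \<forall>j<r. \<forall>\<sigma>\<in>embeddings k. lv \<sigma> (vs ! j) = (\<Sum>l<r. of_int (T j l) * lv \<sigma> (ws ! l))"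
      if vs: "fundamental_units k vs" and ws: "fundamental_units k ws" for vs ws
    proof -
      have "\<forall>j. \<exists>c :: nat \<Rightarrow> int. j < r \<longrightarrow> (\<forall>\<sigma>\<in>embeddings k. lv \<sigma> (vs ! j) = (\<Sum>l<r. of_int (c l) * lv \<sigma> (ws ! l)))"
      proof
        fix j
        show "\<exists>c :: nat \<Rightarrow> int. j < r \<longrightarrow> (\<forall>\<sigma>\<in>embeddings k. lv \<sigma> (vs ! j) = (\<Sum>l<r. of_int (c l) * lv \<sigma> (ws ! l)))"
        proof (cases "j < r")
          case True
          obtain c :: "nat \<Rightarrow> int" where "\<forall>\<sigma>\<in>embeddings k. lv \<sigma> (vs ! j) = (\<Sum>l<length ws. of_int (c l) * lv \<sigma> (ws ! l))"
            using fundamental_units_lv[OF ws uU[OF vs True]] by (elim exE conjE)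
          then show ?thesis using fundamental_units_length[OF ws] by (intro exI[of _ c]) (simp add: r_def)
        qed simp
      qed
      from choice[OF this] show ?thesis by blast
    qed
    have pE: "qs ! i \<in> embeddings k" if "place_representatives k qs" "i \<le> r" for qs i
      using ps_emb[OF that(1)] length_places[OF that(1)] nplaces_pos that(2) by (auto simp: r_def)
    obtain T T' :: "nat \<Rightarrow> nat \<Rightarrow> int" where
      T: "\<forall>j<r. \<forall>\<sigma>\<in>embeddings k. lv \<sigma> (us' ! j) = (\<Sum>l<r. of_int (T j l) * lv \<sigma> (us ! l))" and
      T': "\<forall>j<r. \<forall>\<sigma>\<in>embeddings k. lv \<sigma> (us ! j) = (\<Sum>l<r. of_int (T' j l) * lv \<sigma> (us' ! l))"
      using ex[OF us' us] ex[OF us us'] by blast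
    have c1: "det (mat r r (\<lambda>(j, i). lv (ps ! i) (us' ! j))) = det (mat r r (\<lambda>(j, i). lv (ps ! i) (us ! j))) \<or>
      det (mat r r (\<lambda>(j, i). lv (ps ! i) (us' ! j))) = - det (mat r r (\<lambda>(j, i). lv (ps ! i) (us ! j)))"
      by (rule det_int_change_rows[where T = T and T' = T'])
        (use T T' pE[OF ps] in \<open>simp_all only: less_imp_le simp_thms\<close>)
    have exq: "\<exists>T :: nat \<Rightarrow> nat \<Rightarrow> int. \<forall>i<r. \<forall>u\<in>integer_units k. lv (qs ! i) u = (\<Sum>l<r. of_int (T i l) * lv (rs ! l) u)"
      if qs: "place_representatives k qs" and rs: "place_representatives k rs" for qs rs
    proof -
      have lr: "length rs = Suc r" using length_places[OF rs] nplaces_pos by (simp add: r_def)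
      have "\<exists>c :: nat \<Rightarrow> int. i < r \<longrightarrow> (\<forall>u\<in>integer_units k. lv (qs ! i) u = (\<Sum>l<r. of_int (c l) * lv (rs ! l) u))" for i
      proof (cases "i < r")
        case True
        then have qe: "qs ! i \<in> embeddings k" using pE[OF qs] by simp
        obtain \<rho> where \<rho>: "\<rho> \<in> set rs" "\<rho> = qs ! i \<or> \<rho> = cj (qs ! i)" using ps_ex[OF rs qe] by blast
        obtain m where m: "m \<le> r" "\<rho> = rs ! m" using \<rho>(1) lr by (auto simp: in_set_conv_nth less_Suc_eq_le)
        have eq: "lv (qs ! i) u = lv (rs ! m) u" if "u \<in> integer_units k" for u
          using \<rho>(2) m(2) lv_cj[OF qe units_k[OF that]] by auto
        show ?thesis
        proof (cases "m < r")
          case m': True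
          have *: "(\<Sum>l<r. of_int (if l = m then 1 else 0) * lv (rs ! l) u) = lv (rs ! m) u" for u
          proof -
            have "(\<Sum>l<r. of_int (if l = m then 1 else 0) * lv (rs ! l) u) = (\<Sum>l<r. if l = m then lv (rs ! l) u else 0)"
              by (rule sum.cong) auto
            then show ?thesis using m' by simp
          qed
          show ?thesis by (intro exI[of _ "\<lambda>l. if l = m then 1 else 0"] impI ballI) (simp only: eq *)
        next
          case False
          then have "m = r" using m by simp
          \<comment> \<open>The omitted place contributes a column too: its logarithm is minus the
            sum of all the others.\<close>
          have "lv (rs ! r) u = (\<Sum>l<r. of_int (- 1) * lv (rs ! l) u)" if "u \<in> integer_units k" for u
            using sum_lv_units_nth[OF rs that] by (simp add: lr sum_negf)
          then show ?thesis using eq \<open>m = r\<close> by (intro exI[of _ "\<lambda>l. - 1"]) simp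
        qed
      qed simp
      then have "\<forall>i. \<exists>c :: nat \<Rightarrow> int. i < r \<longrightarrow> (\<forall>u\<in>integer_units k. lv (qs ! i) u = (\<Sum>l<r. of_int (c l) * lv (rs ! l) u))"
        by blast
      from choice[OF this] show ?thesis by blast
    qed
    obtain U U' :: "nat \<Rightarrow> nat \<Rightarrow> int" where
      U: "\<forall>i<r. \<forall>u\<in>integer_units k. lv (ps' ! i) u = (\<Sum>l<r. of_int (U i l) * lv (ps ! l) u)" and
      U': "\<forall>i<r. \<forall>u\<in>integer_units k. lv (ps ! i) u = (\<Sum>l<r. of_int (U' i l) * lv (ps' ! l) u)"
      using exq[OF ps' ps] exq[OF ps ps'] by blast
    have c2: "det (mat r r (\<lambda>(j, i). lv (ps' ! i) (us' ! j))) = det (mat r r (\<lambda>(j, i). lv (ps ! i) (us' ! j))) \<or>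
      det (mat r r (\<lambda>(j, i). lv (ps' ! i) (us' ! j))) = - det (mat r r (\<lambda>(j, i). lv (ps ! i) (us' ! j)))"
      by (rule det_int_change_cols[where T = U and T' = U'])
        (use U U' uU[OF us'] in \<open>simp_all only: less_imp_le simp_thms\<close>)
    show ?thesis unfolding reg_mat_def r_def[symmetric] using c1 c2 by auto
  qed
  have form: "mat (length us') (length ps' - 1) (\<lambda>(j, i). real (local_degree k (ps' ! i)) * ln (cmod ((ps' ! i) (us' ! j)))) = reg_mat ps' us'"
    if "fundamental_units k us'" "place_representatives k ps'" for us' ps'
    using fundamental_units_length[OF that(1)] length_places[OF that(2)] by (simp add: reg_mat_def lv_def)
  show ?thesis unfolding regulator_def
  proof (rule the_equality)
    show "\<exists>us' ps'. fundamental_units k us' \<and> place_representatives k ps' \<and> \<bar>det (reg_mat ps us)\<bar> =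
      \<bar>det (mat (length us') (length ps' - 1) (\<lambda>(j, i). real (local_degree k (ps' ! i)) * ln (cmod ((ps' ! i) (us' ! j)))))\<bar>"
      using us ps form[OF us ps] by (intro exI[of _ us] exI[of _ ps]) simp
  next
    fix R assume "\<exists>us' ps'. fundamental_units k us' \<and> place_representatives k ps' \<and> R =
      \<bar>det (mat (length us') (length ps' - 1) (\<lambda>(j, i). real (local_degree k (ps' ! i)) * ln (cmod ((ps' ! i) (us' ! j)))))\<bar>"
    then obtain us' ps' where *: "fundamental_units k us'" "place_representatives k ps'"
      "R = \<bar>det (mat (length us') (length ps' - 1) (\<lambda>(j, i). real (local_degree k (ps' ! i)) * ln (cmod ((ps' ! i) (us' ! j)))))\<bar>"
      by blast
    show "R = \<bar>det (reg_mat ps us)\<bar>" unfolding *(3) form[OF *(1,2)] by (rule inv[OF *(1,2)])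
  qed
qed

lemma ex_fundamental_units_reg:
  assumes ps: "place_representatives k ps"
  shows "\<exists>us. fundamental_units k us \<and> det (reg_mat ps us) \<noteq> 0"
  using ex_fundamental_units[OF ps] length_places[OF ps] by (auto simp: reg_mat_def)

end

section \<open>Packing and covolume\<close>

text \<open>Determinant of a matrix given as a function, of which only the entries with both indices
  below \<open>r\<close> count. Elementary operations and linear maps then act on plain
  functions.\<close>

definition mdet :: "nat \<Rightarrow> (nat \<Rightarrow> nat \<Rightarrow> real) \<Rightarrow> real" where
  "mdet r A = det (mat r r (\<lambda>(i, j). A i j))"

definition shear :: "(nat \<Rightarrow> nat \<Rightarrow> real) \<Rightarrow> nat \<Rightarrow> nat \<Rightarrow> real \<Rightarrow> nat \<Rightarrow> nat \<Rightarrow> real" where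
  "shear A j p c = (\<lambda>i q. if q = j then A i j + c * A i p else A i q)"

definition scale_col :: "(nat \<Rightarrow> nat \<Rightarrow> real) \<Rightarrow> nat \<Rightarrow> real \<Rightarrow> nat \<Rightarrow> nat \<Rightarrow> real" where
  "scale_col A p c = (\<lambda>i q. if q = p then c * A i p else A i q)"

lemma mdet_transpose: "mdet r A = mdet r (\<lambda>i j. A j i)"
proof -
  have "transpose_mat (mat r r (\<lambda>(i, j). A i j)) = mat r r (\<lambda>(i, j). A j i)" by (rule eq_matI) auto
  then show ?thesis unfolding mdet_def using det_transpose[of "mat r r (\<lambda>(i, j). A i j)" r] by simp
qed

lemma mdet_shear:
  assumes "j < r" "p < r" "j \<noteq> p"
  shows "mdet r (shear A j p c) = mdet r A"
proof -
  let ?B = "mat r r (\<lambda>(i, j). A j i)"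
  have "mat r r (\<lambda>(i, q). shear A j p c q i) = addrow c j p ?B"
    by (rule eq_matI) (use assms in \<open>auto simp: shear_def\<close>)
  then have "mdet r (shear A j p c) = det (addrow c j p ?B)"
    by (subst mdet_transpose) (simp add: mdet_def)
  also have "\<dots> = det ?B" by (rule det_addrow[of _ r]) (use assms in auto)
  finally show ?thesis by (subst (2) mdet_transpose) (simp add: mdet_def)
qed

lemma mdet_scale_col:
  assumes "p < r"
  shows "mdet r (scale_col A p c) = c * mdet r A"
proof -
  let ?B = "mat r r (\<lambda>(i, j). A j i)"
  have "mat r r (\<lambda>(i, q). scale_col A p c q i) = multrow p c ?B"
    by (rule eq_matI) (use assms in \<open>auto simp: scale_col_def\<close>)
  then have "mdet r (scale_col A p c) = det (multrow p c ?B)"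
    by (subst mdet_transpose) (simp add: mdet_def)
  also have "\<dots> = c * det ?B" by (rule det_multrow[of _ r]) (use assms in auto)
  finally show ?thesis by (subst (2) mdet_transpose) (simp add: mdet_def)
qed

text \<open>Gaussian elimination by column operations: row \<open>p\<close> is cleared after the rows above it are unit
  vectors.\<close>

lemma matrix_elimination_induct:
  assumes id: "\<And>A. (\<And>i j. i < r \<Longrightarrow> j < r \<Longrightarrow> A i j = (if i = j then 1 else 0)) \<Longrightarrow> S A"
    and sh: "\<And>A j p c. j < r \<Longrightarrow> p < r \<Longrightarrow> j \<noteq> p \<Longrightarrow> mdet r A \<noteq> 0 \<Longrightarrow> S (shear A j p c) \<Longrightarrow> S A"
    and sc: "\<And>A p c. p < r \<Longrightarrow> c \<noteq> 0 \<Longrightarrow> mdet r A \<noteq> 0 \<Longrightarrow> S (scale_col A p c) \<Longrightarrow> S A"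
    and A: "mdet r A \<noteq> 0"
  shows "S A"
proof -
  have main: "S A" if "mdet r A \<noteq> 0" "\<And>i j. i < r - n \<Longrightarrow> j < r \<Longrightarrow> A i j = (if i = j then 1 else 0)" for n A
    using that
  proof (induction n arbitrary: A)
    case 0
    then show ?case using id by simp
  next
    case (Suc n)
    show ?case
    proof (cases "n < r")
      case False
      then show ?thesis using Suc by auto
    next
      case True
      define p where "p = r - Suc n"
      have p: "p < r" "r - n = Suc p" using True by (auto simp: p_def)
      have rows: "A i j = (if i = j then 1 else 0)" if "i < p" "j < r" for i j
        using Suc.prems(2) that by (simp add: p_def)
      have step: "S B" if "mdet r B \<noteq> 0" "B p p \<noteq> 0" "\<And>i j. i < p \<Longrightarrow> j < r \<Longrightarrow> B i j = (if i = j then 1 else 0)"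
        "card {j. j < r \<and> j \<noteq> p \<and> B p j \<noteq> 0} = m" for m B
        using that
      proof (induction m arbitrary: B)
        case 0
        then have z: "B p j = 0" if "j < r" "j \<noteq> p" for j using that by auto
        show ?case
        proof (rule sc[OF p(1)])
          show "inverse (B p p) \<noteq> 0" "mdet r B \<noteq> 0" using 0 by auto
          show "S (scale_col B p (inverse (B p p)))"
          proof (rule Suc.IH)
            show "mdet r (scale_col B p (inverse (B p p))) \<noteq> 0"
              using 0 by (simp add: mdet_scale_col[OF p(1)])
            fix i j assume ij: "i < r - n" "j < r"
            show "scale_col B p (inverse (B p p)) i j = (if i = j then 1 else 0)"
            proof (cases "i = p")
              case True
              then show ?thesis using 0(2) z ij by (auto simp: scale_col_def)
            next
              case False
              then show ?thesis using 0(3)[of i] ij p by (auto simp: scale_col_def)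
            qed
          qed
        qed
      next
        case (Suc m)
        let ?Z = "{j. j < r \<and> j \<noteq> p \<and> B p j \<noteq> 0}"
        have "?Z \<noteq> {}" using Suc.prems(4) by (metis card.empty nat.distinct(1))
        then obtain j where j: "j < r" "j \<noteq> p" "B p j \<noteq> 0" by auto
        let ?c = "- B p j / B p p"
        show ?case
        proof (rule sh[OF j(1) p(1) j(2) Suc.prems(1)])
          show "S (shear B j p ?c)"
          proof (rule Suc.IH)
            show "mdet r (shear B j p ?c) \<noteq> 0" using Suc.prems(1) by (simp add: mdet_shear[OF j(1) p(1) j(2)])
            show "shear B j p ?c p p \<noteq> 0" using Suc.prems(2) j by (simp add: shear_def)
            show "shear B j p ?c i q = (if i = q then 1 else 0)" if "i < p" "q < r" for i q
              using Suc.prems(3)[OF that] Suc.prems(3)[OF that(1) p(1)] Suc.prems(3)[OF that(1) j(1)] that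
              by (auto simp: shear_def)
            have "{q. q < r \<and> q \<noteq> p \<and> shear B j p ?c p q \<noteq> 0} = ?Z - {j}"
              using Suc.prems(2) j by (auto simp: shear_def)
            then show "card {q. q < r \<and> q \<noteq> p \<and> shear B j p ?c p q \<noteq> 0} = m"
              using Suc.prems(4) j by simp
          qed
        qed
      qed
      show ?thesis
      proof (cases "A p p = 0")
        case False
        then show ?thesis using step[OF Suc.prems(1) _ rows refl] by simp
      next
        case True
        have "\<exists>i. p < i \<and> i < r \<and> A p i \<noteq> 0"
        proof (rule ccontr)
          assume no: "\<not> ?thesis"
          have z: "A p i = 0" if "i < r" "i \<ge> p" for i
            using that True no by (cases "i = p") auto
          let ?T = "mat r r (\<lambda>(i, j). A j i)"
          \<comment> \<open>The rows above \<open>p\<close> are unit vectors. If row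
            \<open>p\<close> vanished from column \<open>p\<close> on, it would be the combination
            of those rows with coefficients \<open>A p q\<close>; \<open>v\<close> records this
            dependence.\<close>
          define v where "v = vec r (\<lambda>q. if q = p then 1 else if q < p then - A p q else 0)"
          have "?T *\<^sub>v v = 0\<^sub>v r"
          proof (rule eq_vecI)
            fix i assume "i < dim_vec (0\<^sub>v r :: real vec)"
            then have i: "i < r" by simp
            have "(?T *\<^sub>v v) $ i = (\<Sum>q<r. A q i * (if q = p then 1 else if q < p then - A p q else 0))"
              using i by (auto simp: v_def scalar_prod_def atLeast0LessThan intro!: sum.cong)
            also have "\<dots> = (\<Sum>q<r. (if q = p then A p i else 0) + (if q = i then (if i < p then - A p i else 0) else 0))"
              by (rule sum.cong) (use rows i in auto)
            also have "\<dots> = A p i + (if i < p then - A p i else 0)" using i p by (simp add: sum.distrib)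
            also have "\<dots> = 0" using z[OF i] by auto
            finally show "(?T *\<^sub>v v) $ i = 0\<^sub>v r $ i" using i by simp
          qed simp
          moreover have "v \<in> carrier_vec r" by (simp add: v_def)
          moreover have "v \<noteq> 0\<^sub>v r"
          proof
            assume "v = 0\<^sub>v r"
            then have "v $ p = 0" using p by simp
            then show False using p by (simp add: v_def)
          qed
          ultimately have "det ?T = 0" using det_0_iff_vec_prod_zero[of ?T r] by auto
          then have "mdet r A = 0" by (subst mdet_transpose) (simp add: mdet_def)
          then show False using Suc.prems(1) by simp
        qed
        then obtain i where i: "p < i" "i < r" "A p i \<noteq> 0" by blast
        \<comment> \<open>Adding column \<open>i\<close> to column \<open>p\<close> creates the
          pivot, so no exchange of columns is needed.\<close>
        show ?thesis
        proof (rule sh[OF p(1) i(2) _ Suc.prems(1)])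
          show "p \<noteq> i" using i by simp
          show "S (shear A p i 1)"
          proof (rule step[OF _ _ _ refl])
            show "mdet r (shear A p i 1) \<noteq> 0" using Suc.prems(1) i p by (simp add: mdet_shear)
            show "shear A p i 1 p p \<noteq> 0" using True i by (simp add: shear_def)
            show "shear A p i 1 a b = (if a = b then 1 else 0)" if "a < p" "b < r" for a b
              using rows[OF that] rows[OF that(1) i(2)] rows[OF that(1) p(1)] i that by (auto simp: shear_def)
          qed
        qed
      qed
    qed
  qed
  show ?thesis by (rule main[of A r]) (use A in auto)
qed

abbreviation Rn :: "nat \<Rightarrow> (nat \<Rightarrow> real) measure" where
  "Rn r \<equiv> Pi\<^sub>M {..<r} (\<lambda>_. lborel)"

text \<open>Fubini with coordinate \<open>p\<close> innermost. Since \<open>t\<close> does not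
  depend on that coordinate, the inner substitution is affine in one real variable.\<close>

lemma nn_integral_coordinate:
  assumes p: "p < r" and g: "g \<in> borel_measurable (Rn r)" and a: "a \<noteq> 0"
    and t: "\<And>y s. t (y(p := s)) = t y" and tm: "t \<in> borel_measurable (Rn r)"
  shows "ennreal \<bar>a\<bar> * (\<integral>\<^sup>+y. g (y(p := a * y p + t y)) \<partial>Rn r) = (\<integral>\<^sup>+y. g y \<partial>Rn r)"
proof -
  interpret product_sigma_finite "\<lambda>_ :: nat. lborel :: real measure" by standard
  define J where "J = {..<r} - {p}"
  have J: "finite J" "p \<notin> J" "insert p J = {..<r}" using p by (auto simp: J_def)
  have gm: "g \<in> borel_measurable (Pi\<^sub>M (insert p J) (\<lambda>_. lborel))" using g J by simp
  have tm': "t \<in> borel_measurable (Pi\<^sub>M (insert p J) (\<lambda>_. lborel))" using tm J by simp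
  have hm: "(\<lambda>y. g (y(p := a * y p + t y))) \<in> borel_measurable (Pi\<^sub>M (insert p J) (\<lambda>_. lborel))"
  proof -
    have "(\<lambda>y. y(p := a * y p + t y)) \<in> measurable (Pi\<^sub>M (insert p J) (\<lambda>_. lborel)) (Pi\<^sub>M (insert p J) (\<lambda>_. lborel))"
    proof (rule measurable_PiM_single')
      fix i assume i: "i \<in> insert p J"
      have pm: "(\<lambda>y. y p) \<in> borel_measurable (Pi\<^sub>M (insert p J) (\<lambda>_. lborel))"
        using measurable_component_singleton[of p "insert p J" "\<lambda>_. lborel :: real measure"] by simp
      show "(\<lambda>y. (y(p := a * y p + t y)) i) \<in> measurable (Pi\<^sub>M (insert p J) (\<lambda>_. lborel)) lborel"
      proof (cases "i = p")
        case True
        then show ?thesis using pm tm' by simp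
      next
        case False
        then show ?thesis using measurable_component_singleton[OF i, of "\<lambda>_. lborel :: real measure"] by simp
      qed
    qed (auto simp: space_PiM PiE_def extensional_def)
    then show ?thesis using gm by (rule measurable_compose)
  qed
  have fst: "(\<lambda>x. \<integral>\<^sup>+s. h (x(p := s)) \<partial>lborel) \<in> borel_measurable (Pi\<^sub>M J (\<lambda>_. lborel))"
    if h: "h \<in> borel_measurable (Pi\<^sub>M (insert p J) (\<lambda>_. lborel))" for h :: "(nat \<Rightarrow> real) \<Rightarrow> ennreal"
  proof -
    have "(\<lambda>z. h ((fst z)(p := snd z))) \<in> borel_measurable (Pi\<^sub>M J (\<lambda>_. lborel) \<Otimes>\<^sub>M lborel)"
      using measurable_compose[OF measurable_add_dim h] by (simp add: case_prod_beta')
    then show ?thesis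
      using lborel.borel_measurable_nn_integral_fst[of "\<lambda>z. h ((fst z)(p := snd z))"] by simp
  qed
  have "ennreal \<bar>a\<bar> * (\<integral>\<^sup>+y. g (y(p := a * y p + t y)) \<partial>Pi\<^sub>M (insert p J) (\<lambda>_. lborel)) =
    ennreal \<bar>a\<bar> * (\<integral>\<^sup>+x. (\<integral>\<^sup>+s. g (x(p := a * s + t x)) \<partial>lborel) \<partial>Pi\<^sub>M J (\<lambda>_. lborel))"
    by (subst product_nn_integral_insert[OF J(1,2) hm]) (simp add: t)
  also have "\<dots> = (\<integral>\<^sup>+x. ennreal \<bar>a\<bar> * (\<integral>\<^sup>+s. g (x(p := a * s + t x)) \<partial>lborel) \<partial>Pi\<^sub>M J (\<lambda>_. lborel))"
    using fst[OF hm] by (intro nn_integral_cmult[symmetric]) (simp add: t)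
  also have "\<dots> = (\<integral>\<^sup>+x. (\<integral>\<^sup>+s. g (x(p := s)) \<partial>lborel) \<partial>Pi\<^sub>M J (\<lambda>_. lborel))"
  proof (rule nn_integral_cong)
    fix x assume x: "x \<in> space (Pi\<^sub>M J (\<lambda>_. lborel :: real measure))"
    have m: "(\<lambda>s. g (x(p := s))) \<in> borel_measurable borel"
    proof -
      have "(\<lambda>s. x(p := s)) \<in> measurable lborel (Pi\<^sub>M (insert p J) (\<lambda>_. lborel))"
        by (rule measurable_fun_upd[where J = J]) (use x in auto)
      from measurable_compose[OF this gm] show ?thesis by simp
    qed
    show "ennreal \<bar>a\<bar> * (\<integral>\<^sup>+s. g (x(p := a * s + t x)) \<partial>lborel) = (\<integral>\<^sup>+s. g (x(p := s)) \<partial>lborel)"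
      using nn_integral_real_affine[OF m a, of "t x"] by (simp add: add.commute)
  qed
  also have "\<dots> = (\<integral>\<^sup>+y. g y \<partial>Pi\<^sub>M (insert p J) (\<lambda>_. lborel))"
    by (rule product_nn_integral_insert[OF J(1,2) gm, symmetric])
  finally show ?thesis unfolding J(3) .
qed

text \<open>The value \<open>undefined\<close> beyond \<open>r\<close> keeps the image in the
  extensional functions, which are the points of the product space.\<close>

definition lin :: "nat \<Rightarrow> (nat \<Rightarrow> nat \<Rightarrow> real) \<Rightarrow> (nat \<Rightarrow> real) \<Rightarrow> nat \<Rightarrow> real" where
  "lin r A y = (\<lambda>i. if i < r then \<Sum>j<r. A i j * y j else undefined)"

lemma lin_measurable: "lin r A \<in> measurable (Rn r) (Rn r)"
proof (rule measurable_PiM_single')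
  fix i assume i: "i \<in> {..<r}"
  have "(\<lambda>y. \<Sum>j<r. A i j * y j) \<in> borel_measurable (Rn r)"
  proof (intro borel_measurable_sum borel_measurable_times borel_measurable_const)
    fix j assume "j \<in> {..<r}"
    then show "(\<lambda>y. y j) \<in> borel_measurable (Rn r)"
      using measurable_component_singleton[of j "{..<r}" "\<lambda>_. lborel :: real measure"] by simp
  qed
  then show "(\<lambda>y. lin r A y i) \<in> measurable (Rn r) lborel" using i by (simp add: lin_def)
qed (auto simp: space_PiM lin_def PiE_def extensional_def)

text \<open>Linear change of variables, by elimination: composing with an elementary column
  operation alters a single coordinate of the argument, which is the case of
  \<open>nn_integral_coordinate\<close>.\<close>

lemma nn_integral_lin:
  assumes F: "F \<in> borel_measurable (Rn r)" and A: "mdet r A \<noteq> 0"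
  shows "ennreal \<bar>mdet r A\<bar> * (\<integral>\<^sup>+y. F (lin r A y) \<partial>Rn r) = (\<integral>\<^sup>+y. F y \<partial>Rn r)"
  using A
proof (induction rule: matrix_elimination_induct[where A = A and r = r, consumes 0, case_names id sh sc A])
  case (id A)
  have "mat r r (\<lambda>(i, j). A i j) = 1\<^sub>m r" by (rule eq_matI) (use id in auto)
  then have "mdet r A = 1" by (simp add: mdet_def)
  moreover have "(\<integral>\<^sup>+y. F (lin r A y) \<partial>Rn r) = (\<integral>\<^sup>+y. F y \<partial>Rn r)"
  proof (rule nn_integral_cong)
    fix y assume y: "y \<in> space (Rn r)"
    have "lin r A y = y"
    proof
      fix i
      show "lin r A y i = y i"
      proof (cases "i < r")
        case True
        have "(\<Sum>j<r. A i j * y j) = (\<Sum>j<r. if j = i then y i else 0)"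
          by (rule sum.cong) (use id True in auto)
        then show ?thesis using True by (simp add: lin_def)
      next
        case False
        then show ?thesis using y by (auto simp: lin_def space_PiM PiE_def extensional_def)
      qed
    qed
    then show "F (lin r A y) = F y" by simp
  qed
  ultimately show ?case by simp
next
  case (sh A j p c)
  have gm: "(\<lambda>y. F (lin r A y)) \<in> borel_measurable (Rn r)" by (rule measurable_compose[OF lin_measurable F])
  have "lin r (shear A j p c) y = lin r A (y(p := 1 * y p + c * y j))" for y
  proof
    fix i
    have "(\<Sum>q<r. shear A j p c i q * y q) = (\<Sum>q<r. A i q * y q + (if q = j then c * A i p * y j else 0))"
      by (rule sum.cong) (auto simp: shear_def algebra_simps)
    also have "\<dots> = (\<Sum>q<r. A i q * y q) + c * A i p * y j" using sh by (simp add: sum.distrib)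
    also have "\<dots> = (\<Sum>q<r. A i q * y q + (if q = p then A i p * (c * y j) else 0))"
      using sh by (simp add: sum.distrib)
    also have "\<dots> = (\<Sum>q<r. A i q * (y(p := 1 * y p + c * y j)) q)"
      by (rule sum.cong) (auto simp: algebra_simps)
    finally show "lin r (shear A j p c) y i = lin r A (y(p := 1 * y p + c * y j)) i" by (simp add: lin_def)
  qed
  then have "(\<integral>\<^sup>+y. F (lin r (shear A j p c) y) \<partial>Rn r) = ennreal \<bar>1\<bar> * (\<integral>\<^sup>+y. F (lin r A (y(p := 1 * y p + c * y j))) \<partial>Rn r)"
    by simp
  also have "\<dots> = (\<integral>\<^sup>+y. F (lin r A y) \<partial>Rn r)"
  proof (rule nn_integral_coordinate[OF sh(2) gm, of 1 "\<lambda>y. c * y j"])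
    show "(\<lambda>y. c * y j) \<in> borel_measurable (Rn r)"
      using measurable_component_singleton[of j "{..<r}" "\<lambda>_. lborel :: real measure"] sh(1) by simp
  qed (use sh in auto)
  finally show ?case using sh by (simp add: mdet_shear)
next
  case (sc A p c)
  have gm: "(\<lambda>y. F (lin r A y)) \<in> borel_measurable (Rn r)" by (rule measurable_compose[OF lin_measurable F])
  have "lin r (scale_col A p c) y = lin r A (y(p := c * y p + 0))" for y
  proof
    fix i
    have "(\<Sum>q<r. scale_col A p c i q * y q) = (\<Sum>q<r. A i q * (y(p := c * y p + 0)) q)"
      by (rule sum.cong) (auto simp: scale_col_def algebra_simps)
    then show "lin r (scale_col A p c) y i = lin r A (y(p := c * y p + 0)) i" by (simp add: lin_def)
  qed
  then have "ennreal \<bar>c\<bar> * (\<integral>\<^sup>+y. F (lin r (scale_col A p c) y) \<partial>Rn r) = (\<integral>\<^sup>+y. F (lin r A y) \<partial>Rn r)"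
    using nn_integral_coordinate[OF sc(1) gm sc(2), of "\<lambda>_. 0"] by simp
  moreover have "ennreal \<bar>mdet r (scale_col A p c)\<bar> = ennreal \<bar>mdet r A\<bar> * ennreal \<bar>c\<bar>"
    by (simp add: mdet_scale_col[OF sc(1)] abs_mult ennreal_mult mult.commute)
  moreover have "mdet r (scale_col A p c) \<noteq> 0" using sc(2,3) by (simp add: mdet_scale_col[OF sc(1)])
  ultimately show ?case using sc(4) by (simp add: mult.assoc)
next
  case A
  then show ?case using assms by simp
qed

text \<open>Only the first \<open>n\<close> coordinates are shifted, so that invariance of the
  integral can be proved one coordinate at a time.\<close>

definition translate :: "nat \<Rightarrow> (nat \<Rightarrow> int) \<Rightarrow> (nat \<Rightarrow> real) \<Rightarrow> nat \<Rightarrow> real" where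
  "translate n x y = (\<lambda>i. if i < n then y i + of_int (x i) else y i)"

lemma translate_measurable: "n \<le> r \<Longrightarrow> translate n x \<in> measurable (Rn r) (Rn r)"
proof (rule measurable_PiM_single')
  fix i assume i: "i \<in> {..<r}"
  have "(\<lambda>y. y i) \<in> borel_measurable (Rn r)"
    using measurable_component_singleton[OF i, of "\<lambda>_. lborel :: real measure"] by simp
  then show "(\<lambda>y. translate n x y i) \<in> measurable (Rn r) lborel" by (simp add: translate_def)
qed (auto simp: space_PiM translate_def PiE_def extensional_def)

lemma nn_integral_translate:
  assumes g: "g \<in> borel_measurable (Rn r)" and "n \<le> r"
  shows "(\<integral>\<^sup>+y. g (translate n x y) \<partial>Rn r) = (\<integral>\<^sup>+y. g y \<partial>Rn r)"
  using assms(2)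
proof (induction n)
  case 0
  then show ?case by (simp add: translate_def)
next
  case (Suc n)
  have gm: "(\<lambda>y. g (translate n x y)) \<in> borel_measurable (Rn r)"
    using Suc.prems by (intro measurable_compose[OF translate_measurable g]) simp
  have "translate (Suc n) x y = translate n x (y(n := 1 * y n + of_int (x n)))" for y
    by (rule ext) (auto simp: translate_def less_Suc_eq)
  then have "(\<integral>\<^sup>+y. g (translate (Suc n) x y) \<partial>Rn r) =
    ennreal \<bar>1\<bar> * (\<integral>\<^sup>+y. g (translate n x (y(n := 1 * y n + of_int (x n)))) \<partial>Rn r)" by simp
  also have "\<dots> = (\<integral>\<^sup>+y. g (translate n x y) \<partial>Rn r)"
    by (rule nn_integral_coordinate[OF _ gm, of n 1 "\<lambda>_. of_int (x n)"]) (use Suc.prems in auto)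
  finally show ?case using Suc by simp
qed

definition std_simplex :: "nat \<Rightarrow> (nat \<Rightarrow> real) set" where
  "std_simplex r = {y. (\<forall>i\<in>{..<r}. 0 \<le> y i) \<and> sum y {..<r} \<le> 1}"

lemma std_simplex_measurable: "std_simplex r \<inter> space (Rn r) \<in> sets (Rn r)"
proof -
  have comp: "(\<lambda>y. y i) \<in> borel_measurable (Rn r)" if "i \<in> {..<r}" for i
    using measurable_component_singleton[OF that, of "\<lambda>_. lborel :: real measure"] by simp
  have sm: "(\<lambda>y. sum y {..<r}) \<in> borel_measurable (Rn r)" by (intro borel_measurable_sum comp)
  have "std_simplex r \<inter> space (Rn r) = PiE {..<r} (\<lambda>_. {0..}) \<inter> ((\<lambda>y. sum y {..<r}) -` {..1} \<inter> space (Rn r))"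
    by (auto simp: std_simplex_def space_PiM)
  moreover have "PiE {..<r} (\<lambda>_. {0 :: real..}) \<in> sets (Rn r)" by (rule sets_PiM_I_finite) auto
  moreover have "(\<lambda>y. sum y {..<r}) -` {..1} \<inter> space (Rn r) \<in> sets (Rn r)"
    by (rule measurable_sets[OF sm]) simp
  ultimately show ?thesis by simp
qed

text \<open>Integrate the number of lattice translates of a point that lie in the simplex over a unit cube.\<close>

lemma packing:
  assumes M: "mdet r M \<noteq> 0"
    and N: "\<And>y W. finite W \<Longrightarrow> W \<subseteq> PiE {..<r} (\<lambda>_. UNIV :: int set) \<Longrightarrow>
      (\<And>x. x \<in> W \<Longrightarrow> (\<lambda>i. y i + (\<Sum>j<r. M i j * of_int (x j))) \<in> std_simplex r) \<Longrightarrow> card W \<le> N"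
  shows "1 \<le> real N * fact r * \<bar>mdet r M\<bar>"
proof -
  interpret product_sigma_finite "\<lambda>_ :: nat. lborel :: real measure" by standard
  define D where "D = std_simplex r \<inter> space (Rn r)"
  have Dm: "D \<in> sets (Rn r)" unfolding D_def by (rule std_simplex_measurable)
  define F where "F = (indicator D :: (nat \<Rightarrow> real) \<Rightarrow> ennreal)"
  have Fm: "F \<in> borel_measurable (Rn r)" unfolding F_def using Dm by simp
  \<comment> \<open>The volume of the standard simplex: the origin of the factorial in the regulator
    bound.\<close>
  have intF: "(\<integral>\<^sup>+y. F y \<partial>Rn r) = ennreal (1 / fact r)"
    using emeasure_std_simplex_aux[of "{..<r}" 1] nn_integral_indicator[OF Dm]
    by (simp add: F_def D_def std_simplex_def)
  define g where "g = (\<lambda>y. F (lin r M y))"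
  have gm: "g \<in> borel_measurable (Rn r)" unfolding g_def by (rule measurable_compose[OF lin_measurable Fm])
  define Z where "Z = PiE {..<r} (\<lambda>_. UNIV :: int set)"
  have cZ: "countable Z" unfolding Z_def by (rule countable_PiE) auto
  define C where "C = PiE {..<r} (\<lambda>_. {0..<1 :: real})"
  have Cm: "C \<in> sets (Rn r)" unfolding C_def by (rule sets_PiM_I_finite) auto
  have eC: "emeasure (Rn r) C = 1" unfolding C_def by (subst emeasure_PiM) auto
  define neg where "neg = (\<lambda>(x :: nat \<Rightarrow> int) i. - x i)"
  \<comment> \<open>Each point has exactly one integral translate in the half-open cube, so the
    integral over the whole space can be folded into a sum over the cube.\<close>
  have fl: "(\<integral>\<^sup>+x. indicator C (translate r (neg x) y) * g y \<partial>count_space Z) = g y" if y: "y \<in> space (Rn r)" for y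
  proof -
    define x0 where "x0 = restrict (\<lambda>i. \<lfloor>y i\<rfloor>) {..<r}"
    have x0: "x0 \<in> Z" by (auto simp: x0_def Z_def)
    have "translate r (neg x) y \<in> C \<longleftrightarrow> x = x0" if x: "x \<in> Z" for x
    proof -
      have "translate r (neg x) y \<in> C \<longleftrightarrow> (\<forall>i<r. 0 \<le> y i - of_int (x i) \<and> y i - of_int (x i) < 1)"
        using y by (auto simp: C_def translate_def neg_def space_PiM PiE_def Pi_def extensional_def)
      also have "\<dots> \<longleftrightarrow> (\<forall>i<r. x i = \<lfloor>y i\<rfloor>)"
      proof -
        have "0 \<le> y i - of_int (x i) \<and> y i - of_int (x i) < 1 \<longleftrightarrow> x i = \<lfloor>y i\<rfloor>" for i
        proof -
          have "(0 \<le> y i - of_int (x i) \<and> y i - of_int (x i) < 1) = (of_int (x i) \<le> y i \<and> y i < of_int (x i) + 1)"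
            by linarith
          then show ?thesis unfolding floor_eq_iff[symmetric] by (simp only: eq_commute[of "x i"])
        qed
        then show ?thesis by simp
      qed
      also have "\<dots> \<longleftrightarrow> x = x0"
      proof
        assume "\<forall>i<r. x i = \<lfloor>y i\<rfloor>"
        then show "x = x0"
          by (intro PiE_ext[OF x[unfolded Z_def] x0[unfolded Z_def]]) (simp add: x0_def)
      qed (simp add: x0_def)
      finally show ?thesis .
    qed
    then have "(\<integral>\<^sup>+x. indicator C (translate r (neg x) y) * g y \<partial>count_space Z) =
      (\<integral>\<^sup>+x. g y * indicator {x0} x \<partial>count_space Z)"
      by (intro nn_integral_cong) (auto simp: indicator_def)
    also have "\<dots> = g y" using x0 by (simp add: nn_integral_cmult_indicator)
    finally show ?thesis .
  qed
  have tm: "(\<lambda>y. translate r x y) \<in> measurable (Rn r) (Rn r)" for x by (rule translate_measurable) simp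
  have "(\<integral>\<^sup>+y. g y \<partial>Rn r) = (\<integral>\<^sup>+y. (\<integral>\<^sup>+x. indicator C (translate r (neg x) y) * g y \<partial>count_space Z) \<partial>Rn r)"
    by (rule nn_integral_cong) (simp only: fl)
  also have "\<dots> = (\<integral>\<^sup>+x. (\<integral>\<^sup>+y. indicator C (translate r (neg x) y) * g y \<partial>Rn r) \<partial>count_space Z)"
  proof (rule nn_integral_count_space_nn_integral[OF cZ])
    show "(\<lambda>y. indicator C (translate r (neg x) y) * g y) \<in> borel_measurable (Rn r)" if "x \<in> Z" for x
      by (rule borel_measurable_times_ennreal[OF measurable_compose[OF tm borel_measurable_indicator[OF Cm]] gm])
  qed
  also have "\<dots> = (\<integral>\<^sup>+x. (\<integral>\<^sup>+y. indicator C y * g (translate r x y) \<partial>Rn r) \<partial>count_space Z)"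
  proof (rule nn_integral_cong)
    fix x
    have m: "(\<lambda>y. indicator C (translate r (neg x) y) * g y) \<in> borel_measurable (Rn r)"
      by (rule borel_measurable_times_ennreal[OF measurable_compose[OF tm borel_measurable_indicator[OF Cm]] gm])
    have "translate r (neg x) (translate r x y) = y" for y by (rule ext) (simp add: translate_def neg_def)
    then show "(\<integral>\<^sup>+y. indicator C (translate r (neg x) y) * g y \<partial>Rn r) = (\<integral>\<^sup>+y. indicator C y * g (translate r x y) \<partial>Rn r)"
      using nn_integral_translate[OF m order_refl, of x] by simp
  qed
  also have "\<dots> = (\<integral>\<^sup>+y. (\<integral>\<^sup>+x. indicator C y * g (translate r x y) \<partial>count_space Z) \<partial>Rn r)"
  proof (rule nn_integral_count_space_nn_integral[OF cZ, symmetric])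
    show "(\<lambda>y. indicator C y * g (translate r x y)) \<in> borel_measurable (Rn r)" if "x \<in> Z" for x
      by (rule borel_measurable_times_ennreal[OF borel_measurable_indicator[OF Cm] measurable_compose[OF tm gm]])
  qed
  \<comment> \<open>For a fixed point of the cube, the translates with nonzero contribution are
    those counted by the hypothesis, with base point \<open>lin r M y\<close>.\<close>
  also have "\<dots> \<le> (\<integral>\<^sup>+y. of_nat N * indicator C y \<partial>Rn r)"
  proof (rule nn_integral_mono)
    fix y
    define W where "W = {x \<in> Z. g (translate r x y) \<noteq> 0}"
    have gW: "g (translate r x y) = indicator W x" if "x \<in> Z" for x
      using that by (auto simp: W_def g_def F_def indicator_def)
    have Wb: "card V \<le> N" if V: "finite V" "V \<subseteq> W" for V
    proof (rule N[OF V(1)])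
      show "V \<subseteq> PiE {..<r} (\<lambda>_. UNIV)" using V(2) by (auto simp: W_def Z_def)
      fix x assume "x \<in> V"
      then have "lin r M (translate r x y) \<in> std_simplex r"
        using V(2) by (auto simp: W_def g_def F_def D_def indicator_def split: if_splits)
      moreover have "lin r M (translate r x y) i = lin r M y i + (\<Sum>j<r. M i j * of_int (x j))" if "i < r" for i
        using that by (simp add: lin_def translate_def distrib_left sum.distrib)
      ultimately show "(\<lambda>i. lin r M y i + (\<Sum>j<r. M i j * of_int (x j))) \<in> std_simplex r"
        by (simp add: std_simplex_def)
    qed
    have finW: "finite W"
    proof (rule ccontr)
      assume "infinite W"
      then obtain V where "finite V" "card V = Suc N" "V \<subseteq> W" using infinite_arbitrarily_large by blast
      then show False using Wb[of V] by simp
    qed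
    have "(\<integral>\<^sup>+x. indicator C y * g (translate r x y) \<partial>count_space Z) = indicator C y * (\<integral>\<^sup>+x. indicator W x \<partial>count_space Z)"
      by (subst nn_integral_cmult) (auto intro!: nn_integral_cong arg_cong2[where f = "(*)"] simp: gW)
    also have "(\<integral>\<^sup>+x. indicator W x \<partial>count_space Z) = emeasure (count_space Z) W"
      by (rule nn_integral_indicator) (auto simp: W_def)
    also have "\<dots> = of_nat (card W)" using finW by (subst emeasure_count_space_finite) (auto simp: W_def)
    also have "indicator C y * of_nat (card W) \<le> of_nat N * (indicator C y :: ennreal)"
      using Wb[OF finW order_refl] by (auto simp: indicator_def)
    finally show "(\<integral>\<^sup>+x. indicator C y * g (translate r x y) \<partial>count_space Z) \<le> of_nat N * indicator C y" .
  qed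
  also have "\<dots> = of_nat N" using Cm eC by (simp add: nn_integral_cmult_indicator)
  finally have le: "(\<integral>\<^sup>+y. g y \<partial>Rn r) \<le> of_nat N" .
  have "ennreal (1 / fact r) = ennreal \<bar>mdet r M\<bar> * (\<integral>\<^sup>+y. g y \<partial>Rn r)"
    unfolding g_def nn_integral_lin[OF Fm M] intF ..
  also have "\<dots> \<le> ennreal \<bar>mdet r M\<bar> * of_nat N" by (rule mult_left_mono[OF le]) simp
  also have "\<dots> = ennreal (\<bar>mdet r M\<bar> * real N)"
    by (simp add: ennreal_mult ennreal_of_nat_eq_real_of_nat)
  finally have "1 / fact r \<le> \<bar>mdet r M\<bar> * real N" by (simp add: ennreal_le_iff)
  then show ?thesis by (simp add: field_simps)
qed

section \<open>Discriminants of fields generated by integers of small height\<close>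

lemma sum_prod_index:
  fixes f :: "nat \<Rightarrow> 'b::comm_monoid_add"
  shows "(\<Sum>i<m * n. f i) = (\<Sum>e<m. \<Sum>j<n. f (e * n + j))"
proof (induction m)
  case (Suc m)
  have "(\<Sum>i<Suc m * n. f i) = (\<Sum>i<m * n. f i) + (\<Sum>i\<in>{m * n..<m * n + n}. f i)"
    using sum.atLeastLessThan_concat[of 0 "m * n" "m * n + n" f] by (simp add: atLeast0LessThan add.commute)
  also have "(\<Sum>i\<in>{m * n..<m * n + n}. f i) = (\<Sum>j<n. f (m * n + j))"
    using sum.shift_bounds_nat_ivl[of f 0 "m * n" n] by (simp add: atLeast0LessThan add.commute)
  finally show ?case using Suc by simp
qed simp

text \<open>The usual tower basis, with the pair of indices encoded as quotient and remainder. The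
  explicit form matters: bounds for the conjugates of both factors multiply.\<close>

lemma basis_product:
  assumes Q: "subfield_of_type Q" and l: "subfield_of_type l" and Ql: "Q \<subseteq> l"
    and bs: "basis_over Q l bs" and cs: "basis_over l e cs" and e: "subfield_of_type e" and le: "l \<subseteq> e"
  shows "basis_over Q e (map (\<lambda>i. bs ! (i mod length bs) * cs ! (i div length bs)) [0..<length cs * length bs])"
proof -
  let ?n = "length bs" and ?m = "length cs"
  let ?ds = "map (\<lambda>i. bs ! (i mod ?n) * cs ! (i div ?n)) [0..<?m * ?n]"
  have bl: "bs ! j \<in> l" if "j < ?n" for j using bs that by (auto simp: basis_over_def)
  have ce: "cs ! j \<in> e" if "j < ?m" for j using cs that by (auto simp: basis_over_def)
  have n0: "?n > 0"
  proof (rule ccontr)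
    assume "\<not> ?n > 0"
    then have "\<exists>c. (\<forall>j. c j \<in> Q) \<and> 1 = (\<Sum>j<0. c j * bs ! j)"
      using bs sf_1[OF l] unfolding basis_over_def by fastforce
    then show False by simp
  qed
  have idx: "e' * ?n + j < ?m * ?n" if "e' < ?m" "j < ?n" for e' j
  proof -
    have "e' * ?n + j < Suc e' * ?n" using that by simp
    also have "\<dots> \<le> ?m * ?n" using that by (intro mult_le_mono1) simp
    finally show ?thesis .
  qed
  have dn: "?ds ! (e' * ?n + j) = bs ! j * cs ! e'" if "e' < ?m" "j < ?n" for e' j
  proof -
    have "(e' * ?n + j) div ?n = e'" "(e' * ?n + j) mod ?n = j" using that n0 by auto
    then show ?thesis using idx[OF that] by simp
  qed
  have ds_sum: "(\<Sum>i<?m * ?n. q i * ?ds ! i) = (\<Sum>e'<?m. (\<Sum>j<?n. q (e' * ?n + j) * bs ! j) * cs ! e')" for q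
  proof -
    have "(\<Sum>i<?m * ?n. q i * ?ds ! i) = (\<Sum>e'<?m. \<Sum>j<?n. q (e' * ?n + j) * ?ds ! (e' * ?n + j))"
      by (rule sum_prod_index)
    also have "\<dots> = (\<Sum>e'<?m. \<Sum>j<?n. q (e' * ?n + j) * (bs ! j * cs ! e'))"
      by (intro sum.cong refl arg_cong2[where f = "(*)"] dn) auto
    finally show ?thesis by (simp add: sum_distrib_right mult.assoc)
  qed
  show ?thesis unfolding basis_over_def length_map length_upt minus_nat.diff_0
  proof (intro conjI ballI allI impI)
    have "i div ?n < ?m" if "i < ?m * ?n" for i using that by (simp add: less_mult_imp_div_less)
    then show "set ?ds \<subseteq> e" using n0 bl ce le by (auto intro!: sf_mult[OF e])
    fix x assume "x \<in> e"
    then obtain c where c: "\<forall>j. c j \<in> l" "x = (\<Sum>j<?m. c j * cs ! j)"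
      using cs unfolding basis_over_def by blast
    have "\<forall>e'. \<exists>q. (\<forall>j. q j \<in> Q) \<and> c e' = (\<Sum>j<?n. q j * bs ! j)"
      using bs c(1) unfolding basis_over_def by blast
    from choice[OF this] obtain q where q: "\<And>e' j. q e' j \<in> Q" "\<And>e'. c e' = (\<Sum>j<?n. q e' j * bs ! j)" by blast
    have "x = (\<Sum>i<?m * ?n. q (i div ?n) (i mod ?n) * ?ds ! i)"
      unfolding ds_sum using n0 by (simp add: c(2) q(2))
    then show "\<exists>c. (\<forall>j. c j \<in> Q) \<and> x = (\<Sum>j<?m * ?n. c j * ?ds ! j)"
      using q(1) by (intro exI[of _ "\<lambda>i. q (i div ?n) (i mod ?n)"]) blast
  next
    fix q i assume q: "\<forall>j. q j \<in> Q" "(\<Sum>j<?m * ?n. q j * ?ds ! j) = 0" and i: "i < ?m * ?n"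
    have a: "(\<Sum>j<?n. q (e' * ?n + j) * bs ! j) = 0" if "e' < ?m" for e'
    proof (rule basis_over_indep[OF cs, of "\<lambda>e'. \<Sum>j<?n. q (e' * ?n + j) * bs ! j" e', OF _ _ that])
      show "(\<Sum>j<?n. q (e' * ?n + j) * bs ! j) \<in> l" for e'
        by (rule sf_sum[OF l], rule sf_mult[OF l]) (use q(1) Ql bl in auto)
      show "(\<Sum>e'<?m. (\<Sum>j<?n. q (e' * ?n + j) * bs ! j) * cs ! e') = 0" using q(2) unfolding ds_sum .
    qed
    have b: "q (e' * ?n + j) = 0" if "e' < ?m" "j < ?n" for e' j
      by (rule basis_over_indep[OF bs, of "\<lambda>j. q (e' * ?n + j)" j]) (use q(1) a[OF that(1)] that in auto)
    have "q ((i div ?n) * ?n + i mod ?n) = 0" by (rule b) (use i n0 in \<open>auto simp: less_mult_imp_div_less\<close>)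
    then show "q i = 0" by simp
  qed
qed

context nf
begin

text \<open>For an algebraic integer this is \<open>d\<close> times the absolute logarithmic Weil height.\<close>

definition ht :: "'a \<Rightarrow> real" where
  "ht x = (\<Sum>\<sigma>\<in>embeddings k. max 0 (ln (cmod (\<sigma> x))))"

text \<open>Elements of \<open>S\<close> are adjoined as long as the field is not all of
  \<open>k\<close>. A step of relative degree \<open>m\<close> multiplies the basis by powers of
  \<open>\<alpha>\<close> below \<open>m\<close>, so it raises the total logarithmic bound by at
  most \<open>(m - 1) * h\<close>. The factor \<open>length bs - 1\<close> in the invariant
  \<open>P\<close> survives since degrees multiply.\<close>

lemma generated_basis:
  assumes S: "S \<subseteq> OK" and h: "\<And>x. x \<in> S \<Longrightarrow> ht x \<le> h" and h0: "h \<ge> 0"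
    and gen: "\<And>l. subfield_of_type l \<Longrightarrow> l \<subseteq> k \<Longrightarrow> S \<subseteq> l \<Longrightarrow> l = k"
  shows "\<exists>bs G. basis_over \<rat> k bs \<and> set bs \<subseteq> OK \<and> (\<forall>\<sigma>\<in>embeddings k. \<forall>b\<in>set bs. cmod (\<sigma> b) \<le> exp (G \<sigma>)) \<and>
    (\<Sum>\<sigma>\<in>embeddings k. G \<sigma>) \<le> real (d - 1) * h"
proof -
  define P where "P = (\<lambda>l bs (G :: ('a \<Rightarrow> complex) \<Rightarrow> real). subfield_of_type l \<and> l \<subseteq> k \<and> basis_over \<rat> l bs \<and> set bs \<subseteq> OK \<and>
    (\<forall>\<sigma>\<in>embeddings k. \<forall>b\<in>set bs. cmod (\<sigma> b) \<le> exp (G \<sigma>)) \<and> (\<Sum>\<sigma>\<in>embeddings k. G \<sigma>) \<le> real (length bs - 1) * h)"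
  have P1: "P \<rat> [1] (\<lambda>_. 0)"
    unfolding P_def basis_over_def using sf_Rats[OF sub] subfield_Rats OK_1
    by (auto simp: emb_1[OF sub])
  have len: "length bs \<le> d" if "P l bs G" for l bs G
  proof -
    have l: "subfield_of_type l" "l \<subseteq> k" "basis_over \<rat> l bs" using that by (auto simp: P_def)
    have "degree_over \<rat> l (length bs)" by (rule basis_degree_over[OF subfield_Rats l(1) sf_Rats[OF l(1)] l(3)])
    moreover obtain a b where ab: "degree_over \<rat> l a" "degree_over l k b" "d = a * b"
      by (rule degree_over_tower[OF kd l(1) sf_Rats[OF l(1)] l(2)])
    ultimately have "a = length bs" using degree_over_unique by blast
    then show ?thesis using ab degree_over_pos[OF ab(2)] by simp
  qed
  have step: "\<exists>l' bs' G'. P l' bs' G' \<and> length bs < length bs'" if Pl: "P l bs G" and ne: "l \<noteq> k" for l bs G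
  proof -
    have l: "subfield_of_type l" "l \<subseteq> k" and bs: "basis_over \<rat> l bs" "set bs \<subseteq> OK"
      "\<And>\<sigma> b. \<sigma> \<in> embeddings k \<Longrightarrow> b \<in> set bs \<Longrightarrow> cmod (\<sigma> b) \<le> exp (G \<sigma>)"
      "(\<Sum>\<sigma>\<in>embeddings k. G \<sigma>) \<le> real (length bs - 1) * h" using Pl by (auto simp: P_def)
    obtain \<alpha> where a: "\<alpha> \<in> S" "\<alpha> \<notin> l" using gen[OF l] ne by blast
    have aO: "\<alpha> \<in> OK" and ak: "\<alpha> \<in> k" using a S OK_k by auto
    obtain a' b where ab: "degree_over \<rat> l a'" "degree_over l k b" "d = a' * b"
      by (rule degree_over_tower[OF kd l(1) sf_Rats[OF l(1)] l(2)])
    obtain f where f: "min_poly l \<alpha> f" by (rule ex_min_poly[OF l(1) ab(2) ak])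
    define m where "m = Polynomial.degree f"
    let ?e = "adjoin l \<alpha>" and ?cs = "map (\<lambda>i. \<alpha> ^ i) [0..<m]"
    have e: "subfield_of_type ?e" by (rule adjoin_subfield[OF l(1) ab(2) ak])
    have le: "l \<subseteq> ?e" and ek: "?e \<subseteq> k" and ae: "\<alpha> \<in> ?e"
      using adjoin_superset[OF l(1)] adjoin_subset[OF l(1) sub l(2) ak] adjoin_self[OF l(1)] by auto
    have cs: "basis_over l ?e ?cs" unfolding m_def by (rule adjoin_basis[OF l(1) f])
    have dm: "degree_over l ?e m" using basis_degree_over[OF l(1) e le cs] by simp
    have m1: "m \<noteq> 1" using degree_over_1_eq[of l ?e] dm ae a by auto
    have m0: "m > 0" by (rule degree_over_pos[OF dm])
    let ?n = "length bs"
    have n0: "?n > 0"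
      using degree_over_pos[OF basis_degree_over[OF subfield_Rats l(1) sf_Rats[OF l(1)] bs(1)]] .
    define ds where "ds = map (\<lambda>i. bs ! (i mod ?n) * ?cs ! (i div ?n)) [0..<m * ?n]"
    have ds: "basis_over \<rat> ?e ds"
      using basis_product[OF subfield_Rats l(1) sf_Rats[OF l(1)] bs(1) cs e le] by (simp add: ds_def)
    have dl: "length ds = m * ?n" by (simp add: ds_def)
    have ds_mem: "\<exists>b i. b \<in> set bs \<and> i < m \<and> x = b * \<alpha> ^ i" if "x \<in> set ds" for x
    proof -
      from that obtain i where i: "i < m * ?n" "x = bs ! (i mod ?n) * ?cs ! (i div ?n)" by (auto simp: ds_def)
      have "i div ?n < m" using i(1) by (simp add: less_mult_imp_div_less)
      then show ?thesis using i n0 by (intro exI[of _ "bs ! (i mod ?n)"] exI[of _ "i div ?n"]) auto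
    qed
    \<comment> \<open>The largest power of \<open>\<alpha>\<close> in the new basis is
      \<open>m - 1\<close>; the maximum with 0 covers the smaller powers as well.\<close>
    define G' where "G' = (\<lambda>\<sigma>. G \<sigma> + real (m - 1) * max 0 (ln (cmod (\<sigma> \<alpha>))))"
    have "P ?e ds G'" unfolding P_def
    proof (intro conjI ballI e ek ds)
      show "set ds \<subseteq> OK"
      proof
        fix x assume "x \<in> set ds"
        then obtain b i where "b \<in> set bs" "x = b * \<alpha> ^ i" using ds_mem by blast
        then show "x \<in> OK" using bs(2) OK_mult OK_power[OF aO] by auto
      qed
      fix \<sigma> x assume s: "\<sigma> \<in> embeddings k" and "x \<in> set ds"
      then obtain b i where bi: "b \<in> set bs" "i < m" "x = b * \<alpha> ^ i" using ds_mem by blast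
      have bk: "b \<in> k" using bs(2) bi(1) OK_k by auto
      let ?t = "max 0 (ln (cmod (\<sigma> \<alpha>)))"
      have "cmod (\<sigma> \<alpha>) \<le> exp ?t"
      proof (cases "cmod (\<sigma> \<alpha>) = 0")
        case False
        then have pos: "cmod (\<sigma> \<alpha>) > 0" by simp
        have "exp (ln (cmod (\<sigma> \<alpha>))) \<le> exp ?t" by simp
        then show ?thesis unfolding exp_ln[OF pos] .
      qed simp
      then have "cmod (\<sigma> \<alpha>) ^ i \<le> exp ?t ^ i" by (intro power_mono) auto
      also have "\<dots> \<le> exp ?t ^ (m - 1)" by (rule power_increasing) (use bi in auto)
      also have "\<dots> = exp (real (m - 1) * ?t)" by (simp only: exp_of_nat_mult)
      finally have "cmod (\<sigma> b) * cmod (\<sigma> \<alpha>) ^ i \<le> exp (G \<sigma>) * exp (real (m - 1) * ?t)"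
        using bs(3)[OF s bi(1)] by (intro mult_mono) auto
      then show "cmod (\<sigma> x) \<le> exp (G' \<sigma>)"
        by (simp add: bi(3) emb_mult[OF sub s bk sf_power[OF sub ak]] emb_power[OF sub s ak] norm_mult norm_power G'_def exp_add)
    next
      have "(\<Sum>\<sigma>\<in>embeddings k. G' \<sigma>) = (\<Sum>\<sigma>\<in>embeddings k. G \<sigma>) + real (m - 1) * ht \<alpha>"
        by (simp add: G'_def sum.distrib sum_distrib_left ht_def)
      also have "\<dots> \<le> real (?n - 1) * h + real (m - 1) * h"
        by (intro add_mono mult_left_mono bs(4) h a) simp
      also have "\<dots> = real ((?n - 1) + (m - 1)) * h" by (simp add: distrib_right)
      \<comment> \<open>This is \<open>(n - 1) + (m - 1) \<le> m * n - 1\<close> for positive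
        \<open>m\<close> and \<open>n\<close>.\<close>
      also have "\<dots> \<le> real (length ds - 1) * h"
      proof (rule mult_right_mono[OF _ h0])
        obtain n' m' where "?n = Suc n'" "m = Suc m'" using n0 m0 by (metis gr0_conv_Suc)
        then show "real ((?n - 1) + (m - 1)) \<le> real (length ds - 1)" by (simp add: dl)
      qed
      finally show "(\<Sum>\<sigma>\<in>embeddings k. G' \<sigma>) \<le> real (length ds - 1) * h" .
    qed
    moreover have "length bs < length ds"
    proof -
      have "2 * ?n \<le> m * ?n" using m0 m1 by (intro mult_le_mono1) simp
      then show ?thesis using n0 dl by simp
    qed
    ultimately show ?thesis by blast
  qed
  \<comment> \<open>Lengths are bounded by \<open>d\<close> and every step increases them, so a
    basis of maximal length spans \<open>k\<close>.\<close>
  define Q where "Q = (\<lambda>n. \<exists>l bs G. P l bs G \<and> length bs = n)"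
  have Q1: "Q 1" unfolding Q_def using P1 by (intro exI[of _ \<rat>] exI[of _ "[1]"] exI[of _ "\<lambda>_. 0"]) simp
  have Qd: "n \<le> d" if "Q n" for n using that len unfolding Q_def by blast
  define n where "n = (GREATEST n. Q n)"
  have Qn: "Q n" unfolding n_def by (rule GreatestI_nat[of Q 1 d]) (use Q1 Qd in auto)
  then obtain l bs G where Pl: "P l bs G" "length bs = n" unfolding Q_def by blast
  have lk: "l = k"
  proof (rule ccontr)
    assume "l \<noteq> k"
    from step[OF Pl(1) this] obtain l' bs' G' where P': "P l' bs' G'" "length bs < length bs'" by blast
    then have "Q (length bs')" unfolding Q_def by blast
    then have "length bs' \<le> n" unfolding n_def by (rule Greatest_le_nat[of Q _ d]) (use Qd in auto)
    then show False using P'(2) Pl(2) by simp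
  qed
  have "length bs = d" using basis_length Pl(1) lk by (simp add: P_def)
  then show ?thesis using Pl(1) lk by (intro exI[of _ bs] exI[of _ G]) (simp add: P_def)
qed

text \<open>Leibniz's expansion with one bound per row. The resulting loss \<open>(d!) ^ 2\<close>
  in the discriminant is affordable from degree 4 on.\<close>

lemma det_le_fact:
  fixes A :: "complex mat"
  assumes A: "A \<in> carrier_mat n n" and B: "\<And>i j. i < n \<Longrightarrow> j < n \<Longrightarrow> cmod (A $$ (i, j)) \<le> B i"
  shows "cmod (det A) \<le> fact n * (\<Prod>i<n. B i)"
proof -
  have "cmod (det A) \<le> (\<Sum>p\<in>{p. p permutes {0..<n}}. cmod (signof p * (\<Prod>i = 0..<n. A $$ (i, p i))))"
    unfolding det_def'[OF A] by (rule norm_sum)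
  also have "\<dots> \<le> (\<Sum>p\<in>{p. p permutes {0..<n}}. \<Prod>i<n. B i)"
  proof (rule sum_mono)
    fix p assume "p \<in> {p. p permutes {0..<n}}"
    then have p: "p permutes {0..<n}" by simp
    have "cmod (signof p * (\<Prod>i = 0..<n. A $$ (i, p i))) = (\<Prod>i = 0..<n. cmod (A $$ (i, p i)))"
      by (simp add: norm_mult prod_norm sign_def)
    also have "\<dots> \<le> (\<Prod>i = 0..<n. B i)"
      by (rule prod_mono) (use B permutes_in_image[OF p] in auto)
    finally show "cmod (signof p * (\<Prod>i = 0..<n. A $$ (i, p i))) \<le> (\<Prod>i<n. B i)" by (simp add: atLeast0LessThan)
  qed
  also have "\<dots> = fact n * (\<Prod>i<n. B i)" by (simp add: card_permutations)
  finally show ?thesis .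
qed

lemma abs_discriminant_pos: "abs_discriminant k > 0"
proof -
  obtain ws where ws: "integral_basis k ws" using ex_integral_basis by blast
  show ?thesis
    unfolding abs_discriminant_def discriminant_eq[OF ws] using det_emb_mat[OF integral_basis_Q_basis[OF ws]] by simp
qed

text \<open>The determinant inequality is a parameter \<open>C\<close>, so that Leibniz's expansion
  and Hadamard's inequality share the argument.\<close>

lemma disc_bound_general:
  assumes S: "S \<subseteq> OK" and h: "\<And>x. x \<in> S \<Longrightarrow> ht x \<le> h" and h0: "h \<ge> 0"
    and gen: "\<And>l. subfield_of_type l \<Longrightarrow> l \<subseteq> k \<Longrightarrow> S \<subseteq> l \<Longrightarrow> l = k"
    and C: "\<And>A B. A \<in> carrier_mat d d \<Longrightarrow> (\<And>i j. i < d \<Longrightarrow> j < d \<Longrightarrow> cmod (A $$ (i, j)) \<le> B i) \<Longrightarrow>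
      (cmod (det A))\<^sup>2 \<le> C * (\<Prod>i<d. B i)\<^sup>2"
  shows "ln (abs_discriminant k) \<le> ln C + 2 * (real d - 1) * h"
proof -
  obtain bs G where bs: "basis_over \<rat> k bs" "set bs \<subseteq> OK"
    "\<forall>\<sigma>\<in>embeddings k. \<forall>b\<in>set bs. cmod (\<sigma> b) \<le> exp (G \<sigma>)" "(\<Sum>\<sigma>\<in>embeddings k. G \<sigma>) \<le> real (d - 1) * h"
    using generated_basis[OF S h h0 gen] by blast
  have "(\<Prod>i<d. exp (G (es ! i))) = exp (\<Sum>\<sigma>\<in>embeddings k. G \<sigma>)"
    using sum_es[of G] exp_sum[of "{..<d}" "\<lambda>i. G (es ! i)"] by simp
  then have pr: "(\<Prod>i<d. exp (G (es ! i))) \<le> exp (real (d - 1) * h)" using bs(4) by simp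
  have "(cmod (det (emb_mat bs)))\<^sup>2 \<le> C * (\<Prod>i<d. exp (G (es ! i)))\<^sup>2"
  proof (rule C[OF emb_mat_carrier])
    fix i j assume ij: "i < d" "j < d"
    have "bs ! j \<in> set bs" using ij basis_length[OF bs(1)] by simp
    then show "cmod (emb_mat bs $$ (i, j)) \<le> exp (G (es ! i))"
      using bs(3) es_emb[OF ij(1)] ij by (simp add: emb_mat_def)
  qed
  then have le: "abs_discriminant k \<le> C * (\<Prod>i<d. exp (G (es ! i)))\<^sup>2"
    using abs_discriminant_le[OF bs(1,2)] by linarith
  have pp: "(\<Prod>i<d. exp (G (es ! i)))\<^sup>2 > 0" by (simp add: prod_pos)
  \<comment> \<open>Forced by positivity of the discriminant, and needed for the logarithm of
    \<open>C\<close>.\<close>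
  have Cp: "C > 0"
  proof (rule ccontr)
    assume "\<not> C > 0"
    then have "C * (\<Prod>i<d. exp (G (es ! i)))\<^sup>2 \<le> 0" using pp by (simp add: mult_nonpos_nonneg)
    then show False using le abs_discriminant_pos by linarith
  qed
  have "abs_discriminant k \<le> C * (exp (real (d - 1) * h))\<^sup>2"
    using le mult_left_mono[OF power_mono[OF pr, of 2] less_imp_le[OF Cp]] by (simp add: prod_nonneg)
  then have "ln (abs_discriminant k) \<le> ln (C * (exp (real (d - 1) * h))\<^sup>2)"
    using abs_discriminant_pos by (intro ln_mono) auto
  also have "\<dots> = ln C + ln ((exp (real (d - 1) * h))\<^sup>2)" using Cp by (simp add: ln_mult)
  also have "ln ((exp (real (d - 1) * h))\<^sup>2) = 2 * (real (d - 1) * h)" by (simp add: ln_realpow)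
  finally show ?thesis using d_pos by (simp add: of_nat_diff algebra_simps)
qed

lemma disc_bound:
  assumes "S \<subseteq> OK" "\<And>x. x \<in> S \<Longrightarrow> ht x \<le> h" "h \<ge> 0"
    "\<And>l. subfield_of_type l \<Longrightarrow> l \<subseteq> k \<Longrightarrow> S \<subseteq> l \<Longrightarrow> l = k"
  shows "ln (abs_discriminant k) \<le> 2 * ln (fact d) + 2 * (real d - 1) * h"
proof -
  have "ln (abs_discriminant k) \<le> ln ((fact d)\<^sup>2) + 2 * (real d - 1) * h"
  proof (rule disc_bound_general[OF assms])
    fix A B assume A: "A \<in> carrier_mat d d" and B: "\<And>i j. i < d \<Longrightarrow> j < d \<Longrightarrow> cmod (A $$ (i, j)) \<le> B i"
    show "(cmod (det A))\<^sup>2 \<le> (fact d)\<^sup>2 * (\<Prod>i<d. B i)\<^sup>2"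
      using power_mono[OF det_le_fact[OF A B], of 2] by (simp add: power_mult_distrib)
  qed
  then show ?thesis by (simp add: ln_realpow)
qed

end

lemma det_3:
  fixes A :: "'b::comm_ring_1 mat"
  assumes A: "A \<in> carrier_mat 3 3"
  shows "det A = A $$ (0,0) * (A $$ (1,1) * A $$ (2,2) - A $$ (1,2) * A $$ (2,1))
    - A $$ (1,0) * (A $$ (0,1) * A $$ (2,2) - A $$ (0,2) * A $$ (2,1))
    + A $$ (2,0) * (A $$ (0,1) * A $$ (1,2) - A $$ (0,2) * A $$ (1,1))"
proof -
  have d1: "det B = B $$ (0,0)" if "B \<in> carrier_mat 1 1" for B :: "'b mat"
    using that by (rule det_single)
  have d2: "det B = B $$ (0,0) * B $$ (1,1) - B $$ (1,0) * B $$ (0,1)" if B: "B \<in> carrier_mat 2 2" for B :: "'b mat"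
  proof -
    have "det B = (\<Sum>i<2. B $$ (i, 0) * cofactor B i 0)" using laplace_expansion_column[OF B, of 0] by simp
    also have "\<dots> = B $$ (0, 0) * det (mat_delete B 0 0) - B $$ (1, 0) * det (mat_delete B 1 0)"
      by (simp add: numeral_2_eq_2 cofactor_def)
    also have "det (mat_delete B 0 0) = B $$ (1, 1)" using B by (subst d1) (auto simp: mat_delete_def)
    also have "det (mat_delete B 1 0) = B $$ (0, 1)" using B by (subst d1) (auto simp: mat_delete_def)
    finally show ?thesis .
  qed
  have "det A = (\<Sum>i<3. A $$ (i, 0) * cofactor A i 0)" using laplace_expansion_column[OF A, of 0] by simp
  also have "\<dots> = A $$ (0, 0) * det (mat_delete A 0 0) - A $$ (1, 0) * det (mat_delete A 1 0) + A $$ (2, 0) * det (mat_delete A 2 0)"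
    by (simp add: numeral_3_eq_3 numeral_2_eq_2 cofactor_def)
  also have "det (mat_delete A 0 0) = A $$ (1,1) * A $$ (2,2) - A $$ (1,2) * A $$ (2,1)"
    using A by (subst d2) (auto simp: mat_delete_def numeral_2_eq_2)
  also have "det (mat_delete A 1 0) = A $$ (0,1) * A $$ (2,2) - A $$ (0,2) * A $$ (2,1)"
    using A by (subst d2) (auto simp: mat_delete_def numeral_2_eq_2)
  also have "det (mat_delete A 2 0) = A $$ (0,1) * A $$ (1,2) - A $$ (0,2) * A $$ (1,1)"
    using A by (subst d2) (auto simp: mat_delete_def numeral_2_eq_2)
  finally show ?thesis .
qed

text \<open>From the identities of Lagrange and Cauchy--Schwarz.\<close>

lemma hadamard_3:
  fixes u v w :: "nat \<Rightarrow> complex"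
  shows "(cmod (u 0 * (v 1 * w 2 - v 2 * w 1) - v 0 * (u 1 * w 2 - u 2 * w 1) + w 0 * (u 1 * v 2 - u 2 * v 1)))\<^sup>2
    \<le> ((cmod (u 0))\<^sup>2 + (cmod (u 1))\<^sup>2 + (cmod (u 2))\<^sup>2) *
      (((cmod (v 0))\<^sup>2 + (cmod (v 1))\<^sup>2 + (cmod (v 2))\<^sup>2) * ((cmod (w 0))\<^sup>2 + (cmod (w 1))\<^sup>2 + (cmod (w 2))\<^sup>2))"
proof -
  define a b c where abc: "a = v 1 * w 2 - v 2 * w 1" "b = v 2 * w 0 - v 0 * w 2" "c = v 0 * w 1 - v 1 * w 0"
  have e: "u 0 * (v 1 * w 2 - v 2 * w 1) - v 0 * (u 1 * w 2 - u 2 * w 1) + w 0 * (u 1 * v 2 - u 2 * v 1) = u 0 * a + u 1 * b + u 2 * c"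
    by (simp add: abc algebra_simps)
  have "cmod (u 0 * a + u 1 * b + u 2 * c) \<le> cmod (u 0) * cmod a + cmod (u 1) * cmod b + cmod (u 2) * cmod c"
    using norm_triangle_ineq[of "u 0 * a + u 1 * b" "u 2 * c"] norm_triangle_ineq[of "u 0 * a" "u 1 * b"]
    by (simp add: norm_mult)
  then have "(cmod (u 0 * a + u 1 * b + u 2 * c))\<^sup>2 \<le> (cmod (u 0) * cmod a + cmod (u 1) * cmod b + cmod (u 2) * cmod c)\<^sup>2"
    by (rule power_mono) simp
  also have "\<dots> \<le> ((cmod (u 0))\<^sup>2 + (cmod (u 1))\<^sup>2 + (cmod (u 2))\<^sup>2) * ((cmod a)\<^sup>2 + (cmod b)\<^sup>2 + (cmod c)\<^sup>2)"
  proof -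
    have cs: "(x1\<^sup>2 + x2\<^sup>2 + x3\<^sup>2) * (y1\<^sup>2 + y2\<^sup>2 + y3\<^sup>2) - (x1 * y1 + x2 * y2 + x3 * y3)\<^sup>2 =
      (x1 * y2 - x2 * y1)\<^sup>2 + (x1 * y3 - x3 * y1)\<^sup>2 + (x2 * y3 - x3 * y2)\<^sup>2" for x1 x2 x3 y1 y2 y3 :: real
      by (simp add: power2_eq_square algebra_simps)
    have "(x1 * y1 + x2 * y2 + x3 * y3)\<^sup>2 \<le> (x1\<^sup>2 + x2\<^sup>2 + x3\<^sup>2) * (y1\<^sup>2 + y2\<^sup>2 + y3\<^sup>2)" for x1 x2 x3 y1 y2 y3 :: real
    proof -
      have "0 \<le> (x1 * y2 - x2 * y1)\<^sup>2 + (x1 * y3 - x3 * y1)\<^sup>2 + (x2 * y3 - x3 * y2)\<^sup>2"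
        by (intro add_nonneg_nonneg zero_le_power2)
      then show ?thesis using cs[of x1 x2 x3 y1 y2 y3] by linarith
    qed
    then show ?thesis .
  qed
  also have "\<dots> \<le> ((cmod (u 0))\<^sup>2 + (cmod (u 1))\<^sup>2 + (cmod (u 2))\<^sup>2) *
      (((cmod (v 0))\<^sup>2 + (cmod (v 1))\<^sup>2 + (cmod (v 2))\<^sup>2) * ((cmod (w 0))\<^sup>2 + (cmod (w 1))\<^sup>2 + (cmod (w 2))\<^sup>2))"
  proof (rule mult_left_mono)
    define z where "z = v 0 * cnj (w 0) + v 1 * cnj (w 1) + v 2 * cnj (w 2)"
    have "complex_of_real (((cmod (v 0))\<^sup>2 + (cmod (v 1))\<^sup>2 + (cmod (v 2))\<^sup>2) * ((cmod (w 0))\<^sup>2 + (cmod (w 1))\<^sup>2 + (cmod (w 2))\<^sup>2)) =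
      complex_of_real ((cmod a)\<^sup>2 + (cmod b)\<^sup>2 + (cmod c)\<^sup>2 + (cmod z)\<^sup>2)"
      unfolding of_real_add of_real_mult complex_norm_square
      by (simp add: abc z_def algebra_simps)
    then have "((cmod (v 0))\<^sup>2 + (cmod (v 1))\<^sup>2 + (cmod (v 2))\<^sup>2) * ((cmod (w 0))\<^sup>2 + (cmod (w 1))\<^sup>2 + (cmod (w 2))\<^sup>2) =
      (cmod a)\<^sup>2 + (cmod b)\<^sup>2 + (cmod c)\<^sup>2 + (cmod z)\<^sup>2" by (simp only: of_real_eq_iff)
    then show "(cmod a)\<^sup>2 + (cmod b)\<^sup>2 + (cmod c)\<^sup>2 \<le> ((cmod (v 0))\<^sup>2 + (cmod (v 1))\<^sup>2 + (cmod (v 2))\<^sup>2) * ((cmod (w 0))\<^sup>2 + (cmod (w 1))\<^sup>2 + (cmod (w 2))\<^sup>2)"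
      by (simp only: zero_le_power2 le_add_same_cancel1)
  qed simp
  finally show ?thesis unfolding e .
qed

text \<open>Hadamard gives the constant \<open>3 ^ 3 = 27\<close> instead of the
  \<open>(3!) ^ 2 = 36\<close> of Leibniz's expansion.\<close>

lemma (in nf) disc_bound_cubic:
  assumes d3: "d = 3" and "S \<subseteq> OK" "\<And>x. x \<in> S \<Longrightarrow> ht x \<le> h" "h \<ge> 0"
    "\<And>l. subfield_of_type l \<Longrightarrow> l \<subseteq> k \<Longrightarrow> S \<subseteq> l \<Longrightarrow> l = k"
  shows "ln (abs_discriminant k) \<le> ln 27 + 4 * h"
proof -
  have "ln (abs_discriminant k) \<le> ln 27 + 2 * (real d - 1) * h"
  proof (rule disc_bound_general[OF assms(2-5)])
    fix A B assume A: "A \<in> carrier_mat d d" and B: "\<And>i j. i < d \<Longrightarrow> j < d \<Longrightarrow> cmod (A $$ (i, j)) \<le> B i"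
    have sq: "(cmod (A $$ (i, 0)))\<^sup>2 + (cmod (A $$ (i, 1)))\<^sup>2 + (cmod (A $$ (i, 2)))\<^sup>2 \<le> 3 * (B i)\<^sup>2" if i: "i < 3" for i
      using power_mono[OF B[of i 0], of 2] power_mono[OF B[of i 1], of 2] power_mono[OF B[of i 2], of 2] i d3 by simp
    have "(cmod (det A))\<^sup>2 \<le> ((cmod (A $$ (0, 0)))\<^sup>2 + (cmod (A $$ (0, 1)))\<^sup>2 + (cmod (A $$ (0, 2)))\<^sup>2) *
      (((cmod (A $$ (1, 0)))\<^sup>2 + (cmod (A $$ (1, 1)))\<^sup>2 + (cmod (A $$ (1, 2)))\<^sup>2) *
       ((cmod (A $$ (2, 0)))\<^sup>2 + (cmod (A $$ (2, 1)))\<^sup>2 + (cmod (A $$ (2, 2)))\<^sup>2))"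
      using hadamard_3[of "\<lambda>j. A $$ (0, j)" "\<lambda>j. A $$ (1, j)" "\<lambda>j. A $$ (2, j)"] A
      by (simp add: det_3 d3)
    also have "\<dots> \<le> (3 * (B 0)\<^sup>2) * ((3 * (B 1)\<^sup>2) * (3 * (B 2)\<^sup>2))"
      by (intro mult_mono sq) (auto intro!: mult_nonneg_nonneg add_nonneg_nonneg)
    also have "\<dots> = 27 * (\<Prod>i<d. B i)\<^sup>2"
      by (simp add: d3 numeral_3_eq_3 numeral_2_eq_2 power_mult_distrib)
    finally show "(cmod (det A))\<^sup>2 \<le> 27 * (\<Prod>i<d. B i)\<^sup>2" .
  qed
  then show ?thesis by (simp add: d3)
qed

section \<open>Relative units\<close>

text \<open>\<open>ov\<close> maps the places of \<open>k\<close> to those of \<open>l\<close>,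
  \<open>U\<close> collects \<open>c\<close> over the fibers, and \<open>t\<close> is the deviation
  from distributing \<open>U\<close> with weights \<open>p\<close>. As the weights in a fiber sum to
  1, the deviations in it sum to 0, so the one at a distinguished place is controlled by the rest:
  hence the factor 2. The distinguished places are \<open>0..<\<rho>\<close> and \<open>r\<close>,
  which leaves \<open>\<rho>..<r\<close>.\<close>

lemma fiber_abs_bound:
  fixes ov :: "nat \<Rightarrow> nat" and p c :: "nat \<Rightarrow> real"
  assumes \<rho>r: "\<rho> \<le> r" and ov: "\<And>j. j \<le> r \<Longrightarrow> ov j \<le> \<rho>" "\<And>j. j < \<rho> \<Longrightarrow> ov j = j" "ov r = \<rho>"
    and p: "\<And>j. j \<le> r \<Longrightarrow> 0 \<le> p j" "\<And>i. i \<le> \<rho> \<Longrightarrow> (\<Sum>j | j \<in> {..r} \<and> ov j = i. p j) = 1"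
    and U: "\<And>i. i \<le> \<rho> \<Longrightarrow> U i = (\<Sum>j | j \<in> {..r} \<and> ov j = i. c j)"
    and t: "\<And>j. j \<le> r \<Longrightarrow> t j = c j - p j * U (ov j)"
  shows "(\<Sum>j\<le>r. \<bar>c j\<bar>) \<le> (\<Sum>i\<le>\<rho>. \<bar>U i\<bar>) + 2 * (\<Sum>j = \<rho>..<r. \<bar>t j\<bar>)"
proof -
  let ?F = "\<lambda>i. {j. j \<in> {..r} \<and> ov j = i}" and ?E = "\<lambda>i. {j. j \<in> {\<rho>..<r} \<and> ov j = i}"
  have fin: "finite (?F i)" for i by simp
  have one: "(\<Sum>j\<in>?F i. \<bar>c j\<bar>) \<le> \<bar>U i\<bar> + 2 * (\<Sum>j\<in>?E i. \<bar>t j\<bar>)" if i: "i \<le> \<rho>" for i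
  proof -
    \<comment> \<open>The distinguished place of the fiber over \<open>i\<close>.\<close>
    define z where "z = (if i < \<rho> then i else r)"
    have z: "z \<in> ?F i" using i ov \<rho>r by (auto simp: z_def)
    have FE: "?F i - {z} = ?E i"
    proof (rule Set.set_eqI)
      fix j show "j \<in> ?F i - {z} \<longleftrightarrow> j \<in> ?E i"
        using ov(2)[of j] ov(3) i \<rho>r by (cases "j < \<rho>"; cases "i < \<rho>"; cases "j = r") (auto simp: z_def)
    qed
    have tc: "t j = c j - p j * U i" if "j \<in> ?F i" for j using t[of j] that by auto
    have "(\<Sum>j\<in>?F i. t j) = (\<Sum>j\<in>?F i. c j) - (\<Sum>j\<in>?F i. p j) * U i"
      using tc by (simp add: sum_subtractf sum_distrib_right)
    also have "\<dots> = 0" using U[OF i] p(2)[OF i] by simp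
    finally have "t z = - (\<Sum>j\<in>?F i - {z}. t j)" using sum.remove[OF fin z, of t] by linarith
    then have tz: "\<bar>t z\<bar> \<le> (\<Sum>j\<in>?E i. \<bar>t j\<bar>)" unfolding FE by (simp add: sum_abs)
    have "(\<Sum>j\<in>?F i. \<bar>c j\<bar>) \<le> (\<Sum>j\<in>?F i. p j * \<bar>U i\<bar> + \<bar>t j\<bar>)"
    proof (rule sum_mono)
      fix j assume j: "j \<in> ?F i"
      have "c j = p j * U i + t j" using tc[OF j] by simp
      then show "\<bar>c j\<bar> \<le> p j * \<bar>U i\<bar> + \<bar>t j\<bar>"
        using p(1)[of j] j abs_triangle_ineq[of "p j * U i" "t j"] by (simp add: abs_mult)
    qed
    also have "\<dots> = (\<Sum>j\<in>?F i. p j) * \<bar>U i\<bar> + (\<Sum>j\<in>?F i. \<bar>t j\<bar>)"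
      by (simp add: sum.distrib sum_distrib_right)
    also have "(\<Sum>j\<in>?F i. \<bar>t j\<bar>) = \<bar>t z\<bar> + (\<Sum>j\<in>?E i. \<bar>t j\<bar>)"
      using sum.remove[OF fin z, of "\<lambda>j. \<bar>t j\<bar>"] unfolding FE .
    finally show ?thesis using tz p(2)[OF i] by simp
  qed
  have "(\<Sum>j\<le>r. \<bar>c j\<bar>) = (\<Sum>i\<le>\<rho>. \<Sum>j\<in>?F i. \<bar>c j\<bar>)"
    by (rule sum.group[symmetric]) (use ov(1) in auto)
  also have "\<dots> \<le> (\<Sum>i\<le>\<rho>. \<bar>U i\<bar> + 2 * (\<Sum>j\<in>?E i. \<bar>t j\<bar>))"
    by (rule sum_mono) (use one in auto)
  also have "\<dots> = (\<Sum>i\<le>\<rho>. \<bar>U i\<bar>) + 2 * (\<Sum>i\<le>\<rho>. \<Sum>j\<in>?E i. \<bar>t j\<bar>)"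
    by (simp add: sum.distrib sum_distrib_left)
  also have "(\<Sum>i\<le>\<rho>. \<Sum>j\<in>?E i. \<bar>t j\<bar>) = (\<Sum>j = \<rho>..<r. \<bar>t j\<bar>)"
    by (rule sum.group) (use ov(1) in auto)
  finally show ?thesis .
qed

lemma mdet_mult: "mdet r (\<lambda>i l. \<Sum>j<r. A i j * B j l) = mdet r A * mdet r B"
proof -
  have "mat r r (\<lambda>(i, l). \<Sum>j<r. A i j * B j l) = mat r r (\<lambda>(i, j). A i j) * mat r r (\<lambda>(i, j). B i j)"
    by (rule eq_matI) (auto simp: scalar_prod_def atLeast0LessThan)
  then show ?thesis by (simp add: mdet_def det_mult[of _ r])
qed

lemma mdet_upper:
  assumes "\<And>i j. i < r \<Longrightarrow> j < i \<Longrightarrow> A i j = 0"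
  shows "mdet r A = (\<Prod>i<r. A i i)"
proof -
  have "upper_triangular (mat r r (\<lambda>(i, j). A i j))" using assms by auto
  from det_upper_triangular[OF this, of r] show ?thesis
    by (simp add: mdet_def prod_list_diag_prod atLeast0LessThan)
qed

lemma mdet_lower:
  assumes "\<And>i j. i < r \<Longrightarrow> i < j \<Longrightarrow> j < r \<Longrightarrow> A i j = 0"
  shows "mdet r A = (\<Prod>i<r. A i i)"
  by (subst mdet_transpose, subst mdet_upper) (use assms in auto)

lemma mdet_cong: "(\<And>i j. i < r \<Longrightarrow> j < r \<Longrightarrow> A i j = B i j) \<Longrightarrow> mdet r A = mdet r B"
  unfolding mdet_def by (rule arg_cong[where f = det], rule eq_matI) auto

text \<open>The logarithms of a unit sum to 0, so their positive parts make up half of the absolute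
  sum.\<close>

lemma (in nf) two_ht:
  assumes ps: "place_representatives k ps" and u: "u \<in> integer_units k"
  shows "2 * ht u = (\<Sum>\<sigma>\<in>set ps. \<bar>lv \<sigma> u\<bar>)"
proof -
  have "2 * ht u = (\<Sum>\<sigma>\<in>embeddings k. 2 * max 0 (ln (cmod (\<sigma> u))))" by (simp add: ht_def sum_distrib_left)
  also have "\<dots> = (\<Sum>\<sigma>\<in>embeddings k. \<bar>ln (cmod (\<sigma> u))\<bar> + ln (cmod (\<sigma> u)))"
    by (rule sum.cong) auto
  also have "\<dots> = (\<Sum>\<sigma>\<in>embeddings k. \<bar>ln (cmod (\<sigma> u))\<bar>)" using sum_ln_units[OF u] by (simp add: sum.distrib)
  also have "\<dots> = (\<Sum>\<sigma>\<in>set ps. real (local_degree k \<sigma>) * \<bar>ln (cmod (\<sigma> u))\<bar>)"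
    by (rule sum_places[OF ps]) (simp add: cj_apply units_k[OF u])
  also have "\<dots> = (\<Sum>\<sigma>\<in>set ps. \<bar>lv \<sigma> u\<bar>)" by (simp add: lv_def abs_mult)
  finally show ?thesis .
qed

section \<open>Places and units in an extension of number fields\<close>

locale nf_ext = K: nf k d + L: nf l n
  for k :: "'a::field_char_0 set" and d and l :: "'a set" and n +
  fixes m :: nat
  assumes lk: "degree_over l k m"
begin

lemma l_subset: "l \<subseteq> k" using lk by (auto simp: degree_over_def)

lemma m_pos: "m > 0" by (rule degree_over_pos[OF lk])

lemma d_eq: "d = n * m"
proof -
  obtain a b where ab: "degree_over \<rat> l a" "degree_over l k b" "d = a * b"
    by (rule degree_over_tower[OF K.kd L.sub sf_Rats[OF L.sub] l_subset])
  have "a = n" "b = m" using degree_over_unique[OF ab(1) L.kd] degree_over_unique[OF ab(2) lk] by auto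
  then show ?thesis using ab(3) by simp
qed

lemma units_l_iff: "u \<in> integer_units l \<longleftrightarrow> u \<in> integer_units k \<and> u \<in> l"
  unfolding L.integer_units_iff K.integer_units_iff
  using l_subset sf_inverse[OF L.sub, of u] sf_inverse[OF K.sub, of u]
  by (auto simp: ring_of_integers_def)

definition res :: "('a \<Rightarrow> complex) \<Rightarrow> 'a \<Rightarrow> complex" where "res \<tau> = restrict \<tau> l"

lemma res_emb: "\<tau> \<in> embeddings k \<Longrightarrow> res \<tau> \<in> embeddings l"
  unfolding res_def by (rule emb_restrict[OF K.sub _ L.sub l_subset])

lemma res_apply: "x \<in> l \<Longrightarrow> res \<tau> x = \<tau> x" by (simp add: res_def)

lemma res_cj: "\<tau> \<in> embeddings k \<Longrightarrow> res (K.cj \<tau>) = L.cj (res \<tau>)"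
  by (rule L.emb_eqI)
    (use l_subset in \<open>auto simp: res_emb K.cj_emb L.cj_emb res_apply K.cj_apply L.cj_apply subset_iff\<close>)

context
  fixes ws assumes ws: "place_representatives l ws"
begin

definition place_below :: "('a \<Rightarrow> complex) \<Rightarrow> 'a \<Rightarrow> complex" where
  "place_below \<tau> = (THE w. w \<in> set ws \<and> (w = res \<tau> \<or> w = L.cj (res \<tau>)))"

lemma place_below: assumes "\<tau> \<in> embeddings k" shows "place_below \<tau> \<in> set ws" "place_below \<tau> = res \<tau> \<or> place_below \<tau> = L.cj (res \<tau>)"
proof -
  have "\<exists>!w. w \<in> set ws \<and> (w = res \<tau> \<or> w = L.cj (res \<tau>))"
    using ws res_emb[OF assms] unfolding L.place_reps_iff by blast
  from theI'[OF this] show "place_below \<tau> \<in> set ws" "place_below \<tau> = res \<tau> \<or> place_below \<tau> = L.cj (res \<tau>)"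
    by (auto simp: place_below_def)
qed

lemma place_below_eqI: "\<tau> \<in> embeddings k \<Longrightarrow> w \<in> set ws \<Longrightarrow> w = res \<tau> \<or> w = L.cj (res \<tau>) \<Longrightarrow> place_below \<tau> = w"
  using ws res_emb place_below unfolding L.place_reps_iff by blast

lemma place_below_cj: assumes t: "\<tau> \<in> embeddings k" shows "place_below (K.cj \<tau>) = place_below \<tau>"
  by (rule place_below_eqI[OF K.cj_emb[OF t] place_below(1)[OF t]])
    (use place_below(2)[OF t] L.cj_cj[OF res_emb[OF t]] in \<open>auto simp: res_cj[OF t]\<close>)

lemma place_below_iff: assumes t: "\<tau> \<in> embeddings k" and w: "w \<in> set ws"
  shows "place_below \<tau> = w \<longleftrightarrow> res \<tau> = w \<or> res \<tau> = L.cj w"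
proof
  assume "place_below \<tau> = w"
  then show "res \<tau> = w \<or> res \<tau> = L.cj w" using place_below(2)[OF t] L.cj_cj[OF res_emb[OF t]] by auto
next
  assume "res \<tau> = w \<or> res \<tau> = L.cj w"
  then show "place_below \<tau> = w" using place_below_eqI[OF t w] L.cj_cj[OF L.ps_emb[OF ws w]] by auto
qed

lemma place_below_cmod: assumes t: "\<tau> \<in> embeddings k" and x: "x \<in> l" shows "cmod (\<tau> x) = cmod (place_below \<tau> x)"
  using place_below(2)[OF t] res_apply[OF x, of \<tau>] L.cj_apply[OF x, of "res \<tau>"] by auto

text \<open>The left side counts the embeddings of \<open>k\<close> restricting to \<open>w\<close>
  or to its conjugate, and each of these has \<open>m\<close> extensions.\<close>

lemma sum_fiber:
  assumes ps: "place_representatives k ps" and w: "w \<in> set ws"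
  shows "(\<Sum>\<tau> | \<tau> \<in> set ps \<and> place_below \<tau> = w. real (local_degree k \<tau>)) = real m * real (local_degree l w)"
proof -
  have we: "w \<in> embeddings l" by (rule L.ps_emb[OF ws w])
  have "(\<Sum>\<tau>\<in>embeddings k. if place_below \<tau> = w then 1 else 0) =
    (\<Sum>\<tau>\<in>set ps. real (local_degree k \<tau>) * (if place_below \<tau> = w then 1 else 0))"
    by (rule K.sum_places[OF ps]) (simp add: place_below_cj)
  moreover have "(\<Sum>\<tau>\<in>set ps. real (local_degree k \<tau>) * (if place_below \<tau> = w then 1 else 0)) =
    (\<Sum>\<tau> | \<tau> \<in> set ps \<and> place_below \<tau> = w. real (local_degree k \<tau>))"
    by (rule sum.mono_neutral_cong_right) auto
  moreover have "(\<Sum>\<tau>\<in>embeddings k. if place_below \<tau> = w then 1 else 0 :: real) = real (card {\<tau> \<in> embeddings k. place_below \<tau> = w})"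
    using K.finite_emb by (simp add: sum.If_cases Int_def)
  moreover have "{\<tau> \<in> embeddings k. place_below \<tau> = w} = (\<Union>\<sigma>\<in>{w, L.cj w}. emb_ext l k \<sigma>)"
  proof -
    have "\<tau> \<in> emb_ext l k \<sigma> \<longleftrightarrow> \<tau> \<in> embeddings k \<and> res \<tau> = \<sigma>" if s: "\<sigma> \<in> embeddings l" for \<tau> \<sigma>
    proof -
      have "(\<forall>x\<in>l. \<tau> x = \<sigma> x) \<longleftrightarrow> res \<tau> = \<sigma>" if "\<tau> \<in> embeddings k"
        using L.emb_eqI[OF res_emb[OF that] s] res_apply[of _ \<tau>] by metis
      then show ?thesis by (auto simp: emb_ext_def)
    qed
    moreover have "{\<tau> \<in> embeddings k. place_below \<tau> = w} = {\<tau> \<in> embeddings k. res \<tau> = w \<or> res \<tau> = L.cj w}"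
      by (rule Collect_cong) (use place_below_iff[OF _ w] in blast)
    ultimately show ?thesis using we L.cj_emb[OF we] by auto
  qed
  moreover have "card (\<Union>\<sigma>\<in>{w, L.cj w}. emb_ext l k \<sigma>) = (\<Sum>\<sigma>\<in>{w, L.cj w}. card (emb_ext l k \<sigma>))"
  proof (rule card_UN_disjoint)
    show "\<forall>\<sigma>\<in>{w, L.cj w}. finite (emb_ext l k \<sigma>)"
      using card_emb_ext[OF lk] we L.cj_emb[OF we] by auto
    show "\<forall>\<sigma>\<in>{w, L.cj w}. \<forall>\<sigma>'\<in>{w, L.cj w}. \<sigma> \<noteq> \<sigma>' \<longrightarrow> emb_ext l k \<sigma> \<inter> emb_ext l k \<sigma>' = {}"
    proof (intro ballI impI, rule ccontr)
      fix \<sigma> \<sigma>' assume s: "\<sigma> \<in> {w, L.cj w}" "\<sigma>' \<in> {w, L.cj w}" "\<sigma> \<noteq> \<sigma>'" "emb_ext l k \<sigma> \<inter> emb_ext l k \<sigma>' \<noteq> {}"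
      then obtain \<tau> where "\<tau> \<in> emb_ext l k \<sigma>" "\<tau> \<in> emb_ext l k \<sigma>'" by auto
      then have eq: "\<sigma> x = \<sigma>' x" if "x \<in> l" for x using that by (auto simp: emb_ext_def)
      have "\<sigma> \<in> embeddings l" "\<sigma>' \<in> embeddings l" using s we L.cj_emb[OF we] by auto
      from L.emb_eqI[OF this eq] show False using s by simp
    qed
  qed simp
  moreover have "(\<Sum>\<sigma>\<in>{w, L.cj w}. card (emb_ext l k \<sigma>)) = m * local_degree l w"
  proof -
    have "(\<Sum>\<sigma>\<in>{w, L.cj w}. card (emb_ext l k \<sigma>)) = (\<Sum>\<sigma>\<in>{w, L.cj w}. m)"
      by (rule sum.cong) (use card_emb_ext[OF lk] we L.cj_emb[OF we] in auto)
    then show ?thesis by (simp only: L.local_degree_card[OF we] sum_constant of_nat_id mult.commute)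
  qed
  ultimately show ?thesis by simp
qed

lemma fiber_nonempty:
  assumes ps: "place_representatives k ps" and w: "w \<in> set ws"
  shows "\<exists>\<tau>\<in>set ps. place_below \<tau> = w"
proof (rule ccontr)
  assume "\<not> ?thesis"
  then have "{\<tau>. \<tau> \<in> set ps \<and> place_below \<tau> = w} = {}" by auto
  then have "real m * real (local_degree l w) = 0" using sum_fiber[OF assms] by (metis sum.empty)
  then show False using m_pos L.local_degree_pos[of w] by simp
qed

text \<open>An order of the places of \<open>k\<close> suited to the fibers: one place over each
  non-final place of \<open>l\<close> comes first, and the final place lies over the final one of
  \<open>l\<close>. The relative directions then have the contiguous indices from
  \<open>L.nplaces - 1\<close> up to the omitted last place.\<close>

lemma ex_adapted_places:
  "\<exists>ps. place_representatives k ps \<and> L.nplaces \<le> K.nplaces \<and>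
    (\<forall>i<L.nplaces - 1. place_below (ps ! i) = ws ! i) \<and> place_below (ps ! (K.nplaces - 1)) = ws ! (L.nplaces - 1)"
proof -
  obtain ps where ps: "place_representatives k ps" using K.ex_place_reps by blast
  define z where "z = (\<lambda>w. SOME \<tau>. \<tau> \<in> set ps \<and> place_below \<tau> = w)"
  have z: "z w \<in> set ps \<and> place_below (z w) = w" if w: "w \<in> set ws" for w
  proof -
    obtain \<tau> where "\<tau> \<in> set ps \<and> place_below \<tau> = w" using fiber_nonempty[OF ps w] by blast
    then show ?thesis unfolding z_def by (rule someI[of "\<lambda>\<tau>. \<tau> \<in> set ps \<and> place_below \<tau> = w"])
  qed
  have inj: "inj_on z (set ws)" by (rule inj_onI) (metis z)
  have lw: "length ws = L.nplaces" by (rule L.length_places[OF ws])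
  have wne: "ws \<noteq> []" using lw L.nplaces_pos by auto
  obtain xs where xs: "distinct xs" "set xs = set ps - z ` set ws"
    using finite_distinct_list[of "set ps - z ` set ws"] by auto
  define qs where "qs = map z (butlast ws) @ xs @ [z (last ws)]"
  have dw: "distinct ws" by (rule L.ps_distinct[OF ws])
  have wsplit: "ws = butlast ws @ [last ws]" using wne by simp
  have sw: "set ws = insert (last ws) (set (butlast ws))" by (subst wsplit) simp
  have lnb: "last ws \<notin> set (butlast ws)" using dw wsplit by (metis distinct_append distinct.simps(2) disjoint_iff list.set_intros(1))
  have "distinct qs" unfolding qs_def distinct_append
  proof (intro conjI)
    show "distinct (map z (butlast ws))"
      using dw inj sw by (simp add: distinct_map distinct_butlast inj_on_subset)
    show "distinct xs" by (rule xs)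
    show "distinct [z (last ws)]" by simp
    show "set xs \<inter> set [z (last ws)] = {}" using xs(2) sw by auto
    show "set (map z (butlast ws)) \<inter> set (xs @ [z (last ws)]) = {}"
    proof -
      have "z w \<noteq> z (last ws)" if "w \<in> set (butlast ws)" for w
        using inj that lnb sw by (metis inj_onD insertCI)
      then have "z (last ws) \<notin> z ` set (butlast ws)" by (metis imageE)
      moreover have "set xs \<inter> z ` set (butlast ws) = {}" using xs(2) sw by auto
      ultimately show ?thesis by auto
    qed
  qed
  moreover have sq: "set qs = set ps"
  proof -
    have "set qs = z ` set ws \<union> (set ps - z ` set ws)" unfolding qs_def using xs(2) sw by auto
    then show ?thesis using z by auto
  qed
  ultimately have qs: "place_representatives k qs" using ps unfolding K.place_reps_iff by simp
  have lq: "length qs = K.nplaces" by (rule K.length_places[OF qs])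
  have lq': "length qs = (L.nplaces - 1) + length xs + 1" by (simp add: qs_def lw)
  have "place_below (qs ! i) = ws ! i" if i: "i < L.nplaces - 1" for i
  proof -
    have "qs ! i = z (ws ! i)" using i lw by (simp add: qs_def nth_append nth_butlast)
    then show ?thesis using z[of "ws ! i"] i lw by simp
  qed
  moreover have "place_below (qs ! (K.nplaces - 1)) = ws ! (L.nplaces - 1)"
  proof -
    have "qs \<noteq> []" by (simp add: qs_def)
    then have "qs ! (K.nplaces - 1) = last qs" using last_conv_nth[of qs] lq by argo
    also have "\<dots> = z (last ws)" by (simp add: qs_def)
    finally have "place_below (qs ! (K.nplaces - 1)) = last ws" using z[OF last_in_set[OF wne]] by simp
    then show ?thesis using last_conv_nth[OF wne] lw by simp
  qed
  ultimately show ?thesis using qs lq lq' L.nplaces_pos by (intro exI[of _ qs]) auto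
qed

end

lemma nplaces_mono: "L.nplaces \<le> K.nplaces"
proof -
  obtain ws where ws: "place_representatives l ws" using L.ex_place_reps by blast
  show ?thesis using ex_adapted_places[OF ws] by blast
qed

text \<open>If \<open>k\<close> has no more places than a proper subfield \<open>l\<close>, then exactly one place of \<open>k\<close> lies over each
  place \<open>w\<close> of \<open>l\<close>, and its local degree is \<open>m\<close> times that of \<open>w\<close>; this forces \<open>m = 2\<close>.\<close>

lemma nplaces_eq_imp_CM:
  assumes eq: "K.nplaces = L.nplaces" and m: "m \<ge> 2"
  shows "CM_field k"
proof -
  obtain ws where ws: "place_representatives l ws" using L.ex_place_reps by blast
  obtain ps where ps: "place_representatives k ps" using K.ex_place_reps by blast
  note ov = place_below[OF ws]
  have im: "place_below ws ` set ps = set ws"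
  proof (intro equalityI subsetI)
    fix w assume "w \<in> place_below ws ` set ps"
    then show "w \<in> set ws" using ov(1) K.ps_emb[OF ps] by auto
  next
    fix w assume "w \<in> set ws"
    then show "w \<in> place_below ws ` set ps" using fiber_nonempty[OF ws ps] by blast
  qed
  have "card (set ps) = card (set ws)"
    using eq K.length_places[OF ps] L.length_places[OF ws] distinct_card[OF K.ps_distinct[OF ps]]
      distinct_card[OF L.ps_distinct[OF ws]] by simp
  then have inj: "inj_on (place_below ws) (set ps)" using im by (intro eq_card_imp_inj_on) auto
  have key: "local_degree k \<tau> = 2 \<and> local_degree l (place_below ws \<tau>) = 1 \<and> m = 2" if t: "\<tau> \<in> set ps" for \<tau>
  proof -
    have "{\<tau>'. \<tau>' \<in> set ps \<and> place_below ws \<tau>' = place_below ws \<tau>} = {\<tau>}" using inj t by (auto dest: inj_onD)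
    then have "real (local_degree k \<tau>) = real m * real (local_degree l (place_below ws \<tau>))"
      using sum_fiber[OF ws ps ov(1)[OF K.ps_emb[OF ps t]]] by simp
    then have e: "local_degree k \<tau> = m * local_degree l (place_below ws \<tau>)" by (simp only: of_nat_eq_iff flip: of_nat_mult)
    have "local_degree k \<tau> \<le> 2" by (simp add: local_degree_def)
    moreover have "local_degree l (place_below ws \<tau>) \<ge> 1" using L.local_degree_pos[of "place_below ws \<tau>"] by simp
    moreover have "m * 1 \<le> m * local_degree l (place_below ws \<tau>)" using calculation(2) by (rule mult_le_mono2)
    ultimately have "m = 2" "local_degree k \<tau> = 2" using e m by linarith+
    then show ?thesis using e by simp
  qed
  have m2: "m = 2"
  proof -
    have "set ps \<noteq> {}" using K.length_places[OF ps] K.nplaces_pos by auto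
    then obtain \<tau> where "\<tau> \<in> set ps" by (meson all_not_in_conv)
    then show ?thesis using key by simp
  qed
  have "totally_imaginary k" unfolding totally_imaginary_def
  proof
    fix \<tau> assume t: "\<tau> \<in> embeddings k"
    obtain \<sigma> where s: "\<sigma> \<in> set ps" "\<sigma> = \<tau> \<or> \<sigma> = K.cj \<tau>" using K.ps_ex[OF ps t] by blast
    have "\<not> real_embedding k \<sigma>" using key[OF s(1)] by (auto simp: local_degree_def split: if_splits)
    then show "\<not> real_embedding k \<tau>" using s(2) K.cj_real[OF t] by auto
  qed
  moreover have "totally_real l" unfolding totally_real_def
  proof
    fix \<sigma> assume s: "\<sigma> \<in> embeddings l"
    obtain w where w: "w \<in> set ws" "w = \<sigma> \<or> w = L.cj \<sigma>" using L.ps_ex[OF ws s] by blast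
    obtain \<tau> where "\<tau> \<in> set ps" "place_below ws \<tau> = w" using fiber_nonempty[OF ws ps w(1)] by blast
    then have "local_degree l w = 1" using key by blast
    then have "real_embedding l w" by (simp add: local_degree_def split: if_splits)
    then have "L.cj w = w" using L.cj_real[OF L.ps_emb[OF ws w(1)]] by simp
    then have "w = \<sigma>" using w(2) L.cj_cj[OF s] by auto
    then show "real_embedding l \<sigma>" using \<open>real_embedding l w\<close> by simp
  qed
  ultimately show ?thesis unfolding CM_field_def
    using K.number_field L.number_field l_subset lk m2 by (auto simp: degree_over_def)
qed

lemma unit_rank_less:
  assumes "\<not> CM_field k" "l \<noteq> k"
  shows "unit_rank l < unit_rank k"
proof -
  have "m \<noteq> 1" using degree_over_1_eq lk assms(2) by blast
  then have "m \<ge> 2" using m_pos by simp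
  then have "K.nplaces \<noteq> L.nplaces" using nplaces_eq_imp_CM assms(1) by blast
  then show ?thesis using nplaces_mono L.nplaces_pos by (simp add: K.unit_rank_eq L.unit_rank_eq)
qed

end

text \<open>The new matrix is \<open>T3 * T2 * T1 * C\<close>. \<open>T1\<close> replaces the first
  \<open>\<rho>\<close> rows by fiber sums, \<open>T2\<close> subtracts their weighted shares from
  the other rows, and \<open>T3\<close> rescales. The first two are triangular with unit diagonal;
  the signs in \<open>T3\<close> disappear in the absolute value.\<close>

lemma mdet_fiber_matrix:
  fixes ov :: "nat \<Rightarrow> nat" and C U :: "nat \<Rightarrow> nat \<Rightarrow> real"
  assumes \<rho>r: "\<rho> \<le> r" and ov: "\<And>j. j \<le> r \<Longrightarrow> ov j \<le> \<rho>" "\<And>j. j < \<rho> \<Longrightarrow> ov j = j" "ov r = \<rho>"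
    and zero: "\<And>l. l < r \<Longrightarrow> (\<Sum>j\<le>r. C j l) = 0"
    and U: "\<And>i l. i \<le> \<rho> \<Longrightarrow> l < r \<Longrightarrow> U i l = (\<Sum>j | j \<in> {..r} \<and> ov j = i. C j l)"
    and A: "A > 0" and \<tau>: "\<tau> > 0"
  shows "\<bar>mdet r (\<lambda>i l. if i < \<rho> then - U i l / A else (C i l - p i * U (ov i) l) / \<tau>)\<bar> * (A ^ \<rho> * \<tau> ^ (r - \<rho>)) = \<bar>mdet r C\<bar>"
proof -
  define T1 :: "nat \<Rightarrow> nat \<Rightarrow> real" where
    "T1 = (\<lambda>i j. if i < \<rho> then (if ov j = i then 1 else 0) else if i = j then 1 else 0)"
  define T2 :: "nat \<Rightarrow> nat \<Rightarrow> real" where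
    \<comment> \<open>The entry -1 serves the rows over the last place of \<open>l\<close>, whose
      fiber sum is not among the first \<open>\<rho>\<close> rows but is minus the sum of
      them.\<close>
    "T2 = (\<lambda>i j. (if i = j then 1 else 0) -
      (if \<rho> \<le> i \<and> j < \<rho> then p i * (if ov i < \<rho> then (if ov i = j then 1 else 0) else - 1) else 0))"
  define s :: "nat \<Rightarrow> real" where "s = (\<lambda>i. if i < \<rho> then - 1 / A else 1 / \<tau>)"
  define T3 :: "nat \<Rightarrow> nat \<Rightarrow> real" where "T3 = (\<lambda>i j. if i = j then s i else 0)"
  define M1 where "M1 = (\<lambda>i l. \<Sum>j<r. T1 i j * C j l)"
  define M2 where "M2 = (\<lambda>i l. \<Sum>j<r. T2 i j * M1 j l)"
  define M3 where "M3 = (\<lambda>i l. \<Sum>j<r. T3 i j * M2 j l)"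
  have d1: "mdet r T1 = 1"
    by (subst mdet_upper) (use ov(2) in \<open>auto simp: T1_def intro!: prod.neutral\<close>)
  have d2: "mdet r T2 = 1"
    by (subst mdet_lower) (auto simp: T2_def intro!: prod.neutral)
  have d3: "mdet r T3 = (\<Prod>i<r. s i)"
    by (subst mdet_upper) (auto simp: T3_def)
  have s: "(\<Prod>i<r. s i) = (- 1 / A) ^ \<rho> * (1 / \<tau>) ^ (r - \<rho>)"
  proof -
    have "(\<Prod>i<r. s i) = (\<Prod>i<\<rho>. s i) * (\<Prod>i=\<rho>..<r. s i)"
      using prod.atLeastLessThan_concat[of 0 \<rho> r s] \<rho>r by (simp add: lessThan_atLeast0)
    also have "(\<Prod>i<\<rho>. s i) = (\<Prod>i<\<rho>. - 1 / A)" by (rule prod.cong) (auto simp: s_def)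
    also have "(\<Prod>i=\<rho>..<r. s i) = (\<Prod>i=\<rho>..<r. 1 / \<tau>)" by (rule prod.cong) (auto simp: s_def)
    finally show ?thesis by simp
  qed
  have M1: "M1 i l = (if i < \<rho> then U i l else C i l)" if i: "i < r" and l: "l < r" for i l
  proof (cases "i < \<rho>")
    case True
    have "M1 i l = (\<Sum>j<r. if ov j = i then C j l else 0)"
      unfolding M1_def by (rule sum.cong) (use True in \<open>auto simp: T1_def\<close>)
    also have "\<dots> = (\<Sum>j | j \<in> {..r} \<and> ov j = i. C j l)"
    proof (rule sum.mono_neutral_cong)
      fix j assume "j \<in> {j. j \<in> {..r} \<and> ov j = i} - {..<r}"
      then have "j = r" "ov j = i" by auto
      then show "C j l = 0" using ov(3) True by simp
    qed auto
    finally show ?thesis using U[of i l] True l by simp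
  next
    case False
    have "M1 i l = (\<Sum>j<r. if i = j then C j l else 0)"
      unfolding M1_def by (rule sum.cong) (use False in \<open>auto simp: T1_def\<close>)
    then show ?thesis using False i by simp
  qed
  have Us: "U \<rho> l = - (\<Sum>i<\<rho>. U i l)" if l: "l < r" for l
  proof -
    have "(\<Sum>i\<le>\<rho>. U i l) = (\<Sum>i\<le>\<rho>. \<Sum>j | j \<in> {..r} \<and> ov j = i. C j l)"
      by (rule sum.cong) (use U l in auto)
    also have "\<dots> = (\<Sum>j\<le>r. C j l)" by (rule sum.group) (use ov(1) in auto)
    also have "\<dots> = 0" by (rule zero[OF l])
    finally show ?thesis by (simp add: lessThan_Suc_atMost[symmetric])
  qed
  have M2: "M2 i l = (if i < \<rho> then U i l else C i l - p i * U (ov i) l)" if i: "i < r" and l: "l < r" for i l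
  proof -
    define c :: "nat \<Rightarrow> real" where "c = (\<lambda>j. if \<rho> \<le> i \<and> j < \<rho> then p i * (if ov i < \<rho> then (if ov i = j then 1 else 0) else - 1) else 0)"
    have "M2 i l = (\<Sum>j<r. (if i = j then M1 j l else 0) - c j * M1 j l)"
      unfolding M2_def by (rule sum.cong) (auto simp: T2_def c_def algebra_simps)
    also have "\<dots> = M1 i l - (\<Sum>j<r. c j * M1 j l)" using i by (simp add: sum_subtractf)
    also have "(\<Sum>j<r. c j * M1 j l) = (\<Sum>j<\<rho>. c j * U j l)"
      by (rule sum.mono_neutral_cong_right) (use \<rho>r M1 l in \<open>auto simp: c_def\<close>)
    also have "(\<Sum>j<\<rho>. c j * U j l) = (if i < \<rho> then 0 else p i * U (ov i) l)"
    proof (cases "i < \<rho>")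
      case True then show ?thesis by (simp add: c_def)
    next
      case False
      show ?thesis
      proof (cases "ov i < \<rho>")
        case True
        have "(\<Sum>j<\<rho>. c j * U j l) = (\<Sum>j<\<rho>. if ov i = j then p i * U j l else 0)"
          by (rule sum.cong) (use True False in \<open>auto simp: c_def\<close>)
        then show ?thesis using True False by simp
      next
        case F: False
        then have "ov i = \<rho>" using ov(1)[of i] i by simp
        moreover have "(\<Sum>j<\<rho>. c j * U j l) = (\<Sum>j<\<rho>. p i * - U j l)"
          by (rule sum.cong) (use F False in \<open>auto simp: c_def\<close>)
        ultimately show ?thesis using False Us[OF l] by (simp add: sum_negf flip: sum_distrib_left)
      qed
    qed
    finally show ?thesis using M1[OF i l] by auto
  qed
  have M3: "M3 i l = (if i < \<rho> then - U i l / A else (C i l - p i * U (ov i) l) / \<tau>)" if i: "i < r" and l: "l < r" for i l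
  proof -
    have "M3 i l = (\<Sum>j<r. if i = j then s i * M2 j l else 0)"
      unfolding M3_def by (rule sum.cong) (auto simp: T3_def)
    then show ?thesis using i M2[OF i l] by (simp add: s_def)
  qed
  have "mdet r M3 = (- 1 / A) ^ \<rho> * (1 / \<tau>) ^ (r - \<rho>) * mdet r C"
    unfolding M3_def mdet_mult M2_def M1_def by (simp add: d1 d2 d3 s)
  moreover have "mdet r M3 = mdet r (\<lambda>i l. if i < \<rho> then - U i l / A else (C i l - p i * U (ov i) l) / \<tau>)"
    by (rule mdet_cong) (rule M3)
  ultimately have "\<bar>mdet r (\<lambda>i l. if i < \<rho> then - U i l / A else (C i l - p i * U (ov i) l) / \<tau>)\<bar>
      = (1 / A) ^ \<rho> * (1 / \<tau>) ^ (r - \<rho>) * \<bar>mdet r C\<bar>"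
    using A \<tau> by (simp add: abs_mult power_abs power_divide)
  then show ?thesis using A \<tau> by (simp add: power_divide)
qed

text \<open>With \<open>S\<close> and \<open>S0\<close> the sums of the first \<open>\<rho>\<close>
  coordinates, the absolute values of \<open>U\<close> sum to at most
  \<open>A * (S0 + S) + A * \<bar>S0 - S\<bar>\<close>, hence at most \<open>2 * A\<close>; the
  deviations sum to at most \<open>2 * \<tau>\<close>. Halved by \<open>two_ht\<close>, the total
  becomes \<open>A + 2 * \<tau>\<close>. The other two claims bound the last place of
  \<open>l\<close> by the slack \<open>1 - S0\<close> of the base point.\<close>

lemma simplex_difference_bound:
  fixes z z0 :: "nat \<Rightarrow> real"
  assumes \<rho>r: "\<rho> \<le> r" and z: "z \<in> std_simplex r" and z0: "z0 \<in> std_simplex r" and A: "A > 0" and \<tau>: "\<tau> > 0"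
    and U: "\<And>i. i < \<rho> \<Longrightarrow> U i = A * (z0 i - z i)" "U \<rho> = - (\<Sum>i<\<rho>. U i)"
    and t: "\<And>j. \<rho> \<le> j \<Longrightarrow> j < r \<Longrightarrow> t j = \<tau> * (z j - z0 j)"
  shows "(\<Sum>i\<le>\<rho>. \<bar>U i\<bar>) + 2 * (\<Sum>j=\<rho>..<r. \<bar>t j\<bar>) \<le> 2 * A + 4 * \<tau>"
    and "U \<rho> \<le> A * (1 - (\<Sum>i<\<rho>. z0 i))"
    and "0 \<le> 1 - (\<Sum>i<\<rho>. z0 i)"
proof -
  have pos: "\<And>i. i < r \<Longrightarrow> 0 \<le> z i" "\<And>i. i < r \<Longrightarrow> 0 \<le> z0 i" using z z0 by (auto simp: std_simplex_def)
  have split: "(\<Sum>i<r. f i) = (\<Sum>i<\<rho>. f i) + (\<Sum>i=\<rho>..<r. f i)" for f :: "nat \<Rightarrow> real"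
    using sum.atLeastLessThan_concat[of 0 \<rho> r f] \<rho>r by (simp add: lessThan_atLeast0)
  define S S0 s s0 where "S = (\<Sum>i<\<rho>. z i)" and "S0 = (\<Sum>i<\<rho>. z0 i)" and "s = (\<Sum>i=\<rho>..<r. z i)" and "s0 = (\<Sum>i=\<rho>..<r. z0 i)"
  have nn: "0 \<le> S" "0 \<le> S0" "0 \<le> s" "0 \<le> s0"
    unfolding S_def S0_def s_def s0_def by (rule sum_nonneg; use pos \<rho>r in auto)+
  have le: "S + s \<le> 1" "S0 + s0 \<le> 1"
    using z z0 split[of z] split[of z0] by (auto simp: std_simplex_def S_def S0_def s_def s0_def)
  have "(\<Sum>i<\<rho>. U i) = (\<Sum>i<\<rho>. A * (z0 i - z i))" by (rule sum.cong) (use U(1) in auto)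
  then have SU: "(\<Sum>i<\<rho>. U i) = A * (S0 - S)" by (simp add: S_def S0_def sum_subtractf flip: sum_distrib_left)
  have "(\<Sum>i<\<rho>. \<bar>U i\<bar>) \<le> (\<Sum>i<\<rho>. A * (z0 i + z i))"
  proof (rule sum_mono)
    fix i assume "i \<in> {..<\<rho>}"
    then have "\<bar>z0 i - z i\<bar> \<le> z0 i + z i" "\<bar>U i\<bar> = A * \<bar>z0 i - z i\<bar>" using pos[of i] \<rho>r U(1)[of i] A by (auto simp: abs_mult)
    then show "\<bar>U i\<bar> \<le> A * (z0 i + z i)" using A by simp
  qed
  then have a: "(\<Sum>i<\<rho>. \<bar>U i\<bar>) \<le> A * (S0 + S)" by (simp add: S_def S0_def sum.distrib flip: sum_distrib_left)
  have b: "\<bar>U \<rho>\<bar> = A * \<bar>S0 - S\<bar>" using U(2) SU A by (simp add: abs_mult)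
  have "(\<Sum>j=\<rho>..<r. \<bar>t j\<bar>) \<le> (\<Sum>j=\<rho>..<r. \<tau> * (z j + z0 j))"
  proof (rule sum_mono)
    fix j assume "j \<in> {\<rho>..<r}"
    then have "\<bar>z j - z0 j\<bar> \<le> z j + z0 j" "\<bar>t j\<bar> = \<tau> * \<bar>z j - z0 j\<bar>" using pos[of j] t[of j] \<tau> by (auto simp: abs_mult)
    then show "\<bar>t j\<bar> \<le> \<tau> * (z j + z0 j)" using \<tau> by simp
  qed
  then have c: "(\<Sum>j=\<rho>..<r. \<bar>t j\<bar>) \<le> \<tau> * (s + s0)" by (simp add: s_def s0_def sum.distrib flip: sum_distrib_left)
  have "\<tau> * (s + s0) \<le> \<tau> * 2" using \<tau> nn le by (intro mult_left_mono) auto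
  moreover have "A * (S0 + S) + A * \<bar>S0 - S\<bar> \<le> A * 2"
    unfolding distrib_left[symmetric] using A nn le by (intro mult_left_mono) auto
  moreover have "(\<Sum>i\<le>\<rho>. \<bar>U i\<bar>) = (\<Sum>i<\<rho>. \<bar>U i\<bar>) + \<bar>U \<rho>\<bar>" by (simp add: lessThan_Suc_atMost[symmetric])
  ultimately show "(\<Sum>i\<le>\<rho>. \<bar>U i\<bar>) + 2 * (\<Sum>j=\<rho>..<r. \<bar>t j\<bar>) \<le> 2 * A + 4 * \<tau>" using a b c by linarith
  have "A * (S - S0) \<le> A * (1 - S0)" using A nn le by (intro mult_left_mono) auto
  then show "U \<rho> \<le> A * (1 - (\<Sum>i<\<rho>. z0 i))" using U(2) SU by (simp add: S0_def[symmetric] algebra_simps)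
  show "0 \<le> 1 - (\<Sum>i<\<rho>. z0 i)" using nn le by (simp add: S0_def)
qed

context nf
begin

text \<open>The last claim allows lattice points to be told apart through their units modulo
  torsion.\<close>

lemma fundamental_units_product:
  fixes c :: "nat \<Rightarrow> int"
  assumes fu: "fundamental_units k us"
  defines "v \<equiv> \<Prod>l<length us. (us ! l) powi c l"
  shows "v \<in> integer_units k"
    and "\<sigma> \<in> embeddings k \<Longrightarrow> lv \<sigma> v = (\<Sum>l<length us. of_int (c l) * lv \<sigma> (us ! l))"
    and "v ^ e = 1 \<Longrightarrow> e > 0 \<Longrightarrow> l < length us \<Longrightarrow> c l = 0"
proof -
  have us: "distinct us" "set us \<subseteq> integer_units k" "mult_independent (set us)" using fu by (auto simp: fundamental_units_def)
  have nU: "us ! l \<in> integer_units k" if "l < length us" for l using us that by auto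
  show "v \<in> integer_units k" unfolding v_def by (rule units_prod, rule units_powi, rule nU) simp
  show "lv \<sigma> v = (\<Sum>l<length us. of_int (c l) * lv \<sigma> (us ! l))" if s: "\<sigma> \<in> embeddings k" for \<sigma>
  proof -
    have "lv \<sigma> v = (\<Sum>l<length us. lv \<sigma> ((us ! l) powi c l))" unfolding v_def
      by (rule lv_prod[OF s]) (use nU units_k units_nz in \<open>auto intro!: sf_powi[OF sub]\<close>)
    also have "\<dots> = (\<Sum>l<length us. of_int (c l) * lv \<sigma> (us ! l))"
      by (rule sum.cong) (use nU units_k units_nz in \<open>auto simp: lv_powi[OF s]\<close>)
    finally show ?thesis .
  qed
  show "c l = 0" if ve: "v ^ e = 1" "e > 0" and l: "l < length us"
  proof -
    have bij: "bij_betw (\<lambda>i. us ! i) {..<length us} (set us)" by (rule bij_betw_nth[OF us(1) refl refl])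
    define f where "f = (\<lambda>u. int e * c (the_inv_into {..<length us} (\<lambda>i. us ! i) u))"
    have f: "f (us ! i) = int e * c i" if "i < length us" for i
      unfolding f_def by (subst the_inv_into_f_f) (use bij that in \<open>auto simp: bij_betw_def\<close>)
    have "(\<Prod>u\<in>set us. u powi f u) = (\<Prod>i<length us. (us ! i) powi f (us ! i))"
      by (rule prod.reindex_bij_betw[OF bij, symmetric])
    also have "\<dots> = (\<Prod>i<length us. ((us ! i) powi c i) ^ e)"
      by (rule prod.cong) (use f in \<open>auto simp: power_int_mult mult.commute[of "int e"]\<close>)
    also have "\<dots> = 1" using ve(1) by (simp add: v_def prod_power_distrib)
    finally have "\<forall>u\<in>set us. f u = 0" using us(3) unfolding mult_independent_def by blast
    then show "c l = 0" using f[OF l] l ve(2) by simp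
  qed
qed

end

context nf_ext
begin

text \<open>Lattice points in one translate of the simplex correspond to units whose quotients have
  height at most \<open>A + 2 * \<tau>\<close>, hence lie in \<open>l\<close>. Relative to one of
  them, they form a set \<open>V\<close> as in \<open>count\<close>: distinct modulo torsion,
  containing 1, and bounded at the places of \<open>l\<close> by nonnegative numbers of sum
  \<open>A\<close>. \<open>packing\<close> then turns the bound \<open>N\<close> into a bound for
  the covolume.\<close>

lemma regulator_packing:
  fixes A \<tau> :: real and N :: nat
  assumes ws: "place_representatives l ws" and A: "A > 0" and \<tau>: "\<tau> > 0"
    and small: "\<And>u. u \<in> integer_units k \<Longrightarrow> K.ht u \<le> A + 2 * \<tau> \<Longrightarrow> u \<in> l"
    and count: "\<And>V \<beta>. finite V \<Longrightarrow> V \<subseteq> integer_units l \<Longrightarrow> 1 \<in> V \<Longrightarrow>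
      (\<And>v v' e. v \<in> V \<Longrightarrow> v' \<in> V \<Longrightarrow> v \<noteq> v' \<Longrightarrow> e > 0 \<Longrightarrow> (v / v') ^ e \<noteq> 1) \<Longrightarrow>
      (\<And>w. w \<in> set ws \<Longrightarrow> 0 \<le> \<beta> w) \<Longrightarrow> (\<Sum>w\<in>set ws. \<beta> w) = A \<Longrightarrow>
      (\<And>v w. v \<in> V \<Longrightarrow> w \<in> set ws \<Longrightarrow> real m * L.lv w v \<le> \<beta> w) \<Longrightarrow> card V \<le> N"
  shows "A ^ unit_rank l * \<tau> ^ (unit_rank k - unit_rank l) \<le> real N * fact (unit_rank k) * regulator k"
proof -
  define r \<rho> where "r = K.nplaces - 1" and "\<rho> = L.nplaces - 1"
  have ur: "unit_rank k = r" "unit_rank l = \<rho>" by (simp_all add: r_def \<rho>_def K.unit_rank_eq L.unit_rank_eq)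
  obtain qs where qs: "place_representatives k qs" "L.nplaces \<le> K.nplaces"
    "\<forall>i<L.nplaces - 1. place_below ws (qs ! i) = ws ! i" "place_below ws (qs ! (K.nplaces - 1)) = ws ! (L.nplaces - 1)"
    using ex_adapted_places[OF ws] by blast
  have lq: "length qs = Suc r" using K.length_places[OF qs(1)] K.nplaces_pos by (simp add: r_def)
  have lw: "length ws = Suc \<rho>" using L.length_places[OF ws] L.nplaces_pos by (simp add: \<rho>_def)
  have \<rho>r: "\<rho> \<le> r" using qs(2) by (simp add: r_def \<rho>_def)
  have qe: "qs ! j \<in> embeddings k" if "j \<le> r" for j using K.ps_emb[OF qs(1)] lq that by simp
  define ov where "ov = (\<lambda>j. THE i. i \<le> \<rho> \<and> ws ! i = place_below ws (qs ! j))"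
  have ovI: "ov j = i" if "i \<le> \<rho>" "ws ! i = place_below ws (qs ! j)" for i j
    unfolding ov_def
  proof (rule the_equality)
    fix i' assume "i' \<le> \<rho> \<and> ws ! i' = place_below ws (qs ! j)"
    then show "i' = i" using that lw nth_eq_iff_index_eq[OF L.ps_distinct[OF ws], of i' i] by simp
  qed (use that in simp)
  have ovle: "ov j \<le> \<rho>" "ws ! ov j = place_below ws (qs ! j)" if j: "j \<le> r" for j
  proof -
    have "place_below ws (qs ! j) \<in> set ws" by (rule place_below(1)[OF ws qe[OF j]])
    then obtain i where i: "i < length ws" "ws ! i = place_below ws (qs ! j)" by (auto simp: in_set_conv_nth)
    then have "ov j = i" using ovI lw by simp
    then show "ov j \<le> \<rho>" "ws ! ov j = place_below ws (qs ! j)" using i lw by simp_all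
  qed
  have ov2: "ov j = j" if "j < \<rho>" for j using ovI[of j j] qs(3) that by (simp add: \<rho>_def)
  have ov3: "ov r = \<rho>" using ovI[of \<rho> r] qs(4) by (simp add: r_def \<rho>_def)
  let ?F = "\<lambda>i. {j. j \<in> {..r} \<and> ov j = i}"
  have fib: "(\<Sum>j\<in>?F i. g (qs ! j)) = (\<Sum>\<sigma> | \<sigma> \<in> set qs \<and> place_below ws \<sigma> = ws ! i. g \<sigma>)"
    if i: "i \<le> \<rho>" for g :: "('a \<Rightarrow> complex) \<Rightarrow> real" and i
  proof (rule sum.reindex_bij_betw)
    show "bij_betw ((!) qs) (?F i) {\<sigma>. \<sigma> \<in> set qs \<and> place_below ws \<sigma> = ws ! i}" unfolding bij_betw_def
    proof
      show "inj_on ((!) qs) (?F i)" using K.ps_distinct[OF qs(1)] lq by (auto simp: inj_on_def nth_eq_iff_index_eq)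
      show "(!) qs ` ?F i = {\<sigma>. \<sigma> \<in> set qs \<and> place_below ws \<sigma> = ws ! i}"
      proof (intro equalityI subsetI)
        fix \<sigma> assume "\<sigma> \<in> (!) qs ` ?F i"
        then obtain j where j: "j \<le> r" "ov j = i" "\<sigma> = qs ! j" by auto
        then show "\<sigma> \<in> {\<sigma>. \<sigma> \<in> set qs \<and> place_below ws \<sigma> = ws ! i}" using ovle[OF j(1)] lq by auto
      next
        fix \<sigma> assume s: "\<sigma> \<in> {\<sigma>. \<sigma> \<in> set qs \<and> place_below ws \<sigma> = ws ! i}"
        then obtain j where j: "j < length qs" "\<sigma> = qs ! j" by (auto simp: in_set_conv_nth)
        then have "ov j = i" using ovI[OF i] s by simp
        then show "\<sigma> \<in> (!) qs ` ?F i" using j lq by (intro image_eqI[of _ _ j]) auto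
      qed
    qed
  qed
  \<comment> \<open>The share of a place of \<open>k\<close> in the local degrees of its fiber: a
    unit of \<open>l\<close> spreads its fiber sum in exactly this proportion.\<close>
  define p where "p = (\<lambda>j. real (local_degree k (qs ! j)) / (real m * real (local_degree l (ws ! ov j))))"
  have p1: "0 \<le> p j" for j unfolding p_def by simp
  have p2: "(\<Sum>j\<in>?F i. p j) = 1" if i: "i \<le> \<rho>" for i
  proof -
    have "(\<Sum>j\<in>?F i. p j) = (\<Sum>j\<in>?F i. real (local_degree k (qs ! j))) / (real m * real (local_degree l (ws ! i)))"
      unfolding sum_divide_distrib by (rule sum.cong) (auto simp: p_def)
    also have "\<dots> = 1"
      using fib[OF i, of "\<lambda>\<sigma>. real (local_degree k \<sigma>)"] sum_fiber[OF ws qs(1), of "ws ! i"] i lw m_pos L.local_degree_pos[of "ws ! i"] by simp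
    finally show ?thesis .
  qed
  define U where "U = (\<lambda>i u. \<Sum>j\<in>?F i. K.lv (qs ! j) u)"
  have Ul: "U i u = real m * L.lv (ws ! i) u" if i: "i \<le> \<rho>" and u: "u \<in> l" for i u
  proof -
    have "U i u = (\<Sum>\<sigma> | \<sigma> \<in> set qs \<and> place_below ws \<sigma> = ws ! i. K.lv \<sigma> u)" unfolding U_def by (rule fib[OF i])
    also have "\<dots> = (\<Sum>\<sigma> | \<sigma> \<in> set qs \<and> place_below ws \<sigma> = ws ! i. real (local_degree k \<sigma>) * ln (cmod ((ws ! i) u)))"
    proof (rule sum.cong[OF refl])
      fix \<sigma> assume s: "\<sigma> \<in> {\<sigma>. \<sigma> \<in> set qs \<and> place_below ws \<sigma> = ws ! i}"
      then have "cmod (\<sigma> u) = cmod ((ws ! i) u)" using place_below_cmod[OF ws K.ps_emb[OF qs(1)] u, of \<sigma>] by simp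
      then show "K.lv \<sigma> u = real (local_degree k \<sigma>) * ln (cmod ((ws ! i) u))" by (simp add: K.lv_def)
    qed
    also have "\<dots> = real m * real (local_degree l (ws ! i)) * ln (cmod ((ws ! i) u))"
      using sum_fiber[OF ws qs(1), of "ws ! i"] i lw by (simp flip: sum_distrib_right)
    finally show ?thesis by (simp add: L.lv_def)
  qed
  obtain us where us: "fundamental_units k us" "det (K.reg_mat qs us) \<noteq> 0" using K.ex_fundamental_units_reg[OF qs(1)] by blast
  have lu: "length us = r" using K.fundamental_units_length[OF us(1)] by (simp add: r_def)
  have usU: "us ! a \<in> integer_units k" if "a < r" for a
    using us(1) that lu nth_mem[of a us] by (auto simp: fundamental_units_def)
  define C where "C = (\<lambda>j a. K.lv (qs ! j) (us ! a))"
  have total: "(\<Sum>j\<le>r. K.lv (qs ! j) u) = 0" if "u \<in> integer_units k" for u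
    using K.sum_lv_units_nth[OF qs(1) that] lq by (simp add: lessThan_Suc_atMost)
  have mC: "mdet r C = det (K.reg_mat qs us)"
    by (subst mdet_transpose) (simp add: mdet_def K.reg_mat_def C_def r_def)
  have detC: "\<bar>mdet r C\<bar> = regulator k" unfolding mC by (rule K.regulator_eq[OF us(1) qs(1), symmetric])
  \<comment> \<open>The minus sign is deliberate: a nonnegative simplex coordinate then bounds
    \<open>U i\<close> from above by \<open>A\<close> times the coordinate of the base point, as
    \<open>count\<close> requires.\<close>
  define M where "M = (\<lambda>i a. if i < \<rho> then - U i (us ! a) / A else (C i a - p i * U (ov i) (us ! a)) / \<tau>)"
  have detM: "\<bar>mdet r M\<bar> * (A ^ \<rho> * \<tau> ^ (r - \<rho>)) = regulator k"
    unfolding M_def detC[symmetric]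
  proof (rule mdet_fiber_matrix[OF \<rho>r ovle(1) ov2 ov3 _ _ A \<tau>])
    fix a assume "a < r"
    then show "(\<Sum>j\<le>r. C j a) = 0" unfolding C_def by (intro total usU)
  qed (simp_all add: U_def C_def)
  have det0: "mdet r M \<noteq> 0" using detM us(2) detC mC by auto
  have "1 \<le> real N * fact r * \<bar>mdet r M\<bar>"
  proof (rule packing[OF det0])
    fix y :: "nat \<Rightarrow> real" and W :: "(nat \<Rightarrow> int) set"
    assume W: "finite W" "W \<subseteq> PiE {..<r} (\<lambda>_. UNIV)"
      and sx: "\<And>x. x \<in> W \<Longrightarrow> (\<lambda>i. y i + (\<Sum>j<r. M i j * of_int (x j))) \<in> std_simplex r"
    show "card W \<le> N"
    proof (cases "W = {}")
      case False
      then obtain x0 where x0: "x0 \<in> W" by auto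
      define v where "v = (\<lambda>x. \<Prod>a<r. (us ! a) powi x a)"
      \<comment> \<open>Dividing by the unit of a fixed point removes the unknown translation
        \<open>y\<close> and puts 1 into the set.\<close>
      define \<delta> where "\<delta> = (\<lambda>x. v x / v x0)"
      have vU: "v x \<in> integer_units k" for x
        using K.fundamental_units_product(1)[OF us(1), of x] by (simp add: lu v_def)
      have lvv: "K.lv \<sigma> (v x) = (\<Sum>a<r. of_int (x a) * K.lv \<sigma> (us ! a))" if "\<sigma> \<in> embeddings k" for \<sigma> x
        using K.fundamental_units_product(2)[OF us(1) that, of x] by (simp add: lu v_def)
      have dU: "\<delta> x \<in> integer_units k" for x unfolding \<delta>_def by (rule K.units_divide[OF vU vU])
      have lvd: "K.lv \<sigma> (\<delta> x) = (\<Sum>a<r. of_int (x a) * K.lv \<sigma> (us ! a)) - (\<Sum>a<r. of_int (x0 a) * K.lv \<sigma> (us ! a))"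
        if "\<sigma> \<in> embeddings k" for \<sigma> x
        unfolding \<delta>_def using K.lv_divide[OF that K.units_k[OF vU] K.units_k[OF vU] K.units_nz[OF vU] K.units_nz[OF vU]] lvv[OF that] by simp
      define z where "z = (\<lambda>x i. y i + (\<Sum>j<r. M i j * of_int (x j)))"
      have zs: "z x \<in> std_simplex r" if "x \<in> W" for x using sx[OF that] by (simp add: z_def)
      have Uv: "U i (\<delta> x) = (\<Sum>a<r. of_int (x a) * U i (us ! a)) - (\<Sum>a<r. of_int (x0 a) * U i (us ! a))" for i x
      proof -
        have sw: "(\<Sum>j\<in>?F i. \<Sum>a<r. of_int (x a) * K.lv (qs ! j) (us ! a)) = (\<Sum>a<r. of_int (x a) * U i (us ! a))" for x :: "nat \<Rightarrow> int"
          by (subst sum.swap) (simp add: U_def sum_distrib_left)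
        have "U i (\<delta> x) = (\<Sum>j\<in>?F i. (\<Sum>a<r. of_int (x a) * K.lv (qs ! j) (us ! a)) - (\<Sum>a<r. of_int (x0 a) * K.lv (qs ! j) (us ! a)))"
          unfolding U_def by (rule sum.cong) (use lvd qe in auto)
        then show ?thesis by (simp only: sum_subtractf sw)
      qed
      have Ui: "U i (\<delta> x) = A * (z x0 i - z x i)" if i: "i < \<rho>" for i x
      proof -
        have "z x i = y i - (\<Sum>a<r. of_int (x a) * U i (us ! a)) / A" for x
          using i by (simp add: z_def M_def sum_divide_distrib sum_negf mult.commute)
        then have "A * z x i = A * y i - (\<Sum>a<r. of_int (x a) * U i (us ! a))" for x using A by (simp add: field_simps)
        from this[of x] this[of x0] show ?thesis using Uv[of i x] by (simp add: algebra_simps)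
      qed
      have U\<rho>: "U \<rho> u = - (\<Sum>i<\<rho>. U i u)" if u: "u \<in> integer_units k" for u
      proof -
        have "(\<Sum>i\<le>\<rho>. U i u) = (\<Sum>j\<le>r. K.lv (qs ! j) u)" unfolding U_def by (rule sum.group) (use ovle(1) in auto)
        also have "\<dots> = 0" by (rule total[OF u])
        finally show ?thesis by (simp add: lessThan_Suc_atMost[symmetric])
      qed
      have tj: "K.lv (qs ! j) (\<delta> x) - p j * U (ov j) (\<delta> x) = \<tau> * (z x j - z x0 j)" if j: "\<rho> \<le> j" "j < r" for j x
      proof -
        have Mj: "\<tau> * M j a = K.lv (qs ! j) (us ! a) - p j * U (ov j) (us ! a)" for a using j \<tau> by (simp add: M_def C_def)
        have "\<tau> * z x j = \<tau> * y j + ((\<Sum>a<r. of_int (x a) * K.lv (qs ! j) (us ! a)) - p j * (\<Sum>a<r. of_int (x a) * U (ov j) (us ! a)))" for x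
        proof -
          have "\<tau> * (\<Sum>a<r. M j a * of_int (x a)) = (\<Sum>a<r. (\<tau> * M j a) * of_int (x a))"
            by (simp only: sum_distrib_left mult.assoc)
          also have "\<dots> = (\<Sum>a<r. of_int (x a) * K.lv (qs ! j) (us ! a) - p j * (of_int (x a) * U (ov j) (us ! a)))"
            unfolding Mj by (rule sum.cong[OF refl]) (simp add: algebra_simps)
          also have "\<dots> = (\<Sum>a<r. of_int (x a) * K.lv (qs ! j) (us ! a)) - p j * (\<Sum>a<r. of_int (x a) * U (ov j) (us ! a))"
            by (simp only: sum_subtractf sum_distrib_left)
          finally show ?thesis by (simp only: z_def distrib_left)
        qed
        from this[of x] this[of x0] show ?thesis
          unfolding lvd[OF qe[OF less_imp_le[OF j(2)]]] Uv right_diff_distrib by linarith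
      qed
      have ht: "K.ht (\<delta> x) \<le> A + 2 * \<tau>" if x: "x \<in> W" for x
      proof -
        have "2 * K.ht (\<delta> x) = (\<Sum>\<sigma>\<in>set qs. \<bar>K.lv \<sigma> (\<delta> x)\<bar>)" by (rule K.two_ht[OF qs(1) dU])
        also have "\<dots> = (\<Sum>j\<le>r. \<bar>K.lv (qs ! j) (\<delta> x)\<bar>)"
          using sum.reindex_bij_betw[OF bij_betw_nth[OF K.ps_distinct[OF qs(1)] refl refl], of "\<lambda>\<sigma>. \<bar>K.lv \<sigma> (\<delta> x)\<bar>"] lq
          by (simp add: lessThan_Suc_atMost)
        also have "\<dots> \<le> (\<Sum>i\<le>\<rho>. \<bar>U i (\<delta> x)\<bar>) + 2 * (\<Sum>j = \<rho>..<r. \<bar>K.lv (qs ! j) (\<delta> x) - p j * U (ov j) (\<delta> x)\<bar>)"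
          by (rule fiber_abs_bound[OF \<rho>r ovle(1) ov2 ov3 p1 p2]) (simp_all add: U_def)
        also have "\<dots> \<le> 2 * A + 4 * \<tau>"
          by (rule simplex_difference_bound(1)[OF \<rho>r zs[OF x] zs[OF x0] A \<tau> Ui U\<rho>[OF dU] tj])
        finally show ?thesis by simp
      qed
      have dl: "\<delta> x \<in> integer_units l" "\<delta> x \<in> l" if "x \<in> W" for x
        using small[OF dU ht[OF that]] dU units_l_iff by auto
      \<comment> \<open>The coordinates of the base point in the directions of \<open>l\<close>,
        scaled by \<open>A\<close>. The last place gets the slack, which makes the sum exactly
        \<open>A\<close>.\<close>
      define b where "b = (\<lambda>i. if i < \<rho> then A * z x0 i else A * (1 - (\<Sum>i<\<rho>. z x0 i)))"
      define \<beta> where "\<beta> = (\<lambda>w. b (THE i. i \<le> \<rho> \<and> ws ! i = w))"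
      have \<beta>: "\<beta> (ws ! i) = b i" if i: "i \<le> \<rho>" for i
      proof -
        have "(THE i'. i' \<le> \<rho> \<and> ws ! i' = ws ! i) = i"
        proof (rule the_equality)
          fix i' assume "i' \<le> \<rho> \<and> ws ! i' = ws ! i"
          then show "i' = i" using i lw nth_eq_iff_index_eq[OF L.ps_distinct[OF ws], of i' i] by simp
        qed (use i in simp)
        then show ?thesis by (simp add: \<beta>_def)
      qed
      have wsn: "\<exists>i\<le>\<rho>. w = ws ! i" if "w \<in> set ws" for w
        using that lw by (auto simp: in_set_conv_nth less_Suc_eq_le)
      have inj: "x = x'" if x: "x \<in> W" "x' \<in> W" and e: "e > 0" "(\<delta> x / \<delta> x') ^ e = 1" for x x' e
      proof -
        have "\<delta> x / \<delta> x' = v x / v x'" using K.units_nz[OF vU[of x0]] by (simp add: \<delta>_def)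
        also have "\<dots> = v (\<lambda>a. x a - x' a)"
          unfolding v_def by (simp add: power_int_diff K.units_nz[OF usU] flip: prod_dividef)
        finally have "(\<Prod>a<length us. (us ! a) powi (x a - x' a)) ^ e = 1" using e(2) by (simp add: v_def lu)
        then have eq: "x a = x' a" if "a < r" for a
          using K.fundamental_units_product(3)[OF us(1) _ e(1), of "\<lambda>a. x a - x' a" a] that lu by simp
        show "x = x'" by (rule PiE_ext[where k = "{..<r}" and s = "\<lambda>_. UNIV"]) (use x W(2) eq in auto)
      qed
      have "card (\<delta> ` W) \<le> N"
      proof (rule count[where \<beta> = \<beta>])
        show "finite (\<delta> ` W)" "\<delta> ` W \<subseteq> integer_units l" using W(1) dl by auto
        have "\<delta> x0 = 1" using K.units_nz[OF vU[of x0]] by (simp add: \<delta>_def)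
        then show "1 \<in> \<delta> ` W" using x0 by (metis image_eqI)
        show "(u / u') ^ e \<noteq> 1" if "u \<in> \<delta> ` W" "u' \<in> \<delta> ` W" "u \<noteq> u'" "e > 0" for u u' e
          using inj that by blast
        have b0: "0 \<le> b i" if "i \<le> \<rho>" for i
          using simplex_difference_bound(3)[OF \<rho>r zs[OF x0] zs[OF x0] A \<tau> Ui U\<rho>[OF dU] tj] zs[OF x0] A \<rho>r that
          by (auto simp: b_def std_simplex_def)
        show "0 \<le> \<beta> w" if "w \<in> set ws" for w using wsn[OF that] \<beta> b0 by auto
        have "(\<Sum>w\<in>set ws. \<beta> w) = (\<Sum>i\<le>\<rho>. \<beta> (ws ! i))"
          using sum.reindex_bij_betw[OF bij_betw_nth[OF L.ps_distinct[OF ws] refl refl], of \<beta>] lw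
          by (simp add: lessThan_Suc_atMost)
        also have "\<dots> = (\<Sum>i\<le>\<rho>. b i)" by (rule sum.cong) (use \<beta> in auto)
        also have "\<dots> = (\<Sum>i<\<rho>. A * z x0 i) + A * (1 - (\<Sum>i<\<rho>. z x0 i))"
          by (simp add: lessThan_Suc_atMost[symmetric] b_def)
        finally show "(\<Sum>w\<in>set ws. \<beta> w) = A" by (simp add: algebra_simps flip: sum_distrib_left)
        show "real m * L.lv w u \<le> \<beta> w" if u: "u \<in> \<delta> ` W" and w: "w \<in> set ws" for u w
        proof -
          obtain x where x: "x \<in> W" "u = \<delta> x" using u by auto
          obtain i where i: "i \<le> \<rho>" "w = ws ! i" using wsn[OF w] by auto
          have "U i (\<delta> x) \<le> b i"
          proof (cases "i < \<rho>")
            case True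
            have "0 \<le> z x i" using zs[OF x(1)] True \<rho>r by (simp add: std_simplex_def)
            then have "A * (z x0 i - z x i) \<le> A * z x0 i" using A by (intro mult_left_mono) auto
            then show ?thesis using Ui[OF True] True by (simp add: b_def)
          next
            case False
            then have "i = \<rho>" using i by simp
            then show ?thesis
              using simplex_difference_bound(2)[OF \<rho>r zs[OF x(1)] zs[OF x0] A \<tau> Ui U\<rho>[OF dU] tj] by (simp add: b_def)
          qed
          then show ?thesis using Ul[OF i(1) dl(2)[OF x(1)]] \<beta>[OF i(1)] i(2) x(2) by simp
        qed
      qed
      moreover have "inj_on \<delta> W"
      proof (rule inj_onI)
        fix x x' assume x: "x \<in> W" "x' \<in> W" "\<delta> x = \<delta> x'"
        then show "x = x'" using inj[OF x(1,2), of 1] K.units_nz[OF dU[of x']] by simp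
      qed
      ultimately show ?thesis by (simp add: card_image)
    qed simp
  qed
  then have "1 * (A ^ \<rho> * \<tau> ^ (r - \<rho>)) \<le> real N * fact r * \<bar>mdet r M\<bar> * (A ^ \<rho> * \<tau> ^ (r - \<rho>))"
    using A \<tau> by (intro mult_right_mono) auto
  also have "\<dots> = real N * fact r * regulator k" unfolding detM[symmetric] by (simp only: mult.assoc)
  finally show ?thesis by (simp add: ur)
qed

end

section \<open>Counting units\<close>

text \<open>Both follow from \<open>1 + x \<le> exp x\<close> at a small \<open>x\<close>, raised to
  the power 16 or 64.\<close>

lemma ln_2_bounds: "2 / 3 < ln (2 :: real)" "ln (2 :: real) \<le> 7 / 10"
proof -
  have "23 / 24 \<le> exp (- 1 / 24 :: real)" using exp_ge_add_one_self[of "- 1 / 24 :: real"] by simp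
  then have "(23 / 24) ^ 16 \<le> exp (- 1 / 24 :: real) ^ 16" by (rule power_mono) simp
  also have "\<dots> = exp (- (2 / 3))" by (simp flip: exp_of_nat_mult)
  finally have "(23 / 24) ^ 16 \<le> exp (- (2 / 3) :: real)" .
  moreover have "1 / 2 < (23 / 24 :: real) ^ 16" by (simp add: power_divide)
  ultimately have "1 / 2 < exp (- (2 / 3) :: real)" by linarith
  then have "exp (2 / 3) < (2 :: real)" unfolding exp_minus by (simp add: field_simps)
  then have "ln (exp (2 / 3)) < ln (2 :: real)" by (subst ln_less_cancel_iff) auto
  then show "2 / 3 < ln (2 :: real)" by simp
  have "1 + 7 / 640 \<le> exp (7 / 640 :: real)" by (rule exp_ge_add_one_self)
  then have "(1 + 7 / 640) ^ 64 \<le> exp (7 / 640 :: real) ^ 64" by (rule power_mono) simp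
  also have "\<dots> = exp (7 / 10)" by (simp flip: exp_of_nat_mult)
  finally have "(647 / 640) ^ 64 \<le> exp (7 / 10 :: real)" by simp
  moreover have "2 \<le> (647 / 640 :: real) ^ 64" by (simp add: power_divide)
  ultimately have "2 \<le> exp (7 / 10 :: real)" by linarith
  then have "ln 2 \<le> ln (exp (7 / 10 :: real))" by (subst ln_le_cancel_iff) auto
  then show "ln (2 :: real) \<le> 7 / 10" by simp
qed

context nf
begin

lemma ht_le_sum:
  assumes ps: "place_representatives k ps" and u: "u \<in> k"
    and \<beta>: "\<And>w. w \<in> set ps \<Longrightarrow> 0 \<le> \<beta> w" "\<And>w. w \<in> set ps \<Longrightarrow> lv w u \<le> \<beta> w"
  shows "ht u \<le> (\<Sum>w\<in>set ps. \<beta> w)"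
proof -
  have "ht u = (\<Sum>w\<in>set ps. real (local_degree k w) * max 0 (ln (cmod (w u))))"
    unfolding ht_def by (rule sum_places[OF ps]) (simp add: cj_apply u)
  also have "\<dots> \<le> (\<Sum>w\<in>set ps. \<beta> w)"
  proof (rule sum_mono)
    fix w assume "w \<in> set ps"
    then show "real (local_degree k w) * max 0 (ln (cmod (w u))) \<le> \<beta> w"
      using \<beta>[of w] by (cases "ln (cmod (w u)) \<ge> 0") (auto simp: lv_def max_def)
  qed
  finally show ?thesis .
qed

lemma rank_0_torsion:
  assumes "unit_rank k = 0" "u \<in> integer_units k"
  shows "\<exists>e>0. u ^ e = 1"
proof -
  obtain ps where ps: "place_representatives k ps" using ex_place_reps by blast
  have "length ps = 1" using assms(1) length_places[OF ps] nplaces_pos by (simp add: unit_rank_eq)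
  then obtain w where w: "ps = [w]" by (cases ps) auto
  show ?thesis by (rule lv_zero_torsion[OF ps assms(2)]) (use sum_lv_units[OF ps assms(2)] w in simp)
qed

text \<open>Each of the forms \<open>rform\<close> is cut into four cells. A difference of two integers in the same cell for every
  form has norm less than 1, since halving the range of the forms of a place gains a factor 2 there.\<close>

lemma card_le_cells:
  assumes ps: "place_representatives k ps" and V: "finite V" "V \<subseteq> OK" "1 \<in> V"
    and M: "M > 0" and bd: "\<And>v w. v \<in> V \<Longrightarrow> w \<in> set ps \<Longrightarrow> v \<noteq> 0 \<and> M * lv w v \<le> \<beta> w"
    and sum: "(\<Sum>w\<in>set ps. \<beta> w) < M * (real nplaces * ln 2)"
  shows "card V \<le> 4 ^ d"
proof -
  \<comment> \<open>Since \<open>1 \<in> V\<close>, this maximum is at least 1, so its logarithm is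
    defined and nonnegative.\<close>
  define B where "B = (\<lambda>\<tau>. Max ((\<lambda>v. cmod (\<tau> v)) ` V))"
  have Vk: "v \<in> k" if "v \<in> V" for v using that V(2) OK_k by blast
  have B: "cmod (\<tau> v) \<le> B \<tau>" if "v \<in> V" for \<tau> v unfolding B_def using V(1) that by (intro Max_ge) auto
  have B1: "1 \<le> B \<tau>" if "\<tau> \<in> embeddings k" for \<tau> using B[OF V(3), of \<tau>] emb_1[OF sub that] by simp
  have Bcj: "B (cj \<tau>) = B \<tau>" for \<tau>
    unfolding B_def by (rule arg_cong[where f = Max], rule image_cong) (simp_all add: cj_apply Vk)
  have BM: "M * (real (local_degree k w) * ln (B w)) \<le> \<beta> w" if w: "w \<in> set ps" for w
  proof -
    have "B w \<in> (\<lambda>v. cmod (w v)) ` V" unfolding B_def using V(1,3) by (intro Max_in) auto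
    then obtain v where "v \<in> V" "B w = cmod (w v)" by auto
    then show ?thesis using bd[OF _ w, of v] by (simp add: lv_def)
  qed
  define W where "W = (\<lambda>\<tau>. (if real_embedding k \<tau> then 1 else sqrt 2) * B \<tau>)"
  \<comment> \<open>The gain in modulus for two elements of one cell. At a complex place the two
    forms satisfy \<open>a ^ 2 + b ^ 2 = 2 * \<bar>z\<bar> ^ 2\<close>, so halving both their ranges
    gains \<open>sqrt 2\<close> over \<open>B \<tau>\<close>; with local degree 2, every place
    contributes exactly \<open>ln 2\<close>.\<close>
  define c where "c = (\<lambda>\<tau>. if real_embedding k \<tau> then 1 / 2 else 1 / sqrt 2)"
  have rf: "\<bar>rform \<tau> v\<bar> \<le> W \<tau>" if v: "v \<in> V" and t: "\<tau> \<in> embeddings k" for v \<tau>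
  proof (cases "real_embedding k \<tau>")
    case True
    then have "\<tau> v \<in> \<real>" using Vk[OF v] by (auto simp: real_embedding_def)
    then have "Im (\<tau> v) = 0" by (simp add: complex_is_Real_iff)
    then show ?thesis using True B[OF v, of \<tau>] abs_Re_le_cmod[of "\<tau> v"] by (simp add: W_def rform_def)
  next
    case False
    have "(rform \<tau> v)\<^sup>2 + (Re (\<tau> v) - Im (\<tau> v))\<^sup>2 = 2 * (cmod (\<tau> v))\<^sup>2"
      unfolding cmod_power2 by (simp add: rform_def power2_eq_square algebra_simps)
    then have "(rform \<tau> v)\<^sup>2 \<le> 2 * (cmod (\<tau> v))\<^sup>2" using zero_le_power2[of "Re (\<tau> v) - Im (\<tau> v)"] by linarith
    then have "\<bar>rform \<tau> v\<bar> \<le> sqrt (2 * (cmod (\<tau> v))\<^sup>2)" by (simp add: real_le_rsqrt)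
    also have "\<dots> = sqrt 2 * cmod (\<tau> v)" by (simp add: real_sqrt_mult)
    also have "\<dots> \<le> sqrt 2 * B \<tau>" using B[OF v] by simp
    finally show ?thesis using False by (simp add: W_def)
  qed
  \<comment> \<open>Four intervals of length \<open>S / 2\<close> covering
    \<open>[- S, S]\<close>.\<close>
  define cell :: "real \<Rightarrow> real \<Rightarrow> nat" where
    "cell = (\<lambda>S t. if t \<le> - S / 2 then 0 else if t \<le> 0 then 1 else if t \<le> S / 2 then 2 else 3)"
  have cell: "\<bar>t - t'\<bar> \<le> S / 2" if "\<bar>t\<bar> \<le> S" "\<bar>t'\<bar> \<le> S" "cell S t = cell S t'" for S t t'
  proof -
    have "t - t' \<le> S / 2 \<and> t' - t \<le> S / 2" using that by (auto simp: cell_def split: if_splits)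
    then show ?thesis by (intro abs_leI) auto
  qed
  define F where "F = (\<lambda>v. restrict (\<lambda>\<tau>. cell (W \<tau>) (rform \<tau> v)) (embeddings k))"
  have "inj_on F V"
  proof (rule inj_onI, rule ccontr)
    fix x y assume x: "x \<in> V" and y: "y \<in> V" and eq: "F x = F y" and ne: "x \<noteq> y"
    have xyO: "x - y \<in> OK" using x y V(2) OK_diff by blast
    have xyk: "x - y \<in> k" by (rule OK_k[OF xyO])
    have dr: "\<bar>rform \<tau> (x - y)\<bar> \<le> W \<tau> / 2" if t: "\<tau> \<in> embeddings k" for \<tau>
    proof -
      have "F x \<tau> = F y \<tau>" by (simp add: eq)
      then have "cell (W \<tau>) (rform \<tau> x) = cell (W \<tau>) (rform \<tau> y)" using t by (simp add: F_def)
      then have "\<bar>rform \<tau> x - rform \<tau> y\<bar> \<le> W \<tau> / 2" by (rule cell[OF rf[OF x t] rf[OF y t]])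
      then show ?thesis by (simp add: rform_def emb_diff[OF sub t Vk[OF x] Vk[OF y]] algebra_simps)
    qed
    have small: "cmod (\<tau> (x - y)) \<le> B \<tau> * c \<tau>" if t: "\<tau> \<in> embeddings k" for \<tau>
    proof (cases "real_embedding k \<tau>")
      case True
      then have "\<tau> (x - y) \<in> \<real>" using xyk by (auto simp: real_embedding_def)
      then have "Im (\<tau> (x - y)) = 0" by (simp add: complex_is_Real_iff)
      then show ?thesis using True dr[OF t] by (simp add: W_def c_def rform_def cmod_eq_Re)
    next
      case False
      have re: "\<not> real_embedding k (cj \<tau>)" using False cj_real[OF t] cj_real[OF cj_emb[OF t]] cj_cj[OF t] by metis
      define a b where "a = rform \<tau> (x - y)" and "b = rform (cj \<tau>) (x - y)"
      have ab: "\<bar>a\<bar> \<le> sqrt 2 * B \<tau> / 2" "\<bar>b\<bar> \<le> sqrt 2 * B \<tau> / 2"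
        using dr[OF t] dr[OF cj_emb[OF t]] False re by (simp_all add: W_def a_def b_def Bcj)
      have sq: "(sqrt 2 * B \<tau> / 2)\<^sup>2 = (B \<tau>)\<^sup>2 / 2" by (simp add: power_mult_distrib power_divide)
      have "a\<^sup>2 \<le> (B \<tau>)\<^sup>2 / 2" "b\<^sup>2 \<le> (B \<tau>)\<^sup>2 / 2"
        using power_mono[OF ab(1) abs_ge_zero, of 2] power_mono[OF ab(2) abs_ge_zero, of 2] unfolding sq by simp_all
      moreover have "a\<^sup>2 + b\<^sup>2 = 2 * (cmod (\<tau> (x - y)))\<^sup>2"
        unfolding a_def b_def rform_cj[OF xyk] cmod_power2 by (simp add: rform_def power2_eq_square algebra_simps)
      ultimately have "(cmod (\<tau> (x - y)))\<^sup>2 \<le> (B \<tau> * c \<tau>)\<^sup>2" using False by (simp add: c_def power_divide)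
      then show ?thesis by (rule power2_le_imp_le) (use B1[OF t] in \<open>simp add: c_def\<close>)
    qed
    have cpos: "c \<tau> > 0" for \<tau> by (simp add: c_def)
    have "1 \<le> (\<Prod>\<tau>\<in>embeddings k. cmod (\<tau> (x - y)))" by (rule norm_ge_1[OF xyO]) (use ne in simp)
    also have "\<dots> \<le> (\<Prod>\<tau>\<in>embeddings k. B \<tau> * c \<tau>)" by (rule prod_mono) (use small in auto)
    finally have "0 \<le> ln (\<Prod>\<tau>\<in>embeddings k. B \<tau> * c \<tau>)" by simp
    also have "\<dots> = (\<Sum>\<tau>\<in>embeddings k. ln (B \<tau> * c \<tau>))"
    proof (rule ln_prod[OF finite_emb])
      fix \<tau> assume "\<tau> \<in> embeddings k"
      then show "B \<tau> * c \<tau> \<noteq> 0" using B1[of \<tau>] cpos[of \<tau>] by auto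
    qed
    also have "\<dots> = (\<Sum>w\<in>set ps. real (local_degree k w) * ln (B w * c w))"
    proof (rule sum_places[OF ps])
      fix \<tau> assume t: "\<tau> \<in> embeddings k"
      have "real_embedding k (cj \<tau>) \<longleftrightarrow> real_embedding k \<tau>"
        using cj_real[OF t] cj_real[OF cj_emb[OF t]] cj_cj[OF t] by metis
      then show "ln (B (cj \<tau>) * c (cj \<tau>)) = ln (B \<tau> * c \<tau>)" by (simp add: Bcj c_def)
    qed
    also have "\<dots> = (\<Sum>w\<in>set ps. real (local_degree k w) * ln (B w) - ln 2)"
    proof (rule sum.cong[OF refl])
      fix w assume w: "w \<in> set ps"
      have "B w > 0" using B1[OF ps_emb[OF ps w]] by linarith
      then have "ln (B w * c w) = ln (B w) + ln (c w)" using cpos[of w] by (simp add: ln_mult)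
      moreover have "real (local_degree k w) * ln (c w) = - ln 2"
        by (simp add: c_def local_degree_def ln_div ln_sqrt)
      ultimately show "real (local_degree k w) * ln (B w * c w) = real (local_degree k w) * ln (B w) - ln 2"
        by (simp add: distrib_left)
    qed
    also have "\<dots> = (\<Sum>w\<in>set ps. real (local_degree k w) * ln (B w)) - real nplaces * ln 2"
      using distinct_card[OF ps_distinct[OF ps]] length_places[OF ps] by (simp add: sum_subtractf)
    finally have "real nplaces * ln 2 \<le> (\<Sum>w\<in>set ps. real (local_degree k w) * ln (B w))" by simp
    then have "M * (real nplaces * ln 2) \<le> M * (\<Sum>w\<in>set ps. real (local_degree k w) * ln (B w))"
      using M by (intro mult_left_mono) auto
    also have "\<dots> \<le> (\<Sum>w\<in>set ps. \<beta> w)" unfolding sum_distrib_left by (rule sum_mono) (rule BM)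
    finally show False using sum by simp
  qed
  moreover have FV: "F ` V \<subseteq> PiE (embeddings k) (\<lambda>_. {..<4})" by (auto simp: F_def cell_def)
  ultimately have "card V \<le> card (PiE (embeddings k) (\<lambda>_. {..<4::nat}))"
    using card_mono[OF finite_PiE[OF finite_emb] FV] by (simp add: card_image)
  also have "\<dots> = 4 ^ d" by (simp add: card_PiE[OF finite_emb] card_emb)
  finally show ?thesis .
qed

lemma nf_ext_self: "nf_ext k d k d 1"
  by standard (rule degree_over_self[OF sub])

text \<open>Packing with \<open>l = k\<close>, where no relative direction remains and
  \<open>\<tau> = 1\<close> is arbitrary. A set \<open>V\<close> has one element: the bounds at the
  places make its members small, hence torsion, so none differs from 1.\<close>

lemma regulator_ge_torsion:
  assumes h: "h > 0" and tors: "\<And>u. u \<in> integer_units k \<Longrightarrow> ht u \<le> h \<Longrightarrow> \<exists>e>0. u ^ e = 1"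
  shows "h ^ unit_rank k \<le> fact (unit_rank k) * regulator k"
proof -
  interpret S: nf_ext k d k d 1 by (rule nf_ext_self)
  obtain ps where ps: "place_representatives k ps" using ex_place_reps by blast
  have one: "0 < (1 :: real)" by simp
  have "h ^ unit_rank k * 1 ^ (unit_rank k - unit_rank k) \<le> real 1 * fact (unit_rank k) * regulator k"
  proof (rule S.regulator_packing[OF ps h one])
    fix V \<beta> assume V: "finite V" "V \<subseteq> integer_units k" "1 \<in> V"
      and r: "\<And>v v' e. v \<in> V \<Longrightarrow> v' \<in> V \<Longrightarrow> v \<noteq> v' \<Longrightarrow> e > 0 \<Longrightarrow> (v / v') ^ e \<noteq> 1"
      and \<beta>: "\<And>w. w \<in> set ps \<Longrightarrow> 0 \<le> \<beta> w" "(\<Sum>w\<in>set ps. \<beta> w) = h"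
        "\<And>v w. v \<in> V \<Longrightarrow> w \<in> set ps \<Longrightarrow> real 1 * lv w v \<le> \<beta> w"
    have "v = 1" if v: "v \<in> V" for v
    proof (rule ccontr)
      assume n1: "v \<noteq> 1"
      have vU: "v \<in> integer_units k" using v V(2) by blast
      have "ht v \<le> h" unfolding \<beta>(2)[symmetric]
        by (rule ht_le_sum[OF ps units_k[OF vU] \<beta>(1)]) (use \<beta>(3)[OF v] in simp_all)
      from tors[OF vU this] obtain e where "e > 0" "v ^ e = 1" by blast
      then show False using r[OF v V(3) n1, of e] by simp
    qed
    then have "V \<subseteq> {1}" by blast
    then show "card V \<le> 1" using card_mono[of "{1}" V] by simp
  qed (rule units_k)
  then show ?thesis by simp
qed

text \<open>Packing with \<open>l = k\<close> and the cell count. No discriminant enters, so the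
  bound does not deteriorate for small \<open>L\<close>; it serves cubic fields.\<close>

lemma regulator_ge_cells:
  assumes h: "h > 0" "h < real nplaces * ln 2"
  shows "h ^ unit_rank k \<le> 4 ^ d * fact (unit_rank k) * regulator k"
proof -
  interpret S: nf_ext k d k d 1 by (rule nf_ext_self)
  obtain ps where ps: "place_representatives k ps" using ex_place_reps by blast
  have one: "0 < (1 :: real)" by simp
  have "h ^ unit_rank k * 1 ^ (unit_rank k - unit_rank k) \<le> real (4 ^ d) * fact (unit_rank k) * regulator k"
  proof (rule S.regulator_packing[OF ps h(1) one])
    fix V \<beta> assume V: "finite V" "V \<subseteq> integer_units k" "1 \<in> V"
      and \<beta>: "(\<Sum>w\<in>set ps. \<beta> w) = h" "\<And>v w. v \<in> V \<Longrightarrow> w \<in> set ps \<Longrightarrow> real 1 * lv w v \<le> \<beta> w"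
    show "card V \<le> 4 ^ d"
      by (rule card_le_cells[OF ps V(1) _ V(3), of 1 \<beta>]) (use V(2) units_OK units_nz \<beta> h(2) in auto)
  qed (rule units_k)
  then show ?thesis by simp
qed

lemma subfield_nf_ext:
  assumes "subfield_of_type l" "l \<subseteq> k"
  obtains n m where "nf_ext k d l n m"
proof -
  obtain a b where ab: "degree_over \<rat> l a" "degree_over l k b" "d = a * b"
    by (rule degree_over_tower[OF kd assms(1) sf_Rats[OF assms(1)] assms(2)])
  have "nf_ext k d l a b" by standard (fact ab(1), fact ab(2))
  then show ?thesis by (rule that)
qed

lemma ex_subfield_small_units:
  assumes "h \<ge> 0" "2 * ln (fact d) + 2 * (real d - 1) * h < ln (abs_discriminant k)"
  shows "\<exists>l n m. nf_ext k d l n m \<and> l \<noteq> k \<and> (\<forall>u\<in>integer_units k. ht u \<le> h \<longrightarrow> u \<in> l)"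
proof -
  let ?S = "{u \<in> integer_units k. ht u \<le> h}"
  have "\<exists>l. subfield_of_type l \<and> l \<subseteq> k \<and> ?S \<subseteq> l \<and> l \<noteq> k"
  proof (rule ccontr)
    assume "\<not> ?thesis"
    then have "ln (abs_discriminant k) \<le> 2 * ln (fact d) + 2 * (real d - 1) * h"
      using assms(1) units_OK by (intro disc_bound[of ?S h]) auto
    then show False using assms(2) by simp
  qed
  then obtain l where l: "subfield_of_type l" "l \<subseteq> k" "?S \<subseteq> l" "l \<noteq> k" by blast
  obtain n m where "nf_ext k d l n m" by (rule subfield_nf_ext[OF l(1,2)])
  then show ?thesis using l by blast
qed

lemma ex_subfield_small_units_cubic:
  assumes "d = 3" "h \<ge> 0" "ln 27 + 4 * h < ln (abs_discriminant k)"
  shows "\<exists>l n m. nf_ext k d l n m \<and> l \<noteq> k \<and> (\<forall>u\<in>integer_units k. ht u \<le> h \<longrightarrow> u \<in> l)"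
proof -
  let ?S = "{u \<in> integer_units k. ht u \<le> h}"
  have "\<exists>l. subfield_of_type l \<and> l \<subseteq> k \<and> ?S \<subseteq> l \<and> l \<noteq> k"
  proof (rule ccontr)
    assume "\<not> ?thesis"
    then have "ln (abs_discriminant k) \<le> ln 27 + 4 * h"
      using assms(2) units_OK by (intro disc_bound_cubic[OF assms(1), of ?S h]) auto
    then show False using assms(3) by simp
  qed
  then obtain l where l: "subfield_of_type l" "l \<subseteq> k" "?S \<subseteq> l" "l \<noteq> k" by blast
  obtain n m where "nf_ext k d l n m" by (rule subfield_nf_ext[OF l(1,2)])
  then show ?thesis using l by blast
qed

end

context nf_ext
begin

lemma m_ge_2: "l \<noteq> k \<Longrightarrow> m \<ge> 2"
proof -
  assume "l \<noteq> k"
  then have "m \<noteq> 1" using degree_over_1_eq lk by blast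
  then show ?thesis using m_pos by simp
qed

lemma unit_rank_bounds: "unit_rank l + 1 \<le> n" "n \<le> 2 * (unit_rank l + 1)"
  using L.nplaces_pos L.nplaces_le L.d_le_nplaces by (simp_all add: L.unit_rank_eq)

text \<open>The units of \<open>l\<close> are torsion here, so all small units of \<open>k\<close>
  are.\<close>

lemma regulator_ge_rank_0:
  assumes "unit_rank l = 0" "h > 0" "\<And>u. u \<in> integer_units k \<Longrightarrow> K.ht u \<le> h \<Longrightarrow> u \<in> l"
  shows "h ^ unit_rank k \<le> fact (unit_rank k) * regulator k"
  by (rule K.regulator_ge_torsion[OF assms(2)])
    (rule L.rank_0_torsion[OF assms(1)], use assms(3) units_l_iff in blast)

text \<open>The factor \<open>m\<close> in the limit for \<open>A\<close> appears because the fiber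
  sum of a unit of \<open>l\<close> is \<open>m\<close> times its logarithm in
  \<open>l\<close>.\<close>

lemma regulator_ge_relative_cells:
  assumes A: "0 < A" "A < real m * (real (unit_rank l + 1) * ln 2)" and \<tau>: "\<tau> > 0"
    and small: "\<And>u. u \<in> integer_units k \<Longrightarrow> K.ht u \<le> A + 2 * \<tau> \<Longrightarrow> u \<in> l"
  shows "A ^ unit_rank l * \<tau> ^ (unit_rank k - unit_rank l) \<le> 4 ^ n * fact (unit_rank k) * regulator k"
proof -
  obtain ws where ws: "place_representatives l ws" using L.ex_place_reps by blast
  have q: "L.nplaces = unit_rank l + 1" using L.nplaces_pos by (simp add: L.unit_rank_eq)
  have "A ^ unit_rank l * \<tau> ^ (unit_rank k - unit_rank l) \<le> real (4 ^ n) * fact (unit_rank k) * regulator k"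
  proof (rule regulator_packing[OF ws A(1) \<tau> small])
    fix V \<beta> assume V: "finite V" "V \<subseteq> integer_units l" "1 \<in> V"
      and \<beta>: "(\<Sum>w\<in>set ws. \<beta> w) = A" "\<And>v w. v \<in> V \<Longrightarrow> w \<in> set ws \<Longrightarrow> real m * L.lv w v \<le> \<beta> w"
    show "card V \<le> 4 ^ n"
      by (rule L.card_le_cells[OF ws V(1) _ V(3), of "real m" \<beta>])
        (use V(2) L.units_OK L.units_nz \<beta> A(2) m_pos q in auto)
  qed
  then show ?thesis by simp
qed

text \<open>A real quadratic \<open>l\<close>: if \<open>v\<close> is a unit with \<open>v\<^sup>2 \<noteq> 1\<close>, then \<open>v\<^sup>2 - 1\<close> has norm at least 1, so that
  some conjugate of \<open>v\<^sup>2\<close> is at least 2.\<close>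

lemma regulator_ge_real_quadratic:
  assumes n: "n = 2" "unit_rank l = 1" and m: "m = 2" and \<tau>: "\<tau> > 0"
    and small: "\<And>u. u \<in> integer_units k \<Longrightarrow> K.ht u \<le> 1 / 2 + 2 * \<tau> \<Longrightarrow> u \<in> l"
  shows "1 / 2 * \<tau> ^ (unit_rank k - 1) \<le> fact (unit_rank k) * regulator k"
proof -
  obtain ws where ws: "place_representatives l ws" using L.ex_place_reps by blast
  have q: "L.nplaces = 2" using L.nplaces_pos n(2) by (simp add: L.unit_rank_eq)
  have cw: "card (set ws) = 2" using distinct_card[OF L.ps_distinct[OF ws]] L.length_places[OF ws] q by simp
  \<comment> \<open>Two places for two embeddings: every embedding is its own representative, so all
    are real.\<close>
  have all: "set ws = embeddings l"
    by (rule card_subset_eq[OF L.finite_emb]) (use L.ps_emb[OF ws] cw L.card_emb n(1) in auto)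
  have ld: "local_degree l w = 1" if w: "w \<in> set ws" for w
  proof -
    have "L.cj w = w" using L.ps_unique[OF ws, of "L.cj w" w] w L.cj_emb[OF L.ps_emb[OF ws w]] all by simp
    then show ?thesis using L.cj_real[OF L.ps_emb[OF ws w]] by (simp add: local_degree_def)
  qed
  have "(1 / 2) ^ unit_rank l * \<tau> ^ (unit_rank k - unit_rank l) \<le> real 1 * fact (unit_rank k) * regulator k"
  proof (rule regulator_packing[OF ws _ \<tau> small])
    fix V \<beta> assume V: "finite V" "V \<subseteq> integer_units l" "1 \<in> V"
      and r: "\<And>v v' e. v \<in> V \<Longrightarrow> v' \<in> V \<Longrightarrow> v \<noteq> v' \<Longrightarrow> e > 0 \<Longrightarrow> (v / v') ^ e \<noteq> 1"
      and \<beta>: "\<And>w. w \<in> set ws \<Longrightarrow> 0 \<le> \<beta> w" "(\<Sum>w\<in>set ws. \<beta> w) = 1 / 2"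
        "\<And>v w. v \<in> V \<Longrightarrow> w \<in> set ws \<Longrightarrow> real m * L.lv w v \<le> \<beta> w"
    have "v = 1" if v: "v \<in> V" for v
    proof (rule ccontr)
      assume n1: "v \<noteq> 1"
      have vU: "v \<in> integer_units l" using v V(2) by blast
      have ne: "v\<^sup>2 - 1 \<noteq> 0" using r[OF v V(3) n1, of 2] by simp
      have OK: "v\<^sup>2 - 1 \<in> ring_of_integers l" by (rule L.OK_diff[OF L.OK_power[OF L.units_OK[OF vU]] L.OK_1])
      \<comment> \<open>With \<open>m = 2\<close> and total \<open>1 / 2\<close>, each conjugate
        \<open>a\<close> of \<open>v\<close> satisfies
        \<open>2 * ln \<bar>a\<bar> \<le> 1 / 2 < ln 2\<close>, so
        \<open>0 < a ^ 2 < 2\<close>.\<close>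
      have lt: "cmod (w (v\<^sup>2 - 1)) < 1" if w: "w \<in> set ws" for w
      proof -
        have we: "w \<in> embeddings l" by (rule L.ps_emb[OF ws w])
        have "real_embedding l w" using ld[OF w] by (simp add: local_degree_def split: if_splits)
        then have "w v \<in> \<real>" using L.units_k[OF vU] by (auto simp: real_embedding_def)
        then obtain a where a: "w v = of_real a" by (auto elim: Reals_cases)
        have a0: "\<bar>a\<bar> > 0" using L.emb_pos[OF we L.units_k[OF vU] L.units_nz[OF vU]] a by simp
        have "\<beta> w \<le> (\<Sum>w\<in>set ws. \<beta> w)" by (rule member_le_sum[OF w]) (use \<beta>(1) in auto)
        then have "2 * ln \<bar>a\<bar> \<le> 1 / 2" using \<beta>(3)[OF v w] \<beta>(2) ld[OF w] m a by (simp add: L.lv_def)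
        moreover have "ln (\<bar>a\<bar>\<^sup>2) = real 2 * ln \<bar>a\<bar>" by (rule ln_realpow)
        then have "ln (a\<^sup>2) = 2 * ln \<bar>a\<bar>" by (simp only: of_nat_numeral power2_abs)
        moreover have "1 / 2 < ln (2::real)" using ln_2_bounds(1) by simp
        ultimately have "ln (a\<^sup>2) < ln 2" by linarith
        then have "a\<^sup>2 < 2" using a0 by (subst (asm) ln_less_cancel_iff) auto
        moreover have "a\<^sup>2 > 0" using a0 by simp
        ultimately have "\<bar>a\<^sup>2 - 1\<bar> < 1" by linarith
        moreover have "w (v\<^sup>2 - 1) = of_real (a\<^sup>2 - 1)"
          using emb_diff[OF L.sub we sf_power[OF L.sub L.units_k[OF vU], of 2] sf_1[OF L.sub]]
            emb_power[OF L.sub we L.units_k[OF vU], of 2] emb_1[OF L.sub we] a by simp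
        ultimately show ?thesis by (simp only: norm_of_real)
      qed
      have "1 \<le> (\<Prod>w\<in>set ws. cmod (w (v\<^sup>2 - 1)))" unfolding all by (rule L.norm_ge_1[OF OK ne])
      moreover have "(\<Prod>w\<in>set ws. cmod (w (v\<^sup>2 - 1))) < 1"
      proof -
        obtain w w' where w: "set ws = {w, w'}" "w \<noteq> w'" using cw by (auto simp: card_2_iff)
        have "cmod (w (v\<^sup>2 - 1)) * cmod (w' (v\<^sup>2 - 1)) < 1 * 1"
          by (rule mult_strict_mono') (use lt w in auto)
        then show ?thesis using w by simp
      qed
      ultimately show False by simp
    qed
    then have "V \<subseteq> {1}" by blast
    then show "card V \<le> 1" using card_mono[of "{1}" V] by simp
  qed simp_all
  then show ?thesis using n(2) by simp
qed

end

context nf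
begin

text \<open>The maximum is attained: the ranks are bounded by \<open>unit_rank_less\<close>, which
  uses that \<open>k\<close> is not a CM-field, and \<open>\<rat>\<close> is a proper subfield since
  \<open>d \<ge> 2\<close>.\<close>

lemma max_subfield_unit_rank:
  assumes nCM: "\<not> CM_field k" and d: "d \<ge> 2"
  shows "max_subfield_unit_rank k < unit_rank k"
    and "\<And>l n m. nf_ext k d l n m \<Longrightarrow> l \<noteq> k \<Longrightarrow> unit_rank l \<le> max_subfield_unit_rank k"
    and "\<exists>l n m. nf_ext k d l n m \<and> l \<noteq> k \<and> max_subfield_unit_rank k = unit_rank l"
proof -
  let ?R = "{unit_rank l |l. subfield_of_type l \<and> l \<subset> k}"
  have lt: "unit_rank l < unit_rank k" if l: "subfield_of_type l" "l \<subset> k" for l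
  proof -
    obtain n m where "nf_ext k d l n m" using subfield_nf_ext[of l] l by blast
    then show ?thesis using nf_ext.unit_rank_less nCM l(2) by blast
  qed
  have fin: "finite ?R" by (rule finite_subset[of _ "{..<unit_rank k}"]) (use lt in auto)
  have "\<rat> \<noteq> k"
  proof
    assume "\<rat> = k"
    then have "degree_over \<rat> k 1" using degree_over_self[OF subfield_Rats] by simp
    then show False using degree_over_unique[OF kd] d by fastforce
  qed
  then have "unit_rank (\<rat> :: 'a set) \<in> ?R" using subfield_Rats[where ?'a = 'a] sf_Rats[OF sub] by blast
  then have "max_subfield_unit_rank k \<in> ?R" unfolding max_subfield_unit_rank_def using fin by (intro Max_in) auto
  then obtain l where l: "max_subfield_unit_rank k = unit_rank l" "subfield_of_type l" "l \<subset> k" by blast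
  show "max_subfield_unit_rank k < unit_rank k" using l lt by simp
  obtain n m where "nf_ext k d l n m" using subfield_nf_ext[of l] l by blast
  then show "\<exists>l n m. nf_ext k d l n m \<and> l \<noteq> k \<and> max_subfield_unit_rank k = unit_rank l" using l by blast
  fix l n m assume "nf_ext k d l n m" and ne: "l \<noteq> k"
  then interpret E: nf_ext k d l n m by simp
  have "unit_rank l \<in> ?R" using E.L.sub E.l_subset ne by blast
  then show "unit_rank l \<le> max_subfield_unit_rank k" unfolding max_subfield_unit_rank_def using fin by (rule Max_ge[rotated])
qed

end

section \<open>The estimates\<close>

lemma log2_ge:
  fixes x :: real
  assumes "x > 0" "b > 0" "2 ^ a \<le> x ^ b"
  shows "real a / real b \<le> log 2 x"
proof -
  have "log 2 (2 ^ a) \<le> log 2 (x ^ b)" using assms by (subst log_le_cancel_iff) auto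
  then have "real a \<le> real b * log 2 x" using assms(1) by (simp add: log_nat_power)
  then show ?thesis using assms(2) by (simp add: field_simps)
qed

lemma ln_ge_ln_2:
  fixes x :: real
  assumes "x > 0" "b > 0" "2 ^ a \<le> x ^ b"
  shows "real a / real b * ln 2 \<le> ln x"
  using log2_ge[OF assms] by (simp add: log_def field_simps)

text \<open>A rational lower bound \<open>a / b\<close> for \<open>log 2 x\<close> reduces the
  estimate to two inequalities between integral powers.\<close>

lemma powr_log2_ge:
  fixes x c :: real
  assumes x: "x \<ge> 1" and b: "b > 0" and c: "c \<ge> 0" and h: "2 ^ a \<le> x ^ b" "c ^ b \<le> x ^ a"
  shows "c \<le> x powr log 2 x"
proof -
  have "(x powr (real a / real b)) ^ b = x powr (real a / real b * real b)"
    using x by (simp add: powr_powr flip: powr_realpow)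
  also have "\<dots> = x ^ a" using x b by (simp add: powr_realpow)
  finally have "c ^ b \<le> (x powr (real a / real b)) ^ b" using h(2) by simp
  then have "c \<le> x powr (real a / real b)" using b c by (simp add: power_mono_iff)
  also have "\<dots> \<le> x powr log 2 x" using log2_ge[of x b a] x b h(1) by (intro powr_mono) auto
  finally show ?thesis .
qed

text \<open>The ratio \<open>(12 / (p + 1)) ^ p\<close> peaks at \<open>p = 4\<close> with about
  33.2, below \<open>135 / 4\<close>. The constant 135 fits \<open>108 * 4 / 135 = 16 / 5\<close>,
  as needed in \<open>cells_le_kap\<close>. From \<open>p = 11\<close> on, each step multiplies the
  right side by at least 12.\<close>

lemma twelve_power_le: "4 * 12 ^ p \<le> 135 * (p + 1) ^ p" for p :: nat
proof (cases "p \<le> 11")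
  case True
  then have "p = 0 \<or> p = 1 \<or> p = 2 \<or> p = 3 \<or> p = 4 \<or> p = 5 \<or> p = 6 \<or> p = 7 \<or> p = 8 \<or> p = 9 \<or> p = 10 \<or> p = 11"
    by presburger
  then show ?thesis by (elim disjE) simp_all
next
  case False
  then have "11 \<le> p" by simp
  then show ?thesis
  proof (induction p rule: dec_induct)
    case (step p)
    have "4 * 12 ^ Suc p \<le> 12 * (135 * (p + 1) ^ p)" using step.IH by simp
    also have "\<dots> \<le> (p + 2) * (135 * (p + 2) ^ p)"
      using step.hyps by (intro mult_mono power_mono) auto
    finally show ?case by simp
  qed simp
qed

text \<open>Chosen so that \<open>4 (d - 1) kap d L\<close> is the part of \<open>ln D\<close> that depends on \<open>L\<close>.\<close>

definition kap :: "nat \<Rightarrow> real" where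
  "kap d = real d powr log 2 (real d) * (real d - 2) / (8 * (real d - 1))"

lemma E_ge_cube: assumes "d \<ge> 8" shows "real d ^ 3 \<le> real d powr log 2 (real d)"
  by (rule powr_log2_ge[where a = 3 and b = 1]) (use assms in auto)

lemma E_6: "88 \<le> 6 powr log 2 (6 :: real)" and E_7: "129 \<le> 7 powr log 2 (7 :: real)"
  by (rule powr_log2_ge[where a = 5 and b = 2]; simp)+

text \<open>The three bounds match the three ranges of \<open>d\<close> in
  \<open>cells_le_kap\<close>; degrees 6 and 7 need their own estimates because
  \<open>log 2 d < 3\<close> there.\<close>

lemma kap_ge:
  assumes d: "d \<ge> 6"
  shows "44 / 5 \<le> kap d" "d \<ge> 8 \<Longrightarrow> 54 \<le> kap d" "d \<ge> 10 \<Longrightarrow> 108 \<le> kap d"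
proof -
  have gen: "c \<le> kap d" if "d \<ge> 8" "c * (8 * (real d - 1)) \<le> real d ^ 3 * (real d - 2)" for c
  proof -
    have "real d ^ 3 * (real d - 2) \<le> real d powr log 2 (real d) * (real d - 2)"
      using E_ge_cube[OF that(1)] that(1) by (intro mult_right_mono) auto
    with that(2) have "c * (8 * (real d - 1)) \<le> real d powr log 2 (real d) * (real d - 2)" by (rule order_trans)
    moreover have "0 < 8 * (real d - 1)" using that(1) by simp
    ultimately show ?thesis unfolding kap_def by (simp only: pos_le_divide_eq)
  qed
  show k2: "54 \<le> kap d" if d8: "d \<ge> 8"
  proof (rule gen[OF d8])
    have "512 * (6 / 7 * (real d - 1)) \<le> real d ^ 3 * (real d - 2)"
      using power_mono[of 8 "real d" 3] d8 by (intro mult_mono) auto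
    then show "54 * (8 * (real d - 1)) \<le> real d ^ 3 * (real d - 2)" using d8 by simp
  qed
  show "108 \<le> kap d" if d10: "d \<ge> 10"
  proof (rule gen)
    have "1000 * (8 / 9 * (real d - 1)) \<le> real d ^ 3 * (real d - 2)"
      using power_mono[of 10 "real d" 3] d10 by (intro mult_mono) auto
    then show "108 * (8 * (real d - 1)) \<le> real d ^ 3 * (real d - 2)" using d10 by simp
  qed (use d10 in simp)
  consider "d = 6" | "d = 7" | "d \<ge> 8" using d by linarith
  then show "44 / 5 \<le> kap d"
  proof cases
    case 1 then show ?thesis using E_6 by (simp add: kap_def)
  next
    case 2 then show ?thesis using E_7 by (simp add: kap_def)
  next
    case 3 then show ?thesis using k2 by simp
  qed
qed

text \<open>The balance behind the constant \<open>1 / 5\<close>: one factor \<open>kap d\<close>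
  and the power of \<open>A\<close> absorb the number of cells. Up to degree 9,
  \<open>n \<le> d / 2\<close> bounds the cells by a number. From degree 10 on,
  \<open>n \<le> 2 * (p + 1)\<close> gives \<open>16 * 16 ^ p\<close>, to be compared with
  \<open>A \<ge> 4 / 3 * (p + 1)\<close>.\<close>

lemma cells_le_kap:
  fixes d n m p :: nat
  assumes d: "d \<ge> 6" "d = n * m" and m: "m \<ge> 2" and p: "p \<ge> 1" "n \<le> 2 * (p + 1)"
  shows "1 / 5 * 4 ^ n \<le> kap d * (2 / 3 * real m * real (p + 1)) ^ p"
proof -
  define A where "A = 2 / 3 * real m * real (p + 1)"
  have A: "4 / 3 * real (p + 1) \<le> A" unfolding A_def using m by (intro mult_right_mono) auto
  have A2: "8 / 3 \<le> A" using A p(1) by simp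
  have Ap: "A \<le> A ^ p" using A2 p(1) by (intro self_le_power) auto
  have n: "2 * n \<le> d" using d(2) m by (simp add: mult.commute mult_le_mono1)
  consider "d \<le> 7" | "d \<ge> 8" "d \<le> 9" | "d \<ge> 10" by linarith
  then have "1 / 5 * 4 ^ n \<le> kap d * A ^ p"
  proof cases
    case 1
    then have "n \<le> 3" using n by linarith
    then have "(4::real) ^ n \<le> 4 ^ 3" by (intro power_increasing) auto
    moreover have "44 / 5 * (8 / 3) \<le> kap d * A ^ p"
      using kap_ge(1)[OF d(1)] A2 Ap by (intro mult_mono) auto
    ultimately show ?thesis by simp
  next
    case 2
    then have "n \<le> 4" using n by linarith
    then have "(4::real) ^ n \<le> 4 ^ 4" by (intro power_increasing) auto
    moreover have "54 * 1 \<le> kap d * A ^ p"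
      using kap_ge(2)[OF d(1)] 2 A2 Ap by (intro mult_mono) auto
    ultimately show ?thesis by simp
  next
    case 3
    have "(4::real) ^ n \<le> 4 ^ (2 * (p + 1))" using p(2) by (intro power_increasing) auto
    also have "\<dots> = 16 * 16 ^ p" by (simp add: power_mult)
    finally have "1 / 5 * 4 ^ n \<le> 108 * (4 / 135 * (16 :: real) ^ p)" by simp
    also have "\<dots> \<le> kap d * A ^ p"
    proof (rule mult_mono)
      have "real (4 * 12 ^ p) \<le> real (135 * (p + 1) ^ p)" by (simp only: of_nat_le_iff twelve_power_le)
      then have "4 / 135 * (12 :: real) ^ p \<le> real (p + 1) ^ p" by simp
      then have "(4 / 3) ^ p * (4 / 135 * (12 :: real) ^ p) \<le> (4 / 3) ^ p * real (p + 1) ^ p"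
        by (intro mult_left_mono) auto
      also have "(4 / 3) ^ p * (4 / 135 * (12 :: real) ^ p) = 4 / 135 * (4 / 3 * 12) ^ p"
        by (simp only: power_mult_distrib mult.left_commute)
      also have "(4 / 3) ^ p * real (p + 1) ^ p = (4 / 3 * real (p + 1)) ^ p" by (simp only: power_mult_distrib)
      also have "\<dots> \<le> A ^ p" using A by (intro power_mono) auto
      finally show "4 / 135 * (16 :: real) ^ p \<le> A ^ p" by simp
    qed (use kap_ge(3)[OF d(1)] 3 in auto)
    finally show ?thesis .
  qed
  then show ?thesis by (simp only: A_def)
qed

text \<open>The right side is the part of \<open>ln D\<close> free of \<open>L\<close>. The left
  side is what the discriminant bound costs at the height \<open>2 / 3 * d + 2\<close>, the part of
  the chosen height free of \<open>L\<close>.\<close>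

lemma disc_estimate:
  assumes "d \<ge> 6"
  shows "2 * ln (fact d) + 2 * (real d - 1) * (2 / 3 * real d + 2) < real d powr log 2 (real d) / 2 * ln (real d)"
proof -
  consider "d = 6" | "d = 7" | "d \<ge> 8" using assms by linarith
  then show ?thesis
  proof cases
    case 1
    have "ln (720 :: real) \<le> ln (6 ^ 4)" by (subst ln_le_cancel_iff) auto
    also have "\<dots> = 4 * ln 6" using ln_realpow[of 6 4] by simp
    finally have a: "ln (720 :: real) \<le> 4 * ln 6" .
    have "real 18 / real 7 * ln 2 \<le> ln (6 :: real)" by (rule ln_ge_ln_2) auto
    then have l6: "12 / 7 \<le> ln (6 :: real)" using ln_2_bounds(1) by simp
    have "88 / 2 * ln 6 \<le> 6 powr log 2 (6 :: real) / 2 * ln 6" using E_6 l6 by (intro mult_right_mono) auto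
    then have "2 * ln 720 + 60 < 6 powr log 2 (6 :: real) / 2 * ln 6" using a l6 by linarith
    moreover have "real d = 6" "fact d = (720 :: real)" using 1 by (simp_all add: fact_numeral)
    ultimately show ?thesis by simp
  next
    case 2
    have "ln (5040 :: real) \<le> ln (7 ^ 5)" by (subst ln_le_cancel_iff) auto
    also have "\<dots> = 5 * ln 7" using ln_realpow[of 7 5] by simp
    finally have a: "ln (5040 :: real) \<le> 5 * ln 7" .
    have "real 5 / real 2 * ln 2 \<le> ln (7 :: real)" by (rule ln_ge_ln_2) auto
    then have l7: "5 / 3 \<le> ln (7 :: real)" using ln_2_bounds(1) by simp
    have "129 / 2 * ln 7 \<le> 7 powr log 2 (7 :: real) / 2 * ln 7" using E_7 l7 by (intro mult_right_mono) auto
    then have "2 * ln 5040 + 80 < 7 powr log 2 (7 :: real) / 2 * ln 7" using a l7 by linarith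
    moreover have "real d = 7" "fact d = (5040 :: real)" using 2 by (simp_all add: fact_numeral)
    ultimately show ?thesis by simp
  next
    case 3
    have d8: "8 \<le> real d" using 3 by simp
    have "ln (fact d) \<le> ln (real d ^ d)"
      using fact_le_power[of d, where ?'a = real] 3 by (subst ln_le_cancel_iff) auto
    also have "\<dots> = real d * ln (real d)" by (rule ln_realpow)
    finally have a: "ln (fact d) \<le> real d * ln (real d)" .
    have "real 3 / real 1 * ln 2 \<le> ln (real d)" by (rule ln_ge_ln_2) (use d8 in auto)
    then have l: "2 \<le> ln (real d)" using ln_2_bounds(1) by simp
    have "real d ^ 3 / 2 * ln (real d) \<le> real d powr log 2 (real d) / 2 * ln (real d)"
      using E_ge_cube[OF 3] l by (intro mult_right_mono) auto
    moreover have "2 * (real d - 1) * (2 / 3 * real d + 2) < (real d ^ 3 / 2 - 2 * real d) * ln (real d)"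
    proof -
      have s: "8 * real d \<le> real d * real d" using d8 by (intro mult_right_mono) auto
      have c: "8 * (real d * real d) \<le> real d ^ 3" using mult_right_mono[of 8 "real d" "real d * real d"] d8
        by (simp add: power3_eq_cube)
      have lin: "4 / 3 * q + 8 / 3 * x - 4 < (t / 2 - 2 * x) * 2 \<and> 0 \<le> t / 2 - 2 * x"
        if "8 * x \<le> q" "8 * q \<le> t" "8 \<le> x" for x q t :: real using that by (intro conjI) simp_all
      have "2 * (real d - 1) * (2 / 3 * real d + 2) = 4 / 3 * (real d * real d) + 8 / 3 * real d - 4"
        by (simp add: field_simps)
      also have "\<dots> < (real d ^ 3 / 2 - 2 * real d) * 2" by (rule lin[OF s c d8, THEN conjunct1])
      also have "\<dots> \<le> (real d ^ 3 / 2 - 2 * real d) * ln (real d)"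
        by (rule mult_left_mono[OF l lin[OF s c d8, THEN conjunct2]])
      finally show ?thesis .
    qed
    ultimately show ?thesis using a by (simp add: left_diff_distrib)
  qed
qed

context nf_ext
begin

lemma two_n_le: "l \<noteq> k \<Longrightarrow> 2 * n \<le> d"
  using m_ge_2 d_eq by (simp add: mult.commute mult_le_mono1)

text \<open>A proper subfield has degree at most \<open>d / 2\<close> dividing the odd
  \<open>d\<close>, which excludes 2 and leaves degree 1.\<close>

lemma unit_rank_0:
  assumes "l \<noteq> k" "d = 3 \<or> d = 5"
  shows "unit_rank l = 0"
proof -
  have "n \<noteq> 2" using d_eq assms(2) by (metis even_numeral odd_numeral dvd_triv_left)
  then have "n \<le> 1" using two_n_le[OF assms(1)] assms(2) by linarith
  then show ?thesis using unit_rank_bounds(1) by simp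
qed

end

text \<open>\<open>L\<close> is the base of the power in the theorem, and \<open>lnD\<close> is its
  definition solved for the discriminant.\<close>

locale non_CM = nf k d for k :: "'a::field_char_0 set" and d +
  fixes L :: real
  assumes nCM: "\<not> CM_field k" and d3: "d \<ge> 3" and L: "L > 0"
    and lnD: "ln (abs_discriminant k) =
      (real d - 2) * real d powr log 2 (real d) * L / 2 + real d powr log 2 (real d) / 2 * ln (real d)"
begin

abbreviation "rk \<equiv> unit_rank k"
abbreviation "\<rho> \<equiv> max_subfield_unit_rank k"

lemma rho_less: "\<rho> < rk" using max_subfield_unit_rank(1)[OF nCM] d3 by simp

lemma rho_ge: "nf_ext k d l n m \<Longrightarrow> l \<noteq> k \<Longrightarrow> unit_rank l \<le> \<rho>"
  using max_subfield_unit_rank(2)[OF nCM] d3 by simp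

text \<open>The discriminant bound costs \<open>ln 27 = 3 * ln 3\<close>, more than the
  \<open>569 / 200 * ln 3\<close> secured in \<open>ln D\<close>, so it gives no height for small
  \<open>L\<close>. There the cell count yields a constant lower bound; the switching point depends
  on the rank.\<close>

lemma regulator_bound_3:
  assumes d: "d = 3"
  shows "1 / 5 * L ^ (rk - \<rho>) \<le> fact rk * regulator k"
proof -
  have \<rho>: "\<rho> = 0" using max_subfield_unit_rank(3)[OF nCM] d nf_ext.unit_rank_0 by fastforce
  define E where "E = 3 powr log 2 (3 :: real)"
  have E: "569 / 100 \<le> E" unfolding E_def
    by (rule powr_log2_ge[where a = 19 and b = 12]) (simp_all add: power_divide)
  have "real 1 / real 1 * ln 2 \<le> ln (3 :: real)" by (rule ln_ge_ln_2) auto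
  then have l0: "0 < ln (3 :: real)" by simp
  have "ln (3 ^ 5 :: real) \<le> ln (2 ^ 8)" by (subst ln_le_cancel_iff) auto
  then have "real 5 * ln 3 \<le> real 8 * ln (2 :: real)" by (simp only: ln_realpow)
  then have l3: "ln (3 :: real) \<le> 28 / 25" using ln_2_bounds(2) by simp
  have "569 / 100 * L \<le> E * L" "569 / 100 * ln 3 \<le> E * ln 3"
    by (rule mult_right_mono[OF E], use L l0 in simp)+
  moreover have "ln (abs_discriminant k) = E * L / 2 + E * ln 3 / 2" using lnD d by (simp add: E_def)
  ultimately have D: "569 / 200 * L + 569 / 200 * ln 3 \<le> ln (abs_discriminant k)" by linarith
  have l27: "ln (27 :: real) = 3 * ln 3" using ln_realpow[of 3 3] by simp
  \<comment> \<open>The deficit \<open>31 / 200 * ln 3\<close> is at most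
    \<open>31 / 200 * 28 / 25 = 868 / 5000\<close>.\<close>
  have tors: "h ^ rk \<le> fact rk * regulator k" if h: "h > 0" "4 * h < 569 / 200 * L - 868 / 5000" for h
  proof -
    have "ln 27 + 4 * h < ln (abs_discriminant k)" using D l27 l3 h(2) by linarith
    then obtain l n m where l: "nf_ext k d l n m" "l \<noteq> k" "\<forall>u\<in>integer_units k. ht u \<le> h \<longrightarrow> u \<in> l"
      using ex_subfield_small_units_cubic[OF d, of h] h(1) by auto
    then interpret X: nf_ext k d l n m by simp
    show ?thesis by (rule X.regulator_ge_rank_0[OF X.unit_rank_0[OF l(2)] h(1)]) (use d l(3) in auto)
  qed
  have np: "nplaces = rk + 1" using nplaces_pos by (simp add: unit_rank_eq)
  have cells: "h ^ rk \<le> 64 * (fact rk * regulator k)" if h: "h > 0" "h < (real rk + 1) * (2 / 3)" for h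
  proof -
    have "(real rk + 1) * (2 / 3) \<le> (real rk + 1) * ln 2" using ln_2_bounds(1) by (intro mult_left_mono) auto
    then have "h < (real rk + 1) * ln 2" using h(2) by linarith
    then have "h < real nplaces * ln 2" using np by (simp add: add.commute)
    from regulator_ge_cells[OF h(1) this] show ?thesis using d by (simp add: mult.assoc)
  qed
  have "rk = 1 \<or> rk = 2" using nplaces_le d_le_nplaces d np by linarith
  then show ?thesis
  proof
    assume r: "rk = 1"
    show ?thesis
    \<comment> \<open>The admissible \<open>h = 1.28 < 4 / 3\<close> gives
      \<open>1.28 / 64 = 1 / 50\<close>, the value of \<open>L / 5\<close> at the switching
      point.\<close>
    proof (cases "L \<le> 1 / 10")
      case True
      then show ?thesis using cells[of "128 / 100"] r \<rho> by simp
    next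
      case False
      then show ?thesis using tors[of "1 / 5 * L"] r \<rho> by simp
    qed
  next
    assume r: "rk = 2"
    show ?thesis
    \<comment> \<open>Below, \<open>1.8 ^ 2 / 64\<close> exceeds \<open>1 / 20\<close>, the value of
      \<open>L ^ 2 / 5\<close> at the switching point; above, \<open>(9 / 20) ^ 2\<close> exceeds
      \<open>1 / 5\<close>.\<close>
    proof (cases "L \<le> 1 / 2")
      case True
      then have "L ^ 2 \<le> (1 / 2) ^ 2" using L by (intro power_mono) auto
      then show ?thesis using cells[of "9 / 5"] r \<rho> by (simp add: power_divide)
    next
      case False
      then have "(9 / 20 * L) ^ 2 \<le> fact rk * regulator k" using tors[of "9 / 20 * L"] r by simp
      moreover have "1 / 5 * L\<^sup>2 \<le> (9 / 20 * L)\<^sup>2" by (simp add: power_mult_distrib power_divide)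
      ultimately show ?thesis using r \<rho> by simp
    qed
  qed
qed

lemma regulator_bound_4:
  assumes d: "d = 4"
  shows "1 / 5 * L ^ (rk - \<rho>) \<le> fact rk * regulator k"
proof -
  define E where "E = 4 powr log 2 (4 :: real)"
  have E: "16 \<le> E" unfolding E_def by (rule powr_log2_ge[where a = 2 and b = 1]) auto
  have \<rho>: "\<rho> \<le> 1"
  proof -
    obtain l n m where l: "nf_ext k d l n m" "l \<noteq> k" "\<rho> = unit_rank l"
      using max_subfield_unit_rank(3)[OF nCM] d by auto
    then show ?thesis using nf_ext.two_n_le[OF l(1,2)] nf_ext.unit_rank_bounds(1)[OF l(1)] d by simp
  qed
  define h where "h = 13 / 5 * L + 7 / 10"
  have l4: "ln (4 :: real) = 2 * ln 2" using ln_realpow[of 2 2] by simp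
  have "ln (24 ^ 4 :: real) \<le> ln (2 ^ 19)" by (subst ln_le_cancel_iff) auto
  then have "real 4 * ln 24 \<le> real 19 * ln (2 :: real)" by (simp only: ln_realpow)
  then have l24: "4 * ln (24 :: real) \<le> 19 * ln 2" by simp
  have "16 * L \<le> E * L" "16 * ln 4 \<le> E * ln 4" by (rule mult_right_mono[OF E], use L in simp)+
  moreover have "ln (abs_discriminant k) = E * L + E * ln 4 / 2" using lnD d by (simp add: E_def)
  ultimately have D: "16 * L + 16 * ln 2 \<le> ln (abs_discriminant k)" using l4 by linarith
  have "2 * ln (fact d) + 2 * (real d - 1) * h < ln (abs_discriminant k)"
    using D l24 L ln_2_bounds(1) d by (simp add: h_def fact_numeral)
  then obtain l n m where l: "nf_ext k d l n m" "l \<noteq> k" "\<forall>u\<in>integer_units k. ht u \<le> h \<longrightarrow> u \<in> l"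
    using ex_subfield_small_units[of h] L by (auto simp: h_def)
  then interpret X: nf_ext k d l n m by simp
  have hL: "L \<le> h" "7 / 10 \<le> h" using L by (auto simp: h_def)
  have p: "unit_rank l \<le> 1" using X.two_n_le[OF l(2)] X.unit_rank_bounds(1) d by simp
  show ?thesis
  proof (cases "unit_rank l = 0")
    case True
    have "h ^ rk \<le> fact rk * regulator k" by (rule X.regulator_ge_rank_0[OF True]) (use hL l(3) in auto)
    moreover have "L ^ (rk - \<rho>) * (1 / 5) \<le> h ^ (rk - \<rho>) * h ^ \<rho>"
      using hL L \<rho> by (intro mult_mono power_mono) (auto simp: le_Suc_eq)
    moreover have "h ^ (rk - \<rho>) * h ^ \<rho> = h ^ rk" using rho_less by (simp flip: power_add)
    ultimately show ?thesis by simp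
  next
    case False
    then have p1: "unit_rank l = 1" using p by simp
    then have \<rho>1: "\<rho> = 1" using rho_ge[OF l(1,2)] \<rho> by simp
    have n2: "n = 2" using X.two_n_le[OF l(2)] X.unit_rank_bounds(1) d p1 by simp
    then have m2: "m = 2" using X.d_eq d by simp
    have "1 / 2 * (13 / 10 * L + 1 / 10) ^ (rk - 1) \<le> fact rk * regulator k"
      by (rule X.regulator_ge_real_quadratic[OF n2 p1 m2]) (use L l(3) in \<open>auto simp: h_def\<close>)
    moreover have "1 / 5 * L ^ (rk - 1) \<le> 1 / 2 * (13 / 10 * L + 1 / 10) ^ (rk - 1)"
      using L by (intro mult_mono power_mono) auto
    ultimately show ?thesis using \<rho>1 by simp
  qed
qed

text \<open>As \<open>h \<ge> 1\<close>, the exponent may be raised from \<open>rk - \<rho>\<close>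
  to \<open>rk\<close>.\<close>

lemma power_gap_le:
  assumes "L + 1 \<le> h" "h ^ rk \<le> fact rk * regulator k"
  shows "1 / 5 * L ^ (rk - \<rho>) \<le> fact rk * regulator k"
proof -
  have "1 / 5 * L ^ (rk - \<rho>) \<le> 1 * h ^ (rk - \<rho>)" using L assms(1) by (intro mult_mono power_mono) auto
  also have "\<dots> \<le> h ^ rk" using L assms(1) by (simp add: power_increasing)
  finally show ?thesis using assms(2) by simp
qed

text \<open>Only \<open>\<rat>\<close> can contain the units of height up to \<open>L + 1\<close>,
  so they are torsion and the full power \<open>(L + 1) ^ rk\<close> is available.\<close>

lemma regulator_bound_5:
  assumes d: "d = 5"
  shows "1 / 5 * L ^ (rk - \<rho>) \<le> fact rk * regulator k"
proof -
  define E where "E = 5 powr log 2 (5 :: real)"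
  have E: "25 \<le> E" unfolding E_def by (rule powr_log2_ge[where a = 2 and b = 1]) auto
  have "ln (120 :: real) \<le> ln (5 ^ 3)" by (subst ln_le_cancel_iff) auto
  then have "ln (120 :: real) \<le> real 3 * ln 5" by (simp only: ln_realpow)
  then have l120: "ln (120 :: real) \<le> 3 * ln 5" by simp
  have "real 2 / real 1 * ln 2 \<le> ln (5 :: real)" by (rule ln_ge_ln_2) auto
  then have l5: "4 / 3 \<le> ln (5 :: real)" using ln_2_bounds(1) by simp
  have "25 * L \<le> E * L" "25 * ln 5 \<le> E * ln 5" by (rule mult_right_mono[OF E], use L l5 in simp)+
  moreover have "ln (abs_discriminant k) = 3 * (E * L) / 2 + E * ln 5 / 2" using lnD d by (simp add: E_def)
  ultimately have D: "75 / 2 * L + 25 / 2 * ln 5 \<le> ln (abs_discriminant k)" by linarith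
  have "2 * ln (fact d) + 2 * (real d - 1) * (L + 1) < ln (abs_discriminant k)"
    using D l120 L l5 d by (simp add: fact_numeral)
  then obtain l n m where l: "nf_ext k d l n m" "l \<noteq> k" "\<forall>u\<in>integer_units k. ht u \<le> L + 1 \<longrightarrow> u \<in> l"
    using ex_subfield_small_units[of "L + 1"] L by auto
  then interpret X: nf_ext k d l n m by simp
  show ?thesis
    by (rule power_gap_le[OF order_refl], rule X.regulator_ge_rank_0[OF X.unit_rank_0[OF l(2)]]) (use d L l(3) in auto)
qed

text \<open>If \<open>l\<close> has rank 0, all small units are torsion. Otherwise the relative
  packing is used with \<open>A\<close> just under the limit of the cell count, and
  \<open>cells_le_kap\<close> settles the constants.\<close>

lemma regulator_bound_6:
  assumes d: "d \<ge> 6"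
  shows "1 / 5 * L ^ (rk - \<rho>) \<le> fact rk * regulator k"
proof -
  \<comment> \<open>The added 1 makes \<open>\<tau> \<ge> 1\<close>, so the exponent
    \<open>rk - p\<close> may be lowered to \<open>rk - \<rho>\<close>.\<close>
  define \<tau> where "\<tau> = kap d * L + 1"
  \<comment> \<open>The height is fixed before \<open>l\<close> is known, hence
    \<open>2 / 3 * d\<close>: it dominates every \<open>A\<close> that can occur, because
    \<open>m * (p + 1) \<le> m * n = d\<close>.\<close>
  define h where "h = 2 / 3 * real d + 2 * \<tau>"
  have k: "44 / 5 \<le> kap d" by (rule kap_ge(1)[OF d])
  have kL: "kap d * L > 0" "L \<le> kap d * L" using k L mult_right_mono[of 1 "kap d" L] by auto
  have "2 * (real d - 1) * h = 2 * (real d - 1) * (2 / 3 * real d + 2) + 4 * ((real d - 1) * kap d) * L"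
    by (simp add: h_def \<tau>_def algebra_simps)
  also have "(real d - 1) * kap d = real d powr log 2 (real d) * (real d - 2) / 8"
  proof -
    have cancel: "x * (N / (8 * x)) = N / 8" if "x \<noteq> 0" for x N :: real using that by simp
    show ?thesis unfolding kap_def by (rule cancel) (use d in simp)
  qed
  also have "4 * (real d powr log 2 (real d) * (real d - 2) / 8) * L = (real d - 2) * real d powr log 2 (real d) * L / 2"
    by simp
  finally have "2 * ln (fact d) + 2 * (real d - 1) * h < ln (abs_discriminant k)"
    unfolding lnD using disc_estimate[OF d] by linarith
  moreover have "h \<ge> 0" using kL by (simp add: h_def \<tau>_def)
  ultimately obtain l n m where l: "nf_ext k d l n m" "l \<noteq> k" "\<forall>u\<in>integer_units k. ht u \<le> h \<longrightarrow> u \<in> l"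
    using ex_subfield_small_units[of h] by auto
  then interpret X: nf_ext k d l n m by simp
  define p where "p = unit_rank l"
  show ?thesis
  proof (cases "p = 0")
    case True
    have "L + 1 \<le> h" using kL d by (simp add: h_def \<tau>_def)
    then show ?thesis
      by (rule power_gap_le) (rule X.regulator_ge_rank_0, use True l(3) L \<open>L + 1 \<le> h\<close> in \<open>auto simp: p_def\<close>)
  next
    case False
    define A where "A = 2 / 3 * real m * real (p + 1)"
    have A0: "A > 0" using X.m_pos by (simp add: A_def)
    have "real m * real (p + 1) \<le> real m * real n"
      using X.unit_rank_bounds(1) by (intro mult_left_mono) (auto simp: p_def)
    then have Ah: "A + 2 * \<tau> \<le> h" using X.d_eq by (simp add: A_def h_def mult.commute)
    have \<tau>1: "\<tau> \<ge> 1" using kL by (simp add: \<tau>_def)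
    have "A < real m * (real (p + 1) * ln 2)"
    proof -
      have "2 / 3 * (real m * real (p + 1)) < ln 2 * (real m * real (p + 1))"
        using X.m_pos ln_2_bounds(1) by (intro mult_strict_right_mono) auto
      then show ?thesis by (simp add: A_def mult_ac)
    qed
    then have main: "A ^ p * \<tau> ^ (rk - p) \<le> 4 ^ n * fact rk * regulator k"
      unfolding p_def by (intro X.regulator_ge_relative_cells) (use A0 \<tau>1 Ah l(3) in auto)
    have pr: "p \<le> \<rho>" unfolding p_def by (rule rho_ge[OF l(1,2)])
    \<comment> \<open>\<open>rk - \<rho>\<close> is positive because \<open>k\<close> is not a
      CM-field, and \<open>kap d \<ge> 1\<close>, so at least one factor \<open>kap d\<close> is
      left over.\<close>
    have "kap d * L ^ (rk - \<rho>) \<le> kap d ^ (rk - \<rho>) * L ^ (rk - \<rho>)"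
      using k L rho_less by (intro mult_right_mono self_le_power) auto
    also have "\<dots> = (kap d * L) ^ (rk - \<rho>)" by (simp only: power_mult_distrib)
    also have "\<dots> \<le> \<tau> ^ (rk - \<rho>)" using kL by (intro power_mono) (auto simp: \<tau>_def)
    also have "\<dots> \<le> \<tau> ^ (rk - p)" using pr \<tau>1 by (intro power_increasing) auto
    finally have t: "kap d * L ^ (rk - \<rho>) \<le> \<tau> ^ (rk - p)" .
    have "1 / 5 * 4 ^ n * L ^ (rk - \<rho>) \<le> kap d * A ^ p * L ^ (rk - \<rho>)"
      using cells_le_kap[OF d X.d_eq X.m_ge_2[OF l(2)], of p] False X.unit_rank_bounds(2) L
      by (intro mult_right_mono) (auto simp: A_def p_def)
    also have "\<dots> = A ^ p * (kap d * L ^ (rk - \<rho>))" by (simp only: mult_ac)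
    also have "\<dots> \<le> A ^ p * \<tau> ^ (rk - p)" using t A0 by (intro mult_left_mono) auto
    also note main
    finally have "4 ^ n * (1 / 5 * L ^ (rk - \<rho>)) \<le> 4 ^ n * (fact rk * regulator k)" by (simp only: mult_ac)
    then show ?thesis by (subst (asm) mult_le_cancel_left_pos) auto
  qed
qed

lemma regulator_bound: "1 / 5 * L ^ (rk - \<rho>) \<le> fact rk * regulator k"
proof -
  consider "d = 3" | "d = 4" | "d = 5" | "d \<ge> 6" using d3 by linarith
  then show ?thesis
    by cases (rule regulator_bound_3 regulator_bound_4 regulator_bound_5 regulator_bound_6; assumption)+
qed

end

theorem theorem1p2:
  fixes k :: "'a::field_char_0 set" and d r :: nat
  assumes "number_field k"
    and "d = ext_degree \<rat> k" and "d \<ge> 3"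
    and "\<not> CM_field k"
    and "r = unit_rank k"
    and "1 < gamma_const d * abs_discriminant k"
  shows "0.2 / fact r *
      (2 * ln (gamma_const d * abs_discriminant k) /
        ((real d - 2) * real d powr log 2 (real d))) powi
          (int r - int (max_subfield_unit_rank k))
    \<le> regulator k"
proof -
  interpret nf k d by standard (use assms(1,2) number_field_iff in auto)
  define E where "E = real d powr log 2 (real d)"
  define L where "L = 2 * ln (gamma_const d * abs_discriminant k) / ((real d - 2) * E)"
  have E: "E > 0" using assms(3) by (simp add: E_def)
  have pos: "(real d - 2) * E > 0" using E assms(3) by simp
  have g: "gamma_const d > 0" "ln (gamma_const d) = - (E / 2 * ln (real d))"
    using assms(3) by (simp_all add: gamma_const_def E_def ln_powr)
  have X: "ln (gamma_const d * abs_discriminant k) = (real d - 2) * E * L / 2"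
  proof -
    have "x = P * (2 * x / P) / 2" if "P > 0" for x P :: real using that by simp
    from this[OF pos] show ?thesis unfolding L_def .
  qed
  moreover have "ln (gamma_const d * abs_discriminant k) = ln (gamma_const d) + ln (abs_discriminant k)"
    using g(1) abs_discriminant_pos by (simp add: ln_mult)
  ultimately have lnD: "ln (abs_discriminant k) = (real d - 2) * E * L / 2 + E / 2 * ln (real d)"
    using g(2) by linarith
  have L: "L > 0" unfolding L_def using pos assms(6) by (intro divide_pos_pos) auto
  interpret non_CM k d L by standard (fact assms(4), fact assms(3), fact L, fact lnD[unfolded E_def])
  \<comment> \<open>The maximal subfield rank is less than \<open>r\<close>, so the integer exponent
    is a natural number.\<close>
  have "int r - int (max_subfield_unit_rank k) = int (unit_rank k - max_subfield_unit_rank k)"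
    using rho_less assms(5) by simp
  then have "0.2 / fact r * L powi (int r - int (max_subfield_unit_rank k)) =
      1 / 5 * L ^ (unit_rank k - max_subfield_unit_rank k) / fact (unit_rank k)"
    by (simp only: power_int_of_nat assms(5)) simp
  also have "\<dots> \<le> regulator k" using regulator_bound by (subst pos_divide_le_eq) (simp_all add: mult.commute)
  finally show ?thesis by (simp only: L_def E_def)
qed

end
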